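(* Let $v$ be the function on the closed orthant $[0,\infty)^4$ defined by the regional formulas in the context. Then $v\in C^2([0,\infty)^4)$ (all derivatives up to order two extend continuously to the closed orthant). The chamber function $\mathcal U(x_1,\dots,x_5)=x_5+v(x_2-x_1,x_3-x_2,x_4-x_3,x_5-x_4)$ belongs to $C^2(\overline{\mathcal W}_5)$, where $\overline{\mathcal W}_5=\{x\in\mathbb R^5:x_1\le\cdots\le x_5\}$, and its symmetric ranked extension $$u(x)=\mathcal U(x^{(1)},\dots,x^{(5)}),$$ where $x^{(1)}\le\cdots\le x^{(5)}$ is the increasing rearrangement of $x$, belongs to $C^2(\mathbb R^5)$.
   Context: **The explicit candidate $v$ on $[0,\infty)^4$.** Values at vanishing denominators / zero arguments are understood by continuous extension. (i) For $t>0$, $$H(t)=\frac{3}{\sqrt2\sinh^5t\cosh^2t}\left(\frac t{16}-\frac{\sinh 2t}{64}-\frac{\sinh 4t}{64}+\frac{\sinh 6t}{192}\right),\qquad U(t)=\cosh t\int_t^\infty H(r)\,dr .$$ (ii) For $r>1$, $$g(r)=\frac{8-25r^2+15r^4-15r(r^2-1)^2\operatorname{arccoth}r}{16\sqrt2\,r\sqrt{r^2-1}},\qquad \operatorname{arccoth}r=\tfrac12\log\tfrac{r+1}{r-1}.$$ For $s>0,w\ge0$, $$\widetilde L(s,w)=\tfrac1{\sqrt2}\arctan(e^{-s})\cosh s+\int_1^{\coth s}(r\sinh s-\cosh s)e^{-2wr}g(r)\,dr .$$ For $y>0,z\ge0$, with $\alpha=z/3$, $\rho=y+\alpha$, $$\begin{aligned}P(y,z)={}&\frac{\sinh^3y}{\sinh^3\rho}U(\rho)+\frac34e^{-y-4\alpha}(e^{2\alpha}-1)^2\int_\rho^\infty\frac{e^{-2r}(e^{2\alpha}-e^{2r})^2U(r)}{\sinh^5r}\,dr\\&+\frac32\sinh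 y\,e^{-2\alpha}(e^{2\alpha}-1)\int_\rho^\infty\frac{e^{-2r}(e^{2\alpha}-e^{2r})\bigl(e^{2\alpha}-(e^{2r}+1)/2\bigr)U(r)}{\sinh^5r}\,dr.\end{aligned}$$ (iii) For bounded smooth $\phi$ on $(0,\infty)$, $y>0$, $p\ge0$, with $d=p/2$, $t=y+d$, $J_\phi(t)=\int_t^\infty\frac{\phi(r)}{\sinh^3r}dr$, $M_\phi(t)=\int_t^\infty\frac{\cosh r\,\phi(r)}{\sinh^4r}dr$, define $$(\mathcal K_p\phi)(y)=\frac{\sinh^2y}{\sinh^2t}\phi(t)+4\sinh y\sinh d\,J_\phi(t)+6\sinh^2d\,\bigl(\cosh t\,J_\phi(t)-\sinh t\,M_\phi(t)\bigr),$$ $$(\mathcal T\phi)(y)=2\sinh^2y\int_y^\infty\frac{\phi(r)}{\sinh^3r}\,dr .$$ (iv) For $x,z\ge0$, $y>0$, put $w=x-z/2$, $p=\min\{z,2x\}$, $\phi_w(s)=\widetilde L(s,w)$ if $w\ge0$ and $\phi_w(s)=P(s,-2w)$ if $w<0$, and $$F(x,y,z)=(\mathcal K_p\phi_w)(y),\qquad R(x,y,z)=(\mathcal T\mathcal K_p\phi_w)(y).$$ Also put $b_0(s)=\frac1{2\sqrt2}(1+\frac{e^{-2s}}3)$, $b_1(s)=\frac2{3\sqrt2}e^{-s}$, $\psi_x(s)=\widetilde L(s,x)-b_0(s)$, and $$H_B(x,y,z)=(\mathcal K_z\psi_x)(y),\qquad R_B(x,y,z)=(\mathcal T\mathcal K_z\psi_x)(y).$$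 (v) If $q_4\ge q_2$, set $x=\sqrt2q_1$, $y=\sqrt2(q_2+q_3)$, $z=\sqrt2(q_4-q_2)$ and $$v(q)=F(x,y,z)\frac{\sinh(\sqrt2q_3)}{\sinh y}+R(x,y,z)\frac{\sinh(\sqrt2q_2)}{\sinh y}.$$ If $q_4\le q_2$, set $x=\sqrt2q_1$, $y=\sqrt2(q_3+q_4)$, $z=\sqrt2(q_2-q_4)$ and $$v(q)=\bigl(H_B(x,y,z)+b_0(y)\bigr)\frac{\sinh(\sqrt2q_3)}{\sinh y}+\bigl(R_B(x,y,z)+b_1(y)\bigr)\frac{\sinh(\sqrt2q_4)}{\sinh y}.$$ The formula regions are $A=\{q_4\ge q_2,\ 2q_1\ge q_4-q_2\}$, $B=\{q_4\le q_2\}$, $C=\{q_4\ge q_2,\ 2q_1\le q_4-q_2\}$ (in $A$ one has $p=z$, $w\ge0$; in $C$ one has $p=2x$, $w\le0$). *)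

theory Defs
  imports "HOL-Analysis.Analysis"
begin

section \<open>Twice continuously differentiable functions on closed sets\<close>

text \<open>
  Meant for closed sets \<open>S\<close> that are the closure of their interior: \<open>f\<close> is \<open>C\<^sup>2\<close> (in the
  Frechet sense) on the interior of \<open>S\<close>, and \<open>f\<close> and its derivatives of order one and two
  extend continuously to \<open>S\<close>. For \<open>S = UNIV\<close> this is the usual class \<open>C\<^sup>2\<close>.
\<close>

definition C2_on :: "'a::euclidean_space set \<Rightarrow> ('a \<Rightarrow> real) \<Rightarrow> bool" where
  "C2_on S f \<longleftrightarrow> continuous_on S f \<and>
    (\<exists>(f' :: 'a \<Rightarrow> 'a \<Rightarrow>\<^sub>L real) (f'' :: 'a \<Rightarrow> 'a \<Rightarrow>\<^sub>L 'a \<Rightarrow>\<^sub>L real).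
      continuous_on S f' \<and> continuous_on S f'' \<and>
      (\<forall>x\<in>interior S. (f has_derivative blinfun_apply (f' x)) (at x) \<and>
                       (f' has_derivative blinfun_apply (f'' x)) (at x)))"


section \<open>The building blocks of the candidate\<close>

definition arccoth :: "real \<Rightarrow> real" where
  "arccoth r = 1/2 * ln ((r + 1) / (r - 1))"

definition H :: "real \<Rightarrow> real" where
  "H t = 3 / (sqrt 2 * sinh t ^ 5 * cosh t ^ 2) *
     (t / 16 - sinh (2 * t) / 64 - sinh (4 * t) / 64 + sinh (6 * t) / 192)"

definition U :: "real \<Rightarrow> real" where
  "U t = cosh t * integral {t..} H"

definition g :: "real \<Rightarrow> real" where
  "g r = (8 - 25 * r ^ 2 + 15 * r ^ 4 - 15 * r * (r ^ 2 - 1) ^ 2 * arccoth r) /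
         (16 * sqrt 2 * r * sqrt (r ^ 2 - 1))"

text \<open>The upper limit of integration is \<open>coth s\<close>.\<close>

definition Ltilde :: "real \<Rightarrow> real \<Rightarrow> real" where
  "Ltilde s w = 1 / sqrt 2 * arctan (exp (- s)) * cosh s +
     integral {1..cosh s / sinh s} (\<lambda>r. (r * sinh s - cosh s) * exp (- 2 * w * r) * g r)"

definition P :: "real \<Rightarrow> real \<Rightarrow> real" where
  "P y z = (let \<alpha> = z / 3; \<rho> = y + \<alpha> in
     sinh y ^ 3 / sinh \<rho> ^ 3 * U \<rho>
     + 3/4 * exp (- y - 4 * \<alpha>) * (exp (2 * \<alpha>) - 1) ^ 2 *
         integral {\<rho>..} (\<lambda>r. exp (- 2 * r) * (exp (2 * \<alpha>) - exp (2 * r)) ^ 2 * U r / sinh r ^ 5)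
     + 3/2 * sinh y * exp (- 2 * \<alpha>) * (exp (2 * \<alpha>) - 1) *
         integral {\<rho>..} (\<lambda>r. exp (- 2 * r) * (exp (2 * \<alpha>) - exp (2 * r)) *
           (exp (2 * \<alpha>) - (exp (2 * r) + 1) / 2) * U r / sinh r ^ 5))"

definition J :: "(real \<Rightarrow> real) \<Rightarrow> real \<Rightarrow> real" where
  "J \<phi> t = integral {t..} (\<lambda>r. \<phi> r / sinh r ^ 3)"

definition M :: "(real \<Rightarrow> real) \<Rightarrow> real \<Rightarrow> real" where
  "M \<phi> t = integral {t..} (\<lambda>r. cosh r * \<phi> r / sinh r ^ 4)"

definition K :: "real \<Rightarrow> (real \<Rightarrow> real) \<Rightarrow> real \<Rightarrow> real" where
  "K p \<phi> y = (let d = p / 2; t = y + d in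
     sinh y ^ 2 / sinh t ^ 2 * \<phi> t
     + 4 * sinh y * sinh d * J \<phi> t
     + 6 * sinh d ^ 2 * (cosh t * J \<phi> t - sinh t * M \<phi> t))"

definition T :: "(real \<Rightarrow> real) \<Rightarrow> real \<Rightarrow> real" where
  "T \<phi> y = 2 * sinh y ^ 2 * integral {y..} (\<lambda>r. \<phi> r / sinh r ^ 3)"

definition phi :: "real \<Rightarrow> real \<Rightarrow> real" where
  "phi w s = (if w \<ge> 0 then Ltilde s w else P s (- 2 * w))"

definition F :: "real \<Rightarrow> real \<Rightarrow> real \<Rightarrow> real" where
  "F x y z = K (min z (2 * x)) (phi (x - z / 2)) y"

definition R :: "real \<Rightarrow> real \<Rightarrow> real \<Rightarrow> real" where
  "R x y z = T (K (min z (2 * x)) (phi (x - z / 2))) y"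

definition b0 :: "real \<Rightarrow> real" where
  "b0 s = 1 / (2 * sqrt 2) * (1 + exp (- 2 * s) / 3)"

definition b1 :: "real \<Rightarrow> real" where
  "b1 s = 2 / (3 * sqrt 2) * exp (- s)"

definition psi :: "real \<Rightarrow> real \<Rightarrow> real" where
  "psi x s = Ltilde s x - b0 s"

definition H_B :: "real \<Rightarrow> real \<Rightarrow> real \<Rightarrow> real" where
  "H_B x y z = K z (psi x) y"

definition R_B :: "real \<Rightarrow> real \<Rightarrow> real \<Rightarrow> real" where
  "R_B x y z = T (K z (psi x)) y"


section \<open>The candidate on the closed orthant\<close>

definition orthant :: "(real ^ 4) set" where
  "orthant = {q. \<forall>i. 0 \<le> q $ i}"

text \<open>The formula on the regions A and C, that is for \<open>q\<^sub>4 \<ge> q\<^sub>2\<close>.\<close>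

definition v_AC :: "real ^ 4 \<Rightarrow> real" where
  "v_AC q = (let x = sqrt 2 * q $ 1; y = sqrt 2 * (q $ 2 + q $ 3); z = sqrt 2 * (q $ 4 - q $ 2) in
     F x y z * (sinh (sqrt 2 * q $ 3) / sinh y) + R x y z * (sinh (sqrt 2 * q $ 2) / sinh y))"

text \<open>The formula on the region B, that is for \<open>q\<^sub>4 \<le> q\<^sub>2\<close>.\<close>

definition v_B :: "real ^ 4 \<Rightarrow> real" where
  "v_B q = (let x = sqrt 2 * q $ 1; y = sqrt 2 * (q $ 3 + q $ 4); z = sqrt 2 * (q $ 2 - q $ 4) in
     (H_B x y z + b0 y) * (sinh (sqrt 2 * q $ 3) / sinh y)
     + (R_B x y z + b1 y) * (sinh (sqrt 2 * q $ 4) / sinh y))"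

text \<open>
  In both formulas \<open>y = sqrt 2 * (q\<^sub>3 + min q\<^sub>2 q\<^sub>4)\<close>, and no denominator vanishes when
  \<open>y > 0\<close>. The points of the orthant with \<open>y > 0\<close> are dense in it.
\<close>

definition regular_points :: "(real ^ 4) set" where
  "regular_points = {q \<in> orthant. 0 < q $ 3 + min (q $ 2) (q $ 4)}"

definition v_regular :: "real ^ 4 \<Rightarrow> real" where
  "v_regular q = (if q $ 2 \<le> q $ 4 then v_AC q else v_B q)"

text \<open>
  Where \<open>y = 0\<close> the value is the limit of the values at regular points. Should that limit not
  exist, \<^const>\<open>Lim\<close> would be unspecified; as \<^const>\<open>C2_on\<close> demands continuity of \<open>v\<close> on the
  whole orthant, the statement \<open>C2_on orthant v\<close> includes the existence of these limits.
\<close>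

definition v :: "real ^ 4 \<Rightarrow> real" where
  "v q = (if q \<in> regular_points then v_regular q
          else Lim (at q within regular_points) v_regular)"


section \<open>The chamber function and its symmetric ranked extension\<close>

text \<open>
  The inequalities are spelled out because the order on the index type \<open>5\<close> starts with
  \<open>5 = 0\<close>.
\<close>

definition chamber :: "(real ^ 5) set" where
  "chamber = {x. x $ 1 \<le> x $ 2 \<and> x $ 2 \<le> x $ 3 \<and> x $ 3 \<le> x $ 4 \<and> x $ 4 \<le> x $ 5}"

definition chamber_fun :: "real ^ 5 \<Rightarrow> real" where
  "chamber_fun x =
     x $ 5 + v (vector [x $ 2 - x $ 1, x $ 3 - x $ 2, x $ 4 - x $ 3, x $ 5 - x $ 4])"

definition rearrangement :: "real ^ 5 \<Rightarrow> real ^ 5" where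
  "rearrangement x = vector (sort [x $ 1, x $ 2, x $ 3, x $ 4, x $ 5])"

definition ranked_extension :: "real ^ 5 \<Rightarrow> real" where
  "ranked_extension x = chamber_fun (rearrangement x)"

end

theory Submission imports Defs "HOL-Real_Asymp.Real_Asymp"
begin

text \<open>
  In suitable linear coordinates \<open>(a, b, t, w)\<close>, one choice for each of the regions A, B, C, the
  candidate is an elementary function plus the integral over \<open>1 < c < coth t\<close> of
  \<open>e\<^sub>c(a) e\<^sub>c(b) e\<^sub>c(t) X\<^sub>c(w) g(c)\<close>, where \<open>e\<^sub>c(x) = c sinh x - cosh x\<close> and \<open>X\<^sub>c(w)\<close> is
  \<open>exp(-2 w c)\<close> in A and B, and \<open>-e\<^sub>c(w)\<close> in C. Since \<open>e\<^sub>c(t)\<close> vanishes at the moving end point,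
  two derivatives exist and extend continuously up to the boundary. The first-order linear differential
  equation satisfied by \<open>g\<close> makes the three expressions agree to second order on the interfaces, and
  gives the Neumann conditions on the walls \<open>q\<^sub>i = 0\<close>. These conditions say that the first and second
  derivatives of the chamber function are invariant under the permutations fixing a given point,
  so that its reflected copies fit together on the whole space.
\<close>

subsection \<open>Two-jets on closed sets\<close>

text \<open>The corner \<open>t = 0\<close>, where the interval of integration becomes unbounded,
  decides how much smoothness is available: \<open>g\<close> decays like c^(-4) and each derivative
  of the kernel costs a factor c, so two derivatives keep an integrable majorant on (1, infinity),
  while a third would leave only 1/c. The elementary parts contain log tanh(t/2), whose
  t-derivatives blow up there as well; factors sinh a and sinh b with |a|, |b| \<le> t compensate.
  The nested integrals in \<open>K\<close>, \<open>T\<close> and \<open>P\<close> are never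
  differentiated. Since e_c'' = e_c, the product e_c(t - a) e_c(t - y) e_c(t) is a linear
  combination of the cube e_c(t)^3 and its first two derivatives. The regional formulas are
  therefore determined by the restriction of the kernel form to the diagonal a = b = t, and this
  polarization identifies the two. Derivatives are taken within closed pieces, boundary included, so
  that on a shared face only the value and two derivatives in one transversal direction have to be
  compared.\<close>

definition jet :: "'a::euclidean_space set \<Rightarrow> ('a \<Rightarrow> real) \<Rightarrow> ('a \<Rightarrow> 'a \<Rightarrow> real) \<Rightarrow> ('a \<Rightarrow> 'a \<Rightarrow> 'a \<Rightarrow> real) \<Rightarrow> bool" where
  "jet S f f1 f2 \<longleftrightarrow> (\<forall>x\<in>S. (f has_derivative f1 x) (at x within S) \<and>
      (\<forall>h. ((\<lambda>x. f1 x h) has_derivative f2 x h) (at x within S)) \<and> (\<forall>h k. f2 x h k = f2 x k h)) \<and>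
    (\<forall>h k. continuous_on S (\<lambda>x. f2 x h k))"

text \<open>In finite dimension, continuity of \<open>f1 x h\<close> for each fixed h is already
  continuity in operator norm: expanding h in the basis reduces the uniform estimate to finitely
  many directions.\<close>

lemma linear_family_close:
  fixes f1 :: "'a::euclidean_space \<Rightarrow> 'a \<Rightarrow> real"
  assumes lin: "\<And>x. x \<in> S \<Longrightarrow> linear (f1 x)"
    and cont: "\<And>h. continuous_on S (\<lambda>x. f1 x h)" and x: "x \<in> S" and e: "0 < e"
  obtains d where "0 < d" "\<And>y h. y \<in> S \<Longrightarrow> dist y x < d \<Longrightarrow> \<bar>f1 y h - f1 x h\<bar> \<le> e * norm h"
proof -
  define e' where "e' = e / DIM('a)"
  have e': "0 < e'" using e by (simp add: e'_def)
  have "\<forall>b\<in>Basis. \<forall>\<^sub>F y in at x within S. \<bar>f1 y b - f1 x b\<bar> < e'"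
    using cont x e' unfolding continuous_on_def tendsto_iff dist_real_def by blast
  then have "\<forall>\<^sub>F y in at x within S. \<forall>b\<in>Basis. \<bar>f1 y b - f1 x b\<bar> < e'"
    by (simp add: eventually_ball_finite)
  then obtain d where d: "0 < d" and D: "\<And>y b. y \<in> S \<Longrightarrow> y \<noteq> x \<Longrightarrow> dist y x < d \<Longrightarrow> b \<in> Basis \<Longrightarrow> \<bar>f1 y b - f1 x b\<bar> < e'"
    unfolding eventually_at by blast
  have "\<bar>f1 y h - f1 x h\<bar> \<le> e * norm h" if y: "y \<in> S" "dist y x < d" for y h
  proof -
    have rep: "f1 z h = (\<Sum>b\<in>Basis. (h \<bullet> b) * f1 z b)" if "z \<in> S" for z
    proof -
      have "f1 z h = f1 z (\<Sum>b\<in>Basis. (h \<bullet> b) *\<^sub>R b)" by (simp add: euclidean_representation)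
      also have "\<dots> = (\<Sum>b\<in>Basis. (h \<bullet> b) * f1 z b)"
        using lin[OF that] by (simp add: linear_sum linear_scale)
      finally show ?thesis .
    qed
    have "\<bar>f1 y h - f1 x h\<bar> = \<bar>\<Sum>b\<in>Basis. (h \<bullet> b) * (f1 y b - f1 x b)\<bar>"
      by (simp add: rep[OF y(1)] rep[OF x] sum_subtractf right_diff_distrib)
    also have "\<dots> \<le> (\<Sum>b\<in>(Basis::'a set). norm h * e')"
    proof (rule order_trans[OF sum_abs], rule sum_mono)
      fix b :: 'a assume b: "b \<in> Basis"
      have "\<bar>f1 y b - f1 x b\<bar> \<le> e'"
        using D[OF y(1) _ y(2) b] e' by (cases "y = x") auto
      moreover have "\<bar>h \<bullet> b\<bar> \<le> norm h" using b by (rule Basis_le_norm)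
      ultimately show "\<bar>(h \<bullet> b) * (f1 y b - f1 x b)\<bar> \<le> norm h * e'"
        by (simp add: abs_mult mult_mono)
    qed
    also have "\<dots> = e * norm h" by (simp add: e'_def)
    finally show ?thesis .
  qed
  then show thesis using that d by blast
qed

text \<open>On a segment inside the interior the mean value theorem bounds the linearization error
  by the oscillation of \<open>D\<close>. An arbitrary pair of points of \<open>S\<close> is shrunk
  towards an interior point, and the estimate passes to the limit.\<close>

lemma has_derivative_within_convexI:
  fixes f :: "'a::euclidean_space \<Rightarrow> real"
  assumes S: "convex S" "interior S \<noteq> {}" and f: "continuous_on S f"
    and lin: "\<And>x. x \<in> S \<Longrightarrow> linear (D x)"
    and cont: "\<And>h. continuous_on S (\<lambda>x. D x h)"
    and der: "\<And>x h. x \<in> interior S \<Longrightarrow> ((\<lambda>s. f (x + s *\<^sub>R h)) has_real_derivative D x h) (at 0)"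
    and x: "x \<in> S"
  shows "(f has_derivative D x) (at x within S)"
  unfolding has_derivative_within_alt
proof (intro conjI allI impI)
  show "bounded_linear (D x)" using lin[OF x] by (simp add: linear_conv_bounded_linear)
  fix e :: real assume e: "0 < e"
  obtain p where p: "p \<in> interior S" using S by auto
  obtain d where d: "0 < d" and Dd: "\<And>y h. y \<in> S \<Longrightarrow> dist y x < d \<Longrightarrow> \<bar>D y h - D x h\<bar> \<le> e * norm h"
    using linear_family_close[OF lin cont x e] by blast
  have intS: "interior S \<subseteq> S" by (rule interior_subset)
  have inner: "\<bar>f y - f z - D x (y - z)\<bar> \<le> e * norm (y - z)"
    if yz: "y \<in> interior S \<inter> ball x d" "z \<in> interior S \<inter> ball x d" for y z
  proof -
    define h where "h = y - z"
    define q where "q s = z + s *\<^sub>R h" for s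
    have qin: "q s \<in> interior S \<inter> ball x d" if "0 \<le> s" "s \<le> 1" for s
    proof -
      have "q s = (1 - s) *\<^sub>R z + s *\<^sub>R y" by (simp add: q_def h_def algebra_simps)
      moreover have "convex (interior S \<inter> ball x d)" using S by (intro convex_Int convex_interior convex_ball)
      ultimately show ?thesis using yz that by (metis convexD_alt)
    qed
    define \<phi> where "\<phi> s = f (q s) - s * D x h" for s
    have dphi: "(\<phi> has_real_derivative D (q s) h - D x h) (at s)" if "0 \<le> s" "s \<le> 1" for s
    proof -
      have "((\<lambda>r. f (q s + r *\<^sub>R h)) has_real_derivative D (q s) h) (at 0)"
        using der qin[OF that] by blast
      then have "((\<lambda>r. f (q (r + s))) has_real_derivative D (q s) h) (at 0)"
        by (simp add: q_def algebra_simps)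
      then have "((\<lambda>r. f (q r)) has_real_derivative D (q s) h) (at s)"
        using DERIV_at_within_shift[of "\<lambda>r. f (q r)" "D (q s) h" s 0 UNIV] by (simp add: add.commute)
      then show ?thesis unfolding \<phi>_def by (auto intro!: derivative_eq_intros)
    qed
    obtain s where s: "0 < s" "s < 1" "\<phi> 1 - \<phi> 0 = D (q s) h - D x h"
      using MVT2[of 0 1 \<phi> "\<lambda>s. D (q s) h - D x h"] dphi by auto
    have "\<phi> 1 - \<phi> 0 = f y - f z - D x (y - z)" by (simp add: \<phi>_def q_def h_def)
    moreover have "\<bar>D (q s) h - D x h\<bar> \<le> e * norm h"
      using Dd qin[of s] s intS by (auto simp: dist_commute)
    ultimately show ?thesis using s by (simp add: h_def)
  qed
  show "\<exists>d>0. \<forall>y\<in>S. norm (y - x) < d \<longrightarrow> norm (f y - f x - D x (y - x)) \<le> e * norm (y - x)"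
  proof (intro exI[of _ d] conjI ballI impI d)
    fix y assume y: "y \<in> S" "norm (y - x) < d"
    \<comment> \<open>Contraction towards the interior point \<open>p\<close>: for small positive
      \<eta> it moves every point of \<open>S\<close> into the interior, and it tends to the
      identity as \<eta> tends to 0.\<close>
    define \<pi> where "\<pi> u \<eta> = u - \<eta> *\<^sub>R (u - p)" for u \<eta>
    have lim: "((\<lambda>\<eta>. \<pi> u \<eta>) \<longlongrightarrow> u) (at_right 0)" for u
      unfolding \<pi>_def by (rule tendsto_eq_intros refl | simp)+
    have pin: "\<forall>\<^sub>F \<eta> in at_right 0. \<pi> u \<eta> \<in> interior S" if "u \<in> S" for u
      using eventually_at_right_less[of 0] eventually_at_right_real[of 0 1, simplified]
      by eventually_elim (use mem_interior_convex_shrink[OF S(1) p that] in \<open>auto simp: \<pi>_def\<close>)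
    have pball: "\<forall>\<^sub>F \<eta> in at_right 0. \<pi> u \<eta> \<in> ball x d" if "u \<in> ball x d" for u
      using topological_tendstoD[OF lim open_ball that] .
    have flim: "((\<lambda>\<eta>. f (\<pi> u \<eta>)) \<longlongrightarrow> f u) (at_right 0)" if "u \<in> S" for u
    proof (rule continuous_on_tendsto_compose[OF f lim that])
      show "\<forall>\<^sub>F \<eta> in at_right 0. \<pi> u \<eta> \<in> S" using pin[OF that] intS by (auto elim: eventually_mono)
    qed
    have "((\<lambda>\<eta>. \<bar>f (\<pi> y \<eta>) - f (\<pi> x \<eta>) - D x (\<pi> y \<eta> - \<pi> x \<eta>)\<bar>) \<longlongrightarrow> \<bar>f y - f x - D x (y - x)\<bar>) (at_right 0)"
      using lin[OF x] by (intro tendsto_intros flim y x linear_lim_0 bounded_linear.tendsto[where f="D x"] lim)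
        (auto simp: linear_conv_bounded_linear)
    moreover have "((\<lambda>\<eta>. e * norm (\<pi> y \<eta> - \<pi> x \<eta>)) \<longlongrightarrow> e * norm (y - x)) (at_right 0)"
      by (intro tendsto_intros lim)
    moreover have "\<forall>\<^sub>F \<eta> in at_right 0. \<bar>f (\<pi> y \<eta>) - f (\<pi> x \<eta>) - D x (\<pi> y \<eta> - \<pi> x \<eta>)\<bar> \<le> e * norm (\<pi> y \<eta> - \<pi> x \<eta>)"
    proof -
      have b: "y \<in> ball x d" "x \<in> ball x d" using y(2) d by (auto simp: dist_norm norm_minus_commute)
      show ?thesis
        using pin[OF y(1)] pin[OF x] pball[OF b(1)] pball[OF b(2)]
        by eventually_elim (rule inner; blast)
    qed
    ultimately have "\<bar>f y - f x - D x (y - x)\<bar> \<le> e * norm (y - x)"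
      by (intro tendsto_le[of "at_right (0::real)"]) auto
    then show "norm (f y - f x - D x (y - x)) \<le> e * norm (y - x)" by simp
  qed
qed

text \<open>Only directional derivatives at interior points have to be computed; continuity of the
  candidates \<open>f1\<close> and \<open>f2\<close> up to the boundary supplies the rest.\<close>

lemma jetI:
  assumes S: "convex S" "interior S \<noteq> {}" and f: "continuous_on S f"
    and lin: "\<And>x. x \<in> S \<Longrightarrow> linear (f1 x)" "\<And>x h. x \<in> S \<Longrightarrow> linear (f2 x h)"
    and cont: "\<And>h. continuous_on S (\<lambda>x. f1 x h)" "\<And>h k. continuous_on S (\<lambda>x. f2 x h k)"
    and sym: "\<And>x h k. x \<in> S \<Longrightarrow> f2 x h k = f2 x k h"
    and der: "\<And>x h. x \<in> interior S \<Longrightarrow> ((\<lambda>s. f (x + s *\<^sub>R h)) has_real_derivative f1 x h) (at 0)"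
      "\<And>x h k. x \<in> interior S \<Longrightarrow> ((\<lambda>s. f1 (x + s *\<^sub>R k) h) has_real_derivative f2 x h k) (at 0)"
  shows "jet S f f1 f2"
  unfolding jet_def
proof (intro conjI ballI allI)
  fix x assume x: "x \<in> S"
  show "(f has_derivative f1 x) (at x within S)"
    by (rule has_derivative_within_convexI[where D=f1, OF S f lin(1) cont(1) der(1) x])
  show "((\<lambda>x. f1 x h) has_derivative f2 x h) (at x within S)" for h
    by (rule has_derivative_within_convexI[where D="\<lambda>x. f2 x h", OF S cont(1) lin(2) cont(2) der(2) x])
qed (use sym cont in auto)

lemma jet_cong:
  assumes "jet S f f1 f2" and "\<And>x. x \<in> S \<Longrightarrow> f' x = f x" "\<And>x h. x \<in> S \<Longrightarrow> f1' x h = f1 x h"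
    "\<And>x h k. x \<in> S \<Longrightarrow> f2' x h k = f2 x h k"
  shows "jet S f' f1' f2'"
  unfolding jet_def
proof (intro conjI ballI allI)
  fix x assume x: "x \<in> S"
  have e: "f1' x = f1 x" "\<And>h. f2' x h = f2 x h" using assms x by auto
  show "(f' has_derivative f1' x) (at x within S)"
    unfolding e using assms x by (auto simp: jet_def intro: has_derivative_transform)
  show "((\<lambda>x. f1' x h) has_derivative f2' x h) (at x within S)" for h
    unfolding e(2) by (rule has_derivative_transform[where f="\<lambda>x. f1 x h"]) (use assms x in \<open>auto simp: jet_def\<close>)
  show "f2' x h k = f2' x k h" for h k using assms x by (auto simp: jet_def)
next
  show "continuous_on S (\<lambda>x. f2' x h k)" for h k
    using assms by (auto simp: jet_def cong: continuous_on_cong_simp)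
qed

text \<open>A closed piece that misses \<open>x\<close> stays at positive distance from it, so it
  does not constrain a small ball; the finitely many radii have a positive minimum.\<close>

lemma has_derivative_within_closed_Union:
  assumes I: "finite I" "\<And>i. i \<in> I \<Longrightarrow> closed (S i)"
    and D: "\<And>i. i \<in> I \<Longrightarrow> x \<in> S i \<Longrightarrow> (f has_derivative D) (at x within S i)"
    and x: "x \<in> (\<Union>i\<in>I. S i)"
  shows "(f has_derivative D) (at x within (\<Union>i\<in>I. S i))"
proof -
  have bl: "bounded_linear D" using x D has_derivative_bounded_linear by blast
  have "\<exists>d>0. \<forall>y\<in>(\<Union>i\<in>I. S i). norm (y - x) < d \<longrightarrow> norm (f y - f x - D (y - x)) \<le> e * norm (y - x)" if e: "0 < e" for e
  proof -
    have "\<exists>d>0. \<forall>y\<in>S i. norm (y - x) < d \<longrightarrow> norm (f y - f x - D (y - x)) \<le> e * norm (y - x)" if i: "i \<in> I" for i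
    proof (cases "x \<in> S i")
      case True
      then show ?thesis using D[OF i] e unfolding has_derivative_within_alt by blast
    next
      case False
      then obtain d where "0 < d" "ball x d \<subseteq> - S i"
        using I(2)[OF i] by (meson ComplI open_Compl open_contains_ball)
      then have "y \<notin> S i" if "norm (y - x) < d" for y using that by (auto simp: mem_ball dist_norm norm_minus_commute)
      with \<open>0 < d\<close> show ?thesis by blast
    qed
    then obtain d where d: "\<And>i. i \<in> I \<Longrightarrow> 0 < d i" "\<And>i y. i \<in> I \<Longrightarrow> y \<in> S i \<Longrightarrow> norm (y - x) < d i \<Longrightarrow> norm (f y - f x - D (y - x)) \<le> e * norm (y - x)"
      by metis
    have ne: "I \<noteq> {}" using x by auto
    show ?thesis
      by (rule exI[of _ "Min (d ` I)"]) (use I(1) ne d in auto)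
  qed
  with bl show ?thesis unfolding has_derivative_within_alt by blast
qed

lemma jet_closed_Union:
  assumes I: "finite I" "\<And>i. i \<in> I \<Longrightarrow> closed (S i)" and J: "\<And>i. i \<in> I \<Longrightarrow> jet (S i) f f1 f2"
  shows "jet (\<Union>i\<in>I. S i) f f1 f2"
  unfolding jet_def
proof (intro conjI ballI allI)
  fix x assume x: "x \<in> (\<Union>i\<in>I. S i)"
  show "(f has_derivative f1 x) (at x within (\<Union>i\<in>I. S i))"
    using J by (intro has_derivative_within_closed_Union[OF I _ x]) (auto simp: jet_def)
  show "((\<lambda>x. f1 x h) has_derivative f2 x h) (at x within (\<Union>i\<in>I. S i))" for h
    using J by (intro has_derivative_within_closed_Union[OF I _ x]) (auto simp: jet_def)
  show "f2 x h k = f2 x k h" for h k using x J by (auto simp: jet_def)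
next
  show "continuous_on (\<Union>i\<in>I. S i) (\<lambda>x. f2 x h k)" for h k
    using J by (intro continuous_on_closed_Union I) (auto simp: jet_def)
qed

lemma jet_linear_pullback:
  fixes L :: "'a::euclidean_space \<Rightarrow> 'b::euclidean_space"
  assumes J: "jet S f f1 f2" and L: "linear L" and A: "L ` A \<subseteq> S"
  shows "jet A (\<lambda>x. f (L x)) (\<lambda>x h. f1 (L x) (L h)) (\<lambda>x h k. f2 (L x) (L h) (L k))"
proof -
  have LD: "(L has_derivative L) (at x within A)" for x
    using L by (simp add: linear_conv_bounded_linear bounded_linear_imp_has_derivative)
  have LC: "continuous_on A L" using L by (simp add: linear_continuous_on linear_conv_bounded_linear)
  show ?thesis
    unfolding jet_def
  proof (intro conjI ballI allI)
    fix x assume x: "x \<in> A"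
    then have Lx: "L x \<in> S" using A by auto
    show "((\<lambda>x. f (L x)) has_derivative (\<lambda>h. f1 (L x) (L h))) (at x within A)"
      by (rule has_derivative_in_compose[OF LD]) (use J Lx A in \<open>auto simp: jet_def intro: has_derivative_subset\<close>)
    show "((\<lambda>x. f1 (L x) (L h)) has_derivative (\<lambda>k. f2 (L x) (L h) (L k))) (at x within A)" for h
      by (rule has_derivative_in_compose[OF LD, where g="\<lambda>y. f1 y (L h)"]) (use J Lx A in \<open>unfold jet_def, blast intro: has_derivative_subset\<close>)
    show "f2 (L x) (L h) (L k) = f2 (L x) (L k) (L h)" for h k using J Lx by (auto simp: jet_def)
  next
    show "continuous_on A (\<lambda>x. f2 (L x) (L h) (L k))" for h k
      using J A by (intro continuous_on_compose2[OF _ LC, of S "\<lambda>y. f2 y (L h) (L k)"]) (auto simp: jet_def)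
  qed
qed

lemma jet_add_linear:
  assumes J: "jet S f f1 f2" and l: "bounded_linear l"
  shows "jet S (\<lambda>x. l x + f x) (\<lambda>x h. l h + f1 x h) f2"
  using J bounded_linear_imp_has_derivative[OF l]
  unfolding jet_def by (auto intro!: derivative_eq_intros)

text \<open>The operators are assembled from their entries on the basis, so that continuity and
  differentiability reduce to real-valued functions. At interior points the derivative within
  \<open>S\<close> is the ordinary one.\<close>

lemma jet_imp_C2_on:
  fixes f :: "'a::euclidean_space \<Rightarrow> real"
  assumes J: "jet S f f1 f2"
  shows "C2_on S f"
proof -
  define F1 where "F1 x = (\<Sum>b\<in>Basis. f1 x b *\<^sub>R blinfun_inner_left b)" for x
  define F2 where "F2 x = Blinfun (\<lambda>k. \<Sum>b\<in>Basis. f2 x b k *\<^sub>R blinfun_inner_left b)" for x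
  have cont: "continuous_on S f" "continuous_on S (\<lambda>x. f1 x h)" "continuous_on S (\<lambda>x. f2 x h k)" for h k
    using J by (auto simp: jet_def continuous_on_eq_continuous_within intro: has_derivative_continuous)
  have F1: "blinfun_apply (F1 x) = f1 x" if "x \<in> S" for x
  proof
    fix h
    have lin: "linear (f1 x)" using J that by (auto simp: jet_def dest: has_derivative_linear)
    have "f1 x h = f1 x (\<Sum>b\<in>Basis. (h \<bullet> b) *\<^sub>R b)" by (simp add: euclidean_representation)
    also have "\<dots> = (\<Sum>b\<in>Basis. (h \<bullet> b) * f1 x b)" using lin by (simp add: linear_sum linear_scale)
    finally show "blinfun_apply (F1 x) h = f1 x h"
      by (simp add: F1_def blinfun.sum_left blinfun.scaleR_left inner_commute mult.commute)
  qed
  have F2: "blinfun_apply (F2 x) k = (\<Sum>b\<in>Basis. f2 x b k *\<^sub>R blinfun_inner_left b)" if "x \<in> S" for x k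
  proof -
    have "bounded_linear (\<lambda>k. \<Sum>b\<in>Basis. f2 x b k *\<^sub>R blinfun_inner_left b)"
      using J that by (intro bounded_linear_sum bounded_linear_scaleR_const)
        (auto simp: jet_def dest: has_derivative_bounded_linear)
    then show ?thesis unfolding F2_def by (simp add: bounded_linear_Blinfun_apply)
  qed
  show ?thesis
    unfolding C2_on_def
  proof (intro conjI exI[of _ F1] exI[of _ F2] ballI cont)
    show "continuous_on S F1" unfolding F1_def by (intro continuous_intros cont)
    show "continuous_on S F2"
    proof (rule continuous_on_blinfun_componentwise)
      fix i :: 'a
      have "continuous_on S (\<lambda>x. \<Sum>b\<in>Basis. f2 x b i *\<^sub>R (blinfun_inner_left b :: 'a \<Rightarrow>\<^sub>L real))"
        by (intro continuous_intros cont)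
      then show "continuous_on S (\<lambda>x. blinfun_apply (F2 x) i)"
        by (rule continuous_on_eq) (simp add: F2)
    qed
    fix x assume x: "x \<in> interior S"
    then have xS: "x \<in> S" using interior_subset by auto
    show "(f has_derivative blinfun_apply (F1 x)) (at x)"
      using J xS x at_within_interior[OF x] by (auto simp: jet_def F1)
    have "(F1 has_derivative (\<lambda>k. \<Sum>b\<in>Basis. f2 x b k *\<^sub>R blinfun_inner_left b)) (at x)"
      unfolding F1_def using J xS x at_within_interior[OF x]
      by (intro has_derivative_sum has_derivative_scaleR_left) (auto simp: jet_def)
    moreover have "blinfun_apply (F2 x) = (\<lambda>k. \<Sum>b\<in>Basis. f2 x b k *\<^sub>R blinfun_inner_left b)" using F2[OF xS] by auto
    ultimately show "(F1 has_derivative blinfun_apply (F2 x)) (at x)" by simp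
  qed
qed

text \<open>Along the segment from \<open>x\<close> to \<open>x'\<close> both functions are the same
  function of one real variable, and a one-sided derivative at the end of an interval is
  unique.\<close>

lemma face_derivative_eq:
  fixes f f' :: "'a::euclidean_space \<Rightarrow> real"
  assumes W: "convex W" "W \<subseteq> S" "W \<subseteq> S'" and eq: "\<And>y. y \<in> W \<Longrightarrow> f y = f' y"
    and D: "(f has_derivative D) (at x within S)" and D': "(f' has_derivative D') (at x within S')"
    and x: "x \<in> W" "x' \<in> W"
  shows "D (x' - x) = D' (x' - x)"
proof -
  define q where "q r = x + r *\<^sub>R (x' - x)" for r :: real
  have q: "q ` {0..1} \<subseteq> W"
  proof
    fix z assume "z \<in> q ` {0..1}"
    then obtain r where r: "0 \<le> r" "r \<le> 1" "z = q r" by auto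
    have "q r = (1 - r) *\<^sub>R x + r *\<^sub>R x'" by (simp add: q_def algebra_simps)
    then show "z \<in> W" using convexD_alt[OF W(1) x] r by simp
  qed
  have qd: "(q has_derivative (\<lambda>r. r *\<^sub>R (x' - x))) (at 0 within {0..1})"
    unfolding q_def by (auto intro!: derivative_eq_intros)
  have q0: "q 0 = x" by (simp add: q_def)
  have a: "((\<lambda>r. f (q r)) has_derivative (\<lambda>r. D (r *\<^sub>R (x' - x)))) (at 0 within {0..1})"
    by (rule has_derivative_in_compose[OF qd]) (use D q W in \<open>auto simp: q0 intro: has_derivative_subset\<close>)
  have b: "((\<lambda>r. f' (q r)) has_derivative (\<lambda>r. D' (r *\<^sub>R (x' - x)))) (at 0 within {0..1})"
    by (rule has_derivative_in_compose[OF qd]) (use D' q W in \<open>auto simp: q0 intro: has_derivative_subset\<close>)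
  have b': "((\<lambda>r. f (q r)) has_derivative (\<lambda>r. D' (r *\<^sub>R (x' - x)))) (at 0 within {0..1})"
    by (rule has_derivative_transform[OF _ _ b]) (use q eq in \<open>auto simp: image_subset_iff\<close>)
  have lin: "D (r *\<^sub>R (x' - x)) = r *\<^sub>R D (x' - x)" "D' (r *\<^sub>R (x' - x)) = r *\<^sub>R D' (x' - x)" for r
    using D D' by (auto dest!: has_derivative_linear simp: linear_scale)
  have "((\<lambda>r. f (q r)) has_vector_derivative D (x' - x)) (at 0 within {0..1})"
    "((\<lambda>r. f (q r)) has_vector_derivative D' (x' - x)) (at 0 within {0..1})"
    using a b' by (simp_all add: has_vector_derivative_def lin)
  then show ?thesis
    by (rule vector_derivative_unique_within[rotated]) (simp add: trivial_limit_within islimpt_Icc)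
qed

text \<open>Agreement along the face gives the tangential derivatives for free, first of
  \<open>f\<close> and then of each \<open>f1 x h\<close>. Together with one transversal direction
  \<open>n\<close> these directions span the space, and symmetry of \<open>f2\<close> reduces the
  missing second derivatives to the single entry (n, n).\<close>

lemma jet_face_match:
  fixes f f' :: "'a::euclidean_space \<Rightarrow> real"
  assumes J: "jet S f f1 f2" "jet S' f' f1' f2'" and W: "convex W" "W \<subseteq> S" "W \<subseteq> S'"
    and sp: "\<And>x. x \<in> W \<Longrightarrow> span (insert n ((\<lambda>y. y - x) ` W)) = UNIV"
    and eq: "\<And>x. x \<in> W \<Longrightarrow> f x = f' x" "\<And>x. x \<in> W \<Longrightarrow> f1 x n = f1' x n" "\<And>x. x \<in> W \<Longrightarrow> f2 x n n = f2' x n n"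
    and x: "x \<in> W"
  shows "f1 x h = f1' x h" "f2 x h k = f2' x h k"
proof -
  have der: "(f has_derivative f1 x) (at x within S)" "(f' has_derivative f1' x) (at x within S')"
      "((\<lambda>x. f1 x h) has_derivative f2 x h) (at x within S)" "((\<lambda>x. f1' x h) has_derivative f2' x h) (at x within S')"
      "f2 x h k = f2 x k h" "f2' x h k = f2' x k h" if "x \<in> W" for x h k
    using J that W by (auto simp: jet_def)
  have e1: "f1 x h = f1' x h" if x: "x \<in> W" for x h
  proof (rule linear_eq_on[of "f1 x" "f1' x" h "insert n ((\<lambda>y. y - x) ` W)"])
    show "linear (f1 x)" "linear (f1' x)" using der[OF x] by (auto dest: has_derivative_linear)
    show "h \<in> span (insert n ((\<lambda>y. y - x) ` W))" using sp[OF x] by simp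
    fix b assume "b \<in> insert n ((\<lambda>y. y - x) ` W)"
    then show "f1 x b = f1' x b"
      using eq(2)[OF x] face_derivative_eq[OF W eq(1) der(1,2)[OF x] x] by auto
  qed
  show "f1 x h = f1' x h" by (rule e1[OF x])
  have t: "f2 x h (y - x) = f2' x h (y - x)" if "y \<in> W" for h y
    by (rule face_derivative_eq[OF W _ der(3,4)[OF x] x that]) (rule e1)
  have e2: "f2 x n k = f2' x n k" for k
  proof (rule linear_eq_on[of "f2 x n" "f2' x n" k "insert n ((\<lambda>y. y - x) ` W)"])
    show "linear (f2 x n)" "linear (f2' x n)" using der[OF x] by (auto dest: has_derivative_linear)
    show "k \<in> span (insert n ((\<lambda>y. y - x) ` W))" using sp[OF x] by simp
    fix b assume "b \<in> insert n ((\<lambda>y. y - x) ` W)"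
    then show "f2 x n b = f2' x n b" using eq(3)[OF x] t by auto
  qed
  show "f2 x h k = f2' x h k"
  proof (rule linear_eq_on[of "f2 x h" "f2' x h" k "insert n ((\<lambda>y. y - x) ` W)"])
    show "linear (f2 x h)" "linear (f2' x h)" using der[OF x] by (auto dest: has_derivative_linear)
    show "k \<in> span (insert n ((\<lambda>y. y - x) ` W))" using sp[OF x] by simp
    fix b assume "b \<in> insert n ((\<lambda>y. y - x) ` W)"
    then consider "b = n" | y where "y \<in> W" "b = y - x" by auto
    then show "f2 x h b = f2' x h b"
    proof cases
      case 1
      then show ?thesis using e2[of h] der(5,6)[OF x, of h n] by simp
    qed (simp add: t)
  qed
qed

text \<open>A function that is constant along \<open>W\<close>, here the derivative in direction
  \<open>n\<close>, has vanishing derivative in the directions of \<open>W\<close>.\<close>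

lemma jet_wall_tangential:
  assumes J: "jet S f f1 f2" and W: "convex W" "W \<subseteq> S" and c: "\<And>x. x \<in> W \<Longrightarrow> f1 x n = c"
    and x: "x \<in> W" "y \<in> W"
  shows "f2 x n (y - x) = 0"
proof -
  have "f2 x n (y - x) = (\<lambda>_. 0) (y - x)"
    by (rule face_derivative_eq[OF W W(2), of "\<lambda>x. f1 x n" "\<lambda>_. c" _ x])
      (use J W x c in \<open>auto simp: jet_def\<close>)
  then show ?thesis by simp
qed

subsection \<open>The weight g and dominated integrals\<close>

lemma arccoth_has_real_derivative:
  assumes "1 < r" shows "(arccoth has_real_derivative - 1 / (r\<^sup>2 - 1)) (at r)"
proof -
  have "((\<lambda>r. 1/2 * ln ((r + 1) / (r - 1))) has_real_derivative - 1 / (r\<^sup>2 - 1)) (at r)"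
    using assms power2_eq_1_iff[of r]
    by (auto intro!: derivative_eq_intros simp: divide_simps power2_eq_square) algebra?
  then show ?thesis by (simp add: arccoth_def[abs_def])
qed

definition gnum :: "real \<Rightarrow> real" where
  "gnum r = 8 - 25 * r ^ 2 + 15 * r ^ 4 - 15 * r * (r ^ 2 - 1) ^ 2 * arccoth r"

lemma g_eq: "g r = gnum r / (16 * sqrt 2 * r * sqrt (r ^ 2 - 1))"
  by (simp add: g_def gnum_def)

text \<open>\<open>arccoth\<close> occurs linearly in \<open>gnum\<close> and has a rational
  derivative, so it can be eliminated between \<open>gnum\<close> and its derivative.\<close>

lemma gnum_has_real_derivative:
  assumes "1 < r"
  shows "(gnum has_real_derivative ((5 * r\<^sup>2 - 1) * gnum r + 8) / ((r\<^sup>2 - 1) * r)) (at r)"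
proof -
  have X: "r\<^sup>2 - 1 \<noteq> 0" using assms by (simp add: power2_eq_1_iff)
  have "(gnum has_real_derivative (- 50 * r + 60 * r^3 - (15 * (r\<^sup>2 - 1)\<^sup>2 + 60 * r\<^sup>2 * (r\<^sup>2 - 1)) * arccoth r
      - 15 * r * (r\<^sup>2 - 1)\<^sup>2 * (- 1 / (r\<^sup>2 - 1)))) (at r)"
    unfolding gnum_def[abs_def]
    by (rule derivative_eq_intros arccoth_has_real_derivative[OF assms] refl | simp)+
      (simp add: algebra_simps power2_eq_square power3_eq_cube power4_eq_xxxx)
  moreover have "- 50 * r + 60 * r^3 - (15 * (r\<^sup>2 - 1)\<^sup>2 + 60 * r\<^sup>2 * (r\<^sup>2 - 1)) * arccoth r
      - 15 * r * (r\<^sup>2 - 1)\<^sup>2 * (- 1 / (r\<^sup>2 - 1)) = ((5 * r\<^sup>2 - 1) * gnum r + 8) / ((r\<^sup>2 - 1) * r)"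
    using X assms unfolding gnum_def
    by (simp add: divide_simps) algebra
  ultimately show ?thesis by simp
qed

lemma continuous_on_gnum: "continuous_on {1<..} gnum"
  by (rule DERIV_continuous_on) (auto intro: has_field_derivative_at_within gnum_has_real_derivative)

lemma continuous_on_g: "continuous_on {1<..} g"
proof -
  have "r ^ 2 \<noteq> 1" if "1 < r" for r :: real using that by (simp add: power2_eq_1_iff)
  then show ?thesis unfolding g_eq[abs_def] by (auto intro!: continuous_intros continuous_on_gnum)
qed

lemma g_measurable [measurable]: "g \<in> borel_measurable borel"
  unfolding g_def[abs_def] arccoth_def[abs_def] by measurable

text \<open>The factor c^2 - 1 clears the singularity at 1, and the inhomogeneity is algebraic;
  hence integrals of \<open>g\<close> against suitable polynomials in c have closed forms.\<close>

lemma g_ode: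
  assumes c: "1 < c"
  shows "((\<lambda>c. (c\<^sup>2 - 1) * g c) has_real_derivative
    5 * c * g c + 1 / (2 * sqrt 2 * c\<^sup>2 * sqrt (c\<^sup>2 - 1))) (at c)"
proof -
  define s where "s = sqrt (c\<^sup>2 - 1)"
  have X: "0 < c\<^sup>2 - 1" using c by (simp add: one_less_power)
  have s: "0 < s" "s * s = c\<^sup>2 - 1" using X by (auto simp: s_def)
  have "((\<lambda>c. sqrt (c\<^sup>2 - 1) * gnum c / (16 * sqrt 2 * c)) has_real_derivative
      ((c / s * gnum c + s * (((5 * c\<^sup>2 - 1) * gnum c + 8) / ((c\<^sup>2 - 1) * c))) * c - s * gnum c) / (16 * sqrt 2 * c\<^sup>2)) (at c)"
    using c X s unfolding s_def
    by (auto intro!: derivative_eq_intros gnum_has_real_derivative simp: divide_simps power2_eq_square) algebra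
  moreover have "((c / s * gnum c + s * (((5 * c\<^sup>2 - 1) * gnum c + 8) / ((c\<^sup>2 - 1) * c))) * c - s * gnum c) / (16 * sqrt 2 * c\<^sup>2)
     = 5 * c * g c + 1 / (2 * sqrt 2 * c\<^sup>2 * sqrt (c\<^sup>2 - 1))"
    unfolding g_eq s_def[symmetric] s(2)[symmetric] using s(1) c
    apply (simp add: divide_simps)
    using s(2) by (simp add: power2_eq_square) algebra
  ultimately have "((\<lambda>c. sqrt (c\<^sup>2 - 1) * gnum c / (16 * sqrt 2 * c)) has_real_derivative
     5 * c * g c + 1 / (2 * sqrt 2 * c\<^sup>2 * sqrt (c\<^sup>2 - 1))) (at c)" by simp
  then show ?thesis
  proof (rule has_field_derivative_transform_within_open[OF _ open_greaterThan, of _ _ _ 1])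
    fix x :: real assume "x \<in> {1<..}"
    then have "0 < x\<^sup>2 - 1" by (simp add: one_less_power)
    then have "sqrt (x\<^sup>2 - 1) * sqrt (x\<^sup>2 - 1) = x\<^sup>2 - 1" "sqrt (x\<^sup>2 - 1) \<noteq> 0" by auto
    then show "sqrt (x\<^sup>2 - 1) * gnum x / (16 * sqrt 2 * x) = (x\<^sup>2 - 1) * g x"
      using \<open>x \<in> {1<..}\<close> unfolding g_eq by (simp add: divide_simps)
  qed (use c in auto)
qed

lemma bounded_of_limits:
  fixes f :: "real \<Rightarrow> real"
  assumes f: "continuous_on {a<..} f" and l: "(f \<longlongrightarrow> l) (at_right a)" and m: "(f \<longlongrightarrow> m) at_top"
  obtains B where "0 < B" "\<And>x. a < x \<Longrightarrow> \<bar>f x\<bar> \<le> B"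
proof -
  have "\<forall>\<^sub>F x in at_right a. \<bar>f x\<bar> < \<bar>l\<bar> + 1"
    using order_tendstoD(2)[OF tendsto_rabs[OF l]] by simp
  then obtain b where b: "a < b" "\<And>x. a < x \<Longrightarrow> x < b \<Longrightarrow> \<bar>f x\<bar> < \<bar>l\<bar> + 1"
    unfolding eventually_at_right_field by blast
  have "\<forall>\<^sub>F x in at_top. \<bar>f x\<bar> < \<bar>m\<bar> + 1"
    using order_tendstoD(2)[OF tendsto_rabs[OF m]] by simp
  then obtain d where d: "\<And>x. d \<le> x \<Longrightarrow> \<bar>f x\<bar> < \<bar>m\<bar> + 1"
    unfolding eventually_at_top_linorder by blast
  have "compact (f ` {b..d})"
    using b by (intro compact_continuous_image continuous_on_subset[OF f]) auto
  then have "bounded (f ` {b..d})" by (rule compact_imp_bounded)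
  then obtain B where B: "\<And>x. b \<le> x \<Longrightarrow> x \<le> d \<Longrightarrow> \<bar>f x\<bar> \<le> B"
    unfolding bounded_iff by (metis atLeastAtMost_iff image_eqI real_norm_def)
  show thesis
  proof (rule that[of "\<bar>l\<bar> + \<bar>m\<bar> + 1 + \<bar>B\<bar>"])
    fix x assume "a < x"
    then show "\<bar>f x\<bar> \<le> \<bar>l\<bar> + \<bar>m\<bar> + 1 + \<bar>B\<bar>"
      using b(2)[of x] d[of x] B[of x] by (cases "x < b"; cases "d \<le> x") auto
  qed auto
qed

text \<open>In the expansion of \<open>gnum\<close> at infinity the powers 4, 2 and 0 cancel and the
  leading term is -8/7 r^(-2). The weight r^2 therefore gives finite limits at both ends, and
  \<open>g\<close> decays like c^(-4).\<close>

lemma g_bound: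
  obtains B where "0 < B" "\<And>c. 1 < c \<Longrightarrow> \<bar>g c\<bar> \<le> B / (c ^ 3 * sqrt (c\<^sup>2 - 1))"
proof -
  have "((\<lambda>r::real. r\<^sup>2 * (8 - 25 * r ^ 2 + 15 * r ^ 4 - 15 * r * (r ^ 2 - 1) ^ 2 * (1/2 * ln ((r + 1) / (r - 1))))) \<longlongrightarrow> -2) (at_right 1)"
    by real_asymp
  moreover have "((\<lambda>r::real. r\<^sup>2 * (8 - 25 * r ^ 2 + 15 * r ^ 4 - 15 * r * (r ^ 2 - 1) ^ 2 * (1/2 * ln ((r + 1) / (r - 1))))) \<longlongrightarrow> -8/7) at_top"
    by real_asymp
  ultimately have "((\<lambda>r. r\<^sup>2 * gnum r) \<longlongrightarrow> -2) (at_right 1)" "((\<lambda>r. r\<^sup>2 * gnum r) \<longlongrightarrow> -8/7) at_top"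
    unfolding gnum_def arccoth_def .
  moreover have "continuous_on {1<..} (\<lambda>r. r\<^sup>2 * gnum r)" by (intro continuous_intros continuous_on_gnum)
  ultimately obtain B where B: "0 < B" "\<And>c. 1 < c \<Longrightarrow> \<bar>c\<^sup>2 * gnum c\<bar> \<le> B"
    using bounded_of_limits[of 1 "\<lambda>r. r\<^sup>2 * gnum r"] by blast
  show thesis
  proof (rule that[OF B(1)])
    fix c :: real assume c: "1 < c"
    define s where "s = sqrt (c\<^sup>2 - 1)"
    have s: "0 < s" using c by (simp add: s_def one_less_power)
    have "\<bar>g c\<bar> = \<bar>c\<^sup>2 * gnum c\<bar> / (16 * sqrt 2 * (c ^ 3 * s))"
      unfolding g_eq s_def[symmetric] using s c by (simp add: abs_mult power2_eq_square power3_eq_cube)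
    also have "\<dots> \<le> B / (16 * sqrt 2 * (c ^ 3 * s))"
      using B(2)[OF c] s c by (intro divide_right_mono) auto
    also have "\<dots> \<le> B / (1 * (c ^ 3 * s))"
    proof (intro divide_left_mono mult_right_mono)
      show "1 \<le> 16 * sqrt 2" using real_sqrt_ge_1_iff[of 2] by linarith
    qed (use B(1) s c in auto)
    finally show "\<bar>g c\<bar> \<le> B / (c ^ 3 * sqrt (c\<^sup>2 - 1))" by (simp add: s_def)
  qed
qed

text \<open>The primitive arctan(sqrt(c^2 - 1)) runs from 0 to pi/2, which covers the singularity at
  1 and the decay at infinity at once.\<close>

lemma dominating_integrable: "set_integrable lborel {1<..} (\<lambda>c::real. 1 / (c * sqrt (c\<^sup>2 - 1)))"
proof -
  have "set_integrable lborel (einterval (ereal 1) \<infinity>) (\<lambda>c::real. 1 / (c * sqrt (c\<^sup>2 - 1)))"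
  proof (rule interval_integral_FTC_nonneg[where F="\<lambda>c. arctan (sqrt (c\<^sup>2 - 1))" and A=0 and B="pi/2"])
    fix x assume "ereal 1 < ereal x" 
    then have x: "1 < x" "0 < x\<^sup>2 - 1" "x\<^sup>2 \<noteq> 1" by (simp_all add: one_less_power power2_eq_1_iff)
    show "((\<lambda>c. arctan (sqrt (c\<^sup>2 - 1))) has_real_derivative 1 / (x * sqrt (x\<^sup>2 - 1))) (at x)"
      using x by (auto intro!: derivative_eq_intros simp: divide_simps power2_eq_square) 
    show "isCont (\<lambda>c. 1 / (c * sqrt (c\<^sup>2 - 1))) x"
      using x by (auto intro!: continuous_intros)
  next
    show "AE x in lborel. ereal 1 < ereal x \<longrightarrow> ereal x < \<infinity> \<longrightarrow> 0 \<le> 1 / (x * sqrt (x\<^sup>2 - 1))"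
      by (auto intro!: AE_I2 simp: one_le_power)
    show "(((\<lambda>c. arctan (sqrt (c\<^sup>2 - 1))) \<circ> real_of_ereal) \<longlongrightarrow> 0) (at_right (ereal 1))"
      unfolding ereal_tendsto_simps by real_asymp
    show "(((\<lambda>c. arctan (sqrt (c\<^sup>2 - 1))) \<circ> real_of_ereal) \<longlongrightarrow> pi/2) (at_left \<infinity>)"
      unfolding ereal_tendsto_simps by real_asymp
  qed auto
  then show ?thesis by (simp add: einterval_def greaterThan_def)
qed

definition dom :: "real \<Rightarrow> real" where
  "dom c = indicator {1<..} c * (1 / (c * sqrt (c\<^sup>2 - 1)))"

lemma integrable_dom: "integrable lborel dom"
  using dominating_integrable by (simp add: set_integrable_def dom_def[abs_def])

lemma dom_nonneg [simp]: "0 \<le> dom c"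
  by (cases "1 < c") (auto simp: dom_def one_le_power)

lemma g_dom:
  obtains B where "0 < B" "\<And>c. 1 < c \<Longrightarrow> c\<^sup>2 * \<bar>g c\<bar> \<le> B * dom c"
proof -
  obtain B where B: "0 < B" "\<And>c. 1 < c \<Longrightarrow> \<bar>g c\<bar> \<le> B / (c ^ 3 * sqrt (c\<^sup>2 - 1))" using g_bound by blast
  show thesis
  proof (rule that[OF B(1)])
    fix c :: real assume c: "1 < c"
    have "c\<^sup>2 * \<bar>g c\<bar> \<le> c\<^sup>2 * (B / (c ^ 3 * sqrt (c\<^sup>2 - 1)))" using B(2)[OF c] by (intro mult_left_mono) auto
    also have "\<dots> = B * dom c" using c by (simp add: dom_def field_simps power2_eq_square power3_eq_cube)
    finally show "c\<^sup>2 * \<bar>g c\<bar> \<le> B * dom c" .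
  qed
qed

lemma g_dom1:
  obtains B where "0 < B" "\<And>c. 1 < c \<Longrightarrow> \<bar>g c\<bar> \<le> B * dom c"
proof -
  obtain B where B: "0 < B" "\<And>c. 1 < c \<Longrightarrow> c\<^sup>2 * \<bar>g c\<bar> \<le> B * dom c" using g_dom by blast
  have "\<bar>g c\<bar> \<le> B * dom c" if "1 < c" for c
    using B(2)[OF that] mult_right_mono[of 1 "c\<^sup>2" "\<bar>g c\<bar>"] that by (simp add: one_le_power)
  then show thesis using that B(1) by blast
qed

section \<open>Hyperbolic factors on the interval from 1 to coth t\<close>

text \<open>The open interval from \<open>1\<close> to \<open>coth t\<close>, with \<open>coth 0 = \<infinity>\<close>.\<close>

definition Cset :: "real \<Rightarrow> real set" where
  "Cset t = {c. 1 < c \<and> c * sinh t < cosh t}"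

lemma Cset_pos: "0 < t \<Longrightarrow> Cset t = {1<..<cosh t / sinh t}"
  by (auto simp: Cset_def pos_less_divide_eq)

lemma Cset_measurable [measurable]: "Cset t \<in> sets borel"
  unfolding Cset_def by measurable

lemma Cset_gt_1: "c \<in> Cset t \<Longrightarrow> 1 < c" by (simp add: Cset_def)

lemma coth_gt_1: "0 < t \<Longrightarrow> 1 < cosh t / (sinh t :: real)"
  by (simp add: pos_less_divide_eq sinh_less_cosh_real)

text \<open>The n-th derivative of e_c at \<open>\<theta>\<close>; since e_c'' = e_c, only the
  parity of \<open>n\<close> matters.\<close>

definition ek :: "nat \<Rightarrow> real \<Rightarrow> real \<Rightarrow> real" where
  "ek n c \<theta> = (if even n then c * sinh \<theta> - cosh \<theta> else c * cosh \<theta> - sinh \<theta>)"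

lemma ek_has_real_derivative [derivative_intros]:
  assumes "(f has_real_derivative f') (at x within S)"
  shows "((\<lambda>x. ek n c (f x)) has_real_derivative ek (Suc n) c (f x) * f') (at x within S)"
  unfolding ek_def by (auto intro!: derivative_eq_intros assms simp: algebra_simps)

lemma continuous_on_ek [continuous_intros]:
  "continuous_on S f \<Longrightarrow> continuous_on S h \<Longrightarrow> continuous_on S (\<lambda>x. ek n (f x) (h x))"
  unfolding ek_def by (cases "even n") (auto intro!: continuous_intros)

text \<open>\<open>coth\<close> decreases, so c \<le> coth t \<le> coth \<theta>; the argument
  avoids division in order to include \<theta> = 0 and t = 0. The lower bound uses only c >
  1.\<close>

lemma ek_neg:
  assumes c: "1 < c" "c * sinh t \<le> cosh t" and \<theta>: "0 \<le> \<theta>" "\<theta> \<le> t"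
  shows "ek 0 c \<theta> \<le> 0" "- exp (- \<theta>) \<le> ek 0 c \<theta>"
proof -
  have "c * (sinh \<theta> * cosh t) \<le> c * (cosh \<theta> * sinh t)"
    using sinh_real_nonneg_iff[of "t - \<theta>"] \<theta> c
    by (intro mult_left_mono) (simp_all add: sinh_diff mult.commute)
  also have "\<dots> \<le> cosh \<theta> * cosh t"
    using mult_left_mono[OF c(2), of "cosh \<theta>"] by (simp add: mult.left_commute)
  finally have "(c * sinh \<theta>) * cosh t \<le> cosh \<theta> * cosh t" by (simp add: mult.assoc)
  then show "ek 0 c \<theta> \<le> 0" by (simp add: ek_def)
  have "1 * sinh \<theta> \<le> c * sinh \<theta>" using \<theta> c(1) by (intro mult_right_mono) auto
  then show "- exp (- \<theta>) \<le> ek 0 c \<theta>" by (simp add: ek_def cosh_minus_sinh[symmetric])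
qed

lemma ek_odd_bounds:
  assumes "1 < c" "0 \<le> \<theta>" "odd n"
  shows "0 \<le> ek n c \<theta>" "ek n c \<theta> \<le> c * cosh \<theta>"
proof -
  have "sinh \<theta> \<le> cosh \<theta>" using sinh_less_cosh_real[of \<theta>] by simp
  also have "\<dots> \<le> c * cosh \<theta>" using assms by simp
  finally show "0 \<le> ek n c \<theta>" using assms by (simp add: ek_def)
  show "ek n c \<theta> \<le> c * cosh \<theta>" using assms by (simp add: ek_def)
qed

text \<open>Each derivative costs at most a factor c. For even n the stronger bound exp(-\<theta>)
  is available and is given away.\<close>

lemma ek_abs_le:
  assumes c: "1 < c" "c * sinh t \<le> cosh t" and \<theta>: "0 \<le> \<theta>" "\<theta> \<le> t"
  shows "\<bar>ek n c \<theta>\<bar> \<le> c ^ n * cosh \<theta>"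
proof (cases "even n")
  case True
  have "ek n c \<theta> = ek 0 c \<theta>" using True by (simp add: ek_def)
  moreover have "exp (- \<theta>) \<le> 1 * cosh \<theta>" using \<theta> by (simp add: cosh_real_ge_1 order_trans[of _ 1])
  moreover have "1 * cosh \<theta> \<le> c ^ n * cosh \<theta>"
    using c(1) by (intro mult_right_mono) (auto simp: one_le_power)
  ultimately show ?thesis using ek_neg[OF c \<theta>] by linarith
next
  case False
  have "c * cosh \<theta> \<le> c ^ n * cosh \<theta>"
    using c(1) False self_le_power[of c n] by (intro mult_right_mono) (auto simp: odd_pos)
  then show ?thesis using ek_odd_bounds[OF c(1) \<theta>(1) False] by linarith
qed

section \<open>Differentiation of integrals with a moving end point\<close>

lemma integral_dominated_at:
  fixes f :: "real \<Rightarrow> 'a \<Rightarrow> real"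
  assumes m: "\<And>s. f s \<in> borel_measurable N" "h \<in> borel_measurable N" and w: "integrable N w"
    and lim: "AE c in N. ((\<lambda>s. f s c) \<longlongrightarrow> h c) (at x)"
    and d: "0 < d" "\<And>s c. dist s x < d \<Longrightarrow> \<bar>f s c\<bar> \<le> w c"
  shows "((\<lambda>s. integral\<^sup>L N (f s)) \<longlongrightarrow> integral\<^sup>L N h) (at x)"
  unfolding tendsto_at_iff_sequentially
proof (intro allI impI)
  fix X assume X: "\<forall>i. X i \<in> UNIV - {x}" "X \<longlonglongrightarrow> x"
  then have fX: "filterlim X (at x) sequentially" by (auto simp: filterlim_at)
  obtain n0 where n0: "\<And>n. n0 \<le> n \<Longrightarrow> dist (X n) x < d"
    using X(2) d(1) unfolding lim_sequentially by blast
  have "(\<lambda>n. integral\<^sup>L N (f (X (n + n0)))) \<longlonglongrightarrow> integral\<^sup>L N h"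
  proof (rule integral_dominated_convergence[OF m(2) m(1) w])
    show "AE c in N. (\<lambda>n. f (X (n + n0)) c) \<longlonglongrightarrow> h c"
      using lim
    proof eventually_elim
      fix c assume "((\<lambda>s. f s c) \<longlongrightarrow> h c) (at x)"
      from filterlim_compose[OF this fX] show "(\<lambda>n. f (X (n + n0)) c) \<longlonglongrightarrow> h c"
        by (rule LIMSEQ_ignore_initial_segment)
    qed
    show "AE c in N. norm (f (X (n + n0)) c) \<le> w c" for n using d n0 by simp
  qed
  then show "((\<lambda>s. integral\<^sup>L N (f s)) \<circ> X) \<longlonglongrightarrow> integral\<^sup>L N h"
    by (simp add: comp_def LIMSEQ_offset[where k=n0])
qed

text \<open>The integrand may be singular at \<open>a\<close>, so the fundamental theorem is applied
  only from the midpoint \<open>m\<close> on; the integral up to \<open>m\<close> is a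
  constant.\<close>

lemma integral_upper_limit_has_real_derivative:
  fixes f :: "real \<Rightarrow> real"
  assumes f: "continuous_on {a<..} f" and b: "a < b" and I: "\<And>d. integrable lborel (\<lambda>c. indicator {a<..<d} c * f c)"
  shows "((\<lambda>d. LINT c|lborel. indicator {a<..<d} c * f c) has_real_derivative f b) (at b)"
proof -
  define m where "m = (a + b) / 2"
  have m: "a < m" "m < b" using b by (auto simp: m_def)
  have split: "(LINT c|lborel. indicator {a<..<d} c * f c)
     = (LINT c|lborel. indicator {a<..<m} c * f c) + integral {m..d} f" if d: "m < d" for d
  proof -
    have si: "set_integrable lborel {m..d} f"
      using m by (intro borel_integrable_atLeastAtMost' continuous_on_subset[OF f]) auto
    have "(LINT c|lborel. indicator {a<..<d} c * f c)
      = (LINT c|lborel. indicator {a<..<m} c * f c + indicator {m..d} c *\<^sub>R f c)"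
    proof (rule integral_cong_AE)
      show "(\<lambda>c. indicator {a<..<m} c * f c + indicator {m..d} c *\<^sub>R f c) \<in> borel_measurable lborel"
        using I[of m] si unfolding set_integrable_def by (intro borel_measurable_add borel_measurable_integrable)
      show "AE c in lborel. indicator {a<..<d} c * f c = indicator {a<..<m} c * f c + indicator {m..d} c *\<^sub>R f c"
        using AE_lborel_singleton[of d] by eventually_elim (use m d in \<open>auto simp: indicator_def\<close>)
    qed (rule borel_measurable_integrable[OF I])
    also have "\<dots> = (LINT c|lborel. indicator {a<..<m} c * f c) + (LINT c:{m..d}|lborel. f c)"
      unfolding set_lebesgue_integral_def
      by (rule Bochner_Integration.integral_add[OF I]) (use si in \<open>simp add: set_integrable_def\<close>)
    finally show ?thesis by (simp add: set_borel_integral_eq_integral(2)[OF si])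
  qed
  have "((\<lambda>d. integral {m..d} f) has_real_derivative f b) (at b within {m..b + 1})"
    using m by (intro integral_has_real_derivative continuous_on_subset[OF f]) auto
  moreover have "at b within {m..b + 1} = at b" using m by (intro at_within_interior) auto
  ultimately have "((\<lambda>d. (LINT c|lborel. indicator {a<..<m} c * f c) + integral {m..d} f) has_real_derivative f b) (at b)"
    by (auto intro!: derivative_eq_intros)
  then show ?thesis
    by (rule has_field_derivative_transform_within_open[of _ _ _ "{m<..}"]) (use m split in auto)
qed

lemma integrable_continuous_g:
  fixes q :: "real \<Rightarrow> real"
  assumes q: "continuous_on UNIV q"
  shows "integrable lborel (\<lambda>c. indicator {1<..<d} c * (q c * g c))"
proof -
  obtain B where B: "0 < B" "\<And>c. 1 < c \<Longrightarrow> \<bar>g c\<bar> \<le> B * dom c" using g_dom1 by blast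
  note gd = B(2)
    have [measurable]: "q \<in> borel_measurable borel" using q by (rule borel_measurable_continuous_onI)
    have "compact (q ` {1..d})" by (intro compact_continuous_image continuous_on_subset[OF q]) auto
    then have "bounded (q ` {1..d})" by (rule compact_imp_bounded)
    then obtain Q where Q: "\<And>c. 1 \<le> c \<Longrightarrow> c \<le> d \<Longrightarrow> \<bar>q c\<bar> \<le> Q"
      unfolding bounded_iff by (metis atLeastAtMost_iff image_eqI real_norm_def)
    have "norm (indicator {1<..<d} c * (q c * g c)) \<le> norm (\<bar>Q\<bar> * B * dom c)" for c
    proof (cases "c \<in> {1<..<d}")
      case True
      then have "\<bar>q c\<bar> \<le> \<bar>Q\<bar>" "\<bar>g c\<bar> \<le> B * dom c" using Q[of c] gd by auto
      then have "\<bar>q c\<bar> * \<bar>g c\<bar> \<le> \<bar>Q\<bar> * (B * dom c)" by (intro mult_mono) auto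
      then show ?thesis using True B(1) by (simp add: abs_mult mult.assoc)
    qed auto
    then show ?thesis
      by (intro Bochner_Integration.integrable_bound[OF integrable_mult_right[OF integrable_dom, of "\<bar>Q\<bar> * B"]]) auto
qed

text \<open>The integral is split into one with the integrand frozen at s = 0, which sees only the
  moving end, and the increment \<open>\<Delta>\<close> of the integrand over the moving interval,
  whose difference quotient converges by domination with a multiple of \<open>dom\<close>.\<close>

lemma leibniz_moving_limit:
  fixes p p' :: "real \<Rightarrow> real \<Rightarrow> real"
  assumes b: "(b has_real_derivative b') (at 0)" "1 < b 0"
    and p: "continuous_on UNIV (\<lambda>(s, c). p s c)" and p': "continuous_on UNIV (\<lambda>(s, c). p' s c)"
    and der: "\<And>s c. ((\<lambda>s. p s c) has_real_derivative p' s c) (at s)"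
  shows "((\<lambda>s. LINT c|lborel. indicator {1<..<b s} c * (p s c * g c)) has_real_derivative
    (LINT c|lborel. indicator {1<..<b 0} c * (p' 0 c * g c)) + b' * (p 0 (b 0) * g (b 0))) (at 0)"
proof -
  have pc: "continuous_on UNIV (\<lambda>c. p s c)" "continuous_on UNIV (\<lambda>c. p' s c)" for s
    using continuous_on_compose2[OF p, of UNIV "\<lambda>c. (s, c)"] continuous_on_compose2[OF p', of UNIV "\<lambda>c. (s, c)"]
    by (simp_all add: continuous_on_Pair continuous_on_const continuous_on_id)
  have [measurable]: "p s \<in> borel_measurable borel" "p' s \<in> borel_measurable borel" for s
    using pc[of s] by (auto intro: borel_measurable_continuous_onI)
  obtain B where B: "0 < B" "\<And>c. 1 < c \<Longrightarrow> \<bar>g c\<bar> \<le> B * dom c" using g_dom1 by blast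
  note gd = B(2)
  note integ = integrable_continuous_g
  have bc: "isCont b 0" using b(1) by (rule DERIV_isCont)
  have "continuous_on {1<..} (\<lambda>c. p 0 c * g c)"
    by (intro continuous_intros continuous_on_g continuous_on_subset[OF pc(1)]) auto
  then have "((\<lambda>d. LINT c|lborel. indicator {1<..<d} c * (p 0 c * g c)) has_real_derivative p 0 (b 0) * g (b 0)) (at (b 0))"
    using b(2) integ[OF pc(1)] by (intro integral_upper_limit_has_real_derivative) auto
  from DERIV_chain2[OF this b(1)]
  have part1: "((\<lambda>s. LINT c|lborel. indicator {1<..<b s} c * (p 0 c * g c)) has_real_derivative b' * (p 0 (b 0) * g (b 0))) (at 0)"
    by (simp add: mult.commute)
  define \<Delta> where "\<Delta> s = (LINT c|lborel. indicator {1<..<b s} c * ((p s c - p 0 c) * g c))" for s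
  have part2: "(\<Delta> has_real_derivative (LINT c|lborel. indicator {1<..<b 0} c * (p' 0 c * g c))) (at 0)"
  proof -
    define b1 where "b1 = b 0 + 1"
    have "compact ((\<lambda>(s, c). p' s c) ` ({-1..1} \<times> {1..b1}))"
      by (intro compact_continuous_image continuous_on_subset[OF p'] compact_Times) auto
    then have "bounded ((\<lambda>(s, c). p' s c) ` ({-1..1} \<times> {1..b1}))" by (rule compact_imp_bounded)
    then obtain Q where "\<forall>y\<in>(\<lambda>(s, c). p' s c) ` ({-1..1} \<times> {1..b1}). norm y \<le> Q"
      unfolding bounded_iff by blast
    then have Q: "\<And>s c. \<bar>s\<bar> \<le> 1 \<Longrightarrow> 1 \<le> c \<Longrightarrow> c \<le> b1 \<Longrightarrow> \<bar>p' s c\<bar> \<le> Q"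
      by fastforce
    obtain d where d: "0 < d" "\<And>s. dist s 0 < d \<Longrightarrow> dist (b s) (b 0) < 1"
      using bc unfolding continuous_at_eps_delta by (metis zero_less_one)
    have lim: "((\<lambda>s. LINT c|lborel. indicator {1<..<b s} c * ((p s c - p 0 c) / s * g c)) \<longlongrightarrow>
        (LINT c|lborel. indicator {1<..<b 0} c * (p' 0 c * g c))) (at 0)"
    proof (rule integral_dominated_at[where d="min d 1" and w="\<lambda>c. \<bar>Q\<bar> * B * dom c"])
      show "integrable lborel (\<lambda>c. \<bar>Q\<bar> * B * dom c)" by (intro integrable_mult_right integrable_dom)
      show "AE c in lborel. ((\<lambda>s. indicator {1<..<b s} c * ((p s c - p 0 c) / s * g c)) \<longlongrightarrow>
          indicator {1<..<b 0} c * (p' 0 c * g c)) (at 0)"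
        using AE_lborel_singleton[of "b 0"]
      proof eventually_elim
        fix c assume c: "c \<noteq> b 0"
        have "\<forall>\<^sub>F s in at 0. indicator {1<..<b s} c = (indicator {1<..<b 0} c :: real)"
        proof (cases "c < b 0")
          case True
          then have "\<forall>\<^sub>F s in at 0. c < b s" using bc by (intro order_tendstoD) (auto simp: isCont_def)
          then show ?thesis by eventually_elim (use True in \<open>auto simp: indicator_def\<close>)
        next
          case False
          then have "\<forall>\<^sub>F s in at 0. b s < c" using bc c by (intro order_tendstoD(2)[of _ "b 0"]) (auto simp: isCont_def)
          then show ?thesis by eventually_elim (use False in \<open>auto simp: indicator_def\<close>)
        qed
        then have "((\<lambda>s. indicator {1<..<b s} c :: real) \<longlongrightarrow> indicator {1<..<b 0} c) (at 0)"
          by (rule tendsto_eventually)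
        moreover have "((\<lambda>s. (p s c - p 0 c) / s) \<longlongrightarrow> p' 0 c) (at 0)"
          using der[of c 0] by (simp add: has_field_derivative_iff)
        ultimately show "((\<lambda>s. indicator {1<..<b s} c * ((p s c - p 0 c) / s * g c)) \<longlongrightarrow>
          indicator {1<..<b 0} c * (p' 0 c * g c)) (at 0)"
          by (intro tendsto_intros)
      qed
      fix s c :: real assume s: "dist s 0 < min d 1"
      show "\<bar>indicator {1<..<b s} c * ((p s c - p 0 c) / s * g c)\<bar> \<le> \<bar>Q\<bar> * B * dom c"
      proof (cases "c \<in> {1<..<b s}")
        case True
        then have c: "1 < c" "c \<le> b1" using d(2)[of s] s by (auto simp: b1_def dist_real_def)
        have "norm (p s c - p 0 c) \<le> Q * norm (s - 0)"
          by (rule field_differentiable_bound[of "{-1..1}" "\<lambda>s. p s c" "\<lambda>s. p' s c"])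
            (use s c Q der in \<open>auto intro: has_field_derivative_at_within\<close>)
        then have "\<bar>p s c - p 0 c\<bar> \<le> \<bar>Q\<bar> * \<bar>s\<bar>"
          using mult_right_mono[OF abs_ge_self[of Q] abs_ge_zero[of s]] by simp
        then have "\<bar>(p s c - p 0 c) / s\<bar> \<le> \<bar>Q\<bar>"
          by (cases "s = 0") (auto simp: abs_divide divide_simps)
        with gd[OF c(1)] have "\<bar>(p s c - p 0 c) / s\<bar> * \<bar>g c\<bar> \<le> \<bar>Q\<bar> * (B * dom c)" by (intro mult_mono) auto
        then show ?thesis using True by (simp add: abs_mult mult.assoc)
      next
        case False
        then show ?thesis using B(1) by (simp add: dom_def indicator_def)
      qed
    qed (use d in \<open>auto\<close>)
    have eq: "\<Delta> s / s = (LINT c|lborel. indicator {1<..<b s} c * ((p s c - p 0 c) / s * g c))" for s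
      unfolding \<Delta>_def by (subst integral_divide_zero[symmetric]) (simp add: algebra_simps)
    have "\<Delta> 0 = 0" by (simp add: \<Delta>_def)
    then show ?thesis unfolding has_field_derivative_iff using lim by (simp add: eq)
  qed
  have sum: "(LINT c|lborel. indicator {1<..<b s} c * (p s c * g c))
     = \<Delta> s + (LINT c|lborel. indicator {1<..<b s} c * (p 0 c * g c))" for s
  proof -
    have "continuous_on UNIV (\<lambda>c. p s c - p 0 c)" by (intro continuous_intros pc)
    from Bochner_Integration.integral_add[OF integ[OF this] integ[OF pc(1)], of "b s" "b s" 0]
    show ?thesis
      unfolding \<Delta>_def by (simp add: left_diff_distrib right_diff_distrib)
  qed
  show ?thesis unfolding sum by (rule DERIV_add[OF part2 part1])
qed

subsection \<open>Kernel integrals and their derivatives\<close>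

type_synonym real4 = "real \<times> real \<times> real \<times> real"

text \<open>In a family \<open>V\<close> the value \<open>V i j k l\<close> plays the role of the partial derivative of \<open>V 0 0 0 0\<close>
  of order \<open>i\<close>, \<open>j\<close>, \<open>k\<close>, \<open>l\<close> in \<open>a\<close>, \<open>b\<close>, \<open>t\<close>, \<open>w\<close>; only total orders up to two matter.\<close>

type_synonym fam = "nat \<Rightarrow> nat \<Rightarrow> nat \<Rightarrow> nat \<Rightarrow> real4 \<Rightarrow> real"

definition D1 :: "fam \<Rightarrow> nat \<Rightarrow> nat \<Rightarrow> nat \<Rightarrow> nat \<Rightarrow> real4 \<Rightarrow> real4 \<Rightarrow> real" where
  "D1 V i j k l x h = (case h of (h1, h2, h3, h4) \<Rightarrow>
     h1 * V (Suc i) j k l x + h2 * V i (Suc j) k l x + h3 * V i j (Suc k) l x + h4 * V i j k (Suc l) x)"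

definition D2 :: "fam \<Rightarrow> real4 \<Rightarrow> real4 \<Rightarrow> real4 \<Rightarrow> real" where
  "D2 V x h h' = (case h of (h1, h2, h3, h4) \<Rightarrow>
     h1 * D1 V 1 0 0 0 x h' + h2 * D1 V 0 1 0 0 x h' + h3 * D1 V 0 0 1 0 x h' + h4 * D1 V 0 0 0 1 x h')"

text \<open>Differentiability is demanded only for t > 0, where the end point coth t is finite;
  continuity up to t = 0 is the separate condition \<open>ctower\<close>, and \<open>jetI\<close>
  combines the two.\<close>

definition tower :: "fam \<Rightarrow> bool" where
  "tower V \<longleftrightarrow> (\<forall>i j k l a b t w h. i + j + k + l \<le> 1 \<longrightarrow> 0 < t \<longrightarrow>
     ((\<lambda>s. V i j k l ((a, b, t, w) + s *\<^sub>R h)) has_real_derivative D1 V i j k l (a, b, t, w) h) (at 0))"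

definition ctower :: "real4 set \<Rightarrow> fam \<Rightarrow> bool" where
  "ctower D V \<longleftrightarrow> (\<forall>i j k l. i + j + k + l \<le> 2 \<longrightarrow> continuous_on D (V i j k l))"

lemma linear_D1: "linear (D1 V i j k l x)"
  by (rule linearI) (auto simp: D1_def algebra_simps split: prod.splits)

lemma linear_D2: "linear (D2 V x h)"
  by (rule linearI) (auto simp: D2_def linear_add[OF linear_D1] linear_scale[OF linear_D1] algebra_simps split: prod.splits)

lemma D2_sym: "D2 V x h h' = D2 V x h' h"
  by (auto simp: D2_def D1_def numeral_2_eq_2 algebra_simps split: prod.splits)

lemma tower_jet:
  fixes L :: "'a::euclidean_space \<Rightarrow> real4"
  assumes V: "tower V" "ctower D V" and L: "linear L" and S: "convex S" "interior S \<noteq> {}" "L ` S \<subseteq> D"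
    and pos: "\<And>x. x \<in> interior S \<Longrightarrow> 0 < fst (snd (snd (L x)))"
  shows "jet S (\<lambda>x. V 0 0 0 0 (L x)) (\<lambda>x h. D1 V 0 0 0 0 (L x) (L h)) (\<lambda>x h h'. D2 V (L x) (L h) (L h'))"
proof -
  have Lc: "continuous_on S L" using L by (simp add: linear_continuous_on linear_conv_bounded_linear)
  have cont: "continuous_on S (\<lambda>x. V i j k l (L x))" if "i + j + k + l \<le> 2" for i j k l
    using V(2) that S(3) by (intro continuous_on_compose2[OF _ Lc]) (auto simp: ctower_def)
  have der: "((\<lambda>s. V i j k l (L (x + s *\<^sub>R h))) has_real_derivative D1 V i j k l (L x) (L h)) (at 0)"
    if "x \<in> interior S" "i + j + k + l \<le> 1" for x h i j k l
  proof -
    obtain a b t w where e: "L x = (a, b, t, w)" by (metis prod.exhaust)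
    then have "0 < t" using pos[OF that(1)] by simp
    then have "((\<lambda>s. V i j k l ((a, b, t, w) + s *\<^sub>R L h)) has_real_derivative D1 V i j k l (a, b, t, w) (L h)) (at 0)"
      using V(1) that(2) unfolding tower_def by blast
    then show ?thesis by (simp only: e[symmetric] linear_add[OF L] linear_scale[OF L])
  qed
  show ?thesis
  proof (rule jetI[OF S(1,2)])
    show "continuous_on S (\<lambda>x. V 0 0 0 0 (L x))" by (rule cont) simp
    show "linear (\<lambda>h. D1 V 0 0 0 0 (L x) (L h))" for x
      using linear_compose[OF L linear_D1] by (simp add: comp_def)
    show "linear (\<lambda>h'. D2 V (L x) (L h) (L h'))" for x h
      using linear_compose[OF L linear_D2] by (simp add: comp_def)
    show "continuous_on S (\<lambda>x. D1 V 0 0 0 0 (L x) (L h))" for h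
      by (cases "L h") (auto simp: D1_def intro!: continuous_intros cont)
    show "continuous_on S (\<lambda>x. D2 V (L x) (L h) (L h'))" for h h'
      by (cases "L h"; cases "L h'") (auto simp: D1_def D2_def intro!: continuous_intros cont)
    show "D2 V (L x) (L h) (L h') = D2 V (L x) (L h') (L h)" for x h h' by (rule D2_sym)
    fix x h assume x: "x \<in> interior S"
    show "((\<lambda>s. V 0 0 0 0 (L (x + s *\<^sub>R h))) has_real_derivative D1 V 0 0 0 0 (L x) (L h)) (at 0)"
      by (rule der[OF x]) simp
    show "((\<lambda>s. D1 V 0 0 0 0 (L (x + s *\<^sub>R h')) (L h)) has_real_derivative D2 V (L x) (L h) (L h')) (at 0)" for h'
    proof -
      obtain h1 h2 h3 h4 where e: "L h = (h1, h2, h3, h4)" by (metis prod.exhaust)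
      show ?thesis
        unfolding e D1_def[of V 0 0 0 0] D2_def One_nat_def prod.case
        by (intro DERIV_add DERIV_cmult der[OF x]) simp_all
    qed
  qed
qed

definition II :: "(nat \<Rightarrow> real \<Rightarrow> real \<Rightarrow> real) \<Rightarrow> fam" where
  "II X i j k l x = (case x of (a, b, t, w) \<Rightarrow>
     LINT c|lborel. indicator (Cset t) c * (ek i c a * ek j c b * ek k c t * X l c w * g c))"

text \<open>The moving end contributes the derivative -1 / sinh(t)^2 of coth t times the integrand
  there. In that integrand e_c has been differentiated once in t, which at c = coth t gives 1 / sinh
  t; hence the cube.\<close>

definition bdry :: "(nat \<Rightarrow> real \<Rightarrow> real \<Rightarrow> real) \<Rightarrow> real4 \<Rightarrow> real" where
  "bdry X x = (case x of (a, b, t, w) \<Rightarrow>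
     - (ek 0 (cosh t / sinh t) a * ek 0 (cosh t / sinh t) b * X 0 (cosh t / sinh t) w * g (cosh t / sinh t)) / sinh t ^ 3)"

text \<open>The second derivative in \<open>t\<close> also sees the moving end of the interval of integration.\<close>

definition VK :: "(nat \<Rightarrow> real \<Rightarrow> real \<Rightarrow> real) \<Rightarrow> fam" where
  "VK X i j k l x = II X i j k l x + (if k = 2 then bdry X x else 0)"

lemma ek_0_coth: "t \<noteq> 0 \<Longrightarrow> ek 0 (cosh t / sinh t) t = 0"
  by (simp add: ek_def)

lemma ek_1_coth: "t \<noteq> 0 \<Longrightarrow> ek (Suc 0) (cosh t / sinh t) t = 1 / sinh t"
  by (simp add: ek_def divide_simps power2_eq_square[symmetric] cosh_square_eq)

text \<open>The last factor is kept abstract to treat exp(-2 w c) and -e_c(w) together. The base 2 c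
  in \<open>X_bound\<close> is dictated by the former, and \<open>ok\<close> records the range of w:
  w \<ge> 0 for the exponential, 0 \<le> w \<le> t for e_c.\<close>

locale kernel =
  fixes X :: "nat \<Rightarrow> real \<Rightarrow> real \<Rightarrow> real" and ok :: "real \<Rightarrow> real \<Rightarrow> bool"
  assumes X_der: "\<And>n c w. ((\<lambda>w. X n c w) has_real_derivative X (Suc n) c w) (at w)"
    and X_cont: "\<And>n. continuous_on UNIV (\<lambda>(c, w). X n c w)"
    and X_bound: "\<And>n c w t. ok w t \<Longrightarrow> 1 < c \<Longrightarrow> c * sinh t \<le> cosh t \<Longrightarrow> \<bar>X n c w\<bar> \<le> (2 * c) ^ n * cosh w"
begin

definition Dom :: "real4 set" where
  "Dom = {(a, b, t, w). 0 \<le> a \<and> a \<le> t \<and> 0 \<le> b \<and> b \<le> t \<and> ok w t}"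

lemma continuous_on_X [continuous_intros]:
  "continuous_on S f \<Longrightarrow> continuous_on S h \<Longrightarrow> continuous_on S (\<lambda>x. X n (f x) (h x))"
  using continuous_on_compose2[OF X_cont, of S "\<lambda>x. (f x, h x)"] by (auto intro: continuous_on_Pair)

lemma prod_bound:
  assumes x: "(a, b, t, w) \<in> Dom" and c: "1 < c" "c * sinh t \<le> cosh t" and n: "i + j + k + l \<le> 2"
  shows "\<bar>ek i c a * ek j c b * ek k c t * X l c w\<bar> \<le> 4 * cosh a * cosh b * cosh t * cosh w * c\<^sup>2"
proof -
  have r: "0 \<le> a" "a \<le> t" "0 \<le> b" "b \<le> t" "ok w t" using x by (auto simp: Dom_def)
  have "\<bar>ek i c a * ek j c b * ek k c t * X l c w\<bar>
      \<le> (c ^ i * cosh a) * (c ^ j * cosh b) * (c ^ k * cosh t) * ((2 * c) ^ l * cosh w)"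
    unfolding abs_mult using r c
    by (intro mult_mono ek_abs_le[OF c] X_bound[OF r(5)]) (auto intro: mult_nonneg_nonneg)
  also have "\<dots> = cosh a * cosh b * cosh t * cosh w * (2 ^ l * c ^ (i + j + k + l))"
    by (simp add: power_add power_mult_distrib)
  also have "\<dots> \<le> cosh a * cosh b * cosh t * cosh w * (2\<^sup>2 * c\<^sup>2)"
    using n c by (intro mult_left_mono mult_mono power_increasing) auto
  finally show ?thesis by (simp add: mult_ac)
qed

lemma X_measurable [measurable]: "(\<lambda>c. X n c w) \<in> borel_measurable borel"
  by (intro borel_measurable_continuous_onI continuous_intros)

lemma ek_measurable [measurable]: "(\<lambda>c. ek n c w) \<in> borel_measurable borel"
  by (intro borel_measurable_continuous_onI continuous_intros)

text \<open>Total order at most two costs at most c^2, which \<open>g_dom\<close> still dominates by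
  an integrable function independent of t; so dominated convergence works even when t tends to 0 and
  the interval becomes unbounded.\<close>

lemma continuous_on_II:
  assumes ijkl: "i + j + k + l \<le> 2"
  shows "continuous_on Dom (II X i j k l)"
  unfolding continuous_on_sequentially
proof (intro allI ballI impI)
  fix u :: "nat \<Rightarrow> real4" and x :: real4
  assume H: "(\<forall>n. u n \<in> Dom) \<and> u \<longlonglongrightarrow> x"
  obtain a b t w where x: "x = (a, b, t, w)" by (metis prod.exhaust)
  define ua ub ut uw where "ua n = fst (u n)" and "ub n = fst (snd (u n))"
    and "ut n = fst (snd (snd (u n)))" and "uw n = snd (snd (snd (u n)))" for n
  have u: "u n = (ua n, ub n, ut n, uw n)" for n by (simp add: ua_def ub_def ut_def uw_def)
  have lim: "ua \<longlonglongrightarrow> a" "ub \<longlonglongrightarrow> b" "ut \<longlonglongrightarrow> t" "uw \<longlonglongrightarrow> w"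
    using tendsto_fst[of u x sequentially] tendsto_fst[OF tendsto_snd[of u x sequentially]]
      tendsto_fst[OF tendsto_snd[OF tendsto_snd[of u x sequentially]]]
      tendsto_snd[OF tendsto_snd[OF tendsto_snd[of u x sequentially]]] H
    by (simp_all add: x ua_def[abs_def] ub_def[abs_def] ut_def[abs_def] uw_def[abs_def])
  have "(\<lambda>n. 4 * cosh (ua n) * cosh (ub n) * cosh (ut n) * cosh (uw n)) \<longlonglongrightarrow> 4 * cosh a * cosh b * cosh t * cosh w"
    by (intro tendsto_intros lim)
  then have "Bseq (\<lambda>n. 4 * cosh (ua n) * cosh (ub n) * cosh (ut n) * cosh (uw n))"
    by (intro convergent_imp_Bseq) (auto simp: convergent_def)
  then obtain m where m: "0 < m" "\<And>n. 4 * cosh (ua n) * cosh (ub n) * cosh (ut n) * cosh (uw n) \<le> m"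
    by (auto simp: Bseq_def)
  obtain B where B: "0 < B" "\<And>c. 1 < c \<Longrightarrow> c\<^sup>2 * \<bar>g c\<bar> \<le> B * dom c" using g_dom by blast
  define q where "q a b t w c = indicator (Cset t) c * (ek i c a * ek j c b * ek k c t * X l c w * g c)" for a b t w c
  have [measurable]: "q a b t w \<in> borel_measurable borel" for a b t w
    unfolding q_def by measurable
  have "(\<lambda>n. integral\<^sup>L lborel (q (ua n) (ub n) (ut n) (uw n))) \<longlonglongrightarrow> integral\<^sup>L lborel (q a b t w)"
  proof (rule integral_dominated_convergence[where w="\<lambda>c. m * (B * dom c)"])
    show "integrable lborel (\<lambda>c. m * (B * dom c))" by (intro integrable_mult_right integrable_dom)
    show "AE c in lborel. (\<lambda>n. q (ua n) (ub n) (ut n) (uw n) c) \<longlonglongrightarrow> q a b t w c"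
      \<comment> \<open>The indicators converge except at the end point. For t = 0 the quotient is 0
        by the convention on division, and then no c satisfies c sinh t = cosh t.\<close>
      using AE_lborel_singleton[of "cosh t / sinh t"]
    proof eventually_elim
      fix c assume c: "c \<noteq> cosh t / sinh t"
      have ne: "c * sinh t \<noteq> cosh t"
      proof
        assume e: "c * sinh t = cosh t"
        then have "sinh t \<noteq> 0" by (metis cosh_real_nonzero mult_zero_right)
        then show False using c e by (simp add: field_simps)
      qed
      have l: "(\<lambda>n. c * sinh (ut n)) \<longlonglongrightarrow> c * sinh t" "(\<lambda>n. cosh (ut n)) \<longlonglongrightarrow> cosh t"
        by (intro tendsto_intros lim)+
      have dl: "(\<lambda>n. c * sinh (ut n) - cosh (ut n)) \<longlonglongrightarrow> c * sinh t - cosh t"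
        by (intro tendsto_intros l)
      have "\<forall>\<^sub>F n in sequentially. indicator (Cset (ut n)) c = (indicator (Cset t) c :: real)"
      proof (cases "c * sinh t < cosh t")
        case True
        then show ?thesis using order_tendstoD(2)[OF dl, of 0]
          by (auto elim!: eventually_mono simp: Cset_def indicator_def)
      next
        case False
        then show ?thesis using order_tendstoD(1)[OF dl, of 0] ne
          by (auto elim!: eventually_mono simp: Cset_def indicator_def)
      qed
      then have "(\<lambda>n. indicator (Cset (ut n)) c :: real) \<longlonglongrightarrow> indicator (Cset t) c"
        by (rule tendsto_eventually)
      moreover have "(\<lambda>n. X l c (uw n)) \<longlonglongrightarrow> X l c w"
        by (rule isCont_tendsto_compose[OF DERIV_isCont[OF X_der] lim(4)])
      moreover have "(\<lambda>n. ek n' c (f n)) \<longlonglongrightarrow> ek n' c y" if "f \<longlonglongrightarrow> y" for n' f y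
        unfolding ek_def using that by (auto intro!: tendsto_intros)
      ultimately show "(\<lambda>n. q (ua n) (ub n) (ut n) (uw n) c) \<longlonglongrightarrow> q a b t w c"
        unfolding q_def using lim by (intro tendsto_intros) blast+
    qed
    fix n
    show "AE c in lborel. norm (q (ua n) (ub n) (ut n) (uw n) c) \<le> m * (B * dom c)"
    proof (rule AE_I2)
      fix c
      show "norm (q (ua n) (ub n) (ut n) (uw n) c) \<le> m * (B * dom c)"
      proof (cases "c \<in> Cset (ut n)")
        case True
        then have c: "1 < c" "c * sinh (ut n) \<le> cosh (ut n)" by (auto simp: Cset_def)
        have "\<bar>ek i c (ua n) * ek j c (ub n) * ek k c (ut n) * X l c (uw n)\<bar> \<le> m * c\<^sup>2"
        proof (rule order_trans[OF prod_bound[OF _ c ijkl]])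
          show "(ua n, ub n, ut n, uw n) \<in> Dom" using H u[of n] by metis
          show "4 * cosh (ua n) * cosh (ub n) * cosh (ut n) * cosh (uw n) * c\<^sup>2 \<le> m * c\<^sup>2"
            by (intro mult_right_mono m) simp
        qed
        then have "\<bar>ek i c (ua n) * ek j c (ub n) * ek k c (ut n) * X l c (uw n)\<bar> * \<bar>g c\<bar> \<le> m * (c\<^sup>2 * \<bar>g c\<bar>)"
          using mult_right_mono by (fastforce simp: mult.assoc)
        also have "\<dots> \<le> m * (B * dom c)" using B(2)[OF c(1)] m(1) by (intro mult_left_mono) auto
        finally show ?thesis using True by (simp add: q_def abs_mult)
      next
        case False
        then show ?thesis using m(1) B(1) by (simp add: q_def)
      qed
    qed
  qed simp_all
  then show "(II X i j k l \<circ> u) \<longlonglongrightarrow> II X i j k l x"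
    unfolding comp_def II_def x u[THEN eq_reflection] prod.case q_def[abs_def] .
qed

text \<open>Because sqrt(coth(t)^2 - 1) = 1 / sinh t, the bound on \<open>g\<close> gives |g(coth
  t)| \<le> B sinh(t)^4. After division by sinh(t)^3 one factor sinh t remains, which yields the
  limit 0 at t = 0; division by zero assigns the same value there.\<close>

lemma continuous_on_bdry: "continuous_on Dom (bdry X)"
  unfolding continuous_on_eq_continuous_within
proof
  fix x assume x: "x \<in> Dom"
  obtain a b t w where e: "x = (a, b, t, w)" by (metis prod.exhaust)
  show "continuous (at x within Dom) (bdry X)"
  proof (cases "t = 0")
    case False
    then have t: "0 < t" using x by (auto simp: e Dom_def)
    define O' :: "real4 set" where "O' = {x. 0 < fst (snd (snd x))}"
    have O': "open O'" unfolding O'_def by (intro open_Collect_less continuous_intros)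
    have cc: "continuous_on O' (\<lambda>x. cosh (fst (snd (snd x))) / sinh (fst (snd (snd x))))"
      by (intro continuous_intros) (auto simp: O'_def)
    have gc: "continuous_on O' (\<lambda>x. g (cosh (fst (snd (snd x))) / sinh (fst (snd (snd x)))))"
      by (rule continuous_on_compose2[OF continuous_on_g cc]) (auto simp: O'_def intro: coth_gt_1)
    have "continuous_on O' (bdry X)"
      unfolding bdry_def[abs_def] case_prod_beta
      by (intro continuous_intros cc gc) (auto simp: O'_def)
    then have "isCont (bdry X) x" using O' t by (auto simp: continuous_on_eq_continuous_at O'_def e)
    then show ?thesis by (rule continuous_at_imp_continuous_at_within)
  next
    case True
    obtain B where B: "0 < B" "\<And>c. 1 < c \<Longrightarrow> \<bar>g c\<bar> \<le> B / (c ^ 3 * sqrt (c\<^sup>2 - 1))" using g_bound by blast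
    define q where "q = (\<lambda>(a, b, t, w). B * sinh t * (4 * cosh a * cosh b * cosh t * cosh w))"
    have qc: "continuous_on UNIV q" unfolding q_def case_prod_beta by (intro continuous_intros)
    have "q x = 0" using True by (simp add: q_def e)
    then have "q \<midarrow>x\<rightarrow> 0" using qc unfolding continuous_on_def by (metis UNIV_I)
    then have qlim: "(q \<longlongrightarrow> 0) (at x within Dom)" by (rule tendsto_within_subset) simp
    have bound: "norm (bdry X y) \<le> q y" if y: "y \<in> Dom" for y
    proof -
      obtain a b t w where e: "y = (a, b, t, w)" by (metis prod.exhaust)
      have t0: "0 \<le> t" using y by (auto simp: e Dom_def)
      show ?thesis
      proof (cases "t = 0")
        case False
        then have t: "0 < t" using t0 by simp
        define C where "C = cosh t / sinh t"
        have C: "1 < C" "C * sinh t \<le> cosh t" using coth_gt_1[OF t] t by (auto simp: C_def)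
        have sq: "sqrt (C\<^sup>2 - 1) = 1 / sinh t"
        proof -
          have "C\<^sup>2 - 1 = (1 / sinh t)\<^sup>2" using t by (simp add: C_def power_divide cosh_square_eq field_simps)
          then show ?thesis using t by simp
        qed
        have "\<bar>g C\<bar> \<le> B / (C ^ 3 * sqrt (C\<^sup>2 - 1))" by (rule B(2)[OF C(1)])
        also have "\<dots> = B * sinh t ^ 4 * (1 / cosh t ^ 3)"
          unfolding sq using t by (simp add: C_def field_simps power3_eq_cube power4_eq_xxxx)
        also have "\<dots> \<le> B * sinh t ^ 4 * 1"
          using B(1) t cosh_real_ge_1[of t] by (intro mult_left_mono) (auto simp: one_le_power)
        finally have gC: "\<bar>g C\<bar> \<le> B * sinh t ^ 4" by simp
        define W where "W = ek 0 C a * ek 0 C b * ek 1 C t * X 0 C w"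
        have W: "\<bar>W\<bar> \<le> 4 * cosh a * cosh b * cosh t * cosh w * C\<^sup>2"
          unfolding W_def by (rule prod_bound[OF _ C]) (use y e in auto)
        have r: "0 \<le> a" "a \<le> t" "0 \<le> b" "b \<le> t" "ok w t" using y by (auto simp: e Dom_def)
        have Y: "\<bar>ek 0 C a * ek 0 C b * X 0 C w\<bar> \<le> cosh a * cosh b * cosh w"
          unfolding abs_mult using ek_abs_le[OF C r(1,2), of 0] ek_abs_le[OF C r(3,4), of 0] X_bound[OF r(5) C, of 0]
          by (intro mult_mono) auto
        have "norm (bdry X y) = \<bar>ek 0 C a * ek 0 C b * X 0 C w\<bar> * \<bar>g C\<bar> / sinh t ^ 3"
          using t by (simp add: bdry_def e C_def[symmetric] abs_mult)
        also have "\<dots> \<le> (cosh a * cosh b * cosh w) * (B * sinh t ^ 4) / sinh t ^ 3"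
          using t by (intro divide_right_mono mult_mono Y gC) auto
        also have "\<dots> = B * sinh t * (1 * (cosh a * cosh b * 1 * cosh w))"
          using t by (simp add: power3_eq_cube power4_eq_xxxx)
        also have "\<dots> \<le> B * sinh t * (4 * (cosh a * cosh b * cosh t * cosh w))"
          using t B(1) cosh_real_ge_1[of t] by (intro mult_left_mono mult_mono) auto
        finally show ?thesis by (simp add: q_def e mult.assoc)
      qed (simp add: bdry_def q_def e)
    qed
    have "(bdry X \<longlongrightarrow> 0) (at x within Dom)"
      by (rule Lim_null_comparison[OF _ qlim]) (use bound in \<open>auto simp: eventually_at intro!: exI[of _ 1]\<close>)
    then show ?thesis by (simp add: continuous_within bdry_def e True)
  qed
qed

lemma ctower_VK: "ctower Dom (VK X)"
  unfolding ctower_def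
proof (intro allI impI)
  fix i j k l :: nat assume n: "i + j + k + l \<le> 2"
  show "continuous_on Dom (VK X i j k l)"
    unfolding VK_def[abs_def] using continuous_on_add[OF continuous_on_II[OF n] continuous_on_bdry] continuous_on_II[OF n]
    by (cases "k = 2") auto
qed

lemma integrable_II:
  assumes "0 < t"
  shows "integrable lborel (\<lambda>c. indicator (Cset t) c * (ek i c a * ek j c b * ek k c t * X l c w * g c))"
  unfolding Cset_pos[OF assms] by (intro integrable_continuous_g continuous_intros)

text \<open>If t has not been differentiated, the integrand vanishes at the moving end and no
  boundary term appears. Otherwise total order at most one forces k = 1 and i = j = l = 0, and the
  boundary term is exactly \<open>bdry\<close>.\<close>

lemma tower_VK: "tower (VK X)"
  unfolding tower_def
proof (intro allI impI)
  fix i j k l :: nat and a b t w :: real and h :: real4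
  assume n: "i + j + k + l \<le> 1" and t: "0 < t"
  obtain h1 h2 h3 h4 where h: "h = (h1, h2, h3, h4)" by (metis prod.exhaust)
  define p where "p s c = ek i c (a + s * h1) * ek j c (b + s * h2) * ek k c (t + s * h3) * X l c (w + s * h4)" for s c
  define p' where "p' s c = h1 * (ek (Suc i) c (a + s * h1) * ek j c (b + s * h2) * ek k c (t + s * h3) * X l c (w + s * h4))
    + h2 * (ek i c (a + s * h1) * ek (Suc j) c (b + s * h2) * ek k c (t + s * h3) * X l c (w + s * h4))
    + h3 * (ek i c (a + s * h1) * ek j c (b + s * h2) * ek (Suc k) c (t + s * h3) * X l c (w + s * h4))
    + h4 * (ek i c (a + s * h1) * ek j c (b + s * h2) * ek k c (t + s * h3) * X (Suc l) c (w + s * h4))" for s c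
  define \<beta> where "\<beta> s = cosh (t + s * h3) / sinh (t + s * h3)" for s
  have \<beta>: "(\<beta> has_real_derivative - h3 / sinh t ^ 2) (at 0)"
    unfolding \<beta>_def[abs_def] using t
    by (auto intro!: derivative_eq_intros simp: divide_simps power2_eq_square[symmetric] cosh_square_eq algebra_simps)
  have \<beta>0: "\<beta> 0 = cosh t / sinh t" by (simp add: \<beta>_def)
  have "((\<lambda>s. LINT c|lborel. indicator {1<..<\<beta> s} c * (p s c * g c)) has_real_derivative
    (LINT c|lborel. indicator {1<..<\<beta> 0} c * (p' 0 c * g c)) + (- h3 / sinh t ^ 2) * (p 0 (\<beta> 0) * g (\<beta> 0))) (at 0)"
  proof (rule leibniz_moving_limit[OF \<beta>])
    show "1 < \<beta> 0" using coth_gt_1[OF t] by (simp add: \<beta>0)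
    show "continuous_on UNIV (\<lambda>(s, c). p s c)"
      unfolding p_def case_prod_beta by (intro continuous_intros)
    show "continuous_on UNIV (\<lambda>(s, c). p' s c)"
      unfolding p'_def case_prod_beta by (intro continuous_intros)
    show "((\<lambda>s. p s c) has_real_derivative p' s c) (at s)" for s c
      unfolding p_def p'_def
      by (rule derivative_eq_intros DERIV_chain2[OF X_der] refl | simp)+ (simp add: algebra_simps)
  qed
  moreover have "(LINT c|lborel. indicator {1<..<\<beta> 0} c * (p' 0 c * g c)) + (- h3 / sinh t ^ 2) * (p 0 (\<beta> 0) * g (\<beta> 0))
      = D1 (VK X) i j k l (a, b, t, w) h"
  proof -
    note I = integrable_II[OF t]
    define q where "q i j k l c = indicator (Cset t) c * (ek i c a * ek j c b * ek k c t * X l c w * g c)" for i j k l c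
    have I: "integrable lborel (q i j k l)" for i j k l
      unfolding q_def[abs_def] by (rule integrable_II[OF t])
    have IIq: "II X i j k l (a, b, t, w) = integral\<^sup>L lborel (q i j k l)" for i j k l
      by (simp add: II_def q_def[abs_def])
    have "(\<lambda>c. indicator {1<..<\<beta> 0} c * (p' 0 c * g c)) =
      (\<lambda>c. h1 * q (Suc i) j k l c + h2 * q i (Suc j) k l c + h3 * q i j (Suc k) l c + h4 * q i j k (Suc l) c)"
      by (rule ext) (simp add: p'_def q_def \<beta>0 Cset_pos[OF t] algebra_simps)
    then have e1: "(LINT c|lborel. indicator {1<..<\<beta> 0} c * (p' 0 c * g c)) =
      h1 * II X (Suc i) j k l (a, b, t, w) + h2 * II X i (Suc j) k l (a, b, t, w)
      + h3 * II X i j (Suc k) l (a, b, t, w) + h4 * II X i j k (Suc l) (a, b, t, w)"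
      by (simp add: I IIq)
    show ?thesis
    proof (cases "k = 0")
      case True
      then show ?thesis using t n by (simp add: e1[unfolded \<beta>0] D1_def h VK_def p_def \<beta>0 ek_0_coth)
    next
      case False
      then have k: "k = 1" "i = 0" "j = 0" "l = 0" using n by auto
      have bd: "- h3 / sinh t ^ 2 * (p 0 (\<beta> 0) * g (\<beta> 0)) = h3 * bdry X (a, b, t, w)"
        using t by (simp add: p_def \<beta>0 ek_1_coth k bdry_def power2_eq_square power3_eq_cube)
      show ?thesis
        unfolding e1 bd by (simp add: D1_def h VK_def k numeral_2_eq_2 algebra_simps)
    qed
  qed
  ultimately have D: "((\<lambda>s. LINT c|lborel. indicator {1<..<\<beta> s} c * (p s c * g c)) has_real_derivative
    D1 (VK X) i j k l (a, b, t, w) h) (at 0)" by simp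
  have "open {s. 0 < t + s * h3}" by (intro open_Collect_less continuous_intros)
  from D this show "((\<lambda>s. VK X i j k l ((a, b, t, w) + s *\<^sub>R h)) has_real_derivative D1 (VK X) i j k l (a, b, t, w) h) (at 0)"
    by (rule has_field_derivative_transform_within_open)
      (use t n in \<open>auto simp: VK_def II_def h p_def \<beta>_def Cset_pos\<close>)
qed

end

definition expX :: "nat \<Rightarrow> real \<Rightarrow> real \<Rightarrow> real" where
  "expX n c w = (- 2 * c) ^ n * exp (- 2 * w * c)"

definition ekX :: "nat \<Rightarrow> real \<Rightarrow> real \<Rightarrow> real" where
  "ekX n c w = - ek n c w"

interpretation A: kernel expX "\<lambda>w t. 0 \<le> w"
proof
  show "((\<lambda>w. expX n c w) has_real_derivative expX (Suc n) c w) (at w)" for n c w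
    unfolding expX_def by (auto intro!: derivative_eq_intros)
  show "continuous_on UNIV (\<lambda>(c, w). expX n c w)" for n
    unfolding expX_def case_prod_beta by (intro continuous_intros)
  fix n and c w t :: real assume "0 \<le> w" "1 < c"
  then show "\<bar>expX n c w\<bar> \<le> (2 * c) ^ n * cosh w"
    unfolding expX_def abs_mult power_abs
    using cosh_real_ge_1[of w] by (intro mult_mono) (auto intro: order_trans[of _ 1])
qed

interpretation C: kernel ekX "\<lambda>w t. 0 \<le> w \<and> w \<le> t"
proof
  show "((\<lambda>w. ekX n c w) has_real_derivative ekX (Suc n) c w) (at w)" for n c w
    unfolding ekX_def by (auto intro!: derivative_eq_intros)
  show "continuous_on UNIV (\<lambda>(c, w). ekX n c w)" for n
    unfolding ekX_def case_prod_beta by (intro continuous_intros)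
  fix n and c w t :: real assume w: "0 \<le> w \<and> w \<le> t" and c: "1 < c" "c * sinh t \<le> cosh t"
  have "c ^ n * cosh w \<le> (2 * c) ^ n * cosh w" using c by (intro mult_right_mono power_mono) auto
  then show "\<bar>ekX n c w\<bar> \<le> (2 * c) ^ n * cosh w"
    using ek_abs_le[OF c, of w n] w by (simp add: ekX_def)
qed

subsection \<open>The elementary parts\<close>

definition sh :: "nat \<Rightarrow> real \<Rightarrow> real" where
  "sh n x = (if even n then sinh x else cosh x)"

definition lt :: "real \<Rightarrow> real" where
  "lt t = ln (tanh (t / 2))"

text \<open>The functions \<open>be n\<close> are the derivatives of \<open>be 0\<close> for \<open>n \<le> 2\<close>, and the functions
  \<open>la n\<close> those of \<open>la 0\<close> for \<open>n \<le> 3\<close>.\<close>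

definition at_exp :: "real \<Rightarrow> real" where
  "at_exp t = arctan (exp (- t))"

definition be :: "nat \<Rightarrow> real \<Rightarrow> real" where
  "be n t = (if n = 0 then cosh t * at_exp t
     else if n = 1 then sinh t * at_exp t - 1 / 2
     else cosh t * at_exp t - tanh t / 2)"

definition la :: "nat \<Rightarrow> real \<Rightarrow> real" where
  "la n t = (if n = 0 then sinh t * lt t else if n = 1 then cosh t * lt t + 1
     else if n = 2 then sinh t * lt t + cosh t / sinh t else cosh t * lt t + 1 - 1 / sinh t ^ 2)"

lemma sh_has_real_derivative [derivative_intros]:
  assumes "(f has_real_derivative f') (at x within S)"
  shows "((\<lambda>x. sh n (f x)) has_real_derivative sh (Suc n) (f x) * f') (at x within S)"
  unfolding sh_def by (auto intro!: derivative_eq_intros assms)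

lemma continuous_on_sh [continuous_intros]:
  "continuous_on S f \<Longrightarrow> continuous_on S (\<lambda>x. sh n (f x))"
  unfolding sh_def by (cases "even n") (auto intro!: continuous_intros)

lemma tanh_half: "tanh (t / 2) = (exp t - 1) / (exp t + (1::real))"
proof -
  have "tanh (t / 2) = (1 - exp (- t)) / (1 + exp (- t))"
    using tanh_real_altdef[of "t / 2"] by simp
  also have "\<dots> = (exp t * (1 - exp (- t))) / (exp t * (1 + exp (- t)))" by simp
  also have "\<dots> = (exp t - 1) / (exp t + 1)" by (simp add: algebra_simps flip: exp_add)
  finally show ?thesis .
qed

lemma lt_has_real_derivative:
  assumes t: "0 < t"
  shows "(lt has_real_derivative 1 / sinh t) (at t)"
proof -
  have e: "1 < exp t" using t by simp
  then have e': "1 < exp t * exp t" "0 < 1 + exp t" using less_1_mult[OF e e] by linarith+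
  have "((\<lambda>t. ln ((exp t - 1) / (exp t + 1))) has_real_derivative 1 / sinh t) (at t)"
    using e e' by (auto intro!: derivative_eq_intros simp: sinh_field_def exp_minus divide_simps power2_eq_square) (auto simp: algebra_simps)
  then show ?thesis by (simp add: lt_def[abs_def] tanh_half)
qed

lemmas lt_derivative [derivative_intros] = DERIV_chain2[OF lt_has_real_derivative]

lemma at_exp_has_real_derivative [THEN DERIV_chain2, derivative_intros]:
  "(at_exp has_real_derivative - 1 / (2 * cosh t)) (at t)"
proof -
  have "0 < 1 + exp (- t) * exp (- t)" by (simp add: add_pos_pos)
  moreover have "0 < exp t" "0 < 1 + exp t * exp t" by (simp_all add: add_pos_pos)
  ultimately show ?thesis unfolding at_exp_def[abs_def]
    by (auto intro!: derivative_eq_intros simp: cosh_field_def exp_minus power2_eq_square divide_simps)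
qed

lemma be_has_real_derivative:
  assumes "n \<le> 1"
  shows "(be n has_real_derivative be (Suc n) t) (at t)"
proof -
  consider "n = 0" | "n = 1" using assms by linarith
  then show ?thesis
  proof cases
    case 1
    have "((\<lambda>t. cosh t * at_exp t) has_real_derivative sinh t * at_exp t - 1 / 2) (at t)"
      by (auto intro!: derivative_eq_intros)
    then show ?thesis by (simp add: 1 be_def[abs_def])
  next
    case 2
    have "((\<lambda>t. sinh t * at_exp t - 1 / 2) has_real_derivative cosh t * at_exp t - tanh t / 2) (at t)"
      by (auto intro!: derivative_eq_intros simp: tanh_def)
    then show ?thesis by (simp add: 2 be_def[abs_def])
  qed
qed

lemma la_has_real_derivative:
  assumes "n \<le> 2" "0 < t"
  shows "(la n has_real_derivative la (Suc n) t) (at t)"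
proof -
  consider "n = 0" | "n = 1" | "n = 2" using assms by linarith
  then show ?thesis
  proof cases
    case 1
    have "((\<lambda>t. sinh t * lt t) has_real_derivative cosh t * lt t + 1) (at t)"
      using assms(2) by (auto intro!: derivative_eq_intros)
    then show ?thesis by (simp add: 1 la_def[abs_def])
  next
    case 2
    have "((\<lambda>t. cosh t * lt t + 1) has_real_derivative sinh t * lt t + cosh t / sinh t) (at t)"
      using assms(2) by (auto intro!: derivative_eq_intros)
    then show ?thesis by (simp add: 2 la_def[abs_def])
  next
    case 3
    have "((\<lambda>t. sinh t * lt t + cosh t / sinh t) has_real_derivative
        cosh t * lt t + 1 / sinh t * sinh t + (sinh t * sinh t - cosh t * cosh t) / (sinh t * sinh t)) (at t)"
      using assms(2) by (auto intro!: derivative_eq_intros)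
    moreover have "cosh t * lt t + 1 / sinh t * sinh t + (sinh t * sinh t - cosh t * cosh t) / (sinh t * sinh t)
        = cosh t * lt t + 1 - 1 / sinh t ^ 2"
      using assms(2) cosh_square_eq[of t] by (simp add: power2_eq_square)
    ultimately have "((\<lambda>t. sinh t * lt t + cosh t / sinh t) has_real_derivative cosh t * lt t + 1 - 1 / sinh t ^ 2) (at t)"
      by metis
    then show ?thesis by (simp add: 3 la_def[abs_def])
  qed
qed

lemma affine_line: "((\<lambda>s. t + s * h) has_real_derivative h) (at (0::real))"
  by (auto intro!: derivative_eq_intros)

lemma be_line:
  "n \<le> 1 \<Longrightarrow> ((\<lambda>s. be n (t + s * h)) has_real_derivative be (Suc n) t * h) (at 0)"
  using DERIV_chain2[of "be n" "be (Suc n) t" "\<lambda>s. t + s * h" 0 h UNIV, OF _ affine_line] be_has_real_derivative[of n t]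
  by simp

lemma la_line:
  "n \<le> 2 \<Longrightarrow> 0 < t \<Longrightarrow> ((\<lambda>s. la n (t + s * h)) has_real_derivative la (Suc n) t * h) (at 0)"
  using DERIV_chain2[of "la n" "la (Suc n) t" "\<lambda>s. t + s * h" 0 h UNIV, OF _ affine_line] la_has_real_derivative[of n t]
  by simp

lemma continuous_on_at_exp [continuous_intros]:
  "continuous_on S f \<Longrightarrow> continuous_on S (\<lambda>x. at_exp (f x))"
  unfolding at_exp_def by (intro continuous_intros)

lemma continuous_on_be [continuous_intros]:
  "continuous_on S f \<Longrightarrow> continuous_on S (\<lambda>x. be n (f x))"
  unfolding be_def by (cases "n = 0"; cases "n = 1") (auto intro!: continuous_intros)

lemma isCont_la: "0 < t \<Longrightarrow> isCont (la n) t"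
proof -
  assume t: "0 < t"
  have "isCont lt t" using lt_has_real_derivative[OF t] by (rule DERIV_isCont)
  then show ?thesis unfolding la_def[abs_def] using t
    by (cases "n = 0"; cases "n = 1"; cases "n = 2") (auto intro!: continuous_intros)
qed

lemma la_lim:
  assumes "n \<le> 3"
  shows "((\<lambda>t. sinh t ^ n * la n t) \<longlongrightarrow> 0) (at_right 0)"
proof -
  consider "n = 0" | "n = 1" | "n = 2" | "n = 3" using assms by linarith
  then show ?thesis
    by cases (simp_all add: la_def lt_def tanh_half sinh_field_def cosh_field_def, real_asymp+)
qed

text \<open>Near 0 the function \<open>la n\<close> grows more slowly than sinh^(-n)
  (\<open>la_lim\<close>), so a coefficient bounded by a multiple of sinh^n removes the
  singularity.\<close>

lemma continuous_on_mult_la: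
  fixes q :: "'a::t2_space \<Rightarrow> real"
  assumes q: "continuous_on D q" and \<tau>: "continuous_on D \<tau>" "\<And>x. x \<in> D \<Longrightarrow> 0 \<le> \<tau> x"
    and m: "continuous_on D m" and b: "\<And>x. x \<in> D \<Longrightarrow> \<bar>q x\<bar> \<le> m x * sinh (\<tau> x) ^ n" and n: "n \<le> 3"
  shows "continuous_on D (\<lambda>x. q x * la n (\<tau> x))"
  unfolding continuous_on_def
proof
  fix x assume x: "x \<in> D"
  have ql: "(q \<longlongrightarrow> q x) (at x within D)" and tl: "(\<tau> \<longlongrightarrow> \<tau> x) (at x within D)" and ml: "(m \<longlongrightarrow> m x) (at x within D)"
    using q \<tau>(1) m x by (auto simp: continuous_on_def)
  show "((\<lambda>x. q x * la n (\<tau> x)) \<longlongrightarrow> q x * la n (\<tau> x)) (at x within D)"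
  proof (cases "\<tau> x = 0")
    case False
    then have "isCont (la n) (\<tau> x)" using \<tau>(2)[OF x] by (intro isCont_la) simp
    then show ?thesis by (intro tendsto_mult ql isCont_tendsto_compose[OF _ tl])
  next
    case True
    define z where "z t = sinh t ^ n * la n t" for t
    have z0: "z 0 = 0" by (cases "n = 0") (auto simp: z_def la_def)
    have "continuous_on {0..} z"
      unfolding continuous_on_def
    proof
      fix t :: real assume t: "t \<in> {0..}"
      show "(z \<longlongrightarrow> z t) (at t within {0..})"
      proof (cases "t = 0")
        case True
        have "(z \<longlongrightarrow> 0) (at_right 0)" unfolding z_def[abs_def] by (rule la_lim[OF n])
        then show ?thesis using z0 at_within_Ici_at_right[of "0::real"] True by simp
      next
        case False
        then have "isCont z t" using t unfolding z_def[abs_def] by (intro continuous_intros isCont_la) auto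
        then show ?thesis unfolding isCont_def by (rule tendsto_within_subset) simp
      qed
    qed
    then have "((\<lambda>x. z (\<tau> x)) \<longlongrightarrow> z (\<tau> x)) (at x within D)"
      using \<tau> x by (intro continuous_on_tendsto_compose[OF _ tl]) (auto simp: eventually_at_filter)
    then have "((\<lambda>x. z (\<tau> x)) \<longlongrightarrow> 0) (at x within D)" using True z0 by simp
    from tendsto_mult[OF ml tendsto_rabs[OF this]]
    have l: "((\<lambda>x. m x * \<bar>z (\<tau> x)\<bar>) \<longlongrightarrow> 0) (at x within D)" by simp
    have "((\<lambda>x. q x * la n (\<tau> x)) \<longlongrightarrow> 0) (at x within D)"
    proof (rule Lim_null_comparison[OF _ l])
      have "norm (q y * la n (\<tau> y)) \<le> m y * \<bar>z (\<tau> y)\<bar>" if "y \<in> D" for y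
        using mult_right_mono[OF b[OF that] abs_ge_zero[of "la n (\<tau> y)"]] \<tau>(2)[OF that]
        by (simp add: z_def abs_mult mult.assoc)
      then show "\<forall>\<^sub>F y in at x within D. norm (q y * la n (\<tau> y)) \<le> m y * \<bar>z (\<tau> y)\<bar>"
        by (simp add: eventually_at_filter)
    qed
    moreover have "q x * la n (\<tau> x) = 0"
    proof (cases "n = 0")
      case False
      then have "q x = 0" using b[OF x] True by (simp add: zero_power)
      then show ?thesis by simp
    qed (simp add: True la_def)
    ultimately show ?thesis by (simp only:)
  qed
qed

text \<open>With truncated subtraction the exponent \<open>1 - n\<close> is 1 for n = 0 and 0
  afterwards: only the undifferentiated sinh counts as a zero at the corner.\<close>

lemma sh_bound:
  assumes "\<bar>a\<bar> \<le> t"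
  shows "\<bar>sh n a\<bar> \<le> cosh t * sinh t ^ (1 - n)" "\<bar>sh n a\<bar> \<le> cosh t"
proof -
  have c: "\<bar>cosh a\<bar> \<le> cosh t" using assms cosh_real_nonneg_le_iff[of "\<bar>a\<bar>" t] by simp
  have s: "\<bar>sinh a\<bar> \<le> sinh t" using assms by (simp add: abs_le_iff flip: sinh_minus)
  have sc: "sinh t \<le> cosh t" using sinh_less_cosh_real[of t] by simp
  show B: "\<bar>sh n a\<bar> \<le> cosh t" using c s sc by (auto simp: sh_def)
  have "sinh t \<le> cosh t * sinh t" using assms cosh_real_ge_1[of t] mult_right_mono[of 1 "cosh t" "sinh t"] by simp
  then show "\<bar>sh n a\<bar> \<le> cosh t * sinh t ^ (1 - n)"
    using B s by (cases n) (auto simp: sh_def)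
qed

text \<open>Derivatives of a term that does not depend on t: \<open>k\<close> counts derivatives in
  t, and any such derivative gives 0.\<close>

definition sk :: "nat \<Rightarrow> nat \<Rightarrow> real \<Rightarrow> real" where
  "sk k n x = (if k = 0 then sh n x else 0)"

lemma sk_Suc [simp]: "sk (Suc k) n x = 0"
  by (simp add: sk_def)

lemma sk_has_real_derivative [derivative_intros]:
  assumes "(f has_real_derivative f') (at x within S)"
  shows "((\<lambda>x. sk k n (f x)) has_real_derivative sk k (Suc n) (f x) * f') (at x within S)"
  unfolding sk_def by (cases "k = 0") (auto intro!: derivative_eq_intros assms)

lemma continuous_on_sk [continuous_intros]:
  "continuous_on S f \<Longrightarrow> continuous_on S (\<lambda>x. sk k n (f x))"
  unfolding sk_def by (cases "k = 0") (auto intro!: continuous_intros)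

section \<open>The elementary parts as families of derivatives\<close>

definition kap :: real where
  "kap = 1 / (2 * sqrt 2)"

definition VE :: fam where
  "VE i j k l x = (case x of (a, b, t, w) \<Rightarrow> if l = 0 then
     kap * (2 * sh (Suc i) a * sh (Suc j) b * be k t - sk k (i + j) (a + b)
      - sh i a * sh j b * la k t) else 0)"

text \<open>In region B the first argument of the elementary part is reflected, while the kernel
  integral stays that of A; the sign is the chain rule.\<close>

definition VEB :: fam where
  "VEB i j k l x = (case x of (a, b, t, w) \<Rightarrow> (- 1) ^ i * VE i j k l (- a, b, t, w))"

text \<open>Symmetric in a, b and w, like the kernel e_c(a) e_c(b) e_c(w); this symmetry later gives
  two of the wall conditions in region C. The shifted \<open>la (Suc k)\<close> is why
  \<open>la\<close> is needed up to order three.\<close>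

definition VE4 :: fam where
  "VE4 i j k l x = (case x of (a, b, t, w) \<Rightarrow>
     kap * (2 * sh (Suc i) a * sh (Suc j) b * sh (Suc l) w * be k t
      - sk k (i + j + l) (a + b + w)
      - sh i a * sh j b * sh l w * la (Suc k) t
      - (sh i a * sh j b * sh (Suc l) w + sh i a * sh (Suc j) b * sh l w + sh (Suc i) a * sh j b * sh l w) * la k t))"

lemma tower_VE: "tower VE"
  unfolding tower_def
proof (intro allI impI)
  fix i j k l :: nat and a b t w :: real and h :: real4
  assume n: "i + j + k + l \<le> 1" and t: "0 < t"
  obtain h1 h2 h3 h4 where h: "h = (h1, h2, h3, h4)" by (metis prod.exhaust)
  have d: "((\<lambda>s. be k (t + s * h3)) has_real_derivative be (Suc k) t * h3) (at 0)"
    "((\<lambda>s. la k (t + s * h3)) has_real_derivative la (Suc k) t * h3) (at 0)"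
    using n t by (auto intro!: be_line la_line)
  show "((\<lambda>s. VE i j k l ((a, b, t, w) + s *\<^sub>R h)) has_real_derivative D1 VE i j k l (a, b, t, w) h) (at 0)"
  proof (cases "l = 0")
    case True
    show ?thesis
      unfolding VE_def D1_def h True by (auto intro!: derivative_eq_intros d simp: algebra_simps)
  next
    case False
    then show ?thesis unfolding VE_def D1_def h by simp
  qed
qed

lemma tower_VEB: "tower VEB"
  unfolding tower_def
proof (intro allI impI)
  fix i j k l :: nat and a b t w :: real and h :: real4
  assume n: "i + j + k + l \<le> 1" and t: "0 < t"
  obtain h1 h2 h3 h4 where h: "h = (h1, h2, h3, h4)" by (metis prod.exhaust)
  have "((\<lambda>s. VE i j k l ((- a, b, t, w) + s *\<^sub>R (- h1, h2, h3, h4))) has_real_derivative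
      D1 VE i j k l (- a, b, t, w) (- h1, h2, h3, h4)) (at 0)"
    using tower_VE n t unfolding tower_def by blast
  then have "((\<lambda>s. (- 1) ^ i * VE i j k l ((- a, b, t, w) + s *\<^sub>R (- h1, h2, h3, h4))) has_real_derivative
      (- 1) ^ i * D1 VE i j k l (- a, b, t, w) (- h1, h2, h3, h4)) (at 0)"
    by (rule DERIV_cmult)
  then show "((\<lambda>s. VEB i j k l ((a, b, t, w) + s *\<^sub>R h)) has_real_derivative D1 VEB i j k l (a, b, t, w) h) (at 0)"
    unfolding VEB_def D1_def h by (simp add: algebra_simps)
qed

lemma tower_VE4: "tower VE4"
  unfolding tower_def
proof (intro allI impI)
  fix i j k l :: nat and a b t w :: real and h :: real4
  assume n: "i + j + k + l \<le> 1" and t: "0 < t"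
  obtain h1 h2 h3 h4 where h: "h = (h1, h2, h3, h4)" by (metis prod.exhaust)
  have d: "((\<lambda>s. be k (t + s * h3)) has_real_derivative be (Suc k) t * h3) (at 0)"
    "((\<lambda>s. la k (t + s * h3)) has_real_derivative la (Suc k) t * h3) (at 0)"
    "((\<lambda>s. la (Suc k) (t + s * h3)) has_real_derivative la (Suc (Suc k)) t * h3) (at 0)"
    using n t by (auto intro!: be_line la_line)
  show "((\<lambda>s. VE4 i j k l ((a, b, t, w) + s *\<^sub>R h)) has_real_derivative D1 VE4 i j k l (a, b, t, w) h) (at 0)"
    unfolding VE4_def D1_def h by (auto intro!: derivative_eq_intros d simp: algebra_simps)
qed

lemma continuous_on_real4 [continuous_intros]:
  "continuous_on S (\<lambda>x::real4. fst x)" "continuous_on S (\<lambda>x::real4. fst (snd x))"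
  "continuous_on S (\<lambda>x::real4. fst (snd (snd x)))" "continuous_on S (\<lambda>x::real4. snd (snd (snd x)))"
  by (intro continuous_intros)+

definition DE :: "real4 set" where
  "DE = {(a, b, t, w). \<bar>a\<bar> \<le> t \<and> \<bar>b\<bar> \<le> t}"

text \<open>Only the term with \<open>la k\<close> is singular at t = 0. Since i + j + k \<le> 2, at
  least k of the factors sinh a, sinh b are still undifferentiated, each bounded by a multiple of
  sinh t.\<close>

lemma ctower_VE: "ctower DE VE"
  unfolding ctower_def
proof (intro allI impI)
  fix i j k l :: nat assume n: "i + j + k + l \<le> 2"
  have sing: "continuous_on DE (\<lambda>x. sh i (fst x) * sh j (fst (snd x)) * la k (fst (snd (snd x))))"
  proof (rule continuous_on_mult_la)
    fix x assume "x \<in> DE"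
    then obtain a b t w where x: "x = (a, b, t, w)" "\<bar>a\<bar> \<le> t" "\<bar>b\<bar> \<le> t" by (auto simp: DE_def)
    have "k \<le> (1 - i) + (1 - j)" using n by linarith
    then have e: "sinh t ^ (1 - i) * sinh t ^ (1 - j) = sinh t ^ ((1 - i) + (1 - j) - k) * sinh t ^ k"
      by (simp flip: power_add)
    have "\<bar>sh i a * sh j b\<bar> \<le> (cosh t * sinh t ^ (1 - i)) * (cosh t * sinh t ^ (1 - j))"
      unfolding abs_mult using x by (intro mult_mono sh_bound) auto
    also have "\<dots> = cosh t * cosh t * (sinh t ^ (1 - i) * sinh t ^ (1 - j))" by (simp only: mult_ac)
    finally show "\<bar>sh i (fst x) * sh j (fst (snd x))\<bar> \<le>
        (cosh (fst (snd (snd x))) * cosh (fst (snd (snd x))) * sinh (fst (snd (snd x))) ^ ((1 - i) + (1 - j) - k)) * sinh (fst (snd (snd x))) ^ k"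
      unfolding e x by (simp add: mult.assoc)
  qed (use n in \<open>auto intro!: continuous_intros simp: DE_def\<close>)
  have c: "continuous_on DE (\<lambda>x. 2 * sh (Suc i) (fst x) * sh (Suc j) (fst (snd x)) * be k (fst (snd (snd x))) - sk k (i + j) (fst x + fst (snd x)))"
    by (intro continuous_intros)
  from continuous_on_mult_left[OF continuous_on_diff[OF c sing], of kap]
  show "continuous_on DE (VE i j k l)"
    unfolding VE_def[abs_def] case_prod_beta by (cases "l = 0") simp_all
qed

lemma ctower_VEB: "ctower DE VEB"
  unfolding ctower_def
proof (intro allI impI)
  fix i j k l :: nat assume n: "i + j + k + l \<le> 2"
  have "continuous_on DE (\<lambda>x. VE i j k l (- fst x, snd x))"
    by (rule continuous_on_compose2[of DE "VE i j k l"]) (use ctower_VE n in \<open>auto simp: ctower_def DE_def intro!: continuous_intros\<close>)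
  then show "continuous_on DE (VEB i j k l)"
    unfolding VEB_def[abs_def] case_prod_beta by (auto intro!: continuous_intros)
qed

text \<open>The same count of undifferentiated factors: three of them face
  \<open>la (Suc k)\<close>, and in each of the three remaining singular terms two of them face
  \<open>la k\<close>.\<close>

lemma ctower_VE4: "ctower C.Dom VE4"
  unfolding ctower_def
proof (intro allI impI)
  fix i j k l :: nat assume n: "i + j + k + l \<le> 2"
  let ?a = "\<lambda>x::real4. fst x" and ?b = "\<lambda>x::real4. fst (snd x)" and ?t = "\<lambda>x::real4. fst (snd (snd x))"
    and ?w = "\<lambda>x::real4. snd (snd (snd x))"
  have r: "\<bar>?a x\<bar> \<le> ?t x" "\<bar>?b x\<bar> \<le> ?t x" "\<bar>?w x\<bar> \<le> ?t x" "0 \<le> ?t x" if "x \<in> C.Dom" for x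
    using that by (auto simp: C.Dom_def)
  have sing3: "continuous_on C.Dom (\<lambda>x. sh i (?a x) * sh j (?b x) * sh l (?w x) * la (Suc k) (?t x))"
  proof (rule continuous_on_mult_la)
    fix x assume x: "x \<in> C.Dom"
    define t where "t = ?t x"
    have "Suc k \<le> (1 - i) + (1 - j) + (1 - l)" using n by linarith
    then have e: "sinh t ^ (1 - i) * sinh t ^ (1 - j) * sinh t ^ (1 - l) = sinh t ^ ((1 - i) + (1 - j) + (1 - l) - Suc k) * sinh t ^ Suc k"
      unfolding power_add[symmetric] by (simp only: le_add_diff_inverse2)
    have "\<bar>sh i (?a x) * sh j (?b x) * sh l (?w x)\<bar>
        \<le> (cosh t * sinh t ^ (1 - i)) * (cosh t * sinh t ^ (1 - j)) * (cosh t * sinh t ^ (1 - l))"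
      unfolding abs_mult t_def using r[OF x] by (intro mult_mono sh_bound) auto
    also have "\<dots> = cosh t * cosh t * cosh t * (sinh t ^ (1 - i) * sinh t ^ (1 - j) * sinh t ^ (1 - l))" by (simp only: mult_ac)
    also have "\<dots> = (cosh t * cosh t * cosh t * sinh t ^ ((1 - i) + (1 - j) + (1 - l) - Suc k)) * sinh t ^ Suc k"
      unfolding e by (simp only: mult.assoc)
    finally show "\<bar>sh i (?a x) * sh j (?b x) * sh l (?w x)\<bar> \<le>
        (cosh (?t x) * cosh (?t x) * cosh (?t x) * sinh (?t x) ^ ((1 - i) + (1 - j) + (1 - l) - Suc k)) * sinh (?t x) ^ Suc k"
      unfolding t_def .
  qed (use n r in \<open>auto intro!: continuous_intros\<close>)
  have sing2: "continuous_on C.Dom (\<lambda>x. (sh i' (y x) * sh j' (z x) * u x) * la k (?t x))"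
    if "i' + j' + k \<le> 2" "continuous_on C.Dom y" "continuous_on C.Dom z" "continuous_on C.Dom u"
      "\<And>x. x \<in> C.Dom \<Longrightarrow> \<bar>y x\<bar> \<le> ?t x" "\<And>x. x \<in> C.Dom \<Longrightarrow> \<bar>z x\<bar> \<le> ?t x" for i' j' y z u
  proof (rule continuous_on_mult_la)
    fix x assume x: "x \<in> C.Dom"
    define t where "t = ?t x"
    have "k \<le> (1 - i') + (1 - j')" using that(1) by linarith
    then have e: "sinh t ^ (1 - i') * sinh t ^ (1 - j') = sinh t ^ ((1 - i') + (1 - j') - k) * sinh t ^ k"
      by (simp flip: power_add)
    have "\<bar>sh i' (y x) * sh j' (z x) * u x\<bar> \<le> (cosh t * sinh t ^ (1 - i')) * (cosh t * sinh t ^ (1 - j')) * \<bar>u x\<bar>"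
      unfolding abs_mult t_def using that(5,6)[OF x] r[OF x] by (intro mult_mono sh_bound) auto
    also have "\<dots> = cosh t * cosh t * \<bar>u x\<bar> * (sinh t ^ (1 - i') * sinh t ^ (1 - j'))" by (simp only: mult_ac)
    also have "\<dots> = (cosh t * cosh t * \<bar>u x\<bar> * sinh t ^ ((1 - i') + (1 - j') - k)) * sinh t ^ k"
      unfolding e by (simp only: mult.assoc)
    finally show "\<bar>sh i' (y x) * sh j' (z x) * u x\<bar> \<le>
        (cosh (?t x) * cosh (?t x) * \<bar>u x\<bar> * sinh (?t x) ^ ((1 - i') + (1 - j') - k)) * sinh (?t x) ^ k"
      unfolding t_def .
  qed (use that r in \<open>auto intro!: continuous_intros\<close>)
  have s1: "continuous_on C.Dom (\<lambda>x. (sh i (?a x) * sh j (?b x) * sh (Suc l) (?w x)) * la k (?t x))"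
    by (rule sing2) (use n r in \<open>auto intro!: continuous_intros\<close>)
  have s2: "continuous_on C.Dom (\<lambda>x. (sh i (?a x) * sh l (?w x) * sh (Suc j) (?b x)) * la k (?t x))"
    by (rule sing2) (use n r in \<open>auto intro!: continuous_intros\<close>)
  have s3: "continuous_on C.Dom (\<lambda>x. (sh j (?b x) * sh l (?w x) * sh (Suc i) (?a x)) * la k (?t x))"
    by (rule sing2) (use n r in \<open>auto intro!: continuous_intros\<close>)
  have s: "continuous_on C.Dom (\<lambda>x. (sh i (?a x) * sh j (?b x) * sh (Suc l) (?w x) + sh i (?a x) * sh (Suc j) (?b x) * sh l (?w x)
      + sh (Suc i) (?a x) * sh j (?b x) * sh l (?w x)) * la k (?t x))"
    using continuous_on_add[OF continuous_on_add[OF s1 s2] s3] by (simp add: algebra_simps)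
  have c: "continuous_on C.Dom (\<lambda>x. 2 * sh (Suc i) (?a x) * sh (Suc j) (?b x) * sh (Suc l) (?w x) * be k (?t x) - sk k (i + j + l) (?a x + ?b x + ?w x))"
    by (intro continuous_intros)
  from continuous_on_mult_left[OF continuous_on_diff[OF continuous_on_diff[OF c sing3] s], of kap]
  show "continuous_on C.Dom (VE4 i j k l)"
    unfolding VE4_def[abs_def] case_prod_beta .
qed

text \<open>The candidate in the regions A, B and C, up to the linear changes of coordinates \<open>LA\<close>, \<open>LB\<close>, \<open>LC\<close>.\<close>

definition VA :: fam where "VA i j k l x = VE i j k l x + VK expX i j k l x"

definition VB :: fam where "VB i j k l x = VEB i j k l x + VK expX i j k l x"

definition VC :: fam where "VC i j k l x = VE4 i j k l x + VK ekX i j k l x"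

lemma tower_add:
  assumes "tower V" "tower V'" shows "tower (\<lambda>i j k l x. V i j k l x + V' i j k l x)"
  unfolding tower_def
proof (intro allI impI)
  fix i j k l :: nat and a b t w :: real and h :: real4
  assume n: "i + j + k + l \<le> 1" and t: "0 < t"
  have "((\<lambda>s. V i j k l ((a, b, t, w) + s *\<^sub>R h)) has_real_derivative D1 V i j k l (a, b, t, w) h) (at 0)"
    "((\<lambda>s. V' i j k l ((a, b, t, w) + s *\<^sub>R h)) has_real_derivative D1 V' i j k l (a, b, t, w) h) (at 0)"
    using assms n t unfolding tower_def by blast+
  from DERIV_add[OF this]
  show "((\<lambda>s. V i j k l ((a, b, t, w) + s *\<^sub>R h) + V' i j k l ((a, b, t, w) + s *\<^sub>R h)) has_real_derivative
      D1 (\<lambda>i j k l x. V i j k l x + V' i j k l x) i j k l (a, b, t, w) h) (at 0)"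
    by (rule DERIV_cong) (simp add: D1_def algebra_simps split: prod.splits)
qed

lemma tower_VABC: "tower VA" "tower VB" "tower VC"
  using tower_add[OF tower_VE A.tower_VK] tower_add[OF tower_VEB A.tower_VK] tower_add[OF tower_VE4 C.tower_VK]
  by (simp_all add: VA_def[abs_def] VB_def[abs_def] VC_def[abs_def])

lemma ctower_VABC: "ctower A.Dom VA" "ctower A.Dom VB" "ctower C.Dom VC"
proof -
  have "A.Dom \<subseteq> DE" by (auto simp: A.Dom_def DE_def)
  then have "ctower A.Dom VE" "ctower A.Dom VEB"
    using ctower_VE ctower_VEB continuous_on_subset unfolding ctower_def by blast+
  then show "ctower A.Dom VA" "ctower A.Dom VB"
    using A.ctower_VK by (auto simp: ctower_def VA_def[abs_def] VB_def[abs_def] intro!: continuous_on_add)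
  show "ctower C.Dom VC"
    using ctower_VE4 C.ctower_VK by (auto simp: ctower_def VC_def[abs_def] intro!: continuous_on_add)
qed

subsection \<open>The three regions\<close>

text \<open>In terms of y and z of the formulas these coordinates are (t - y, t - sqrt 2 q_3, t, w)
  with t = y + z/2 and w = x - z/2. \<open>LB\<close> has the same shape with last entry x. In
  \<open>LC\<close> the last entry is \<alpha> = -2 w / 3, and t = y + p/2 + \<alpha> with p = 2
  x.\<close>

definition LA :: "real ^ 4 \<Rightarrow> real4" where
  "LA q = (sqrt 2 * ((q $ 4 - q $ 2) / 2), sqrt 2 * ((q $ 2 + q $ 4) / 2),
     sqrt 2 * (q $ 3 + (q $ 2 + q $ 4) / 2), sqrt 2 * (q $ 1 - (q $ 4 - q $ 2) / 2))"

definition LB :: "real ^ 4 \<Rightarrow> real4" where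
  "LB q = (sqrt 2 * ((q $ 2 - q $ 4) / 2), sqrt 2 * ((q $ 2 + q $ 4) / 2),
     sqrt 2 * (q $ 3 + (q $ 2 + q $ 4) / 2), sqrt 2 * q $ 1)"

definition LC :: "real ^ 4 \<Rightarrow> real4" where
  "LC q = (sqrt 2 * ((q $ 1 - q $ 2 + q $ 4) / 3), sqrt 2 * ((q $ 1 + 2 * q $ 2 + q $ 4) / 3),
     sqrt 2 * ((q $ 1 + 2 * q $ 2 + 3 * q $ 3 + q $ 4) / 3), sqrt 2 * ((q $ 4 - q $ 2 - 2 * q $ 1) / 3))"

definition SA :: "(real ^ 4) set" where
  "SA = {q. 0 \<le> q $ 1 \<and> 0 \<le> q $ 2 \<and> 0 \<le> q $ 3 \<and> q $ 2 \<le> q $ 4 \<and> q $ 4 - q $ 2 \<le> 2 * q $ 1}"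

definition SB :: "(real ^ 4) set" where
  "SB = {q. 0 \<le> q $ 1 \<and> 0 \<le> q $ 3 \<and> 0 \<le> q $ 4 \<and> q $ 4 \<le> q $ 2}"

definition SC :: "(real ^ 4) set" where
  "SC = {q. 0 \<le> q $ 1 \<and> 0 \<le> q $ 2 \<and> 0 \<le> q $ 3 \<and> q $ 2 \<le> q $ 4 \<and> 2 * q $ 1 \<le> q $ 4 - q $ 2}"

lemma orthant_eq: "orthant = SA \<union> SB \<union> SC"
  unfolding orthant_def SA_def SB_def SC_def forall_4 by auto

lemma linear_LABC: "linear LA" "linear LB" "linear LC"
  by (auto intro!: linearI simp: LA_def LB_def LC_def algebra_simps add_divide_distrib diff_divide_distrib)

lemma convex_SABC: "convex SA" "convex SB" "convex SC"
proof -
  have *: "convex {q. (0::real) \<le> f q}" if "linear f" for f :: "real ^ 4 \<Rightarrow> real"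
  proof (rule convexI)
    fix x y :: "real ^ 4" and u v :: real
    assume "x \<in> {q. 0 \<le> f q}" "y \<in> {q. 0 \<le> f q}" "0 \<le> u" "0 \<le> v" "u + v = 1"
    then show "u *\<^sub>R x + v *\<^sub>R y \<in> {q. 0 \<le> f q}"
      by (simp add: linear_add[OF that] linear_scale[OF that])
  qed
  have l: "linear (\<lambda>q::real^4. q $ i)" "linear (\<lambda>q::real^4. q $ 4 - q $ 2)" "linear (\<lambda>q::real^4. q $ 2 - q $ 4)"
    "linear (\<lambda>q::real^4. 2 * q $ 1 - (q $ 4 - q $ 2))" "linear (\<lambda>q::real^4. q $ 4 - q $ 2 - 2 * q $ 1)" for i
    by (auto intro!: linearI simp: algebra_simps)
  have "SA = {q. 0 \<le> q $ 1} \<inter> {q. 0 \<le> q $ 2} \<inter> {q. 0 \<le> q $ 3} \<inter> {q. 0 \<le> q $ 4 - q $ 2} \<inter> {q. 0 \<le> 2 * q $ 1 - (q $ 4 - q $ 2)}"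
    "SB = {q. 0 \<le> q $ 1} \<inter> {q. 0 \<le> q $ 3} \<inter> {q. 0 \<le> q $ 4} \<inter> {q. 0 \<le> q $ 2 - q $ 4}"
    "SC = {q. 0 \<le> q $ 1} \<inter> {q. 0 \<le> q $ 2} \<inter> {q. 0 \<le> q $ 3} \<inter> {q. 0 \<le> q $ 4 - q $ 2} \<inter> {q. 0 \<le> q $ 4 - q $ 2 - 2 * q $ 1}"
    by (auto simp: SA_def SB_def SC_def)
  note eqs = this
  show "convex SA" unfolding eqs(1) by (intro convex_Int * l)
  show "convex SB" unfolding eqs(2) by (intro convex_Int * l)
  show "convex SC" unfolding eqs(3) by (intro convex_Int * l)
qed

lemma closed_SABC: "closed SA" "closed SB" "closed SC"
  unfolding SA_def SB_def SC_def
  by (auto intro!: closed_Collect_conj closed_Collect_le continuous_intros)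

definition vec4 :: "real \<Rightarrow> real \<Rightarrow> real \<Rightarrow> real \<Rightarrow> real ^ 4" where
  "vec4 a b c d = vector [a, b, c, d]"

lemma vec4_nth [simp]: "vec4 a b c d $ 1 = a" "vec4 a b c d $ 2 = b" "vec4 a b c d $ 3 = c" "vec4 a b c d $ 4 = d"
  unfolding vec4_def vector_def by simp_all

lemma vec4_add [simp]: "vec4 a b c d + vec4 a' b' c' d' = vec4 (a + a') (b + b') (c + c') (d + d')"
  by (simp add: vec_eq_iff forall_4)

lemma vec4_scaleR [simp]: "r *\<^sub>R vec4 a b c d = vec4 (r * a) (r * b) (r * c) (r * d)"
  by (simp add: vec_eq_iff forall_4)

lemma interior_SABC: "interior SA \<noteq> {}" "interior SB \<noteq> {}" "interior SC \<noteq> {}"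
proof -
  let ?A = "{q::real^4. 0 < q $ 1 \<and> 0 < q $ 2 \<and> 0 < q $ 3 \<and> q $ 2 < q $ 4 \<and> q $ 4 - q $ 2 < 2 * q $ 1}"
  have "open ?A" by (auto intro!: open_Collect_conj open_Collect_less continuous_intros)
  then have "?A \<subseteq> interior SA" by (intro interior_maximal) (auto simp: SA_def)
  moreover have "vec4 1 1 1 2 \<in> ?A" by simp
  ultimately show "interior SA \<noteq> {}" by blast
  let ?B = "{q::real^4. 0 < q $ 1 \<and> 0 < q $ 3 \<and> 0 < q $ 4 \<and> q $ 4 < q $ 2}"
  have "open ?B" by (auto intro!: open_Collect_conj open_Collect_less continuous_intros)
  then have "?B \<subseteq> interior SB" by (intro interior_maximal) (auto simp: SB_def)
  moreover have "vec4 1 2 1 1 \<in> ?B" by simp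
  ultimately show "interior SB \<noteq> {}" by blast
  let ?C = "{q::real^4. 0 < q $ 1 \<and> 0 < q $ 2 \<and> 0 < q $ 3 \<and> q $ 2 < q $ 4 \<and> 2 * q $ 1 < q $ 4 - q $ 2}"
  have "open ?C" by (auto intro!: open_Collect_conj open_Collect_less continuous_intros)
  then have "?C \<subseteq> interior SC" by (intro interior_maximal) (auto simp: SC_def)
  moreover have "vec4 1 1 1 4 \<in> ?C" by simp
  ultimately show "interior SC \<noteq> {}" by blast
qed

lemma interior_pos3:
  assumes "S \<subseteq> orthant" "q \<in> interior S" shows "0 < q $ 3"
proof -
  have "S \<subseteq> {x. 0 \<le> x $ 3}" using assms(1) by (auto simp: orthant_def)
  then have "q \<in> interior {x::real^4. 0 \<le> x $ 3}" using assms(2) interior_mono by blast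
  then show ?thesis by simp
qed

lemma LABC_Dom: "LA ` SA \<subseteq> A.Dom" "LB ` SB \<subseteq> A.Dom" "LC ` SC \<subseteq> C.Dom"
  by (auto simp: LA_def LB_def LC_def SA_def SB_def SC_def A.Dom_def C.Dom_def add_divide_distrib diff_divide_distrib)

lemma jet_ABC:
  "jet SA (\<lambda>q. VA 0 0 0 0 (LA q)) (\<lambda>q h. D1 VA 0 0 0 0 (LA q) (LA h)) (\<lambda>q h k. D2 VA (LA q) (LA h) (LA k))"
  "jet SB (\<lambda>q. VB 0 0 0 0 (LB q)) (\<lambda>q h. D1 VB 0 0 0 0 (LB q) (LB h)) (\<lambda>q h k. D2 VB (LB q) (LB h) (LB k))"
  "jet SC (\<lambda>q. VC 0 0 0 0 (LC q)) (\<lambda>q h. D1 VC 0 0 0 0 (LC q) (LC h)) (\<lambda>q h k. D2 VC (LC q) (LC h) (LC k))"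
proof -
  have sub: "SA \<subseteq> orthant" "SB \<subseteq> orthant" "SC \<subseteq> orthant" by (auto simp: orthant_eq)
  have pos: "0 < q $ 3 + (q $ 2 + q $ 4) / 2" "0 < q $ 1 + 2 * q $ 2 + 3 * q $ 3 + q $ 4"
    if "S \<subseteq> orthant" "q \<in> interior S" for q S
  proof -
    have "0 \<le> q $ 1" "0 \<le> q $ 2" "0 \<le> q $ 4" using that interior_subset[of S] by (auto simp: orthant_def)
    moreover have "0 < q $ 3" by (rule interior_pos3[OF that])
    ultimately show "0 < q $ 1 + 2 * q $ 2 + 3 * q $ 3 + q $ 4" "0 < q $ 3 + (q $ 2 + q $ 4) / 2"
      by (simp_all add: add_pos_nonneg add_nonneg_pos)
  qed
  show "jet SA (\<lambda>q. VA 0 0 0 0 (LA q)) (\<lambda>q h. D1 VA 0 0 0 0 (LA q) (LA h)) (\<lambda>q h k. D2 VA (LA q) (LA h) (LA k))"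
    by (rule tower_jet[OF tower_VABC(1) ctower_VABC(1) linear_LABC(1) convex_SABC(1) interior_SABC(1) LABC_Dom(1)])
      (use pos[of SA, OF sub(1)] in \<open>auto simp: LA_def\<close>)
  show "jet SB (\<lambda>q. VB 0 0 0 0 (LB q)) (\<lambda>q h. D1 VB 0 0 0 0 (LB q) (LB h)) (\<lambda>q h k. D2 VB (LB q) (LB h) (LB k))"
    by (rule tower_jet[OF tower_VABC(2) ctower_VABC(2) linear_LABC(2) convex_SABC(2) interior_SABC(2) LABC_Dom(2)])
      (use pos[of SB, OF sub(2)] in \<open>auto simp: LB_def\<close>)
  show "jet SC (\<lambda>q. VC 0 0 0 0 (LC q)) (\<lambda>q h. D1 VC 0 0 0 0 (LC q) (LC h)) (\<lambda>q h k. D2 VC (LC q) (LC h) (LC k))"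
    by (rule tower_jet[OF tower_VABC(3) ctower_VABC(3) linear_LABC(3) convex_SABC(3) interior_SABC(3) LABC_Dom(3)])
      (use pos[of SC, OF sub(3)] in \<open>auto simp: LC_def\<close>)
qed

subsection \<open>Relations between the kernel integrals\<close>

text \<open>\<open>g\<close> may be unbounded near 1, so the form of the fundamental theorem is used
  that needs only continuity of \<open>\<Phi>\<close> at the end points; the two end points are then
  discarded.\<close>

lemma Cset_FTC:
  assumes t: "0 < t" and q: "continuous_on UNIV q" and \<Phi>: "continuous_on {1..cosh t / sinh t} \<Phi>"
    and d: "\<And>c. 1 < c \<Longrightarrow> c < cosh t / sinh t \<Longrightarrow> (\<Phi> has_real_derivative q c * g c) (at c)"
  shows "(LINT c|lborel. indicator (Cset t) c * (q c * g c)) = \<Phi> (cosh t / sinh t) - \<Phi> 1"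
proof -
  define C where "C = cosh t / sinh t"
  have C: "1 < C" unfolding C_def by (rule coth_gt_1[OF t])
  let ?f = "\<lambda>c. indicator (Cset t) c * (q c * g c)"
  have "integrable lborel ?f" unfolding Cset_pos[OF t] by (rule integrable_continuous_g[OF q])
  then have 1: "(?f has_integral (LINT c|lborel. ?f c)) UNIV" by (rule has_integral_integral_lborel)
  have "((\<lambda>c. q c * g c) has_integral (\<Phi> C - \<Phi> 1)) {1..C}"
    using C \<Phi> d by (intro fundamental_theorem_of_calculus_interior)
      (auto simp: has_real_derivative_iff_has_vector_derivative C_def)
  then have 2: "((\<lambda>c. if c \<in> {1..C} then q c * g c else 0) has_integral (\<Phi> C - \<Phi> 1)) UNIV"
    by (simp only: has_integral_restrict_UNIV)
  have "(?f has_integral (\<Phi> C - \<Phi> 1)) UNIV"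
    by (rule has_integral_spike_finite[OF _ _ 2, of "{1, C}"]) (auto simp: Cset_pos[OF t] C_def[symmetric])
  with 1 show ?thesis unfolding C_def by (rule has_integral_unique)
qed

section \<open>Closed forms for combinations of integrals against g\<close>

definition IQ :: "nat \<Rightarrow> nat \<Rightarrow> nat \<Rightarrow> nat \<Rightarrow> real \<Rightarrow> real \<Rightarrow> real \<Rightarrow> real" where
  "IQ p i j k a b t = (LINT c|lborel. indicator (Cset t) c * (c ^ p * (ek i c a * ek j c b * ek k c t) * g c))"

lemma II_expX: "II expX i j k l (a, b, t, 0) = (- 2) ^ l * IQ l i j k a b t"
proof -
  have "II expX i j k l (a, b, t, 0) = (LINT c|lborel. (- 2) ^ l * (indicator (Cset t) c * (c ^ l * (ek i c a * ek j c b * ek k c t) * g c)))"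
    unfolding II_def expX_def prod.case power_mult_distrib
    by (rule Bochner_Integration.integral_cong) (simp_all add: mult_ac)
  then show ?thesis by (simp add: IQ_def)
qed

text \<open>At w = 0 the factor -e_c(w) and its first two derivatives are 1, -c and 1.\<close>

lemma II_ekX:
  "II ekX i j k 0 (a, b, t, 0) = IQ 0 i j k a b t"
  "II ekX i j k (Suc 0) (a, b, t, 0) = - IQ 1 i j k a b t"
  "II ekX i j k (Suc (Suc 0)) (a, b, t, 0) = IQ 0 i j k a b t"
  unfolding II_def ekX_def IQ_def prod.case ek_def
  by (simp_all add: mult_ac flip: integral_minus)

text \<open>At c = 1 the bound on \<open>g\<close> leaves a factor sqrt(c^2 - 1), so the product
  tends to 0, which is also its value there whatever \<open>g 1\<close> is.\<close>

lemma Xg_continuous: "continuous_on {1..} (\<lambda>c. (c\<^sup>2 - 1) * g c)"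
  unfolding continuous_on_def
proof
  fix c :: real assume c: "c \<in> {1..}"
  show "((\<lambda>c. (c\<^sup>2 - 1) * g c) \<longlongrightarrow> (c\<^sup>2 - 1) * g c) (at c within {1..})"
  proof (cases "c = 1")
    case False
    then have "isCont (\<lambda>c. (c\<^sup>2 - 1) * g c) c" using c by (intro DERIV_isCont[OF g_ode]) auto
    then show ?thesis unfolding isCont_def by (rule tendsto_within_subset) simp
  next
    case True
    obtain B where B: "0 < B" "\<And>c. 1 < c \<Longrightarrow> \<bar>g c\<bar> \<le> B / (c ^ 3 * sqrt (c\<^sup>2 - 1))" using g_bound by blast
    have b: "norm ((c\<^sup>2 - 1) * g c) \<le> B * sqrt (c\<^sup>2 - 1)" if c: "1 < c" for c :: real
    proof -
      define s where "s = sqrt (c\<^sup>2 - 1)"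
      have s: "0 < s" "s * s = c\<^sup>2 - 1" using c by (auto simp: s_def one_less_power)
      have "\<bar>g c\<bar> \<le> B / (c ^ 3 * s)" using B(2)[OF c] by (simp add: s_def)
      also have "\<dots> \<le> B / (1 * s)"
        using s c B(1) by (intro divide_left_mono mult_right_mono) (auto simp: one_le_power)
      finally have "s * s * \<bar>g c\<bar> \<le> s * s * (B / (1 * s))" by (intro mult_left_mono) auto
      also have "\<dots> = B * s" using s(1) by simp
      finally have "s * s * \<bar>g c\<bar> \<le> B * s" .
      then show ?thesis unfolding s(2)[symmetric] s_def[symmetric] using s(1) by (simp add: abs_mult)
    qed
    have l: "((\<lambda>c. B * sqrt (c\<^sup>2 - 1)) \<longlongrightarrow> 0) (at_right 1)" by (auto intro!: tendsto_eq_intros)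
    have "((\<lambda>c. (c\<^sup>2 - 1) * g c) \<longlongrightarrow> 0) (at_right 1)"
      by (rule Lim_null_comparison[OF _ l]) (use b in \<open>auto simp: eventually_at_filter\<close>)
    then show ?thesis using True at_within_Ici_at_right[of "1::real"] by simp
  qed
qed

definition r0 :: "real \<Rightarrow> real" where
  "r0 c = kap / (c\<^sup>2 * sqrt (c\<^sup>2 - 1))"

lemma Xg_derivative:
  "1 < c \<Longrightarrow> ((\<lambda>c. (c\<^sup>2 - 1) * g c) has_real_derivative 5 * c * g c + r0 c) (at c)"
  using g_ode[of c] by (simp add: r0_def kap_def mult.assoc)

text \<open>The c-derivative of e_c(a) is sinh a, so this relation trades a derivative in a for (c^2
  - 1) times a derivative in c, the form in which \<open>Xg_derivative\<close> applies.\<close>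

lemma ek_shift: "ek (Suc 0) c a = (c\<^sup>2 - 1) * sinh a - c * ek 0 c a"
  by (simp add: ek_def power2_eq_square algebra_simps)

lemma ek_two: "ek (Suc (Suc n)) c a = ek n c a"
  by (simp add: ek_def)

text \<open>Primitives, vanishing at \<open>c = 1\<close>, of \<open>c ^ (n - 2) / sqrt (c ^ 2 - 1)\<close>.\<close>

definition pr :: "nat \<Rightarrow> real \<Rightarrow> real" where
  "pr n c = (let s = sqrt (c\<^sup>2 - 1) in
     if n = 0 then s / c else if n = 1 then arctan s else if n = 2 then ln (c + s)
     else if n = 3 then s else (c * s + ln (c + s)) / 2)"

lemma pr_derivative:
  assumes c: "1 < c" and n: "n \<le> 4"
  shows "(pr n has_real_derivative c ^ n / (c\<^sup>2 * sqrt (c\<^sup>2 - 1))) (at c)"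
proof -
  define s where "s = sqrt (c\<^sup>2 - 1)"
  have X: "0 < c\<^sup>2 - 1" "c\<^sup>2 \<noteq> 1" using c by (auto simp: one_less_power power2_eq_1_iff)
  have s: "0 < s" "s\<^sup>2 = c\<^sup>2 - 1" using X by (auto simp: s_def)
  have ds: "((\<lambda>c. sqrt (c\<^sup>2 - 1)) has_real_derivative c / s) (at c)"
    using X unfolding s_def by (auto intro!: derivative_eq_intros simp: divide_simps)
  have cs: "0 < c + s" using c s by simp
  have "((\<lambda>c. ln (c + sqrt (c\<^sup>2 - 1))) has_real_derivative (1 + c / s) / (c + s)) (at c)"
    using DERIV_chain2[OF DERIV_ln_divide[of "c + sqrt (c\<^sup>2 - 1)"] DERIV_add[OF DERIV_ident ds]] cs
    by (simp add: s_def[symmetric])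
  moreover have "(1 + c / s) / (c + s) = 1 / s"
  proof -
    have "1 + c / s = (c + s) / s" using s by (simp add: field_simps)
    then show ?thesis using cs by simp
  qed
  ultimately have dl: "((\<lambda>c. ln (c + sqrt (c\<^sup>2 - 1))) has_real_derivative 1 / s) (at c)" by simp
  have p0: "((\<lambda>c. sqrt (c\<^sup>2 - 1) / c) has_real_derivative 1 / (c\<^sup>2 * s)) (at c)"
    by (rule DERIV_cong, rule DERIV_divide[OF ds DERIV_ident])
      (use c s in \<open>unfold s_def[symmetric], simp_all add: field_simps power2_eq_square\<close>)
  have p1: "((\<lambda>c. arctan (sqrt (c\<^sup>2 - 1))) has_real_derivative c / (c\<^sup>2 * s)) (at c)"
    using X by (auto intro!: derivative_eq_intros ds simp: s_def[symmetric] s field_simps)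
  have p4: "((\<lambda>c. (c * sqrt (c\<^sup>2 - 1) + ln (c + sqrt (c\<^sup>2 - 1))) / 2) has_real_derivative c\<^sup>2 / s) (at c)"
    by (rule DERIV_cong, rule DERIV_cdivide, rule DERIV_add[OF DERIV_mult[OF DERIV_ident ds] dl])
      (use c s in \<open>unfold s_def[symmetric], simp add: field_simps power2_eq_square, algebra\<close>)
  consider "n = 0" | "n = 1" | "n = 2" | "n = 3" | "n = 4" using n by linarith
  then show ?thesis
  proof cases
    case 1 then show ?thesis using p0 by (simp add: pr_def[abs_def] s_def[symmetric])
  next
    case 2 then show ?thesis using p1 by (simp add: pr_def[abs_def] s_def[symmetric])
  next
    case 3 then show ?thesis using dl c by (simp add: pr_def[abs_def] s_def[symmetric])
  next
    case 4 then show ?thesis using ds[unfolded s_def] c by (simp add: pr_def[abs_def] s_def[symmetric] power3_eq_cube power2_eq_square)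
  next
    case 5 then show ?thesis using p4[unfolded s_def] c by (simp add: pr_def[abs_def] Let_def power4_eq_xxxx power2_eq_square)
  qed
qed

lemma pr_continuous: "continuous_on {1..} (pr n)"
proof -
  have "0 < c + sqrt (c\<^sup>2 - 1)" if "1 \<le> c" for c :: real
    using that by (intro add_pos_nonneg) (auto simp: one_le_power)
  then have "\<And>c::real. 1 \<le> c \<Longrightarrow> c + sqrt (c\<^sup>2 - 1) \<noteq> 0" by force
  then show ?thesis unfolding pr_def[abs_def] Let_def
    by (cases "n = 0"; cases "n = 1"; cases "n = 2"; cases "n = 3") (auto intro!: continuous_intros)
qed

lemma pr_1 [simp]: "pr n 1 = 0"
  by (simp add: pr_def)

lemma coth_sq: "0 < t \<Longrightarrow> sqrt ((cosh t / sinh t)\<^sup>2 - 1) = 1 / sinh (t::real)"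
proof -
  assume t: "0 < t"
  have "(cosh t / sinh t)\<^sup>2 - 1 = (1 / sinh t)\<^sup>2" using t by (simp add: power_divide cosh_square_eq field_simps)
  then show ?thesis using t by simp
qed

lemma arctan_inverse_sinh:
  assumes t: "0 < t" shows "arctan (1 / sinh t) = 2 * at_exp t"
proof -
  have e: "exp (- t) < 1" using t by simp
  have "2 * arctan (exp (- t)) = arctan (2 * exp (- t) / (1 - (exp (- t))\<^sup>2))"
    by (rule arctan_double) (use e in simp)
  also have "2 * exp (- t) / (1 - (exp (- t))\<^sup>2) = 1 / sinh t"
  proof -
    have "1 - exp (- t) * exp (- t) \<noteq> 0" using e by (smt (verit) exp_gt_zero mult_less_cancel_left1)
    moreover have "exp t - exp (- t) = exp t * (1 - exp (- t) * exp (- t))"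
      by (simp add: algebra_simps flip: exp_add mult.assoc)
    ultimately show ?thesis
      by (simp add: sinh_field_def power2_eq_square divide_simps) (simp flip: exp_add)
  qed
  finally show ?thesis by (simp add: at_exp_def)
qed

lemma lt_eq: assumes t: "0 < t" shows "ln (cosh t / sinh t + 1 / sinh t) = - lt t"
proof -
  have s: "0 < sinh (t / 2)" "0 < cosh (t / 2)" using t by auto
  have "cosh t + 1 = 2 * cosh (t / 2) ^ 2" "sinh t = 2 * sinh (t / 2) * cosh (t / 2)"
    using cosh_double[of "t / 2"] sinh_double[of "t / 2"] cosh_square_eq[of "t / 2"] by simp_all
  then have "cosh t / sinh t + 1 / sinh t = inverse (tanh (t / 2))"
    using s by (simp add: tanh_def add_divide_distrib[symmetric] power2_eq_square field_simps)
  then show ?thesis using t by (simp add: lt_def ln_inverse)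
qed

lemma pr_coth:
  assumes t: "0 < t"
  shows "pr 0 (cosh t / sinh t) = 1 / cosh t" "pr 1 (cosh t / sinh t) = 2 * at_exp t"
    "pr 2 (cosh t / sinh t) = - lt t" "pr 3 (cosh t / sinh t) = 1 / sinh t"
    "pr 4 (cosh t / sinh t) = (cosh t / sinh t ^ 2 - lt t) / 2"
  using t arctan_inverse_sinh[OF t] lt_eq[OF t] unfolding pr_def Let_def coth_sq[OF t]
  by (simp_all add: power2_eq_square)

lemma IQ_integrable:
  assumes "0 < t"
  shows "integrable lborel (\<lambda>c. indicator (Cset t) c * (c ^ p * (ek i c a * ek j c b * ek k c t) * g c))"
  unfolding Cset_pos[OF assms] by (intro integrable_continuous_g continuous_intros)

text \<open>Let E be the product of the three factors e_c and Y = (c^2 - 1) g. In the derivative of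
  Y E / 2 the equation for Y gives 5 c g E / 2, and \<open>ek_shift\<close> turns (c^2 - 1) E' into
  3 c E plus the sum of the once differentiated products; this explains the factor 4 = (5 + 3)/2.
  The rest is kap/2 times E times an algebraic weight, integrated by the primitives
  \<open>pr\<close>. Y E vanishes at both ends.\<close>

lemma IQ_relation_first:
  assumes t: "0 < t"
  shows "4 * IQ 1 0 0 0 a b t + (IQ 0 1 0 0 a b t + IQ 0 0 1 0 a b t + IQ 0 0 0 1 a b t) / 2
    = - kap / 2 * (- cosh a * cosh b
        + 2 * at_exp t * (sinh a * cosh b * cosh t + cosh a * sinh b * cosh t + cosh a * cosh b * sinh t)
        + lt t * (sinh a * sinh b * cosh t + sinh a * cosh b * sinh t + cosh a * sinh b * sinh t)
        + sinh a * sinh b)"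
proof -
  define C where "C = cosh t / sinh t"
  define q where "q c = 4 * (c * (ek 0 c a * ek 0 c b * ek 0 c t)) + (ek 1 c a * ek 0 c b * ek 0 c t + ek 0 c a * ek 1 c b * ek 0 c t
     + ek 0 c a * ek 0 c b * ek 1 c t) / 2" for c
  define Qi where "Qi p i j k c = indicator (Cset t) c * (c ^ p * (ek i c a * ek j c b * ek k c t) * g c)" for p i j k c
  have I: "integrable lborel (Qi p i j k)" for p i j k unfolding Qi_def[abs_def] by (rule IQ_integrable[OF t])
  have IQ: "IQ p i j k a b t = integral\<^sup>L lborel (Qi p i j k)" for p i j k by (simp add: IQ_def Qi_def[abs_def])
  define Y where "Y c = (c\<^sup>2 - 1) * g c" for c
  define \<Phi> where "\<Phi> c = Y c * (ek 0 c a * ek 0 c b * ek 0 c t) / 2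
    - kap / 2 * (- cosh a * cosh b * cosh t * pr 0 c
       + (sinh a * cosh b * cosh t + cosh a * sinh b * cosh t + cosh a * cosh b * sinh t) * pr 1 c
       - (sinh a * sinh b * cosh t + sinh a * cosh b * sinh t + cosh a * sinh b * sinh t) * pr 2 c
       + sinh a * sinh b * sinh t * pr 3 c)" for c
  have "4 * IQ 1 0 0 0 a b t + (IQ 0 1 0 0 a b t + IQ 0 0 1 0 a b t + IQ 0 0 0 1 a b t) / 2
     = (LINT c|lborel. indicator (Cset t) c * (q c * g c))"
  proof -
    have "(\<lambda>c. indicator (Cset t) c * (q c * g c)) = (\<lambda>c. 4 * Qi 1 0 0 0 c + (Qi 0 1 0 0 c + Qi 0 0 1 0 c + Qi 0 0 0 1 c) / 2)"
      by (rule ext) (simp add: q_def Qi_def algebra_simps add_divide_distrib)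
    then show ?thesis by (simp add: IQ I)
  qed
  also have "\<dots> = \<Phi> C - \<Phi> 1"
    unfolding C_def
  proof (rule Cset_FTC[OF t])
    show "continuous_on UNIV q" unfolding q_def[abs_def] by (intro continuous_intros) auto
    show "continuous_on {1..cosh t / sinh t} \<Phi>"
    proof -
      have cY: "continuous_on {1..cosh t / sinh t} Y"
        unfolding Y_def[abs_def] by (rule continuous_on_subset[OF Xg_continuous]) auto
      have cp: "continuous_on {1..cosh t / sinh t} (pr n)" for n
        by (rule continuous_on_subset[OF pr_continuous]) auto
      show ?thesis unfolding \<Phi>_def[abs_def] by (intro continuous_intros cY cp) simp_all
    qed
    fix c :: real assume c: "1 < c"
    have dek: "((\<lambda>c. ek 0 c x) has_real_derivative sinh x) (at c)" for x
      unfolding ek_def by (auto intro!: derivative_eq_intros)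
    define r where "r = 1 / (c\<^sup>2 * sqrt (c\<^sup>2 - 1))"
    have rr: "r0 c = kap * r" "c ^ n / (c\<^sup>2 * sqrt (c\<^sup>2 - 1)) = c ^ n * r" for n
      by (simp_all add: r0_def r_def)
    have dY: "(Y has_real_derivative 5 * c * g c + kap * r) (at c)"
      using Xg_derivative[OF c] by (simp add: Y_def[abs_def] rr)
    have dp: "(pr n has_real_derivative c ^ n * r) (at c)" if "n \<le> 4" for n
      using pr_derivative[OF c that] by (simp add: rr)
    show "(\<Phi> has_real_derivative q c * g c) (at c)"
      unfolding \<Phi>_def[abs_def]
      apply (rule derivative_eq_intros dY dp dek refl | simp)+
      unfolding q_def One_nat_def ek_shift Y_def
      by (simp add: ek_def field_simps power2_eq_square power3_eq_cube)
  qed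
  also have "\<Phi> 1 = 0" by (simp add: \<Phi>_def Y_def)
  also have "\<Phi> C - 0 = - kap / 2 * (- cosh a * cosh b
        + 2 * at_exp t * (sinh a * cosh b * cosh t + cosh a * sinh b * cosh t + cosh a * cosh b * sinh t)
        + lt t * (sinh a * sinh b * cosh t + sinh a * cosh b * sinh t + cosh a * sinh b * sinh t)
        + sinh a * sinh b)"
    using t ek_0_coth[of t] unfolding \<Phi>_def C_def pr_coth[OF t] by (simp add: algebra_simps)
  finally show ?thesis .
qed


text \<open>With E and Y as for the first relation and X = c^2 - 1, the left-hand integrand is g
  times (14/3 c^2 - 7/9) E - X^2 E'' / 9, the terms in E' cancelling. The primitive -X Y E' / 9
  produces the last term together with -7/9 c Y E', where 7 = 2 + 5 combines the derivative of X
  with the equation for Y; adding 7/9 c Y E removes this and yields the term in E.\<close>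

lemma IQ_relation_second:
  assumes t: "0 < t"
  shows "4 * IQ 2 0 0 0 a b t - (3 * IQ 0 0 0 0 a b t + 2 * (IQ 0 1 1 0 a b t + IQ 0 1 0 1 a b t + IQ 0 0 1 1 a b t)) / 9
      - 4 / 9 * (IQ 1 1 0 0 a b t + IQ 1 0 1 0 a b t + IQ 1 0 0 1 a b t) - 4 / 9 * IQ 0 0 0 0 a b t
    = - (ek 0 (cosh t / sinh t) a * ek 0 (cosh t / sinh t) b * g (cosh t / sinh t)) / (9 * sinh t ^ 3)
      + kap / 9 * (- cosh a * cosh b * tanh t + 4 * sinh a * cosh b + 4 * cosh a * sinh b
          + 2 * (sinh a * sinh b * cosh t + sinh a * cosh b * sinh t + cosh a * sinh b * sinh t) * 2 * at_exp t
          + 14 * cosh a * cosh b * cosh t * at_exp t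
          - (3 * sinh a * sinh b * sinh t) * (- lt t)
          - 6 * (sinh a * cosh b * cosh t + cosh a * sinh b * cosh t + cosh a * cosh b * sinh t) * (- lt t)
          + 5 * sinh a * sinh b * cosh t / sinh t
          - 4 * sinh a * sinh b * sinh t * (cosh t / sinh t ^ 2 - lt t) / 2)"
proof -
  define C where "C = cosh t / sinh t"
  define q where "q c = 4 * (c ^ 2 * (ek 0 c a * ek 0 c b * ek 0 c t)) - (3 * (ek 0 c a * ek 0 c b * ek 0 c t)
      + 2 * (ek 1 c a * ek 1 c b * ek 0 c t + ek 1 c a * ek 0 c b * ek 1 c t + ek 0 c a * ek 1 c b * ek 1 c t)) / 9
      - 4 / 9 * (c * (ek 1 c a * ek 0 c b * ek 0 c t + ek 0 c a * ek 1 c b * ek 0 c t + ek 0 c a * ek 0 c b * ek 1 c t))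
      - 4 / 9 * (ek 0 c a * ek 0 c b * ek 0 c t)" for c
  define Qi where "Qi p i j k c = indicator (Cset t) c * (c ^ p * (ek i c a * ek j c b * ek k c t) * g c)" for p i j k c
  have I: "integrable lborel (Qi p i j k)" for p i j k unfolding Qi_def[abs_def] by (rule IQ_integrable[OF t])
  have IQ: "IQ p i j k a b t = integral\<^sup>L lborel (Qi p i j k)" for p i j k by (simp add: IQ_def Qi_def[abs_def])
  define P0 p1 p2 p3 where "P0 = cosh a * cosh b * cosh t"
    and "p1 = sinh a * cosh b * cosh t + cosh a * sinh b * cosh t + cosh a * cosh b * sinh t"
    and "p2 = sinh a * sinh b * cosh t + sinh a * cosh b * sinh t + cosh a * sinh b * sinh t"
    and "p3 = sinh a * sinh b * sinh t"
  define Y where "Y c = (c\<^sup>2 - 1) * g c" for c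
  \<comment> \<open>Collects the contributions of the inhomogeneity \<open>r0\<close>: its
    derivative is \<open>r0 c\<close> times (X E' - 7 c E) / 9, with E and E' expanded in powers of
    c.\<close>
  define \<Psi> where "\<Psi> c = kap / 9 * (- p1 * pr 0 c + 2 * p2 * pr 1 c + (p1 - 3 * p3) * pr 2 c - 2 * p2 * pr 3 c + 3 * p3 * pr 4 c)
     - kap * 7 / 9 * (- P0 * pr 1 c + p1 * pr 2 c - p2 * pr 3 c + p3 * pr 4 c)" for c
  define \<Phi> where "\<Phi> c = - (c\<^sup>2 - 1) * Y c * (sinh a * ek 0 c b * ek 0 c t + ek 0 c a * sinh b * ek 0 c t + ek 0 c a * ek 0 c b * sinh t) / 9
    + 7 / 9 * c * Y c * (ek 0 c a * ek 0 c b * ek 0 c t) + \<Psi> c" for c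
  have "4 * IQ 2 0 0 0 a b t - (3 * IQ 0 0 0 0 a b t + 2 * (IQ 0 1 1 0 a b t + IQ 0 1 0 1 a b t + IQ 0 0 1 1 a b t)) / 9
      - 4 / 9 * (IQ 1 1 0 0 a b t + IQ 1 0 1 0 a b t + IQ 1 0 0 1 a b t) - 4 / 9 * IQ 0 0 0 0 a b t
     = (LINT c|lborel. indicator (Cset t) c * (q c * g c))"
  proof -
    have "(\<lambda>c. indicator (Cset t) c * (q c * g c)) = (\<lambda>c. 4 * Qi 2 0 0 0 c - (3 * Qi 0 0 0 0 c + 2 * (Qi 0 1 1 0 c + Qi 0 1 0 1 c + Qi 0 0 1 1 c)) / 9
      - 4 / 9 * (Qi 1 1 0 0 c + Qi 1 0 1 0 c + Qi 1 0 0 1 c) - 4 / 9 * Qi 0 0 0 0 c)"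
      by (rule ext) (simp add: q_def Qi_def algebra_simps add_divide_distrib diff_divide_distrib)
    then show ?thesis by (simp add: IQ I)
  qed
  also have "\<dots> = \<Phi> C - \<Phi> 1"
    unfolding C_def
  proof (rule Cset_FTC[OF t])
    show "continuous_on UNIV q" unfolding q_def[abs_def] by (intro continuous_intros) auto
    show "continuous_on {1..cosh t / sinh t} \<Phi>"
    proof -
      have cY: "continuous_on {1..cosh t / sinh t} Y"
        unfolding Y_def[abs_def] by (rule continuous_on_subset[OF Xg_continuous]) auto
      have cp: "continuous_on {1..cosh t / sinh t} (pr n)" for n
        by (rule continuous_on_subset[OF pr_continuous]) auto
      show ?thesis unfolding \<Phi>_def[abs_def] \<Psi>_def by (intro continuous_intros cY cp) simp_all
    qed
    fix c :: real assume c: "1 < c"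
    have dek: "((\<lambda>c. ek 0 c x) has_real_derivative sinh x) (at c)" for x
      unfolding ek_def by (auto intro!: derivative_eq_intros)
    define r where "r = 1 / (c\<^sup>2 * sqrt (c\<^sup>2 - 1))"
    have rr: "r0 c = kap * r" "c ^ n / (c\<^sup>2 * sqrt (c\<^sup>2 - 1)) = c ^ n * r" for n
      by (simp_all add: r0_def r_def)
    have dY: "(Y has_real_derivative 5 * c * g c + kap * r) (at c)"
      using Xg_derivative[OF c] by (simp add: Y_def[abs_def] rr)
    have dp: "(pr n has_real_derivative c ^ n * r) (at c)" if "n \<le> 4" for n
      using pr_derivative[OF c that] by (simp add: rr)
    have pol: "p1 - 2 * c * p2 + 3 * c\<^sup>2 * p3 = sinh a * ek 0 c b * ek 0 c t + ek 0 c a * sinh b * ek 0 c t + ek 0 c a * ek 0 c b * sinh t"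
      "- P0 + c * p1 - c\<^sup>2 * p2 + c ^ 3 * p3 = ek 0 c a * ek 0 c b * ek 0 c t"
      unfolding P0_def p1_def p2_def p3_def
      by (simp_all add: ek_def algebra_simps power2_eq_square power3_eq_cube)
    have "(\<Psi> has_real_derivative kap * r * ((c\<^sup>2 - 1) * (p1 - 2 * c * p2 + 3 * c\<^sup>2 * p3) - 7 * c * (- P0 + c * p1 - c\<^sup>2 * p2 + c ^ 3 * p3)) / 9) (at c)"
      unfolding \<Psi>_def[abs_def]
      apply (rule derivative_eq_intros dp refl | simp)+
      by (simp add: field_simps power2_eq_square power3_eq_cube power4_eq_xxxx)
    note d\<Psi> = this[unfolded pol]
    show "(\<Phi> has_real_derivative q c * g c) (at c)"
      unfolding \<Phi>_def[abs_def]
      apply (rule derivative_eq_intros dY d\<Psi> dek refl | simp)+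
      unfolding q_def One_nat_def ek_shift Y_def
      by (simp add: field_simps power2_eq_square)
  qed
  also have "\<Phi> 1 = 0" by (simp add: \<Phi>_def Y_def \<Psi>_def)
  \<comment> \<open>At the upper end only the summand of E' in which e_c(t) itself was
    differentiated survives; it produces the end-point term that has to match
    \<open>bdry\<close>.\<close>
  also have "\<Phi> C - 0 = - (ek 0 C a * ek 0 C b * g C) / (9 * sinh t ^ 3) + \<Psi> C"
  proof -
    have "C\<^sup>2 - 1 = 1 / sinh t ^ 2" using t by (simp add: C_def power_divide cosh_square_eq field_simps)
    then show ?thesis
      using t ek_0_coth[of t] by (simp add: \<Phi>_def Y_def C_def[symmetric] power2_eq_square power3_eq_cube mult_ac)
  qed
  also have "\<Psi> C = kap / 9 * (- cosh a * cosh b * tanh t + 4 * sinh a * cosh b + 4 * cosh a * sinh b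
          + 2 * (sinh a * sinh b * cosh t + sinh a * cosh b * sinh t + cosh a * sinh b * sinh t) * 2 * at_exp t
          + 14 * cosh a * cosh b * cosh t * at_exp t
          - (3 * sinh a * sinh b * sinh t) * (- lt t)
          - 6 * (sinh a * cosh b * cosh t + cosh a * sinh b * cosh t + cosh a * cosh b * sinh t) * (- lt t)
          + 5 * sinh a * sinh b * cosh t / sinh t
          - 4 * sinh a * sinh b * sinh t * (cosh t / sinh t ^ 2 - lt t) / 2)"
  proof -
    have s: "sinh t \<noteq> 0" "cosh t \<noteq> 0" using t by auto
    show ?thesis
      unfolding \<Psi>_def C_def pr_coth[OF t] P0_def p1_def p2_def p3_def tanh_def
      using s by (simp add: field_simps power2_eq_square)
  qed
  finally show ?thesis by (simp add: C_def)
qed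

section \<open>Transversal derivatives at w = 0\<close>

lemma sh_simps: "sh 0 x = sinh x" "sh (Suc 0) x = cosh x" "sh (Suc (Suc n)) x = sh n x"
  by (simp_all add: sh_def)

lemma be_simps: "be 0 t = cosh t * at_exp t" "be (Suc 0) t = sinh t * at_exp t - 1 / 2"
  "be (Suc (Suc 0)) t = cosh t * at_exp t - tanh t / 2"
  by (simp_all add: be_def)

lemma la_simps: "la 0 t = sinh t * lt t" "la (Suc 0) t = cosh t * lt t + 1"
  "la (Suc (Suc 0)) t = sinh t * lt t + cosh t / sinh t"
  by (simp_all add: la_def)

lemma match_AC0: "VA 0 0 0 0 (a, b, t, 0) = VC 0 0 0 0 (a, b, t, 0)"
  by (simp add: VA_def VC_def VK_def II_expX II_ekX VE_def VE4_def sk_def sh_simps)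

text \<open>The two directions are the images of the first unit vector of the orthant under
  \<open>LA\<close> and \<open>LC\<close>, divided by sqrt 2; it is transversal to the interface of
  A and C.\<close>

lemma match_AC1:
  assumes t: "0 < t"
  shows "D1 VA 0 0 0 0 (a, b, t, 0) (0, 0, 0, 1) = D1 VC 0 0 0 0 (a, b, t, 0) (1/3, 1/3, 1/3, - 2/3)"
proof -
  have sq: "cosh a * cosh a = 1 + sinh a * sinh a" "cosh b * cosh b = 1 + sinh b * sinh b" "cosh t * cosh t = 1 + sinh t * sinh t"
    by (simp_all add: cosh_square_eq flip: power2_eq_square)
  show ?thesis
    using IQ_relation_first[OF t, of a b] sq
    by (simp add: D1_def VA_def VC_def VK_def II_expX II_ekX VE_def VE4_def sk_def sh_simps be_simps la_simps sinh_add cosh_add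
        ) (simp add: field_simps)
qed


text \<open>On the C side the direction has a t-component, so \<open>bdry\<close> enters with weight
  1/9; on the A side it does not. The end-point term of \<open>IQ_relation_second\<close> accounts
  for the difference.\<close>

lemma match_AC2:
  assumes t: "0 < t"
  shows "D2 VA (a, b, t, 0) (0, 0, 0, 1) (0, 0, 0, 1) = D2 VC (a, b, t, 0) (1/3, 1/3, 1/3, - 2/3) (1/3, 1/3, 1/3, - 2/3)"
proof -
  have sq: "cosh a * cosh a = 1 + sinh a * sinh a" "cosh b * cosh b = 1 + sinh b * sinh b" "cosh t * cosh t = 1 + sinh t * sinh t"
    by (simp_all add: cosh_square_eq flip: power2_eq_square)
  have tw: "IQ p (Suc (Suc i)) j k a b t = IQ p i j k a b t" "IQ p i (Suc (Suc j)) k a b t = IQ p i j k a b t"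
    "IQ p i j (Suc (Suc k)) a b t = IQ p i j k a b t" for p i j k
    by (simp_all add: IQ_def ek_two)
  have bd: "bdry ekX (a, b, t, 0) = - (ek 0 (cosh t / sinh t) a * ek 0 (cosh t / sinh t) b * g (cosh t / sinh t)) / sinh t ^ 3"
    by (simp add: bdry_def ekX_def ek_def)
  define Bd where "Bd = bdry ekX (a, b, t, 0)"
  have Bd9: "- (ek 0 (cosh t / sinh t) a * ek 0 (cosh t / sinh t) b * g (cosh t / sinh t)) / (9 * sinh t ^ 3) = Bd / 9"
    unfolding Bd_def bd by simp
  define I0 I2 O1 O2 O3 N1 N2 N3 where "I0 = IQ 0 0 0 0 a b t" and "I2 = IQ 2 0 0 0 a b t"
    and "O1 = IQ 0 1 1 0 a b t" and "O2 = IQ 0 1 0 1 a b t" and "O3 = IQ 0 0 1 1 a b t"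
    and "N1 = IQ 1 1 0 0 a b t" and "N2 = IQ 1 0 1 0 a b t" and "N3 = IQ 1 0 0 1 a b t"
  have KA: "D2 (VK expX) (a, b, t, 0) (0, 0, 0, 1) (0, 0, 0, 1) = 4 * I2"
    by (simp add: D2_def D1_def VK_def II_expX I2_def numeral_2_eq_2)
  have KC: "D2 (VK ekX) (a, b, t, 0) (1/3, 1/3, 1/3, - 2/3) (1/3, 1/3, 1/3, - 2/3)
     = (3 * I0 + Bd + 2 * (O1 + O2 + O3)) / 9 + 4/9 * (N1 + N2 + N3) + 4/9 * I0"
    by (simp add: D2_def D1_def VK_def II_ekX tw Bd_def[symmetric] I0_def O1_def O2_def O3_def N1_def N2_def N3_def numeral_2_eq_2)
      (simp add: field_simps)
  have EA: "D2 VE (a, b, t, 0) (0, 0, 0, 1) (0, 0, 0, 1) = 0"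
    by (simp add: D2_def D1_def VE_def)
  have split: "D2 VA x h h = D2 VE x h h + D2 (VK expX) x h h" "D2 VC x h h = D2 VE4 x h h + D2 (VK ekX) x h h" for x h
    by (simp_all add: D2_def D1_def VA_def VC_def algebra_simps split: prod.splits)
  have EC: "D2 VE4 (a, b, t, 0) (1/3, 1/3, 1/3, - 2/3) (1/3, 1/3, 1/3, - 2/3)
     = kap / 9 * (- cosh a * cosh b * tanh t + 4 * sinh a * cosh b + 4 * cosh a * sinh b
          + 2 * (sinh a * sinh b * cosh t + sinh a * cosh b * sinh t + cosh a * sinh b * sinh t) * 2 * at_exp t
          + 14 * cosh a * cosh b * cosh t * at_exp t
          - (3 * sinh a * sinh b * sinh t) * (- lt t)
          - 6 * (sinh a * cosh b * cosh t + cosh a * sinh b * cosh t + cosh a * cosh b * sinh t) * (- lt t)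
          + 5 * sinh a * sinh b * cosh t / sinh t
          - 4 * sinh a * sinh b * sinh t * (cosh t / sinh t ^ 2 - lt t) / 2)"
    using t
    by (simp add: D2_def D1_def VE4_def sk_def sh_simps be_simps la_simps sinh_add cosh_add numeral_2_eq_2)
      (simp add: field_simps power2_eq_square)
  have key: "0 + 4 * I2 = e + ((3 * I0 + Bd + 2 * (O1 + O2 + O3)) / 9 + 4 / 9 * (N1 + N2 + N3) + 4 / 9 * I0)"
    if "4 * I2 - (3 * I0 + 2 * (O1 + O2 + O3)) / 9 - 4 / 9 * (N1 + N2 + N3) - 4 / 9 * I0 = Bd / 9 + e" for e :: real
    using that by (simp add: field_simps)
  show ?thesis
    unfolding split KA KC EA EC
    by (rule key)
      (use IQ_relation_second[OF t, of a b] in \<open>unfold Bd9 I0_def I2_def O1_def O2_def O3_def N1_def N2_def N3_def\<close>)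
qed

text \<open>The direction is \<open>LB (vec4 2 (- 1) 0 0)\<close> divided by sqrt 2. The relation
  that matches A and C to first order also gives this condition, because the elementary part is
  reflected in a.\<close>

lemma neumann_B:
  assumes t: "0 < t"
  shows "D1 VB 0 0 0 0 (a, b, t, 0) (- 1/2, - 1/2, - 1/2, 2) = 0"
proof -
  have sq: "cosh a * cosh a = 1 + sinh a * sinh a" "cosh b * cosh b = 1 + sinh b * sinh b" "cosh t * cosh t = 1 + sinh t * sinh t"
    by (simp_all add: cosh_square_eq flip: power2_eq_square)
  show ?thesis
    using IQ_relation_first[OF t, of a b] sq
    by (simp add: D1_def VB_def VEB_def VK_def II_expX VE_def sk_def sh_simps be_simps la_simps sinh_add cosh_add)
      (simp add: field_simps)
qed

subsection \<open>Matching across the interfaces and the walls\<close>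

definition w0 :: "real ^ 4 \<Rightarrow> real" where
  "w0 q = (if q \<in> SB then VB 0 0 0 0 (LB q) else if q \<in> SA then VA 0 0 0 0 (LA q) else VC 0 0 0 0 (LC q))"

definition w1 :: "real ^ 4 \<Rightarrow> real ^ 4 \<Rightarrow> real" where
  "w1 q h = (if q \<in> SB then D1 VB 0 0 0 0 (LB q) (LB h) else if q \<in> SA then D1 VA 0 0 0 0 (LA q) (LA h)
     else D1 VC 0 0 0 0 (LC q) (LC h))"

definition w2 :: "real ^ 4 \<Rightarrow> real ^ 4 \<Rightarrow> real ^ 4 \<Rightarrow> real" where
  "w2 q h k = (if q \<in> SB then D2 VB (LB q) (LB h) (LB k) else if q \<in> SA then D2 VA (LA q) (LA h) (LA k)
     else D2 VC (LC q) (LC h) (LC k))"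

lemma ctower_D1: "ctower D V \<Longrightarrow> continuous_on D (\<lambda>x. D1 V 0 0 0 0 x h)"
  by (cases h) (auto simp: D1_def ctower_def intro!: continuous_intros)

lemma ctower_D2: "ctower D V \<Longrightarrow> continuous_on D (\<lambda>x. D2 V x h k)"
  by (cases h; cases k) (auto simp: D1_def D2_def ctower_def intro!: continuous_intros)

text \<open>The identities at w = 0 were proved for t > 0. At the corner all four coordinates
  vanish, and the identities extend to it by continuity along the t-axis.\<close>

lemma eq_along_ray:
  fixes f f' :: "real4 \<Rightarrow> real"
  assumes f: "continuous_on S f" "continuous_on S' f'" and S: "\<And>s. 0 \<le> s \<Longrightarrow> (0, 0, s, 0) \<in> S \<inter> S'"
    and eq: "\<And>s. 0 < s \<Longrightarrow> f (0, 0, s, 0) = f' (0, 0, s, 0)"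
  shows "f (0, 0, 0, 0) = f' (0, 0, 0, 0)"
proof -
  define d where "d s = f (0, 0, s, 0) - f' (0, 0, s, 0)" for s
  have "continuous_on {0..} d"
    unfolding d_def using S
    by (intro continuous_intros continuous_on_compose2[OF f(1)] continuous_on_compose2[OF f(2)]) auto
  then have "(d \<longlongrightarrow> d 0) (at 0 within {0..})" unfolding continuous_on_def by simp
  then have "(d \<longlongrightarrow> d 0) (at_right 0)"
    using at_within_Ici_at_right[of "0::real"] by simp
  moreover have "(d \<longlongrightarrow> 0) (at_right 0)"
    by (rule tendsto_eventually) (auto simp: d_def eq eventually_at_filter)
  ultimately have "d 0 = 0" by (rule tendsto_unique[rotated]) simp
  then show ?thesis by (simp add: d_def)
qed

text \<open>At a = 0 one has e_c(0) = -1 and e_c'(0) = c, so the factor -2 c of a w-derivative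
  equals twice the effect of an a-derivative.\<close>

lemma II_expX_0:
  "II expX 0 j k (Suc l) (0, b, t, w) = 2 * II expX (Suc 0) j k l (0, b, t, w)"
proof -
  have "II expX 0 j k (Suc l) (0, b, t, w) =
      (LINT c|lborel. 2 * (indicator (Cset t) c * (ek (Suc 0) c 0 * ek j c b * ek k c t * expX l c w * g c)))"
    unfolding II_def expX_def prod.case
    by (rule Bochner_Integration.integral_cong) (simp_all add: ek_def[of 0 _ 0] ek_def[of "Suc 0" _ 0] mult_ac)
  then show ?thesis by (simp add: II_def)
qed

text \<open>The integrand is symmetric in its e_c-factors. Where two coordinates coincide, the
  corresponding derivatives agree, which is the kernel part of a Neumann condition.\<close>

lemma II_swap_ab: "II X i j k l (a, a, t, w) = II X j i k l (a, a, t, w)"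
  unfolding II_def by (simp add: mult_ac)

lemma II_swap_bt: "II X i j k l (a, t, t, w) = II X i k j l (a, t, t, w)"
  unfolding II_def by (simp add: mult_ac)

lemma II_swap_aw: "II ekX i j k l (a, b, t, a) = II ekX l j k i (a, b, t, a)"
  unfolding II_def ekX_def by (simp add: mult_ac)

lemma match_AB0: "VA 0 0 0 0 (0, b, t, w) = VB 0 0 0 0 (0, b, t, w)"
  by (simp add: VA_def VB_def VEB_def)

text \<open>At a = 0 the w-derivative of the kernel part is twice the a-derivative, so the
  difference of the a- and w-derivatives is minus the a-derivative. On the elementary part the sign
  comes from the reflection in \<open>VEB\<close>.\<close>

lemma match_AB1:
  "D1 VA 0 0 0 0 (0, b, t, w) (r, 0, 0, - r) = D1 VB 0 0 0 0 (0, b, t, w) (- r, 0, 0, 0)"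
  by (simp add: D1_def VA_def VB_def VEB_def VK_def VE_def II_expX_0 algebra_simps)

lemma match_AB2:
  "D2 VA (0, b, t, w) (r, 0, 0, - r) (r, 0, 0, - r) = D2 VB (0, b, t, w) (- r, 0, 0, 0) (- r, 0, 0, 0)"
  by (simp add: D2_def D1_def VA_def VB_def VEB_def VK_def VE_def II_expX_0 algebra_simps)

lemma span4:
  fixes S :: "(real ^ 4) set"
  assumes "u1 \<in> S" "u2 \<in> S" "u3 \<in> S" "n \<in> S"
    and "\<And>h. h = c1 h *\<^sub>R u1 + c2 h *\<^sub>R u2 + c3 h *\<^sub>R u3 + c4 h *\<^sub>R n"
  shows "span S = UNIV"
proof -
  have "h \<in> span S" for h
    by (subst assms(5)[of h]) (intro span_add span_scale span_base assms(1-4))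
  then show ?thesis by auto
qed

lemma match_AB:
  assumes x: "q \<in> SA \<inter> SB"
  shows "VA 0 0 0 0 (LA q) = VB 0 0 0 0 (LB q)" "D1 VA 0 0 0 0 (LA q) (LA h) = D1 VB 0 0 0 0 (LB q) (LB h)"
    "D2 VA (LA q) (LA h) (LA k) = D2 VB (LB q) (LB h) (LB k)"
proof -
  define n where "n = vec4 0 (- 1) 0 1"
  have L: "LA y = (0, sqrt 2 * ((y $ 2 + y $ 4) / 2), sqrt 2 * (y $ 3 + (y $ 2 + y $ 4) / 2), sqrt 2 * y $ 1)" "LB y = LA y"
    if "y \<in> SA \<inter> SB" for y
    using that by (auto simp: LA_def LB_def SA_def SB_def)
  have n: "LA n = (sqrt 2, 0, 0, - sqrt 2)" "LB n = (- sqrt 2, 0, 0, 0)"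
    by (simp_all add: LA_def LB_def n_def)
  have eq0: "VA 0 0 0 0 (LA y) = VB 0 0 0 0 (LB y)" if "y \<in> SA \<inter> SB" for y
    unfolding L[OF that] by (rule match_AB0)
  then show "VA 0 0 0 0 (LA q) = VB 0 0 0 0 (LB q)" using x .
  have eq1: "D1 VA 0 0 0 0 (LA y) (LA n) = D1 VB 0 0 0 0 (LB y) (LB n)" if "y \<in> SA \<inter> SB" for y
    unfolding n L[OF that] by (rule match_AB1)
  have eq2: "D2 VA (LA y) (LA n) (LA n) = D2 VB (LB y) (LB n) (LB n)" if "y \<in> SA \<inter> SB" for y
    unfolding n L[OF that] by (rule match_AB2)
  have sp: "span (insert n ((\<lambda>z. z - y) ` (SA \<inter> SB))) = UNIV" if y: "y \<in> SA \<inter> SB" for y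
  proof (rule span4[of "vec4 1 0 0 0" _ "vec4 0 0 1 0" "vec4 0 1 0 1" n "\<lambda>h. h $ 1" "\<lambda>h. h $ 3" "\<lambda>h. (h $ 2 + h $ 4) / 2" "\<lambda>h. (h $ 4 - h $ 2) / 2"])
    have i: "u \<in> insert n ((\<lambda>z. z - y) ` (SA \<inter> SB))" if "y + u \<in> SA \<inter> SB" for u
      using image_eqI[of u "\<lambda>z. z - y" "y + u" "SA \<inter> SB"] that by simp
    show "vec4 1 0 0 0 \<in> insert n ((\<lambda>z. z - y) ` (SA \<inter> SB))" by (rule i) (use y in \<open>auto simp: SA_def SB_def\<close>)
    show "vec4 0 0 1 0 \<in> insert n ((\<lambda>z. z - y) ` (SA \<inter> SB))" by (rule i) (use y in \<open>auto simp: SA_def SB_def\<close>)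
    show "vec4 0 1 0 1 \<in> insert n ((\<lambda>z. z - y) ` (SA \<inter> SB))" by (rule i) (use y in \<open>auto simp: SA_def SB_def\<close>)
    show "h = h $ 1 *\<^sub>R vec4 1 0 0 0 + h $ 3 *\<^sub>R vec4 0 0 1 0 + ((h $ 2 + h $ 4) / 2) *\<^sub>R vec4 0 1 0 1 + ((h $ 4 - h $ 2) / 2) *\<^sub>R n" for h
      by (simp add: n_def vec_eq_iff forall_4 field_simps)
  qed simp
  note m = jet_face_match[OF jet_ABC(1,2) convex_Int[OF convex_SABC(1,2)] Int_lower1 Int_lower2 sp eq0 eq1 eq2 x]
  show "D1 VA 0 0 0 0 (LA q) (LA h) = D1 VB 0 0 0 0 (LB q) (LB h)" by (rule m(1))
  show "D2 VA (LA q) (LA h) (LA k) = D2 VB (LB q) (LB h) (LB k)" by (rule m(2))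
qed

lemma ray_Dom: "0 \<le> s \<Longrightarrow> (0, 0, s, 0) \<in> A.Dom" "0 \<le> s \<Longrightarrow> (0, 0, s, 0) \<in> C.Dom"
  by (auto simp: A.Dom_def C.Dom_def)

lemma match_AC:
  assumes x: "q \<in> SA \<inter> SC"
  shows "VA 0 0 0 0 (LA q) = VC 0 0 0 0 (LC q)" "D1 VA 0 0 0 0 (LA q) (LA h) = D1 VC 0 0 0 0 (LC q) (LC h)"
    "D2 VA (LA q) (LA h) (LA k) = D2 VC (LC q) (LC h) (LC k)"
proof -
  define n where "n = vec4 1 0 0 0"
  define m where "m = (1/3::real, 1/3::real, 1/3::real, - 2/3::real)"
  have L: "LA y = (sqrt 2 * y $ 1, sqrt 2 * (y $ 2 + y $ 1), sqrt 2 * (y $ 3 + y $ 2 + y $ 1), 0)" "LC y = LA y"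
    if "y \<in> SA \<inter> SC" for y
  proof -
    have e: "y $ 4 = y $ 2 + 2 * y $ 1" using that by (auto simp: SA_def SC_def)
    show "LA y = (sqrt 2 * y $ 1, sqrt 2 * (y $ 2 + y $ 1), sqrt 2 * (y $ 3 + y $ 2 + y $ 1), 0)" "LC y = LA y"
      by (simp_all add: LA_def LC_def e)
  qed
  have n: "LA n = sqrt 2 *\<^sub>R (0, 0, 0, 1)" "LC n = sqrt 2 *\<^sub>R m"
    by (simp_all add: LA_def LC_def n_def m_def)
  have eq0: "VA 0 0 0 0 (LA y) = VC 0 0 0 0 (LC y)" if "y \<in> SA \<inter> SC" for y
    unfolding L[OF that] by (rule match_AC0)
  then show "VA 0 0 0 0 (LA q) = VC 0 0 0 0 (LC q)" using x .
  \<comment> \<open>On this interface t is a positive multiple of q_1 + q_2 + q_3, so t = 0 forces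
    the corner, where \<open>eq_along_ray\<close> replaces the identities.\<close>
  have z: "LA y = (0, 0, 0, 0)" if "y \<in> SA \<inter> SC" "\<not> 0 < sqrt 2 * (y $ 3 + y $ 2 + y $ 1)" for y
  proof -
    have "y $ 1 = 0" "y $ 2 = 0" "y $ 3 = 0" using that by (auto simp: SA_def zero_less_mult_iff)
    then show ?thesis unfolding L(1)[OF that(1)] by simp
  qed
  have eq1: "D1 VA 0 0 0 0 (LA y) (LA n) = D1 VC 0 0 0 0 (LC y) (LC n)" if y: "y \<in> SA \<inter> SC" for y
  proof -
    have "D1 VA 0 0 0 0 (LA y) (0, 0, 0, 1) = D1 VC 0 0 0 0 (LA y) m"
    proof (cases "0 < sqrt 2 * (y $ 3 + y $ 2 + y $ 1)")
      case True
      then show ?thesis unfolding L(1)[OF y] m_def by (rule match_AC1)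
    next
      case False
      show ?thesis unfolding z[OF y False]
        by (rule eq_along_ray[OF ctower_D1[OF ctower_VABC(1)] ctower_D1[OF ctower_VABC(3)]])
          (use ray_Dom match_AC1 in \<open>auto simp: m_def\<close>)
    qed
    then show ?thesis by (simp only: n L(2)[OF y] linear_scale[OF linear_D1])
  qed
  have eq2: "D2 VA (LA y) (LA n) (LA n) = D2 VC (LC y) (LC n) (LC n)" if y: "y \<in> SA \<inter> SC" for y
  proof -
    have "D2 VA (LA y) (0, 0, 0, 1) (0, 0, 0, 1) = D2 VC (LA y) m m"
    proof (cases "0 < sqrt 2 * (y $ 3 + y $ 2 + y $ 1)")
      case True
      then show ?thesis unfolding L(1)[OF y] m_def by (rule match_AC2)
    next
      case False
      show ?thesis unfolding z[OF y False]
        by (rule eq_along_ray[OF ctower_D2[OF ctower_VABC(1)] ctower_D2[OF ctower_VABC(3)]])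
          (use ray_Dom match_AC2 in \<open>auto simp: m_def\<close>)
    qed
    then show ?thesis
      by (simp only: n L(2)[OF y] linear_scale[OF linear_D2] D2_sym[of _ _ "sqrt 2 *\<^sub>R _"])
  qed
  have sp: "span (insert n ((\<lambda>z. z - y) ` (SA \<inter> SC))) = UNIV" if y: "y \<in> SA \<inter> SC" for y
  proof (rule span4[of "vec4 0 1 0 1" _ "vec4 0 0 1 0" "vec4 1 0 0 2" n "\<lambda>h. h $ 2" "\<lambda>h. h $ 3" "\<lambda>h. (h $ 4 - h $ 2) / 2" "\<lambda>h. h $ 1 - (h $ 4 - h $ 2) / 2"])
    have i: "u \<in> insert n ((\<lambda>z. z - y) ` (SA \<inter> SC))" if "y + u \<in> SA \<inter> SC" for u
      using image_eqI[of u "\<lambda>z. z - y" "y + u" "SA \<inter> SC"] that by simp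
    show "vec4 0 1 0 1 \<in> insert n ((\<lambda>z. z - y) ` (SA \<inter> SC))" by (rule i) (use y in \<open>auto simp: SA_def SC_def\<close>)
    show "vec4 0 0 1 0 \<in> insert n ((\<lambda>z. z - y) ` (SA \<inter> SC))" by (rule i) (use y in \<open>auto simp: SA_def SC_def\<close>)
    show "vec4 1 0 0 2 \<in> insert n ((\<lambda>z. z - y) ` (SA \<inter> SC))" by (rule i) (use y in \<open>auto simp: SA_def SC_def\<close>)
    show "h = h $ 2 *\<^sub>R vec4 0 1 0 1 + h $ 3 *\<^sub>R vec4 0 0 1 0 + ((h $ 4 - h $ 2) / 2) *\<^sub>R vec4 1 0 0 2 + (h $ 1 - (h $ 4 - h $ 2) / 2) *\<^sub>R n" for h
      by (simp add: n_def vec_eq_iff forall_4 field_simps)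
  qed simp
  note m = jet_face_match[OF jet_ABC(1,3) convex_Int[OF convex_SABC(1,3)] Int_lower1 Int_lower2 sp eq0 eq1 eq2 x]
  show "D1 VA 0 0 0 0 (LA q) (LA h) = D1 VC 0 0 0 0 (LC q) (LC h)" by (rule m(1))
  show "D2 VA (LA q) (LA h) (LA k) = D2 VC (LC q) (LC h) (LC k)" by (rule m(2))
qed

section \<open>The glued jet and its Neumann conditions on the walls\<close>

lemma w_B:
  "q \<in> SB \<Longrightarrow> w0 q = VB 0 0 0 0 (LB q)" "q \<in> SB \<Longrightarrow> w1 q h = D1 VB 0 0 0 0 (LB q) (LB h)"
  "q \<in> SB \<Longrightarrow> w2 q h k = D2 VB (LB q) (LB h) (LB k)"
  by (simp_all add: w0_def w1_def w2_def)

lemma w_A: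
  "q \<in> SA \<Longrightarrow> w0 q = VA 0 0 0 0 (LA q)" "q \<in> SA \<Longrightarrow> w1 q h = D1 VA 0 0 0 0 (LA q) (LA h)"
  "q \<in> SA \<Longrightarrow> w2 q h k = D2 VA (LA q) (LA h) (LA k)"
  using match_AB[of q] by (simp_all add: w0_def w1_def w2_def)

lemma w_C:
  assumes "q \<in> SC"
  shows "w0 q = VC 0 0 0 0 (LC q)" "w1 q h = D1 VC 0 0 0 0 (LC q) (LC h)"
    "w2 q h k = D2 VC (LC q) (LC h) (LC k)"
proof -
  have "q \<in> SB \<Longrightarrow> q \<in> SA" using assms by (auto simp: SA_def SB_def SC_def)
  then show "w0 q = VC 0 0 0 0 (LC q)" "w1 q h = D1 VC 0 0 0 0 (LC q) (LC h)"
    "w2 q h k = D2 VC (LC q) (LC h) (LC k)"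
    using assms w_A[of q] match_AC[of q] by (auto simp: w0_def w1_def w2_def)
qed

lemma jet_w: "jet orthant w0 w1 w2"
proof -
  have "jet (\<Union>S\<in>{SA, SB, SC}. S) w0 w1 w2"
  proof (rule jet_closed_Union)
    show "jet S w0 w1 w2" if "S \<in> {SA, SB, SC}" for S
      using that jet_cong[OF jet_ABC(1) w_A] jet_cong[OF jet_ABC(2) w_B] jet_cong[OF jet_ABC(3) w_C] by auto
  qed (use closed_SABC in auto)
  then show ?thesis by (simp add: orthant_eq Un_assoc)
qed

text \<open>The vector is the gap vector of the second minus the first unit vector of R^5, normal to
  the wall x_1 = x_2. In C the wall is a = w and symmetry suffices; B needs
  \<open>neumann_B\<close>. A point of A on this wall has q_2 = q_4 and lies in B.\<close>

lemma wall1: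
  assumes q: "q \<in> orthant" "q $ 1 = 0"
  shows "w1 q (vec4 2 (- 1) 0 0) = 0"
proof -
  consider "q \<in> SB" | "q \<in> SC" using q by (auto simp: orthant_eq SA_def SB_def SC_def)
  then show ?thesis
  proof cases
    case 1
    have h: "LB (vec4 2 (- 1) 0 0) = sqrt 2 *\<^sub>R (- 1/2, - 1/2, - 1/2, 2)" by (simp add: LB_def)
    have "LB q = (fst (LB q), fst (snd (LB q)), fst (snd (snd (LB q))), 0)"
      by (simp add: LB_def q(2))
    then obtain a b t where e: "LB q = (a, b, t, 0)" by blast
    have "D1 VB 0 0 0 0 (LB q) (- 1/2, - 1/2, - 1/2, 2) = 0"
    proof (cases "0 < t")
      case True
      then show ?thesis unfolding e by (rule neumann_B)
    next
      case False
      then have "LB q = (0, 0, 0, 0)" using LABC_Dom(2) 1 e by (force simp: A.Dom_def)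
      moreover have "D1 VB 0 0 0 0 (0, 0, 0, 0) (- 1/2, - 1/2, - 1/2, 2) = (\<lambda>_. 0) (0, 0, 0, 0)"
        by (rule eq_along_ray[OF ctower_D1[OF ctower_VABC(2)] continuous_on_const])
          (use ray_Dom neumann_B in auto)
      ultimately show ?thesis by simp
    qed
    then show ?thesis using 1 by (simp only: w_B h linear_scale[OF linear_D1] scaleR_zero_right)
  next
    case 2
    have h: "LC (vec4 2 (- 1) 0 0) = (sqrt 2, 0, 0, - sqrt 2)" by (simp add: LC_def)
    have "LC q = (fst (LC q), fst (snd (LC q)), fst (snd (snd (LC q))), fst (LC q))"
      by (simp add: LC_def q(2))
    then obtain a b t where e: "LC q = (a, b, t, a)" by blast
    have "VE4 (Suc 0) 0 0 0 (a, b, t, a) = VE4 0 0 0 (Suc 0) (a, b, t, a)"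
      by (simp add: VE4_def algebra_simps)
    then show ?thesis
      using 2 II_swap_aw[of "Suc 0" 0 0 0 a b t] by (simp add: w_C h e D1_def VC_def VK_def)
  qed
qed

text \<open>On this wall a = b in both regions, and the direction exchanges a against b; points of B
  on the wall lie in A.\<close>

lemma wall2:
  assumes q: "q \<in> orthant" "q $ 2 = 0"
  shows "w1 q (vec4 (- 1) 2 (- 1) 0) = 0"
proof -
  consider "q \<in> SA" | "q \<in> SC" using q by (auto simp: orthant_eq SA_def SB_def SC_def)
  then show ?thesis
  proof cases
    case 1
    have h: "LA (vec4 (- 1) 2 (- 1) 0) = (- sqrt 2, sqrt 2, 0, 0)" by (simp add: LA_def)
    have "LA q = (fst (LA q), fst (LA q), fst (snd (snd (LA q))), snd (snd (snd (LA q))))"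
      by (simp add: LA_def q(2))
    then obtain a t w where e: "LA q = (a, a, t, w)" by blast
    have "VE (Suc 0) 0 0 0 (a, a, t, w) = VE 0 (Suc 0) 0 0 (a, a, t, w)"
      by (simp add: VE_def algebra_simps)
    then show ?thesis
      using 1 II_swap_ab[of expX "Suc 0" 0 0 0 a t w] by (simp add: w_A h e D1_def VA_def VK_def)
  next
    case 2
    have h: "LC (vec4 (- 1) 2 (- 1) 0) = (- sqrt 2, sqrt 2, 0, 0)" by (simp add: LC_def)
    have "LC q = (fst (LC q), fst (LC q), fst (snd (snd (LC q))), snd (snd (snd (LC q))))"
      by (simp add: LC_def q(2))
    then obtain a t w where e: "LC q = (a, a, t, w)" by blast
    have "VE4 (Suc 0) 0 0 0 (a, a, t, w) = VE4 0 (Suc 0) 0 0 (a, a, t, w)"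
      by (simp add: VE4_def algebra_simps)
    then show ?thesis
      using 2 II_swap_ab[of ekX "Suc 0" 0 0 0 a t w] by (simp add: w_C h e D1_def VC_def VK_def)
  qed
qed

lemma VE_swap_bt: "VE 0 (Suc 0) 0 0 (a, t, t, w) = VE 0 0 (Suc 0) 0 (a, t, t, w)"
  by (simp add: VE_def sk_def sh_simps be_simps la_simps cosh_add algebra_simps)

text \<open>Here b = t, and the direction exchanges b against t. Unlike the kernel, the elementary
  parts are not symmetric in b and t, but their first derivatives agree where b = t.\<close>

lemma wall3:
  assumes q: "q \<in> orthant" "q $ 3 = 0"
  shows "w1 q (vec4 0 (- 1) 2 (- 1)) = 0"
proof -
  consider "q \<in> SA" | "q \<in> SB" | "q \<in> SC" using q by (auto simp: orthant_eq)
  then show ?thesis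
  proof cases
    case 1
    have h: "LA (vec4 0 (- 1) 2 (- 1)) = (0, - sqrt 2, sqrt 2, 0)" by (simp add: LA_def)
    have "LA q = (fst (LA q), fst (snd (LA q)), fst (snd (LA q)), snd (snd (snd (LA q))))"
      by (simp add: LA_def q(2))
    then obtain a t w where e: "LA q = (a, t, t, w)" by blast
    show ?thesis
      using 1 II_swap_bt[of expX 0 "Suc 0" 0 0 a t w] VE_swap_bt[of a t w] by (simp add: w_A h e D1_def VA_def VK_def)
  next
    case 2
    have h: "LB (vec4 0 (- 1) 2 (- 1)) = (0, - sqrt 2, sqrt 2, 0)" by (simp add: LB_def)
    have "LB q = (fst (LB q), fst (snd (LB q)), fst (snd (LB q)), snd (snd (snd (LB q))))"
      by (simp add: LB_def q(2))
    then obtain a t w where e: "LB q = (a, t, t, w)" by blast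
    show ?thesis
      using 2 II_swap_bt[of expX 0 "Suc 0" 0 0 a t w] VE_swap_bt[of "- a" t w] by (simp add: w_B h e D1_def VB_def VEB_def VK_def)
  next
    case 3
    have h: "LC (vec4 0 (- 1) 2 (- 1)) = (0, - sqrt 2, sqrt 2, 0)" by (simp add: LC_def)
    have "LC q = (fst (LC q), fst (snd (LC q)), fst (snd (LC q)), snd (snd (snd (LC q))))"
      by (simp add: LC_def q(2))
    then obtain a t w where e: "LC q = (a, t, t, w)" by blast
    have D: "(a, t, t, w) \<in> C.Dom" using LABC_Dom(3) 3 e by force
    \<comment> \<open>At t = 0 the quotient cosh t / sinh t is 0 by convention; a = 0 makes the
      terms concerned vanish on both sides.\<close>
    have "t = 0 \<Longrightarrow> a = 0" using D by (auto simp: C.Dom_def)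
    then have "VE4 0 (Suc 0) 0 0 (a, t, t, w) = VE4 0 0 (Suc 0) 0 (a, t, t, w)"
      by (simp add: VE4_def sk_def sh_simps be_simps la_simps cosh_add sinh_add algebra_simps)
    then show ?thesis
      using 3 II_swap_bt[of ekX 0 "Suc 0" 0 0 a t w] by (simp add: w_C h e D1_def VC_def VK_def)
  qed
qed

text \<open>The value is -1 and not 0 because the chamber function adds x_5, whose derivative in
  this direction is 1. It comes from the term sinh(b - a) of the reflected elementary part; the
  other terms cancel by symmetry.\<close>

lemma wall4:
  assumes q: "q \<in> orthant" "q $ 4 = 0"
  shows "w1 q (vec4 0 0 (- 1) 2) = - 1"
proof -
  have 1: "q \<in> SB" using q by (auto simp: orthant_eq SA_def SB_def SC_def)
  have h: "LB (vec4 0 0 (- 1) 2) = (- sqrt 2, sqrt 2, 0, 0)" by (simp add: LB_def)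
  have "LB q = (fst (LB q), fst (LB q), fst (snd (snd (LB q))), snd (snd (snd (LB q))))"
      by (simp add: LB_def q(2))
    then obtain a t w where e: "LB q = (a, a, t, w)" by blast
  have s: "sqrt 2 * kap = 1 / 2" "kap * (2 * sqrt 2) = 1" by (simp_all add: kap_def)
  have "sqrt 2 * (VE 0 (Suc 0) 0 0 (- a, a, t, w) + VE (Suc 0) 0 0 0 (- a, a, t, w)) = (sqrt 2 * kap) * (- 2)"
    by (simp add: VE_def sk_def sh_simps algebra_simps)
  then show ?thesis
    using 1 II_swap_ab[of expX "Suc 0" 0 0 0 a t w] by (simp add: w_B h e D1_def VB_def VEB_def VK_def s algebra_simps)
qed

subsection \<open>The operators K and T\<close>

text \<open>The integral over the half-line is the limit of those over [a, a + k], by domination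
  with the exponential.\<close>

lemma improper_FTC:
  fixes f G :: "real \<Rightarrow> real"
  assumes f: "continuous_on {a..} f" and G: "\<And>x. a \<le> x \<Longrightarrow> (G has_real_derivative f x) (at x)"
    and lim: "(G \<longlongrightarrow> l) at_top" and b: "\<And>x. a \<le> x \<Longrightarrow> \<bar>f x\<bar> \<le> B * exp (- x)"
  shows "integral {a..} f = l - G a"
proof -
  define fk where "fk k x = (if x \<in> {a..a + real k} then f x else 0)" for k x
  have i: "(f has_integral (G (a + real k) - G a)) {a..a + real k}" for k
    using G by (intro fundamental_theorem_of_calculus)
      (auto simp: has_real_derivative_iff_has_vector_derivative intro: has_vector_derivative_at_within)
  have ik: "(fk k has_integral (G (a + real k) - G a)) {a..}" for k
    unfolding fk_def using i[of k] has_integral_restrict[of "{a..a + real k}" "{a..}" f] by auto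
  have "(\<lambda>x. B * exp (- 1 * x)) integrable_on {a..}"
    using integrable_on_exp_minus_to_infinity[of 1 a] by (intro integrable_on_mult_right) auto
  then have h: "(\<lambda>x. \<bar>B\<bar> * exp (- x)) integrable_on {a..}"
    using integrable_on_mult_right[of "\<lambda>x. exp (- 1 * x)" "{a..}" "\<bar>B\<bar>"] integrable_on_exp_minus_to_infinity[of 1 a] by simp
  have dc: "(\<lambda>k. integral {a..} (fk k)) \<longlonglongrightarrow> integral {a..} f"
  proof (rule dominated_convergence(2)[OF _ h])
    show "fk k integrable_on {a..}" for k using ik by blast
    fix k x assume "x \<in> {a..}"
    then have "\<bar>f x\<bar> \<le> \<bar>B\<bar> * exp (- x)"
      by (intro order_trans[OF b mult_right_mono[OF abs_ge_self]]) simp_all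
    then show "norm (fk k x) \<le> \<bar>B\<bar> * exp (- x)" by (simp add: fk_def)
  next
    fix x assume x: "x \<in> {a..}"
    obtain N where "x - a \<le> real N" using real_arch_simple by blast
    then have "\<forall>\<^sub>F k in sequentially. fk k x = f x"
      using x unfolding eventually_sequentially fk_def by (intro exI[of _ N]) auto
    then show "(\<lambda>k. fk k x) \<longlonglongrightarrow> f x" by (rule tendsto_eventually)
  qed
  have "filterlim (\<lambda>k. a + real k) at_top sequentially"
    by (intro filterlim_tendsto_add_at_top[OF tendsto_const] filterlim_real_sequentially)
  then have "(\<lambda>k. G (a + real k) - G a) \<longlonglongrightarrow> l - G a"
    by (intro tendsto_diff filterlim_compose[OF lim] tendsto_const)
  moreover have "integral {a..} (fk k) = G (a + real k) - G a" for k using ik by (rule integral_unique)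
  ultimately show ?thesis using dc LIMSEQ_unique by simp
qed

lemma bounded_atLeast:
  fixes f :: "real \<Rightarrow> real"
  assumes f: "continuous_on {a..} f" and m: "(f \<longlongrightarrow> m) at_top"
  obtains B where "0 < B" "\<And>x. a \<le> x \<Longrightarrow> \<bar>f x\<bar> \<le> B"
proof -
  define f' where "f' x = f (max a x)" for x
  have "continuous_on UNIV f'" unfolding f'_def by (intro continuous_on_compose2[OF f]) (auto intro!: continuous_intros)
  then have "continuous_on {a - 1<..} f'" "(f' \<longlongrightarrow> f' (a - 1)) (at_right (a - 1))"
    by (auto intro: continuous_on_subset simp: continuous_on_def intro: tendsto_within_subset)
  moreover have "(f' \<longlongrightarrow> m) at_top"
  proof (rule Lim_transform_eventually[OF m])
    show "\<forall>\<^sub>F x in at_top. f x = f' x" using eventually_ge_at_top[of a] by eventually_elim (simp add: f'_def)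
  qed
  ultimately obtain B where B: "0 < B" "\<And>x. a - 1 < x \<Longrightarrow> \<bar>f' x\<bar> \<le> B" by (rule bounded_of_limits) auto
  show thesis
  proof (rule that[OF B(1)])
    fix x assume "a \<le> x"
    then show "\<bar>f x\<bar> \<le> B" using B(2)[of x] by (simp add: f'_def max_def)
  qed
qed

lemma sinh_cosh_decay:
  fixes a :: real
  assumes "0 < a"
  obtains B :: real where "0 < B" "\<And>x. a \<le> x \<Longrightarrow> cosh x ^ 2 / sinh x ^ 3 \<le> B * exp (- x)"
    "\<And>x. a \<le> x \<Longrightarrow> cosh x ^ 3 / sinh x ^ 4 \<le> B * exp (- x)"
proof -
  have "((\<lambda>x::real. ((exp x + exp (- x)) / 2) ^ 2 / ((exp x - exp (- x)) / 2) ^ 3 * exp x) \<longlongrightarrow> 2) at_top"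
    by real_asymp (simp add: eval_nat_numeral)
  moreover have "((\<lambda>x::real. ((exp x + exp (- x)) / 2) ^ 3 / ((exp x - exp (- x)) / 2) ^ 4 * exp x) \<longlongrightarrow> 2) at_top"
    by real_asymp (simp add: eval_nat_numeral)
  ultimately have l: "((\<lambda>x::real. cosh x ^ 2 / sinh x ^ 3 * exp x) \<longlongrightarrow> 2) at_top" "((\<lambda>x::real. cosh x ^ 3 / sinh x ^ 4 * exp x) \<longlongrightarrow> 2) at_top"
    unfolding sinh_field_def cosh_field_def .
  obtain B where B: "0 < B" "\<And>x::real. a \<le> x \<Longrightarrow> \<bar>cosh x ^ 2 / sinh x ^ 3 * exp x\<bar> \<le> B"
    by (rule bounded_atLeast[OF _ l(1), of a]) (use assms in \<open>auto intro!: continuous_intros\<close>)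
  obtain B' where B': "0 < B'" "\<And>x::real. a \<le> x \<Longrightarrow> \<bar>cosh x ^ 3 / sinh x ^ 4 * exp x\<bar> \<le> B'"
    by (rule bounded_atLeast[OF _ l(2), of a]) (use assms in \<open>auto intro!: continuous_intros\<close>)
  have e: "y \<le> b * exp (- x)" if "\<bar>y * exp x\<bar> \<le> b" for x y b :: real
  proof -
    have "y * exp x * exp (- x) \<le> b * exp (- x)" using that by (intro mult_right_mono) auto
    then show ?thesis by (simp add: mult.assoc flip: exp_add)
  qed
  show thesis
  proof (rule that[of "B + B'"])
    fix x assume x: "a \<le> x"
    have p: "0 \<le> B * exp (- x)" "0 \<le> B' * exp (- x)" using B(1) B'(1) by auto
    show "cosh x ^ 2 / sinh x ^ 3 \<le> (B + B') * exp (- x)" "cosh x ^ 3 / sinh x ^ 4 \<le> (B + B') * exp (- x)"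
      using e[OF B(2)[OF x]] e[OF B'(2)[OF x]] p by (simp_all add: distrib_right)
  qed (use B B' in auto)
qed

lemma abs_combinations:
  fixes p q c :: real
  shows "\<bar>p\<bar> \<le> c \<Longrightarrow> \<bar>q\<bar> \<le> c \<Longrightarrow> \<bar>- (3 * p - q) / 6\<bar> \<le> c"
    "\<bar>p\<bar> \<le> c \<Longrightarrow> \<bar>q\<bar> \<le> c \<Longrightarrow> \<bar>- (p - q / 3) / 2\<bar> \<le> c"
    "\<bar>p\<bar> \<le> 3 * c \<Longrightarrow> \<bar>q\<bar> \<le> c \<Longrightarrow> \<bar>- (p - q) / 6\<bar> \<le> c"
  by (simp_all add: abs_le_iff)

text \<open>The functions \<open>\<phi>\<close>, \<open>K p \<phi>\<close> and \<open>T (K p \<phi>)\<close> are all combinations of one function \<open>Z\<close>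
  and its first two derivatives, with coefficients that are regular at \<open>y = 0\<close>:
  the integrals \<open>J\<close> and \<open>M\<close> disappear.\<close>

locale zfun =
  fixes Z Z1 Z2 :: "real \<Rightarrow> real"
  assumes dZ: "\<And>t. 0 < t \<Longrightarrow> (Z has_real_derivative Z1 t) (at t)"
    and dZ1: "\<And>t. 0 < t \<Longrightarrow> (Z1 has_real_derivative Z2 t) (at t)"
    and cZ2: "continuous_on {0<..} Z2"
    and bZ: "\<And>a. 0 < a \<Longrightarrow> \<exists>B. \<forall>t\<ge>a. \<bar>Z t\<bar> \<le> B \<and> \<bar>Z1 t\<bar> \<le> B \<and> \<bar>Z2 t\<bar> \<le> B"
begin

text \<open>For Z = e_c^3 the relation e_c'' = e_c gives Z1 / 3 = e_c^2 e_c' and (Z2 - 3 Z) / 6 =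
  e_c e_c'^2, so \<open>W a y t\<close> is the product e_c(t - a) e_c(t - y) e_c(t).\<close>

definition W :: "real \<Rightarrow> real \<Rightarrow> real \<Rightarrow> real" where
  "W a y t = (cosh a * cosh y - sinh a * sinh y / 2) * Z t - sinh (a + y) / 3 * Z1 t + sinh a * sinh y / 6 * Z2 t"

text \<open>This is \<open>W y y t\<close>, written as a polynomial in sinh y and cosh y.\<close>

definition KW :: "real \<Rightarrow> real \<Rightarrow> real" where
  "KW y t = (sinh y ^ 2 * Z2 t - 4 * sinh y * cosh y * Z1 t + (3 * sinh y ^ 2 + 6) * Z t) / 6"

lemma cZ: "continuous_on {0<..} Z" "continuous_on {0<..} Z1"
  using dZ dZ1 by (auto intro!: DERIV_continuous_on intro: has_field_derivative_at_within)

lemma KW_bound: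
  assumes "\<bar>Z t\<bar> \<le> B" "\<bar>Z1 t\<bar> \<le> B" "\<bar>Z2 t\<bar> \<le> B"
  shows "\<bar>KW y t\<bar> \<le> 3 * B * cosh y ^ 2"
proof -
  have B: "0 \<le> B" using assms by linarith
  have s: "\<bar>sinh y\<bar> \<le> cosh y" by (simp add: sinh_le_cosh_real abs_le_iff flip: sinh_minus) (metis cosh_minus sinh_le_cosh_real)
  have s2: "sinh y ^ 2 \<le> cosh y ^ 2" by (simp add: cosh_square_eq)
  have c1: "1 \<le> cosh y ^ 2" by (simp add: cosh_square_eq)
  have sc: "\<bar>sinh y * cosh y\<bar> \<le> cosh y ^ 2"
    using mult_right_mono[OF s, of "cosh y"] by (simp add: abs_mult power2_eq_square)
  have "\<bar>sinh y ^ 2 * Z2 t\<bar> \<le> cosh y ^ 2 * B" "\<bar>sinh y * cosh y * Z1 t\<bar> \<le> cosh y ^ 2 * B"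
    unfolding abs_mult[of _ "Z2 t"] abs_mult[of _ "Z1 t"] using assms s2 sc B by (auto intro!: mult_mono)
  moreover have "\<bar>(3 * sinh y ^ 2 + 6) * Z t\<bar> \<le> (9 * cosh y ^ 2) * B"
    unfolding abs_mult using assms B c1 s2 by (intro mult_mono) (auto simp: cosh_square_eq)
  moreover have "6 * KW y t = sinh y ^ 2 * Z2 t - 4 * (sinh y * cosh y * Z1 t) + (3 * sinh y ^ 2 + 6) * Z t"
    by (simp add: KW_def)
  moreover have "9 * cosh y ^ 2 * B = 9 * (cosh y ^ 2 * B)" "3 * B * cosh y ^ 2 = 3 * (cosh y ^ 2 * B)"
    "0 \<le> cosh y ^ 2 * B" using B by simp_all
  ultimately show ?thesis by linarith
qed

lemma KW_diag: "KW t t = W t t t"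
proof -
  have "sinh (t + t) = 2 * sinh t * cosh t" by (subst sinh_add) simp
  moreover have "cosh t * cosh t = 1 + sinh t * sinh t" by (simp add: cosh_square_eq flip: power2_eq_square)
  ultimately show ?thesis unfolding KW_def W_def by (simp only: power2_eq_square) (simp add: field_simps)
qed

lemma bounded_over_sinh:
  fixes f :: "real \<Rightarrow> real"
  assumes b: "\<And>t. a \<le> t \<Longrightarrow> \<bar>f t\<bar> \<le> B * cosh t" and a: "0 < a"
  shows "((\<lambda>t. f t / sinh t ^ 2) \<longlongrightarrow> 0) at_top"
proof (rule Lim_null_comparison)
  have "((\<lambda>t::real. (B::real) * ((exp t + exp (- t)) / 2) / ((exp t - exp (- t)) / 2) ^ 2) \<longlongrightarrow> 0) at_top" by real_asymp
  then show "((\<lambda>t::real. B * cosh t / sinh t ^ 2) \<longlongrightarrow> 0) at_top" unfolding sinh_field_def cosh_field_def .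
  show "\<forall>\<^sub>F t in at_top. norm (f t / sinh t ^ 2) \<le> B * cosh t / sinh t ^ 2"
    using eventually_ge_at_top[of a] by eventually_elim (use b in \<open>auto simp: abs_divide intro!: divide_right_mono\<close>)
qed

lemma J_eq:
  assumes \<phi>: "\<And>t. 0 < t \<Longrightarrow> \<phi> t = W t t t" and t: "0 < t"
  shows "J \<phi> t = (3 * cosh t * Z t - sinh t * Z1 t) / (6 * sinh t ^ 2)"
proof -
  \<comment> \<open>In the model case Z = e_c^3, where \<phi> = e_c, this is (c - coth t)^2 / 2,
    whose derivative is e_c(t) / sinh(t)^3.\<close>
  define G where "G t = - (3 * cosh t * Z t - sinh t * Z1 t) / 6 / sinh t ^ 2" for t
  obtain B where B: "\<And>r. t \<le> r \<Longrightarrow> \<bar>Z r\<bar> \<le> B \<and> \<bar>Z1 r\<bar> \<le> B \<and> \<bar>Z2 r\<bar> \<le> B" using bZ[OF t] by blast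
  have B0: "0 \<le> B" using B[of t] by linarith
  obtain D where D: "0 < D" "\<And>x. t \<le> x \<Longrightarrow> cosh x ^ 2 / sinh x ^ 3 \<le> D * exp (- x)" using sinh_cosh_decay[OF t] by metis
  have \<phi>': "\<phi> r = KW r r" if "t \<le> r" for r using \<phi>[of r] that t KW_diag by simp
  have "integral {t..} (\<lambda>r. KW r r / sinh r ^ 3) = 0 - G t"
  proof (rule improper_FTC[where B="3 * B * D"])
    show "continuous_on {t..} (\<lambda>r. KW r r / sinh r ^ 3)"
      unfolding KW_def using t
      by (intro continuous_intros continuous_on_subset[OF cZ(1)] continuous_on_subset[OF cZ(2)] continuous_on_subset[OF cZ2]) auto
    show "(G has_real_derivative KW r r / sinh r ^ 3) (at r)" if r: "t \<le> r" for r
    proof -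
      have r0: "0 < r" using r t by simp
      then have s: "sinh r \<noteq> 0" by simp
      have c: "cosh r * cosh r = 1 + sinh r * sinh r" by (simp add: cosh_square_eq flip: power2_eq_square)
      have "(G has_real_derivative (- (3 * (sinh r * Z r + cosh r * Z1 r) - (cosh r * Z1 r + sinh r * Z2 r)) / 6 * sinh r ^ 2
           - - (3 * cosh r * Z r - sinh r * Z1 r) / 6 * (2 * sinh r * cosh r)) / (sinh r ^ 2 * sinh r ^ 2)) (at r)"
        unfolding G_def[abs_def] using s r0
        by (intro DERIV_divide) (auto intro!: derivative_eq_intros dZ dZ1 simp: field_simps)
      moreover have "(- (3 * (sinh r * Z r + cosh r * Z1 r) - (cosh r * Z1 r + sinh r * Z2 r)) / 6 * sinh r ^ 2
           - - (3 * cosh r * Z r - sinh r * Z1 r) / 6 * (2 * sinh r * cosh r)) / (sinh r ^ 2 * sinh r ^ 2) = KW r r / sinh r ^ 3"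
        using s unfolding KW_def by (simp add: divide_simps power2_eq_square power3_eq_cube) (use c in algebra)
      ultimately show ?thesis by simp
    qed
    have "((\<lambda>r. (- (3 * cosh r * Z r - sinh r * Z1 r) / 6) / sinh r ^ 2) \<longlongrightarrow> 0) at_top"
    proof (rule bounded_over_sinh[OF _ t])
      fix r assume r: "t \<le> r"
      have "\<bar>cosh r * Z r\<bar> \<le> cosh r * B" "\<bar>sinh r * Z1 r\<bar> \<le> cosh r * B"
        unfolding abs_mult using B[OF r] B0 r t sinh_le_cosh_real[of r] by (auto intro!: mult_mono)
      from abs_combinations(1)[OF this] show "\<bar>- (3 * cosh r * Z r - sinh r * Z1 r) / 6\<bar> \<le> B * cosh r"
        by (simp add: mult_ac)
    qed
    then show "(G \<longlongrightarrow> 0) at_top" by (simp add: G_def[abs_def])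
    show "\<bar>KW r r / sinh r ^ 3\<bar> \<le> 3 * B * D * exp (- r)" if r: "t \<le> r" for r
    proof -
      have "\<bar>KW r r / sinh r ^ 3\<bar> \<le> 3 * B * cosh r ^ 2 / sinh r ^ 3"
        using KW_bound[of r B r] B[OF r] r t by (auto simp: abs_divide intro!: divide_right_mono)
      also have "\<dots> = 3 * B * (cosh r ^ 2 / sinh r ^ 3)" by simp
      also have "\<dots> \<le> 3 * B * (D * exp (- r))" using D(2)[OF r] B0 by (intro mult_left_mono) auto
      finally show ?thesis by (simp add: mult.assoc)
    qed
  qed
  moreover have "J \<phi> t = integral {t..} (\<lambda>r. KW r r / sinh r ^ 3)"
    unfolding J_def by (rule integral_cong) (simp add: \<phi>')
  moreover have "0 - G t = (3 * cosh t * Z t - sinh t * Z1 t) / (6 * sinh t ^ 2)"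
    using t unfolding G_def by (simp add: field_simps)
  ultimately show ?thesis by simp
qed

lemma M_eq:
  assumes \<phi>: "\<And>t. 0 < t \<Longrightarrow> \<phi> t = W t t t" and t: "0 < t"
  shows "M \<phi> t = ((3 * cosh t ^ 2 - 1) * Z t - sinh t * cosh t * Z1 t) / (6 * sinh t ^ 3)"
proof -
  \<comment> \<open>In the model case Z = e_c^3, with u = c - coth t, this is c u^2 / 2 - u^3 /
    3.\<close>
  define G where "G t = - ((3 * cosh t ^ 2 - 1) * Z t - sinh t * cosh t * Z1 t) / 6 / sinh t ^ 3" for t
  obtain B where B: "\<And>r. t \<le> r \<Longrightarrow> \<bar>Z r\<bar> \<le> B \<and> \<bar>Z1 r\<bar> \<le> B \<and> \<bar>Z2 r\<bar> \<le> B" using bZ[OF t] by blast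
  have B0: "0 \<le> B" using B[of t] by linarith
  obtain D where D: "0 < D" "\<And>x. t \<le> x \<Longrightarrow> cosh x ^ 3 / sinh x ^ 4 \<le> D * exp (- x)"
    "\<And>x. t \<le> x \<Longrightarrow> cosh x ^ 2 / sinh x ^ 3 \<le> D * exp (- x)" using sinh_cosh_decay[OF t] by metis
  have \<phi>': "\<phi> r = KW r r" if "t \<le> r" for r using \<phi>[of r] that t KW_diag by simp
  have "integral {t..} (\<lambda>r. cosh r * KW r r / sinh r ^ 4) = 0 - G t"
  proof (rule improper_FTC[where B="3 * B * D"])
    show "continuous_on {t..} (\<lambda>r. cosh r * KW r r / sinh r ^ 4)"
      unfolding KW_def using t
      by (intro continuous_intros continuous_on_subset[OF cZ(1)] continuous_on_subset[OF cZ(2)] continuous_on_subset[OF cZ2]) auto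
    show "(G has_real_derivative cosh r * KW r r / sinh r ^ 4) (at r)" if r: "t \<le> r" for r
    proof -
      have r0: "0 < r" using r t by simp
      then have s: "sinh r \<noteq> 0" by simp
      have c: "cosh r * cosh r = 1 + sinh r * sinh r" by (simp add: cosh_square_eq flip: power2_eq_square)
      have "(G has_real_derivative (- ((6 * cosh r * sinh r) * Z r + (3 * cosh r ^ 2 - 1) * Z1 r - ((cosh r ^ 2 + sinh r ^ 2) * Z1 r + sinh r * cosh r * Z2 r)) / 6 * sinh r ^ 3
           - - ((3 * cosh r ^ 2 - 1) * Z r - sinh r * cosh r * Z1 r) / 6 * (3 * sinh r ^ 2 * cosh r)) / (sinh r ^ 3 * sinh r ^ 3)) (at r)"
        unfolding G_def[abs_def] using s r0
        by (intro DERIV_divide) (auto intro!: derivative_eq_intros dZ dZ1 simp: field_simps power2_eq_square)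
      moreover have "(- ((6 * cosh r * sinh r) * Z r + (3 * cosh r ^ 2 - 1) * Z1 r - ((cosh r ^ 2 + sinh r ^ 2) * Z1 r + sinh r * cosh r * Z2 r)) / 6 * sinh r ^ 3
           - - ((3 * cosh r ^ 2 - 1) * Z r - sinh r * cosh r * Z1 r) / 6 * (3 * sinh r ^ 2 * cosh r)) / (sinh r ^ 3 * sinh r ^ 3) = cosh r * KW r r / sinh r ^ 4"
        using s unfolding KW_def by (simp add: divide_simps power2_eq_square power3_eq_cube power4_eq_xxxx) (use c in algebra)
      ultimately show ?thesis by simp
    qed
    have "((\<lambda>r. (3 * B * D) * exp (- r)) \<longlongrightarrow> 0) at_top" by real_asymp
    then show "(G \<longlongrightarrow> 0) at_top"
    proof (rule Lim_null_comparison[rotated])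
      show "\<forall>\<^sub>F r in at_top. norm (G r) \<le> (3 * B * D) * exp (- r)"
        using eventually_ge_at_top[of t]
      proof eventually_elim
        fix r assume r: "t \<le> r"
        have s: "0 < sinh r" "sinh r \<le> cosh r" using r t sinh_le_cosh_real[of r] by auto
        have "\<bar>(3 * cosh r ^ 2 - 1) * Z r\<bar> \<le> (3 * cosh r ^ 2) * B"
          unfolding abs_mult using B[OF r] B0 by (intro mult_mono) (auto simp: cosh_square_eq)
        moreover have "\<bar>sinh r * cosh r * Z1 r\<bar> \<le> (cosh r ^ 2) * B"
          unfolding abs_mult[of _ "Z1 r"] using B[OF r] B0 s
          by (intro mult_mono) (auto simp: power2_eq_square abs_mult intro: mult_right_mono)
        ultimately have "\<bar>- ((3 * cosh r ^ 2 - 1) * Z r - sinh r * cosh r * Z1 r) / 6\<bar> \<le> B * cosh r ^ 2"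
          using abs_combinations(3)[of "(3 * cosh r ^ 2 - 1) * Z r" "cosh r ^ 2 * B" "sinh r * cosh r * Z1 r"]
          by (simp only: mult.assoc mult.commute[of B])
        then have "norm (G r) \<le> B * cosh r ^ 2 / sinh r ^ 3"
          unfolding G_def real_norm_def abs_divide[of _ "sinh r ^ 3"] using s by (intro frac_le) (auto simp: abs_mult)
        also have "\<dots> = B * (cosh r ^ 2 / sinh r ^ 3)" by simp
        also have "\<dots> \<le> B * (D * exp (- r))" using D(3)[OF r] B0 by (intro mult_left_mono) auto
        also have "\<dots> \<le> (3 * B * D) * exp (- r)" using B0 D(1) by (simp add: mult.assoc)
        finally show "norm (G r) \<le> (3 * B * D) * exp (- r)" .
      qed
    qed
    show "\<bar>cosh r * KW r r / sinh r ^ 4\<bar> \<le> 3 * B * D * exp (- r)" if r: "t \<le> r" for r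
    proof -
      have "\<bar>cosh r * KW r r / sinh r ^ 4\<bar> \<le> cosh r * (3 * B * cosh r ^ 2) / sinh r ^ 4"
        using KW_bound[of r B r] B[OF r] r t by (auto simp: abs_divide abs_mult intro!: divide_right_mono)
      also have "\<dots> = 3 * B * (cosh r ^ 3 / sinh r ^ 4)" by (simp add: power2_eq_square power3_eq_cube)
      also have "\<dots> \<le> 3 * B * (D * exp (- r))" using D(2)[OF r] B0 by (intro mult_left_mono) auto
      finally show ?thesis by (simp add: mult.assoc)
    qed
  qed
  moreover have "M \<phi> t = integral {t..} (\<lambda>r. cosh r * KW r r / sinh r ^ 4)"
    unfolding M_def by (rule integral_cong) (simp add: \<phi>')
  moreover have "0 - G t = ((3 * cosh t ^ 2 - 1) * Z t - sinh t * cosh t * Z1 t) / (6 * sinh t ^ 3)"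
    using t unfolding G_def by (simp add: field_simps)
  ultimately show ?thesis by simp
qed

text \<open>With d = t - y expanded by the addition theorem and \<open>J\<close>, \<open>M\<close>
  replaced by their closed forms, the powers of sinh t in the denominators cancel.\<close>

lemma K_eq:
  assumes \<phi>: "\<And>t. 0 < t \<Longrightarrow> \<phi> t = W t t t" and y: "0 < y" and p: "0 \<le> p"
  shows "K p \<phi> y = KW y (y + p / 2)"
proof -
  define t where "t = y + p / 2"
  have t: "0 < t" using y p by (simp add: t_def)
  then have s: "sinh t \<noteq> 0" by simp
  have d: "sinh (p / 2) = sinh t * cosh y - cosh t * sinh y"
    using sinh_diff[of t y] by (simp add: t_def)
  have c: "cosh t * cosh t = 1 + sinh t * sinh t" "cosh y * cosh y = 1 + sinh y * sinh y"
    by (simp_all add: cosh_square_eq flip: power2_eq_square)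
  have JM: "J \<phi> t = (3 * cosh t * Z t - sinh t * Z1 t) / (6 * sinh t ^ 2)"
    "M \<phi> t = ((3 * cosh t ^ 2 - 1) * Z t - sinh t * cosh t * Z1 t) / (6 * sinh t ^ 3)"
    by (rule J_eq[OF \<phi> t] M_eq[OF \<phi> t]; assumption)+
  show ?thesis
    unfolding K_def Let_def t_def[symmetric] JM \<phi>[OF t] KW_diag[symmetric] d
    unfolding KW_def
    using s by (simp add: divide_simps power2_eq_square power3_eq_cube) (use c in algebra)
qed

text \<open>The right-hand side is \<open>W 0 y t\<close> at t = y + p/2, the counterpart of
  \<open>K p \<phi> y\<close>, which is \<open>W y y t\<close>.\<close>

lemma TK_eq:
  assumes \<phi>: "\<And>t. 0 < t \<Longrightarrow> \<phi> t = W t t t" and y: "0 < y" and p: "0 \<le> p"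
  shows "T (K p \<phi>) y = cosh y * Z (y + p / 2) - sinh y / 3 * Z1 (y + p / 2)"
proof -
  define d where "d = p / 2"
  have d: "0 \<le> d" using p by (simp add: d_def)
  define G where "G y = - (cosh y * Z (y + d) - sinh y / 3 * Z1 (y + d)) / 2 / sinh y ^ 2" for y
  obtain B where B': "\<And>r. y \<le> r \<Longrightarrow> \<bar>Z r\<bar> \<le> B \<and> \<bar>Z1 r\<bar> \<le> B \<and> \<bar>Z2 r\<bar> \<le> B" using bZ[OF y] by blast
  have B: "\<bar>Z (r + d)\<bar> \<le> B \<and> \<bar>Z1 (r + d)\<bar> \<le> B \<and> \<bar>Z2 (r + d)\<bar> \<le> B" if "y \<le> r" for r using B'[of "r + d"] that d by simp
  have B0: "0 \<le> B" using B[of y] by linarith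
  obtain D where D: "0 < D" "\<And>x. y \<le> x \<Longrightarrow> cosh x ^ 2 / sinh x ^ 3 \<le> D * exp (- x)" using sinh_cosh_decay[OF y] by metis
  have "integral {y..} (\<lambda>r. KW r (r + d) / sinh r ^ 3) = 0 - G y"
  proof (rule improper_FTC[where B="3 * B * D"])
    have cc: "continuous_on {y..} (\<lambda>r. Z (r + d))" "continuous_on {y..} (\<lambda>r. Z1 (r + d))" "continuous_on {y..} (\<lambda>r. Z2 (r + d))"
      using y d by (auto intro!: continuous_on_compose2[OF cZ(1)] continuous_on_compose2[OF cZ(2)] continuous_on_compose2[OF cZ2] continuous_intros)
    show "continuous_on {y..} (\<lambda>r. KW r (r + d) / sinh r ^ 3)"
      unfolding KW_def using y by (intro continuous_intros cc) auto
    show "(G has_real_derivative KW r (r + d) / sinh r ^ 3) (at r)" if r: "y \<le> r" for r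
    proof -
      have r0: "0 < r" "0 < r + d" using r y d by simp_all
      then have s: "sinh r \<noteq> 0" by simp
      have c: "cosh r * cosh r = 1 + sinh r * sinh r" by (simp add: cosh_square_eq flip: power2_eq_square)
      have dd: "((\<lambda>r. Z (r + d)) has_real_derivative Z1 (r + d)) (at r)" "((\<lambda>r. Z1 (r + d)) has_real_derivative Z2 (r + d)) (at r)"
        using DERIV_shift[of Z "Z1 (r + d)" r d] DERIV_shift[of Z1 "Z2 (r + d)" r d] dZ[OF r0(2)] dZ1[OF r0(2)] by simp_all
      have "(G has_real_derivative (- ((sinh r * Z (r + d) + cosh r * Z1 (r + d)) - (cosh r * Z1 (r + d) + sinh r * Z2 (r + d)) / 3) / 2 * sinh r ^ 2
           - - (cosh r * Z (r + d) - sinh r / 3 * Z1 (r + d)) / 2 * (2 * sinh r * cosh r)) / (sinh r ^ 2 * sinh r ^ 2)) (at r)"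
        unfolding G_def[abs_def] using s
        by (intro DERIV_divide) (auto intro!: derivative_eq_intros dd simp: field_simps)
      moreover have "(- ((sinh r * Z (r + d) + cosh r * Z1 (r + d)) - (cosh r * Z1 (r + d) + sinh r * Z2 (r + d)) / 3) / 2 * sinh r ^ 2
           - - (cosh r * Z (r + d) - sinh r / 3 * Z1 (r + d)) / 2 * (2 * sinh r * cosh r)) / (sinh r ^ 2 * sinh r ^ 2) = KW r (r + d) / sinh r ^ 3"
        using s unfolding KW_def by (simp add: divide_simps power2_eq_square power3_eq_cube) (use c in algebra)
      ultimately show ?thesis by simp
    qed
    have "((\<lambda>r. (- (cosh r * Z (r + d) - sinh r / 3 * Z1 (r + d)) / 2) / sinh r ^ 2) \<longlongrightarrow> 0) at_top"
    proof (rule bounded_over_sinh[OF _ y])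
      fix r assume r: "y \<le> r"
      have "\<bar>cosh r * Z (r + d)\<bar> \<le> cosh r * B" "\<bar>sinh r * Z1 (r + d)\<bar> \<le> cosh r * B"
        unfolding abs_mult using B[OF r] B0 r y sinh_le_cosh_real[of r] by (auto intro!: mult_mono)
      from abs_combinations(2)[OF this] show "\<bar>- (cosh r * Z (r + d) - sinh r / 3 * Z1 (r + d)) / 2\<bar> \<le> B * cosh r"
        by (simp add: mult_ac)
    qed
    then show "(G \<longlongrightarrow> 0) at_top" by (simp add: G_def[abs_def])
    show "\<bar>KW r (r + d) / sinh r ^ 3\<bar> \<le> 3 * B * D * exp (- r)" if r: "y \<le> r" for r
    proof -
      have "\<bar>KW r (r + d) / sinh r ^ 3\<bar> \<le> 3 * B * cosh r ^ 2 / sinh r ^ 3"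
        using KW_bound[of "r + d" B r] B[OF r] r y by (auto simp: abs_divide intro!: divide_right_mono)
      also have "\<dots> = 3 * B * (cosh r ^ 2 / sinh r ^ 3)" by simp
      also have "\<dots> \<le> 3 * B * (D * exp (- r))" using D(2)[OF r] B0 by (intro mult_left_mono) auto
      finally show ?thesis by (simp add: mult.assoc)
    qed
  qed
  moreover have "integral {y..} (\<lambda>r. K p \<phi> r / sinh r ^ 3) = integral {y..} (\<lambda>r. KW r (r + d) / sinh r ^ 3)"
    by (rule integral_cong) (use y in \<open>simp add: d_def K_eq[OF \<phi> _ p]\<close>)
  ultimately show ?thesis using y by (simp add: T_def G_def d_def)
qed

text \<open>As a function of a, \<open>W a y t\<close> is a combination of cosh a and sinh a, hence
  determined by its values at a = y and a = 0. Those are the outputs of \<open>K\<close> and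
  \<open>T\<close>, and the left-hand side is the hyperbolic interpolation between them.\<close>

lemma KT_combination:
  assumes \<phi>: "\<And>t. 0 < t \<Longrightarrow> \<phi> t = W t t t" and y: "0 < y" and p: "0 \<le> p" and ab: "y = a + b"
  shows "K p \<phi> y * (sinh a / sinh y) + T (K p \<phi>) y * (sinh b / sinh y) = W a y (y + p / 2)"
proof -
  have s: "sinh y \<noteq> 0" using y by simp
  have b: "sinh b = sinh y * cosh a - cosh y * sinh a"
    using sinh_diff[of y a] ab by simp
  have c: "cosh y * cosh y = 1 + sinh y * sinh y"
    by (simp add: cosh_square_eq flip: power2_eq_square)
  have KT: "K p \<phi> y = KW y (y + p / 2)"
    "T (K p \<phi>) y = cosh y * Z (y + p / 2) - sinh y / 3 * Z1 (y + p / 2)"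
    by (rule K_eq[OF \<phi> y p] TK_eq[OF \<phi> y p]; assumption)+
  show ?thesis
    unfolding KT KW_def W_def b sinh_add
    using s by (simp add: divide_simps power2_eq_square) (use c in algebra)
qed

end

subsection \<open>Restriction to the diagonal\<close>

text \<open>On the diagonal \<open>a = b = t\<close> the elementary parts of \<open>VA\<close>, of the \<open>w\<close>-derivative of \<open>VC\<close> and of
  their diagonal derivatives are \<open>kap\<close> times \<open>EZ, EZ1, EZ2\<close> and \<open>EY, EY1, EY2\<close>. With \<open>EB\<close> the same procedure
  produces \<open>b0\<close>, and \<open>EQ\<close> is the elementary part of \<open>VC\<close> at \<open>a = b = t = w\<close>.\<close>

definition EZ :: "real \<Rightarrow> real" where
  "EZ t = 2 * cosh t ^ 3 * at_exp t - 2 * cosh t * sinh t - sinh t ^ 3 * lt t"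

definition EZ1 :: "real \<Rightarrow> real" where
  "EZ1 t = 6 * cosh t ^ 2 * sinh t * at_exp t - 3 * cosh t ^ 2 - 3 * sinh t ^ 2 - 3 * sinh t ^ 2 * cosh t * lt t"

definition EZ2 :: "real \<Rightarrow> real" where
  "EZ2 t = (12 * cosh t * sinh t ^ 2 + 6 * cosh t ^ 3) * at_exp t - 18 * cosh t * sinh t
    - (6 * sinh t * cosh t ^ 2 + 3 * sinh t ^ 3) * lt t"

definition EY :: "real \<Rightarrow> real" where
  "EY t = - 1 * cosh t ^ 2 - 2 * sinh t ^ 2 - 3 * sinh t ^ 2 * cosh t * lt t"

definition EY1 :: "real \<Rightarrow> real" where
  "EY1 t = - 9 * cosh t * sinh t - (6 * sinh t * cosh t ^ 2 + 3 * sinh t ^ 3) * lt t"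

definition EY2 :: "real \<Rightarrow> real" where
  "EY2 t = - 15 * cosh t ^ 2 - 12 * sinh t ^ 2 - (6 * cosh t ^ 3 + 21 * sinh t ^ 2 * cosh t) * lt t"

definition EB :: "real \<Rightarrow> real" where
  "EB t = 2 / 3 - sinh t * cosh t - sinh t ^ 3 * lt t"

definition EQ :: "real \<Rightarrow> real" where
  "EQ t = 2 * cosh t ^ 4 * at_exp t - 3 * sinh t - 5 * sinh t ^ 3 - 4 * sinh t ^ 3 * cosh t * lt t"

lemma exp_forms:
  fixes t :: real
  shows "cosh t = (1 / exp (- t) + exp (- t)) / 2" "sinh t = (1 / exp (- t) - exp (- t)) / 2"
    "lt t = ln ((1 - exp (- t)) / (1 + exp (- t)))" "at_exp t = arctan (exp (- t))"
proof -
  show "cosh t = (1 / exp (- t) + exp (- t)) / 2" "sinh t = (1 / exp (- t) - exp (- t)) / 2"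
    by (simp_all add: cosh_field_def sinh_field_def exp_minus inverse_eq_divide)
  have "tanh (t / 2) = (1 - exp (- t)) / (1 + exp (- t))"
    using tanh_real_altdef[of "t / 2"] by simp
  then show "lt t = ln ((1 - exp (- t)) / (1 + exp (- t)))" by (simp add: lt_def)
qed (simp add: at_exp_def)

lemma tendsto_via_exp:
  assumes "(h \<longlongrightarrow> l) (at_right 0)"
  shows "((\<lambda>t::real. h (exp (- t))) \<longlongrightarrow> l) at_top"
proof (rule filterlim_compose[OF assms])
  show "filterlim (\<lambda>t::real. exp (- t)) (at_right 0) at_top" by real_asymp
qed

text \<open>With \<open>u = exp (- t)\<close> the behaviour at infinity becomes a Taylor expansion at \<open>u = 0\<close>.\<close>

lemma EZ_limits:
  "(EZ \<longlongrightarrow> 0) at_top" "(EZ1 \<longlongrightarrow> 0) at_top" "(EZ2 \<longlongrightarrow> 0) at_top"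
  "(EY \<longlongrightarrow> 0) at_top" "(EY1 \<longlongrightarrow> 0) at_top" "(EY2 \<longlongrightarrow> 0) at_top"
  "(EB \<longlongrightarrow> 0) at_top" "(EQ \<longlongrightarrow> 0) at_top"
proof -
  have "((\<lambda>u::real. 2 * ((1 / u + u) / 2) ^ 3 * arctan u - 2 * ((1 / u + u) / 2) * ((1 / u - u) / 2)
      - ((1 / u - u) / 2) ^ 3 * ln ((1 - u) / (1 + u))) \<longlongrightarrow> 0) (at_right 0)" by (real_asymp simp: eval_nat_numeral)
  from tendsto_via_exp[OF this] show "(EZ \<longlongrightarrow> 0) at_top" by (simp only: EZ_def[abs_def] exp_forms)
  have "((\<lambda>u::real. 6 * ((1 / u + u) / 2) ^ 2 * ((1 / u - u) / 2) * arctan u - 3 * ((1 / u + u) / 2) ^ 2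
      - 3 * ((1 / u - u) / 2) ^ 2 - 3 * ((1 / u - u) / 2) ^ 2 * ((1 / u + u) / 2) * ln ((1 - u) / (1 + u))) \<longlongrightarrow> 0) (at_right 0)" by (real_asymp simp: eval_nat_numeral)
  from tendsto_via_exp[OF this] show "(EZ1 \<longlongrightarrow> 0) at_top" by (simp only: EZ1_def[abs_def] exp_forms)
  have "((\<lambda>u::real. (12 * ((1 / u + u) / 2) * ((1 / u - u) / 2) ^ 2 + 6 * ((1 / u + u) / 2) ^ 3) * arctan u
      - 18 * ((1 / u + u) / 2) * ((1 / u - u) / 2)
      - (6 * ((1 / u - u) / 2) * ((1 / u + u) / 2) ^ 2 + 3 * ((1 / u - u) / 2) ^ 3) * ln ((1 - u) / (1 + u))) \<longlongrightarrow> 0) (at_right 0)" by (real_asymp simp: eval_nat_numeral)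
  from tendsto_via_exp[OF this] show "(EZ2 \<longlongrightarrow> 0) at_top" by (simp only: EZ2_def[abs_def] exp_forms)
  have "((\<lambda>u::real. - 1 * ((1 / u + u) / 2) ^ 2 - 2 * ((1 / u - u) / 2) ^ 2
      - 3 * ((1 / u - u) / 2) ^ 2 * ((1 / u + u) / 2) * ln ((1 - u) / (1 + u))) \<longlongrightarrow> 0) (at_right 0)" by (real_asymp simp: eval_nat_numeral)
  from tendsto_via_exp[OF this] show "(EY \<longlongrightarrow> 0) at_top" by (simp only: EY_def[abs_def] exp_forms)
  have "((\<lambda>u::real. - 9 * ((1 / u + u) / 2) * ((1 / u - u) / 2)
      - (6 * ((1 / u - u) / 2) * ((1 / u + u) / 2) ^ 2 + 3 * ((1 / u - u) / 2) ^ 3) * ln ((1 - u) / (1 + u))) \<longlongrightarrow> 0) (at_right 0)" by (real_asymp simp: eval_nat_numeral)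
  from tendsto_via_exp[OF this] show "(EY1 \<longlongrightarrow> 0) at_top" by (simp only: EY1_def[abs_def] exp_forms)
  have "((\<lambda>u::real. - 15 * ((1 / u + u) / 2) ^ 2 - 12 * ((1 / u - u) / 2) ^ 2
      - (6 * ((1 / u + u) / 2) ^ 3 + 21 * ((1 / u - u) / 2) ^ 2 * ((1 / u + u) / 2)) * ln ((1 - u) / (1 + u))) \<longlongrightarrow> 0) (at_right 0)" by (real_asymp simp: eval_nat_numeral)
  from tendsto_via_exp[OF this] show "(EY2 \<longlongrightarrow> 0) at_top" by (simp only: EY2_def[abs_def] exp_forms)
  have "((\<lambda>u::real. 2 / 3 - ((1 / u - u) / 2) * ((1 / u + u) / 2) - ((1 / u - u) / 2) ^ 3 * ln ((1 - u) / (1 + u))) \<longlongrightarrow> 0) (at_right 0)" by (real_asymp simp: eval_nat_numeral)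
  from tendsto_via_exp[OF this] show "(EB \<longlongrightarrow> 0) at_top" by (simp only: EB_def[abs_def] exp_forms)
  have "((\<lambda>u::real. 2 * ((1 / u + u) / 2) ^ 4 * arctan u - 3 * ((1 / u - u) / 2) - 5 * ((1 / u - u) / 2) ^ 3
      - 4 * ((1 / u - u) / 2) ^ 3 * ((1 / u + u) / 2) * ln ((1 - u) / (1 + u))) \<longlongrightarrow> 0) (at_right 0)" by (real_asymp simp: eval_nat_numeral)
  from tendsto_via_exp[OF this] show "(EQ \<longlongrightarrow> 0) at_top" by (simp only: EQ_def[abs_def] exp_forms)
qed

lemma EZ_bounded:
  assumes a: "0 < a"
  obtains B where "0 < B" "\<And>t f. a \<le> t \<Longrightarrow> f \<in> {EZ, EZ1, EZ2, EY, EY1, EY2, EB, EQ} \<Longrightarrow> \<bar>f t\<bar> \<le> B"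
proof -
  have cl: "continuous_on {a..} lt"
  proof (rule DERIV_continuous_on)
    fix x assume "x \<in> {a..}"
    then show "(lt has_real_derivative 1 / sinh x) (at x within {a..})"
      using a by (intro has_field_derivative_at_within[OF lt_has_real_derivative]) simp
  qed
  have ca: "continuous_on {a..} at_exp"
    unfolding at_exp_def[abs_def] by (intro continuous_on_arctan continuous_on_exp continuous_on_minus continuous_on_id)
  have c: "continuous_on {a..} EZ" "continuous_on {a..} EZ1" "continuous_on {a..} EZ2"
    "continuous_on {a..} EY" "continuous_on {a..} EY1" "continuous_on {a..} EY2"
    "continuous_on {a..} EB" "continuous_on {a..} EQ"
    unfolding EZ_def[abs_def] EZ1_def[abs_def] EZ2_def[abs_def] EY_def[abs_def] EY1_def[abs_def] EY2_def[abs_def] EB_def[abs_def] EQ_def[abs_def]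
    by (intro continuous_on_diff continuous_on_mult continuous_on_add continuous_on_power continuous_on_cosh continuous_on_sinh
        continuous_on_const continuous_on_id cl ca)+
  have key: "\<exists>B. \<forall>t\<ge>a. \<bar>f t\<bar> \<le> B" if "continuous_on {a..} f" "(f \<longlongrightarrow> 0) at_top" for f :: "real \<Rightarrow> real"
    using bounded_atLeast[OF that] by blast
  have "\<exists>B. \<forall>t\<ge>a. \<bar>f t\<bar> \<le> B" if "f \<in> {EZ, EZ1, EZ2, EY, EY1, EY2, EB, EQ}" for f
    using that key[OF c(1) EZ_limits(1)] key[OF c(2) EZ_limits(2)] key[OF c(3) EZ_limits(3)] key[OF c(4) EZ_limits(4)]
      key[OF c(5) EZ_limits(5)] key[OF c(6) EZ_limits(6)] key[OF c(7) EZ_limits(7)] key[OF c(8) EZ_limits(8)] by blast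
  then obtain b where b: "\<And>f t. f \<in> {EZ, EZ1, EZ2, EY, EY1, EY2, EB, EQ} \<Longrightarrow> a \<le> t \<Longrightarrow> \<bar>f t\<bar> \<le> b f" by metis
  define B where "B = 1 + (\<Sum>f\<in>{EZ, EZ1, EZ2, EY, EY1, EY2, EB, EQ}. \<bar>b f\<bar>)"
  show thesis
  proof (rule that)
    show "0 < B" unfolding B_def by (intro add_pos_nonneg sum_nonneg) auto
    fix t f assume t: "a \<le> t" and f: "f \<in> {EZ, EZ1, EZ2, EY, EY1, EY2, EB, EQ}"
    have "\<bar>b f\<bar> \<le> (\<Sum>f\<in>{EZ, EZ1, EZ2, EY, EY1, EY2, EB, EQ}. \<bar>b f\<bar>)"
      using f by (intro member_le_sum) auto
    then show "\<bar>f t\<bar> \<le> B" using b[OF f t] unfolding B_def by linarith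
  qed
qed

abbreviation dg :: real4 where "dg \<equiv> (1, 1, 1, 0)"

lemma VE_diag:
  assumes t: "0 < t"
  shows "VE 0 0 0 0 (t, t, t, w) = kap * EZ t" "D1 VE 0 0 0 0 (t, t, t, w) dg = kap * EZ1 t"
    "D2 VE (t, t, t, w) dg dg = kap * EZ2 t"
  using t
  by (simp_all add: VE_def D1_def D2_def sk_def sh_simps be_simps la_simps sinh_add[of t t, unfolded mult_2[symmetric]]
      cosh_add[of t t, unfolded mult_2[symmetric]] sinh_double cosh_double numeral_2_eq_2 EZ_def EZ1_def EZ2_def tanh_def)
    (simp_all add: field_simps power2_eq_square power3_eq_cube)

lemma la3: "la (Suc (Suc (Suc 0))) t = cosh t * lt t + 1 - 1 / sinh t ^ 2"
  by (simp add: la_def)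

lemma VE4_diag:
  assumes t: "0 < t"
  shows "VE4 0 0 0 (Suc 0) (t, t, t, 0) = kap * EY t" "D1 VE4 0 0 0 (Suc 0) (t, t, t, 0) dg = kap * EY1 t"
    "D2 (\<lambda>i j k l. VE4 i j k (Suc l)) (t, t, t, 0) dg dg = kap * EY2 t"
proof -
  have c: "cosh t * cosh t = 1 + sinh t * sinh t" by (simp add: cosh_square_eq flip: power2_eq_square)
  show "VE4 0 0 0 (Suc 0) (t, t, t, 0) = kap * EY t" "D1 VE4 0 0 0 (Suc 0) (t, t, t, 0) dg = kap * EY1 t"
    "D2 (\<lambda>i j k l. VE4 i j k (Suc l)) (t, t, t, 0) dg dg = kap * EY2 t"
    using t
    by (simp_all add: VE4_def D1_def D2_def sk_def sh_simps be_simps la_simps la3 sinh_double cosh_double numeral_2_eq_2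
        EY_def EY1_def EY2_def)
      (simp_all add: field_simps power2_eq_square power3_eq_cube, use c in algebra)
qed

text \<open>In w the elementary part of C is a combination of cosh w and sinh w. Its value at w = 0
  is the elementary part of A, which does not depend on w.\<close>

lemma VE4_split:
  "VE4 i j k 0 (a, b, t, w) = cosh w * VE i j k 0 (a, b, t, w') + sinh w * VE4 i j k (Suc 0) (a, b, t, 0)"
proof -
  have "sh n (x + w) = cosh w * sh n x + sinh w * sh (Suc n) x" for n x
    by (simp add: sh_def sinh_add cosh_add mult.commute)
  then have "sk k n (x + w) = cosh w * sk k n x + sinh w * sk k (Suc n) x" for n x
    by (simp add: sk_def)
  then have "sk k n (a + b + w) = cosh w * sk k n (a + b) + sinh w * sk k (Suc n) (a + b)" for n by blast
  then show ?thesis by (simp add: VE4_def VE_def sh_simps) (simp add: algebra_simps)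
qed

lemma D_VE4_split:
  "D1 VE4 0 0 0 0 (a, b, t, w) (h1, h2, h3, 0)
    = cosh w * D1 VE 0 0 0 0 (a, b, t, w') (h1, h2, h3, 0) + sinh w * D1 VE4 0 0 0 (Suc 0) (a, b, t, 0) (h1, h2, h3, 0)"
  "D2 VE4 (a, b, t, w) (h1, h2, h3, 0) (h1, h2, h3, 0)
    = cosh w * D2 VE (a, b, t, w') (h1, h2, h3, 0) (h1, h2, h3, 0)
      + sinh w * D2 (\<lambda>i j k l. VE4 i j k (Suc l)) (a, b, t, 0) (h1, h2, h3, 0) (h1, h2, h3, 0)"
  by (simp_all add: D1_def D2_def VE4_split[of _ _ _ a b t w w'] algebra_simps)

text \<open>\<open>ek_abs_le\<close> contains a factor cosh t. On the diagonal c < coth t gives c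
  cosh t - sinh t \<le> 1 / sinh t, a bound uniform for t \<ge> a, as needed at infinity.\<close>

lemma ek_diag_bound:
  assumes a: "0 < a" "a \<le> t" and c: "c \<in> Cset t"
  shows "\<bar>ek n c t\<bar> \<le> 1 + 1 / sinh a"
proof -
  have t: "0 < t" "0 < sinh a" "sinh a \<le> sinh t" using a by auto
  have c': "1 < c" "c * sinh t < cosh t" using c by (auto simp: Cset_def)
  show ?thesis
  proof (cases "even n")
    case True
    then have "ek n c t = ek 0 c t" by (simp add: ek_def)
    moreover have "exp (- t) \<le> 1" using t by simp
    ultimately have "\<bar>ek n c t\<bar> \<le> 1" using ek_neg[OF c'(1) less_imp_le[OF c'(2)], of t] t by linarith
    then show ?thesis using t by (simp add: add_increasing2)
  next
    case False
    have "c \<le> cosh t / sinh t" using c' t by (simp add: pos_le_divide_eq)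
    then have "c * cosh t \<le> cosh t / sinh t * cosh t" by (intro mult_right_mono) auto
    then have "c * cosh t - sinh t \<le> 1 / sinh t"
      using t by (simp add: divide_simps cosh_square_eq flip: power2_eq_square) (simp add: algebra_simps power2_eq_square)
    also have "\<dots> \<le> 1 / sinh a" using t by (intro divide_left_mono) auto
    finally have "ek n c t \<le> 1 / sinh a" using False by (simp add: ek_def)
    then show ?thesis using ek_odd_bounds(1)[OF c'(1) _ False, of t] t by simp
  qed
qed

lemma (in kernel) II_diag_bounded:
  assumes a: "0 < a" and m: "\<And>t c. a \<le> t \<Longrightarrow> c \<in> Cset t \<Longrightarrow> \<bar>X 0 c w\<bar> \<le> m"
  obtains B where "0 \<le> B" "\<And>t i j k. a \<le> t \<Longrightarrow> \<bar>VK X i j k 0 (t, t, t, w)\<bar> \<le> B"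
proof -
  define N where "N = 1 + 1 / sinh a"
  have N: "0 \<le> N" using a by (simp add: N_def)
  obtain G where G: "0 < G" "\<And>c. 1 < c \<Longrightarrow> \<bar>g c\<bar> \<le> G * dom c" using g_dom1 by blast
  define h where "h c = N * N * N * \<bar>m\<bar> * (G * dom c)" for c
  have h0: "0 \<le> h c" for c using N G(1) by (simp add: h_def)
  have hi: "integrable lborel h" unfolding h_def by (intro integrable_mult_right integrable_dom)
  show thesis
  proof (rule that[of "integral\<^sup>L lborel h"])
    show "0 \<le> integral\<^sup>L lborel h" using h0 by (intro Bochner_Integration.integral_nonneg) auto
    fix t i j k assume t: "a \<le> t"
    then have t0: "0 < t" using a by simp
    have "bdry X (t, t, t, w) = 0" using ek_0_coth[of t] t0 by (simp add: bdry_def)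
    then have "VK X i j k 0 (t, t, t, w) = II X i j k 0 (t, t, t, w)" by (simp add: VK_def)
    moreover have "norm (II X i j k 0 (t, t, t, w)) \<le> integral\<^sup>L lborel h"
      unfolding II_def prod.case
    proof (rule Bochner_Integration.integral_norm_bound_integral[OF integrable_II[OF t0] hi])
      fix c
      show "norm (indicator (Cset t) c * (ek i c t * ek j c t * ek k c t * X 0 c w * g c)) \<le> h c"
      proof (cases "c \<in> Cset t")
        case True
        note e = ek_diag_bound[OF a t True, folded N_def]
        have "\<bar>X 0 c w\<bar> \<le> \<bar>m\<bar>" using m[OF t True] by simp
        then have "\<bar>ek i c t * ek j c t * ek k c t * X 0 c w * g c\<bar> \<le> h c"
          unfolding abs_mult h_def using e N G(2)[OF Cset_gt_1[OF True]] by (intro mult_mono) auto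
        then show ?thesis using True by simp
      qed (simp add: h0)
    qed
    ultimately show "\<bar>VK X i j k 0 (t, t, t, w)\<bar> \<le> integral\<^sup>L lborel h" by simp
  qed
qed

text \<open>The shift \<open>s\<close> serves region C, where the diagonal is met at t + \<alpha>
  and the constraint w \<le> t of the domain then holds with w = \<alpha>.\<close>

lemma tower_zfun:
  assumes V: "tower V" "ctower D V" and D: "\<And>t. 0 < t \<Longrightarrow> (t + s, t + s, t + s, w) \<in> D" and s: "0 \<le> s"
    and b: "\<And>a. 0 < a \<Longrightarrow> \<exists>B. \<forall>t\<ge>a. \<bar>V 0 0 0 0 (t, t, t, w)\<bar> \<le> B \<and> \<bar>D1 V 0 0 0 0 (t, t, t, w) dg\<bar> \<le> B \<and> \<bar>D2 V (t, t, t, w) dg dg\<bar> \<le> B"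
  shows "zfun (\<lambda>t. V 0 0 0 0 (t + s, t + s, t + s, w)) (\<lambda>t. D1 V 0 0 0 0 (t + s, t + s, t + s, w) dg)
    (\<lambda>t. D2 V (t + s, t + s, t + s, w) dg dg)"
proof
  have der: "((\<lambda>t. V i j k l (t, t, t, w)) has_real_derivative D1 V i j k l (t, t, t, w) dg) (at t)"
    if n: "i + j + k + l \<le> 1" and t: "0 < t" for i j k l t
  proof -
    have "((\<lambda>r. V i j k l ((t, t, t, w) + r *\<^sub>R dg)) has_real_derivative D1 V i j k l (t, t, t, w) dg) (at 0)"
      using V(1) n t unfolding tower_def by blast
    then have "((\<lambda>r. V i j k l (r + t, r + t, r + t, w)) has_real_derivative D1 V i j k l (t, t, t, w) dg) (at 0)"
      by (simp add: add.commute)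
    then show ?thesis
      using DERIV_at_within_shift[of "\<lambda>t. V i j k l (t, t, t, w)" "D1 V i j k l (t, t, t, w) dg" t 0 UNIV] by (simp add: add.commute)
  qed
  fix t :: real assume t: "0 < t"
  then have ts: "0 < t + s" using s by simp
  show "((\<lambda>t. V 0 0 0 0 (t + s, t + s, t + s, w)) has_real_derivative D1 V 0 0 0 0 (t + s, t + s, t + s, w) dg) (at t)"
    using der[of 0 0 0 0, OF _ ts] DERIV_shift[of "\<lambda>t. V 0 0 0 0 (t, t, t, w)" _ t s] by simp
  have "((\<lambda>t. D1 V 0 0 0 0 (t, t, t, w) dg) has_real_derivative D2 V (t + s, t + s, t + s, w) dg dg) (at (t + s))"
    unfolding D1_def[of V 0 0 0 0] D2_def prod.case One_nat_def
    by (intro DERIV_add DERIV_cmult der ts) simp_all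
  then show "((\<lambda>t. D1 V 0 0 0 0 (t + s, t + s, t + s, w) dg) has_real_derivative D2 V (t + s, t + s, t + s, w) dg dg) (at t)"
    using DERIV_shift[of "\<lambda>t. D1 V 0 0 0 0 (t, t, t, w) dg" _ t s] by simp
next
  show "continuous_on {0<..} (\<lambda>t. D2 V (t + s, t + s, t + s, w) dg dg)"
    by (rule continuous_on_compose2[OF ctower_D2[OF V(2)]]) (use D in \<open>auto intro!: continuous_intros\<close>)
  fix a :: real assume a: "0 < a"
  obtain B where "\<forall>t\<ge>a. \<bar>V 0 0 0 0 (t, t, t, w)\<bar> \<le> B \<and> \<bar>D1 V 0 0 0 0 (t, t, t, w) dg\<bar> \<le> B \<and> \<bar>D2 V (t, t, t, w) dg dg\<bar> \<le> B"
    using b[OF a] by blast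
  then show "\<exists>B. \<forall>t\<ge>a. \<bar>V 0 0 0 0 (t + s, t + s, t + s, w)\<bar> \<le> B \<and> \<bar>D1 V 0 0 0 0 (t + s, t + s, t + s, w) dg\<bar> \<le> B \<and> \<bar>D2 V (t + s, t + s, t + s, w) dg dg\<bar> \<le> B"
    using s by (intro exI[of _ B]) auto
qed

lemma D_add:
  "D1 (\<lambda>i j k l x. V i j k l x + V' i j k l x) i j k l x h = D1 V i j k l x h + D1 V' i j k l x h"
  "D2 (\<lambda>i j k l x. V i j k l x + V' i j k l x) x h h' = D2 V x h h' + D2 V' x h h'"
  by (auto simp: D1_def D2_def algebra_simps split: prod.splits)

lemma D_VABC:
  "D1 VA i j k l x h = D1 VE i j k l x h + D1 (VK expX) i j k l x h"
  "D2 VA x h h' = D2 VE x h h' + D2 (VK expX) x h h'"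
  "D1 VC i j k l x h = D1 VE4 i j k l x h + D1 (VK ekX) i j k l x h"
  "D2 VC x h h' = D2 VE4 x h h' + D2 (VK ekX) x h h'"
  unfolding VA_def[abs_def] VC_def[abs_def] by (rule D_add)+

lemma (in kernel) VK_diag_bounds:
  assumes a: "0 < a" and m: "\<And>t c. a \<le> t \<Longrightarrow> c \<in> Cset t \<Longrightarrow> \<bar>X 0 c w\<bar> \<le> m"
  shows "\<exists>B. \<forall>t\<ge>a. \<bar>VK X 0 0 0 0 (t, t, t, w)\<bar> \<le> B \<and> \<bar>D1 (VK X) 0 0 0 0 (t, t, t, w) dg\<bar> \<le> B \<and> \<bar>D2 (VK X) (t, t, t, w) dg dg\<bar> \<le> B"
proof -
  obtain B where B: "0 \<le> B" "\<And>t i j k. a \<le> t \<Longrightarrow> \<bar>VK X i j k 0 (t, t, t, w)\<bar> \<le> B"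
    using II_diag_bounded[of a w m] a m by blast
  \<comment> \<open>Nine is the number of second partial derivatives in a, b, t that
    \<open>D2\<close> sums along the diagonal direction.\<close>
  have "\<bar>VK X 0 0 0 0 (t, t, t, w)\<bar> \<le> 9 * B \<and> \<bar>D1 (VK X) 0 0 0 0 (t, t, t, w) dg\<bar> \<le> 9 * B \<and> \<bar>D2 (VK X) (t, t, t, w) dg dg\<bar> \<le> 9 * B"
    if t: "a \<le> t" for t
  proof -
    have b: "\<bar>VK X i j k 0 (t, t, t, w)\<bar> \<le> B" for i j k by (rule B(2)[OF t])
    show ?thesis
      using B(1) b[of 0 0 0] b[of "Suc 0" 0 0] b[of 0 "Suc 0" 0] b[of 0 0 "Suc 0"]
        b[of "Suc (Suc 0)" 0 0] b[of 0 "Suc (Suc 0)" 0] b[of 0 0 "Suc (Suc 0)"]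
        b[of "Suc 0" "Suc 0" 0] b[of "Suc 0" 0 "Suc 0"] b[of 0 "Suc 0" "Suc 0"]
      by (simp add: D1_def D2_def abs_le_iff)
  qed
  then show ?thesis by blast
qed

lemma zfun_VA:
  assumes w: "0 \<le> w"
  shows "zfun (\<lambda>t. VA 0 0 0 0 (t, t, t, w)) (\<lambda>t. D1 VA 0 0 0 0 (t, t, t, w) dg) (\<lambda>t. D2 VA (t, t, t, w) dg dg)"
proof -
  have "\<exists>B. \<forall>t\<ge>a. \<bar>VA 0 0 0 0 (t, t, t, w)\<bar> \<le> B \<and> \<bar>D1 VA 0 0 0 0 (t, t, t, w) dg\<bar> \<le> B \<and> \<bar>D2 VA (t, t, t, w) dg dg\<bar> \<le> B"
    if a: "0 < a" for a
  proof -
    obtain B where B: "0 < B" "\<And>t f. a \<le> t \<Longrightarrow> f \<in> {EZ, EZ1, EZ2, EY, EY1, EY2, EB, EQ} \<Longrightarrow> \<bar>f t\<bar> \<le> B"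
      using EZ_bounded[OF a] by blast
    have "\<bar>expX 0 c w\<bar> \<le> 1" if "c \<in> Cset t" for t c
      using Cset_gt_1[OF that] w by (simp add: expX_def)
    then obtain B' where B': "\<And>t. a \<le> t \<Longrightarrow> \<bar>VK expX 0 0 0 0 (t, t, t, w)\<bar> \<le> B' \<and> \<bar>D1 (VK expX) 0 0 0 0 (t, t, t, w) dg\<bar> \<le> B' \<and> \<bar>D2 (VK expX) (t, t, t, w) dg dg\<bar> \<le> B'"
      using A.VK_diag_bounds[OF a, of w 1] by blast
    have k: "0 < kap" by (simp add: kap_def)
    have kb: "\<bar>kap * f t\<bar> \<le> kap * B" if "a \<le> t" "f \<in> {EZ, EZ1, EZ2, EY, EY1, EY2, EB, EQ}" for f t
      using B(2)[OF that] k by (simp add: abs_mult)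
    show ?thesis
    proof (intro exI[of _ "kap * B + B'"] allI impI)
      fix t assume t: "a \<le> t"
      then have t0: "0 < t" using a by simp
      show "\<bar>VA 0 0 0 0 (t, t, t, w)\<bar> \<le> kap * B + B' \<and> \<bar>D1 VA 0 0 0 0 (t, t, t, w) dg\<bar> \<le> kap * B + B' \<and> \<bar>D2 VA (t, t, t, w) dg dg\<bar> \<le> kap * B + B'"
        unfolding D_VABC VA_def[of 0 0 0 0] VE_diag[OF t0]
        using B'[OF t] kb[OF t, of EZ] kb[OF t, of EZ1] kb[OF t, of EZ2] by (auto intro: abs_triangle_ineq[THEN order_trans])
    qed
  qed
  from tower_zfun[OF tower_VABC(1) ctower_VABC(1) _ _ this, where s=0] w
  show ?thesis by (simp add: A.Dom_def)
qed

lemma zfun_VC: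
  assumes \<alpha>: "0 \<le> \<alpha>"
  shows "zfun (\<lambda>t. VC 0 0 0 0 (t + \<alpha>, t + \<alpha>, t + \<alpha>, \<alpha>)) (\<lambda>t. D1 VC 0 0 0 0 (t + \<alpha>, t + \<alpha>, t + \<alpha>, \<alpha>) dg)
    (\<lambda>t. D2 VC (t + \<alpha>, t + \<alpha>, t + \<alpha>, \<alpha>) dg dg)"
proof -
  have "\<exists>B. \<forall>t\<ge>a. \<bar>VC 0 0 0 0 (t, t, t, \<alpha>)\<bar> \<le> B \<and> \<bar>D1 VC 0 0 0 0 (t, t, t, \<alpha>) dg\<bar> \<le> B \<and> \<bar>D2 VC (t, t, t, \<alpha>) dg dg\<bar> \<le> B"
    if a: "0 < a" for a
  proof -
    obtain B where B: "0 < B" "\<And>t f. a \<le> t \<Longrightarrow> f \<in> {EZ, EZ1, EZ2, EY, EY1, EY2, EB, EQ} \<Longrightarrow> \<bar>f t\<bar> \<le> B"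
      using EZ_bounded[OF a] by blast
    have "\<bar>ekX 0 c \<alpha>\<bar> \<le> cosh a / sinh a * sinh \<alpha> + cosh \<alpha>" if "a \<le> t" "c \<in> Cset t" for t c
    proof -
      have t: "0 < t" using that a by simp
      have c: "1 < c" "c * sinh t < cosh t" using that(2) by (auto simp: Cset_def)
      have "cosh t * sinh a \<le> cosh a * sinh t"
        using sinh_diff[of t a] that(1) sinh_real_nonneg_iff[of "t - a"] by (simp add: mult.commute)
      then have "cosh t / sinh t \<le> cosh a / sinh a" using t a by (simp add: divide_simps)
      moreover have "c \<le> cosh t / sinh t" using c t by (simp add: pos_le_divide_eq)
      ultimately have "c * sinh \<alpha> \<le> cosh a / sinh a * sinh \<alpha>" using \<alpha> by (intro mult_right_mono) auto
      moreover have "0 \<le> c * sinh \<alpha>" "0 \<le> cosh \<alpha>" using c \<alpha> by auto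
      ultimately have "\<bar>- (c * sinh \<alpha> - cosh \<alpha>)\<bar> \<le> cosh a / sinh a * sinh \<alpha> + cosh \<alpha>" by linarith
      then show ?thesis by (simp add: ekX_def ek_def)
    qed
    then obtain B' where B': "\<And>t. a \<le> t \<Longrightarrow> \<bar>VK ekX 0 0 0 0 (t, t, t, \<alpha>)\<bar> \<le> B' \<and> \<bar>D1 (VK ekX) 0 0 0 0 (t, t, t, \<alpha>) dg\<bar> \<le> B' \<and> \<bar>D2 (VK ekX) (t, t, t, \<alpha>) dg dg\<bar> \<le> B'"
      using C.VK_diag_bounds[OF a, of \<alpha> "cosh a / sinh a * sinh \<alpha> + cosh \<alpha>"] by blast
    have k: "0 < kap" by (simp add: kap_def)
    define b where "b = cosh \<alpha> * (kap * B) + \<bar>sinh \<alpha>\<bar> * (kap * B)"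
    have kb: "\<bar>cosh \<alpha> * (kap * f t) + sinh \<alpha> * (kap * h t)\<bar> \<le> b"
      if "a \<le> t" "f \<in> {EZ, EZ1, EZ2, EY, EY1, EY2, EB, EQ}" "h \<in> {EZ, EZ1, EZ2, EY, EY1, EY2, EB, EQ}" for f h t
    proof -
      have "\<bar>cosh \<alpha> * (kap * f t)\<bar> \<le> cosh \<alpha> * (kap * B)" "\<bar>sinh \<alpha> * (kap * h t)\<bar> \<le> \<bar>sinh \<alpha>\<bar> * (kap * B)"
        unfolding abs_mult using B(2)[OF that(1,2)] B(2)[OF that(1,3)] k by (auto intro!: mult_left_mono)
      then show ?thesis unfolding b_def by (rule abs_triangle_ineq[THEN order_trans, OF add_mono])
    qed
    show ?thesis
    proof (intro exI[of _ "b + B'"] allI impI)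
      fix t assume t: "a \<le> t"
      then have t0: "0 < t" using a by simp
      show "\<bar>VC 0 0 0 0 (t, t, t, \<alpha>)\<bar> \<le> b + B' \<and> \<bar>D1 VC 0 0 0 0 (t, t, t, \<alpha>) dg\<bar> \<le> b + B' \<and> \<bar>D2 VC (t, t, t, \<alpha>) dg dg\<bar> \<le> b + B'"
        unfolding D_VABC VC_def[of 0 0 0 0] D_VE4_split[of t t t \<alpha> _ _ _ 0] VE4_split[of 0 0 0 t t t \<alpha> 0] VE_diag[OF t0] VE4_diag[OF t0]
        using B'[OF t] kb[OF t, of EZ EY] kb[OF t, of EZ1 EY1] kb[OF t, of EZ2 EY2] by (auto intro: abs_triangle_ineq[THEN order_trans])
    qed
  qed
  from tower_zfun[OF tower_VABC(3) ctower_VABC(3) _ \<alpha> this] \<alpha>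
  show ?thesis by (simp add: C.Dom_def)
qed

text \<open>The expression of \<open>zfun.W\<close> with plain numbers in place of Z and its
  derivatives, so that its linearity in them can be used term by term.\<close>

definition polar :: "real \<Rightarrow> real \<Rightarrow> real \<Rightarrow> real \<Rightarrow> real \<Rightarrow> real" where
  "polar a y z z1 z2 = (cosh a * cosh y - sinh a * sinh y / 2) * z - sinh (a + y) / 3 * z1 + sinh a * sinh y / 6 * z2"

lemma polar_add: "polar a y (z + r * x) (z1 + r * x1) (z2 + r * x2) = polar a y z z1 z2 + r * polar a y x x1 x2"
  by (simp add: polar_def field_simps)

text \<open>Polarization under the integral sign: e_c(t - x) = cosh x e_c(t) - sinh x e_c'(t). On
  the diagonal the integrand is symmetric in its three factors, so the diagonal derivatives give all
  the products that occur, and \<open>bdry\<close> vanishes there.\<close>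

lemma (in kernel) polar_VK:
  assumes t: "0 < t"
  shows "polar a y (VK X 0 0 0 0 (t, t, t, w)) (D1 (VK X) 0 0 0 0 (t, t, t, w) dg) (D2 (VK X) (t, t, t, w) dg dg)
    = VK X 0 0 0 0 (t - y, t - a, t, w)"
proof -
  define q where "q i j k c = indicator (Cset t) c * (ek i c t * ek j c t * ek k c t * X 0 c w * g c)" for i j k c
  have I: "integrable lborel (q i j k)" for i j k unfolding q_def[abs_def] by (rule integrable_II[OF t])
  have V: "VK X i j k 0 (t, t, t, w) = integral\<^sup>L lborel (q i j k)" for i j k
    using ek_0_coth[of t] t by (simp add: VK_def II_def q_def[abs_def] bdry_def)
  have sh2: "ek 0 c (t - x) = cosh x * ek 0 c t - sinh x * ek (Suc 0) c t" for x c
    by (simp add: ek_def sinh_diff cosh_diff algebra_simps)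
  have "VK X 0 0 0 0 (t - y, t - a, t, w) = (LINT c|lborel. (cosh y * cosh a) * q 0 0 0 c - (cosh y * sinh a) * q 0 (Suc 0) 0 c
      - (sinh y * cosh a) * q (Suc 0) 0 0 c + (sinh y * sinh a) * q (Suc 0) (Suc 0) 0 c)"
    unfolding VK_def II_def prod.case
    by (simp, rule Bochner_Integration.integral_cong) (simp_all add: q_def sh2 algebra_simps)
  also have "\<dots> = (cosh y * cosh a) * VK X 0 0 0 0 (t, t, t, w) - (cosh y * sinh a) * VK X 0 (Suc 0) 0 0 (t, t, t, w)
      - (sinh y * cosh a) * VK X (Suc 0) 0 0 0 (t, t, t, w) + (sinh y * sinh a) * VK X (Suc 0) (Suc 0) 0 0 (t, t, t, w)"
    by (simp add: I V)
  finally have e: "VK X 0 0 0 0 (t - y, t - a, t, w) = \<dots>" .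
  have sy: "q (Suc 0) 0 0 = q 0 0 (Suc 0)" "q 0 (Suc 0) 0 = q 0 0 (Suc 0)"
    "q (Suc 0) (Suc 0) 0 = q 0 (Suc 0) (Suc 0)" "q (Suc 0) 0 (Suc 0) = q 0 (Suc 0) (Suc 0)"
    "q (Suc (Suc 0)) 0 0 = q 0 0 0" "q 0 (Suc (Suc 0)) 0 = q 0 0 0" "q 0 0 (Suc (Suc 0)) = q 0 0 0"
    by (rule ext, simp add: q_def ek_two mult_ac)+
  show ?thesis
    unfolding e by (simp add: polar_def D1_def D2_def V sy sinh_add) (simp add: field_simps)
qed

lemma polar_VE:
  "polar a y (kap * EZ t) (kap * EZ1 t) (kap * EZ2 t) = VE 0 0 0 0 (t - y, t - a, t, w)"
proof -
  have "t - y + (t - a) = (t + t) - (y + a)" by simp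
  then have "sinh (t - y + (t - a)) = sinh ((t + t) - (y + a))" by simp
  also have "\<dots> = 2 * sinh t * cosh t * (cosh y * cosh a + sinh y * sinh a)
      - (cosh t * cosh t + sinh t * sinh t) * (sinh y * cosh a + cosh y * sinh a)"
    unfolding sinh_diff sinh_add cosh_add by simp
  finally show ?thesis
    by (simp add: VE_def sk_def sh_simps be_simps la_simps polar_def EZ_def EZ1_def EZ2_def sinh_add sinh_diff cosh_diff)
      (simp add: field_simps power2_eq_square power3_eq_cube)
qed

lemma polar_VE4:
  "polar a y (kap * EY t) (kap * EY1 t) (kap * EY2 t) = VE4 0 0 0 (Suc 0) (t - y, t - a, t, 0)"
proof -
  have "t - y + (t - a) = (t + t) - (y + a)" by simp
  then have "cosh (t - y + (t - a)) = cosh ((t + t) - (y + a))" by simp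
  also have "\<dots> = (cosh t * cosh t + sinh t * sinh t) * (cosh y * cosh a + sinh y * sinh a)
      - 2 * sinh t * cosh t * (sinh y * cosh a + cosh y * sinh a)"
    unfolding cosh_diff sinh_add cosh_add by simp
  finally show ?thesis
    by (simp add: VE4_def sk_def sh_simps be_simps la_simps polar_def EY_def EY1_def EY2_def sinh_add sinh_diff cosh_diff)
      (simp add: field_simps power2_eq_square power3_eq_cube)
qed

lemma polar_VA:
  assumes t: "0 < t"
  shows "polar a y (VA 0 0 0 0 (t, t, t, w)) (D1 VA 0 0 0 0 (t, t, t, w) dg) (D2 VA (t, t, t, w) dg dg)
    = VA 0 0 0 0 (t - y, t - a, t, w)"
  unfolding D_VABC VA_def[of 0 0 0 0] VE_diag[OF t]
  using polar_add[of a y "kap * EZ t" 1] polar_VE[of a y t w] A.polar_VK[OF t, of a y w] by simp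

lemma polar_VC:
  assumes t: "0 < t"
  shows "polar a y (VC 0 0 0 0 (t, t, t, w)) (D1 VC 0 0 0 0 (t, t, t, w) dg) (D2 VC (t, t, t, w) dg dg)
    = VC 0 0 0 0 (t - y, t - a, t, w)"
proof -
  have l: "polar a y (p * z + r * x) (p * z1 + r * x1) (p * z2 + r * x2) = p * polar a y z z1 z2 + r * polar a y x x1 x2" for p r z z1 z2 x x1 x2
    by (simp add: polar_def field_simps)
  show ?thesis
    unfolding D_VABC VC_def[of 0 0 0 0] D_VE4_split[of t t t w _ _ _ 0] VE4_split[of 0 0 0 _ _ t w 0] VE_diag[OF t] VE4_diag[OF t]
    using polar_add[of a y _ 1] l polar_VE[of a y t 0] polar_VE4[of a y t] C.polar_VK[OF t, of a y w] by simp
qed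

subsection \<open>The regional formulas\<close>

lemma zfun_W_polar:
  assumes "zfun Z Z1 Z2" shows "zfun.W Z Z1 Z2 a y t = polar a y (Z t) (Z1 t) (Z2 t)"
  unfolding zfun.W_def[OF assms] polar_def ..

text \<open>At a = b = 0 two factors of the kernel are e_c(0) = -1 and their product is 1; of the
  elementary part only the arctan term remains.\<close>

lemma Ltilde_eq:
  assumes s: "0 < s"
  shows "Ltilde s w = VA 0 0 0 0 (0, 0, s, w)"
proof -
  define f where "f c = (c * sinh s - cosh s) * exp (- 2 * w * c) * g c" for c
  have e: "indicator (Cset s) c * (ek 0 c 0 * ek 0 c 0 * ek 0 c s * expX 0 c w * g c) = indicator (Cset s) c *\<^sub>R f c" for c
    by (simp add: ek_def expX_def f_def)
  have i: "set_integrable lborel (Cset s) f"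
    unfolding set_integrable_def e[symmetric] by (rule A.integrable_II[OF s])
  have "II expX 0 0 0 0 (0, 0, s, w) = (LINT c:Cset s|lborel. f c)"
    unfolding II_def prod.case set_lebesgue_integral_def e ..
  also have "\<dots> = integral (Cset s) f" by (rule set_borel_integral_eq_integral(2)[OF i])
  also have "\<dots> = integral {1..cosh s / sinh s} f"
    using integral_open_interval_real[of 1 "cosh s / sinh s" f] by (simp add: Cset_pos[OF s])
  finally have "II expX 0 0 0 0 (0, 0, s, w) = integral {1..cosh s / sinh s} f" .
  moreover have "1 / sqrt 2 = 2 * kap" by (simp add: kap_def)
  ultimately show ?thesis
    unfolding Ltilde_def f_def
    by (simp add: VA_def VK_def VE_def sk_def sh_def be_def at_exp_def mult_ac)
qed

lemma phi_VA:
  assumes "0 < s" "0 \<le> w"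
  shows "phi w s = VA 0 0 0 0 (0, 0, s, w)"
  using assms by (simp add: phi_def Ltilde_eq)

text \<open>\<open>phi w\<close> is the polarized diagonal function at a = y = t. Applying
  \<open>K\<close> and \<open>T\<close> and interpolating only replaces these arguments by sqrt 2
  q_3 and y, with t = y + z/2.\<close>

lemma v_AC_on_SA:
  assumes q: "q \<in> SA" and r: "0 < q $ 2 + q $ 3"
  shows "v_AC q = VA 0 0 0 0 (LA q)"
proof -
  define y z w where "y = sqrt 2 * (q $ 2 + q $ 3)" and "z = sqrt 2 * (q $ 4 - q $ 2)" and "w = sqrt 2 * q $ 1 - z / 2"
  have q': "0 \<le> q $ 1" "0 \<le> q $ 2" "0 \<le> q $ 3" "q $ 2 \<le> q $ 4" "q $ 4 - q $ 2 \<le> 2 * q $ 1" using q by (auto simp: SA_def)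
  have y: "0 < y" "y = sqrt 2 * q $ 3 + sqrt 2 * q $ 2" using r by (simp_all add: y_def) (simp add: algebra_simps)
  have z: "0 \<le> z" using q' by (simp add: z_def)
  have "sqrt 2 * (q $ 4 - q $ 2) \<le> sqrt 2 * (2 * q $ 1)" using q'(5) by (intro mult_left_mono) auto
  then have p: "min z (2 * (sqrt 2 * q $ 1)) = z" and w: "0 \<le> w" by (auto simp: z_def w_def)
  note zf = zfun_VA[OF w]
  have \<phi>: "phi w t = zfun.W (\<lambda>t. VA 0 0 0 0 (t, t, t, w)) (\<lambda>t. D1 VA 0 0 0 0 (t, t, t, w) dg) (\<lambda>t. D2 VA (t, t, t, w) dg dg) t t t"
    if "0 < t" for t
    unfolding zfun_W_polar[OF zf] polar_VA[OF that] using phi_VA[OF that w] by simp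
  have "v_AC q = K z (phi w) y * (sinh (sqrt 2 * q $ 3) / sinh y) + T (K z (phi w)) y * (sinh (sqrt 2 * q $ 2) / sinh y)"
    unfolding v_AC_def Let_def F_def R_def y_def[symmetric] z_def[symmetric] p w_def[symmetric] ..
  also have "\<dots> = polar (sqrt 2 * q $ 3) y (VA 0 0 0 0 (y + z / 2, y + z / 2, y + z / 2, w))
      (D1 VA 0 0 0 0 (y + z / 2, y + z / 2, y + z / 2, w) dg) (D2 VA (y + z / 2, y + z / 2, y + z / 2, w) dg dg)"
    unfolding zfun_W_polar[OF zf, symmetric] by (rule zfun.KT_combination[OF zf \<phi> y(1) z y(2)])
  also have "\<dots> = VA 0 0 0 0 (y + z / 2 - y, y + z / 2 - sqrt 2 * q $ 3, y + z / 2, w)"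
    using y z by (intro polar_VA) simp
  also have "(y + z / 2 - y, y + z / 2 - sqrt 2 * q $ 3, y + z / 2, w) = LA q"
    by (simp add: LA_def y_def z_def w_def field_simps)
  finally show ?thesis .
qed

text \<open>The strict inequality \<open>w0\<close> selects the branch of \<open>phi\<close> that
  uses \<open>P\<close>. Its kernel form is the hypothesis \<open>Peq\<close>; in it the third
  coordinate is s + \<alpha>, which shifts the diagonal function by \<alpha>.\<close>

lemma v_AC_on_SC:
  assumes q: "q \<in> SC" and r: "0 < q $ 2 + q $ 3" and w0: "2 * q $ 1 < q $ 4 - q $ 2"
    and Peq: "\<And>s z. 0 < s \<Longrightarrow> 0 < z \<Longrightarrow> P s z = VC 0 0 0 0 (z / 3, z / 3, s + z / 3, z / 3)"
  shows "v_AC q = VC 0 0 0 0 (LC q)"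
proof -
  define y z w where "y = sqrt 2 * (q $ 2 + q $ 3)" and "z = sqrt 2 * (q $ 4 - q $ 2)" and "w = sqrt 2 * q $ 1 - z / 2"
  define p \<alpha> where "p = 2 * (sqrt 2 * q $ 1)" and "\<alpha> = - 2 * w / 3"
  have q': "0 \<le> q $ 1" "0 \<le> q $ 2" "0 \<le> q $ 3" "q $ 2 \<le> q $ 4" using q by (auto simp: SC_def)
  have y: "0 < y" "y = sqrt 2 * q $ 3 + sqrt 2 * q $ 2" using r by (simp_all add: y_def) (simp add: algebra_simps)
  have p0: "0 \<le> p" using q' by (simp add: p_def)
  have "sqrt 2 * (2 * q $ 1) < sqrt 2 * (q $ 4 - q $ 2)" using w0 by (intro mult_strict_left_mono) auto
  then have p: "min z (2 * (sqrt 2 * q $ 1)) = p" and w: "w < 0" by (auto simp: z_def w_def p_def)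
  then have \<alpha>: "0 \<le> \<alpha>" by (simp add: \<alpha>_def)
  note zf = zfun_VC[OF \<alpha>]
  have \<phi>: "phi w t = zfun.W (\<lambda>t. VC 0 0 0 0 (t + \<alpha>, t + \<alpha>, t + \<alpha>, \<alpha>)) (\<lambda>t. D1 VC 0 0 0 0 (t + \<alpha>, t + \<alpha>, t + \<alpha>, \<alpha>) dg)
      (\<lambda>t. D2 VC (t + \<alpha>, t + \<alpha>, t + \<alpha>, \<alpha>) dg dg) t t t"
    if "0 < t" for t
  proof -
    have t: "0 < t + \<alpha>" using that \<alpha> by simp
    show ?thesis
      unfolding zfun_W_polar[OF zf] polar_VC[OF t] using Peq[OF that, of "- 2 * w"] w by (simp add: phi_def \<alpha>_def)
  qed
  define t where "t = y + p / 2 + \<alpha>"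
  have t: "0 < t" using y p0 \<alpha> by (simp add: t_def)
  have "v_AC q = K p (phi w) y * (sinh (sqrt 2 * q $ 3) / sinh y) + T (K p (phi w)) y * (sinh (sqrt 2 * q $ 2) / sinh y)"
    unfolding v_AC_def Let_def F_def R_def y_def[symmetric] z_def[symmetric] p w_def[symmetric] ..
  also have "\<dots> = polar (sqrt 2 * q $ 3) y (VC 0 0 0 0 (t, t, t, \<alpha>)) (D1 VC 0 0 0 0 (t, t, t, \<alpha>) dg) (D2 VC (t, t, t, \<alpha>) dg dg)"
    unfolding t_def zfun_W_polar[OF zf, symmetric] by (rule zfun.KT_combination[OF zf \<phi> y(1) p0 y(2)])
  also have "\<dots> = VC 0 0 0 0 (t - y, t - sqrt 2 * q $ 3, t, \<alpha>)"
    by (rule polar_VC[OF t])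
  also have "(t - y, t - sqrt 2 * q $ 3, t, \<alpha>) = LC q"
    by (simp add: LC_def t_def p_def \<alpha>_def y_def z_def w_def field_simps)
  finally show ?thesis .
qed

lemma EB_derivatives:
  assumes t: "0 < t"
  shows "(EB has_real_derivative EY t) (at t)" "(EY has_real_derivative EY1 t) (at t)"
proof -
  have c: "cosh t * cosh t = 1 + sinh t * sinh t" by (simp add: cosh_square_eq flip: power2_eq_square)
  have s: "sinh t \<noteq> 0" using t by simp
  show "(EB has_real_derivative EY t) (at t)"
    unfolding EB_def[abs_def] EY_def
    by (rule derivative_eq_intros lt_has_real_derivative[OF t] refl)+ (use s in \<open>simp add: field_simps power2_eq_square power3_eq_cube\<close>)
  show "(EY has_real_derivative EY1 t) (at t)"
    unfolding EY_def[abs_def] EY1_def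
    by (rule derivative_eq_intros lt_has_real_derivative[OF t] refl)+ (use s in \<open>simp add: field_simps power2_eq_square power3_eq_cube\<close>)
qed

text \<open>\<open>b0\<close> is the polarization of 2 kap \<open>EB\<close> at a = y = t, so
  passing from \<open>Ltilde\<close> to \<open>psi\<close> subtracts this multiple on the diagonal.
  The derivatives of \<open>EB\<close> are the functions \<open>EY\<close> and \<open>EY1\<close>
  already met in region C.\<close>

lemma zfun_VA_minus_EB:
  assumes w: "0 \<le> w"
  shows "zfun (\<lambda>t. VA 0 0 0 0 (t, t, t, w) + - 2 * kap * EB t) (\<lambda>t. D1 VA 0 0 0 0 (t, t, t, w) dg + - 2 * kap * EY t)
    (\<lambda>t. D2 VA (t, t, t, w) dg dg + - 2 * kap * EY1 t)"
proof -
  interpret zA: zfun "\<lambda>t. VA 0 0 0 0 (t, t, t, w)" "\<lambda>t. D1 VA 0 0 0 0 (t, t, t, w) dg" "\<lambda>t. D2 VA (t, t, t, w) dg dg"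
    by (rule zfun_VA[OF w])
  show ?thesis
  proof
    fix t :: real assume t: "0 < t"
    show "((\<lambda>t. VA 0 0 0 0 (t, t, t, w) + - 2 * kap * EB t) has_real_derivative D1 VA 0 0 0 0 (t, t, t, w) dg + - 2 * kap * EY t) (at t)"
      by (intro DERIV_add DERIV_cmult zA.dZ EB_derivatives t)
    show "((\<lambda>t. D1 VA 0 0 0 0 (t, t, t, w) dg + - 2 * kap * EY t) has_real_derivative D2 VA (t, t, t, w) dg dg + - 2 * kap * EY1 t) (at t)"
      by (intro DERIV_add DERIV_cmult zA.dZ1 EB_derivatives t)
  next
    have "continuous_on {0<..} lt"
      by (rule DERIV_continuous_on, rule has_field_derivative_at_within, rule lt_has_real_derivative) simp
    then have "continuous_on {0<..} EY1"
      unfolding EY1_def[abs_def]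
      by (intro continuous_on_diff continuous_on_mult continuous_on_add continuous_on_power continuous_on_cosh continuous_on_sinh
          continuous_on_const continuous_on_id)
    then show "continuous_on {0<..} (\<lambda>t. D2 VA (t, t, t, w) dg dg + - 2 * kap * EY1 t)"
      by (intro continuous_on_add continuous_on_mult continuous_on_const zA.cZ2)
  next
    fix a :: real assume a: "0 < a"
    obtain B where B: "0 < B" "\<And>t f. a \<le> t \<Longrightarrow> f \<in> {EZ, EZ1, EZ2, EY, EY1, EY2, EB, EQ} \<Longrightarrow> \<bar>f t\<bar> \<le> B"
      using EZ_bounded[OF a] by blast
    obtain B' where B': "\<And>t. a \<le> t \<Longrightarrow> \<bar>VA 0 0 0 0 (t, t, t, w)\<bar> \<le> B' \<and> \<bar>D1 VA 0 0 0 0 (t, t, t, w) dg\<bar> \<le> B' \<and> \<bar>D2 VA (t, t, t, w) dg dg\<bar> \<le> B'"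
      using zA.bZ[OF a] by blast
    have k: "0 < kap" by (simp add: kap_def)
    have kb: "\<bar>- 2 * kap * f t\<bar> \<le> 2 * kap * B" if "a \<le> t" "f \<in> {EZ, EZ1, EZ2, EY, EY1, EY2, EB, EQ}" for f t
      using B(2)[OF that] k by (simp add: abs_mult)
    show "\<exists>B. \<forall>t\<ge>a. \<bar>VA 0 0 0 0 (t, t, t, w) + - 2 * kap * EB t\<bar> \<le> B \<and> \<bar>D1 VA 0 0 0 0 (t, t, t, w) dg + - 2 * kap * EY t\<bar> \<le> B
        \<and> \<bar>D2 VA (t, t, t, w) dg dg + - 2 * kap * EY1 t\<bar> \<le> B"
      by (intro exI[of _ "B' + 2 * kap * B"] allI impI conjI abs_triangle_ineq[THEN order_trans, OF add_mono] kb)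
        (use B' in auto)
  qed
qed

text \<open>Subtracting b_0 before \<open>K\<close> and \<open>T\<close> and restoring b_0, b_1
  afterwards has one net effect on the elementary part: its first argument changes sign. This is the
  origin of \<open>VEB\<close>.\<close>

lemma polar_EB:
  assumes y: "y \<noteq> 0"
  shows "VE 0 0 0 0 (t - y, t - a, t, w) - 2 * kap * polar a y (EB t) (EY t) (EY1 t)
    + (b0 y * sinh a + b1 y * sinh (y - a)) / sinh y = VE 0 0 0 0 (y - t, t - a, t, w)"
proof -
  have sq: "cosh a * cosh a = 1 + sinh a * sinh a" "cosh y * cosh y = 1 + sinh y * sinh y" "cosh t * cosh t = 1 + sinh t * sinh t"
    by (simp_all add: cosh_square_eq flip: power2_eq_square)
  have s: "sinh y \<noteq> 0" using y by simp
  have e: "exp (- y) = cosh y - sinh y" "exp (- 2 * y) = (cosh y - sinh y) ^ 2"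
    by (simp_all add: cosh_minus_sinh flip: exp_double)
  have k: "1 / (2 * sqrt 2) = kap" "2 / (3 * sqrt 2) = 4 / 3 * kap" by (simp_all add: kap_def)
  have b: "b0 y = kap * (1 + (cosh y - sinh y) ^ 2 / 3)" "b1 y = 4 / 3 * kap * (cosh y - sinh y)"
    unfolding b0_def b1_def e k by (rule refl)+
  have e1: "(b0 y * sinh a + b1 y * sinh (y - a)) / sinh y = kap * (2 / 3 * (cosh y - sinh y) * (sinh a + 2 * cosh a))"
    unfolding b sinh_diff using s by (simp add: divide_simps power2_eq_square) (use sq in algebra)
  have e2: "sinh (t - y + (t - a)) = sinh (t - y) * cosh (t - a) + cosh (t - y) * sinh (t - a)"
    "sinh (y - t + (t - a)) = cosh (t - y) * sinh (t - a) - sinh (t - y) * cosh (t - a)"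
    using sinh_add[of "t - y" "t - a"] sinh_diff[of "t - a" "t - y"] by (simp_all add: mult.commute)
  have e3: "sinh (y - t) = - sinh (t - y)" "cosh (y - t) = cosh (t - y)"
    using sinh_minus[of "t - y"] cosh_minus[of "t - y"] by simp_all
  have "2 * polar a y (EB t) (EY t) (EY1 t) = - 2 * cosh (t - a) * sinh (t - y) - 2 * sinh (t - y) * sinh (t - a) * sinh t * lt t
      + 2 / 3 * (cosh y - sinh y) * (sinh a + 2 * cosh a)"
    unfolding polar_def EB_def EY_def EY1_def sinh_diff cosh_diff sinh_add power2_eq_square power3_eq_cube
    by (simp add: field_simps) (use sq in algebra)
  then have e4: "2 * kap * polar a y (EB t) (EY t) (EY1 t) = kap * (- 2 * cosh (t - a) * sinh (t - y)
      - 2 * sinh (t - y) * sinh (t - a) * sinh t * lt t + 2 / 3 * (cosh y - sinh y) * (sinh a + 2 * cosh a))"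
    by (metis mult.assoc mult.left_commute)
  have v: "VE 0 0 0 0 (u, t - a, t, w) = kap * (2 * cosh u * cosh (t - a) * (cosh t * at_exp t) - sinh (u + (t - a))
      - sinh u * sinh (t - a) * (sinh t * lt t))" for u
    by (simp add: VE_def sk_def sh_simps be_simps la_simps)
  show ?thesis unfolding v e1 e2 e3 e4 by (simp only: ring_distribs) simp
qed

text \<open>The case y = a = t of \<open>polar_EB\<close>: the coefficient of b_1 vanishes and both
  elementary parts have first arguments 0.\<close>

lemma polar_EB_diag:
  assumes t: "0 < t"
  shows "2 * kap * polar t t (EB t) (EY t) (EY1 t) = b0 t"
proof -
  have "t \<noteq> 0" using t by simp
  from polar_EB[OF this, of t t 0] show ?thesis using t by simp
qed

lemma v_B_on_SB:
  assumes q: "q \<in> SB" and r: "0 < q $ 3 + q $ 4"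
  shows "v_B q = VB 0 0 0 0 (LB q)"
proof -
  define y z x where "y = sqrt 2 * (q $ 3 + q $ 4)" and "z = sqrt 2 * (q $ 2 - q $ 4)" and "x = sqrt 2 * q $ 1"
  define a b where "a = sqrt 2 * q $ 3" and "b = sqrt 2 * q $ 4"
  define Z Z1 Z2 where Zdef: "Z = (\<lambda>t. VA 0 0 0 0 (t, t, t, x) + - 2 * kap * EB t)"
    "Z1 = (\<lambda>t. D1 VA 0 0 0 0 (t, t, t, x) dg + - 2 * kap * EY t)"
    "Z2 = (\<lambda>t. D2 VA (t, t, t, x) dg dg + - 2 * kap * EY1 t)"
  have q': "0 \<le> q $ 1" "0 \<le> q $ 3" "0 \<le> q $ 4" "q $ 4 \<le> q $ 2" using q by (auto simp: SB_def)
  have y: "0 < y" "y = a + b" using r by (simp_all add: y_def a_def b_def) (simp add: algebra_simps)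
  have z: "0 \<le> z" using q' by (simp add: z_def)
  have x: "0 \<le> x" using q' by (simp add: x_def)
  have zf: "zfun Z Z1 Z2" unfolding Zdef by (rule zfun_VA_minus_EB[OF x])
  have W: "zfun.W Z Z1 Z2 a y t = VA 0 0 0 0 (t - y, t - a, t, x) + - 2 * kap * polar a y (EB t) (EY t) (EY1 t)" if "0 < t" for a y t
    unfolding zfun_W_polar[OF zf] unfolding Zdef polar_add polar_VA[OF that] ..
  have \<phi>: "psi x t = zfun.W Z Z1 Z2 t t t" if "0 < t" for t
    unfolding W[OF that] using polar_EB_diag[OF that] Ltilde_eq[OF that, of x] by (simp add: psi_def)
  define t where "t = y + z / 2"
  have t: "0 < t" using y z by (simp add: t_def)
  have "v_B q = (K z (psi x) y + b0 y) * (sinh a / sinh y) + (T (K z (psi x)) y + b1 y) * (sinh b / sinh y)"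
    unfolding v_B_def Let_def H_B_def R_B_def y_def[symmetric] z_def[symmetric] x_def[symmetric] a_def b_def ..
  also have "\<dots> = K z (psi x) y * (sinh a / sinh y) + T (K z (psi x)) y * (sinh b / sinh y) + (b0 y * sinh a + b1 y * sinh b) / sinh y"
    by (simp add: add_divide_distrib algebra_simps)
  also have "K z (psi x) y * (sinh a / sinh y) + T (K z (psi x)) y * (sinh b / sinh y) = zfun.W Z Z1 Z2 a y t"
    unfolding t_def by (rule zfun.KT_combination[OF zf \<phi> y(1) z y(2)])
  also have "\<dots> + (b0 y * sinh a + b1 y * sinh b) / sinh y
      = VK expX 0 0 0 0 (t - y, t - a, t, x) + (VE 0 0 0 0 (t - y, t - a, t, x) - 2 * kap * polar a y (EB t) (EY t) (EY1 t)
        + (b0 y * sinh a + b1 y * sinh (y - a)) / sinh y)"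
    unfolding W[OF t] using y(2) by (simp add: VA_def)
  also have "\<dots> = VK expX 0 0 0 0 (t - y, t - a, t, x) + VE 0 0 0 0 (y - t, t - a, t, x)"
    using y(1) by (subst polar_EB) auto
  also have "\<dots> = VB 0 0 0 0 (t - y, t - a, t, x)" by (simp add: VB_def VEB_def)
  also have "(t - y, t - a, t, x) = LB q"
    by (simp add: LB_def t_def a_def y_def z_def x_def field_simps)
  finally show ?thesis .
qed

subsection \<open>The function U\<close>

lemma towerD:
  "tower V \<Longrightarrow> i + j + k + l \<le> 1 \<Longrightarrow> 0 < t \<Longrightarrow>
    ((\<lambda>s. V i j k l ((a, b, t, w) + s *\<^sub>R h)) has_real_derivative D1 V i j k l (a, b, t, w) h) (at 0)"
  unfolding tower_def by blast

text \<open>Moments of powers of e_c(t). They suffice for \<open>P\<close>, because e_c(\<alpha>) is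
  an affine function of e_c(\<rho>) with coefficients independent of c.\<close>

definition EI :: "nat \<Rightarrow> real \<Rightarrow> real" where
  "EI k t = (LINT c|lborel. indicator (Cset t) c * (ek 0 c t ^ k * g c))"

lemma integrable_EI:
  assumes "0 < t" shows "integrable lborel (\<lambda>c. indicator (Cset t) c * (ek 0 c t ^ k * g c))"
  unfolding Cset_pos[OF assms] by (intro integrable_continuous_g continuous_intros)

lemma EI_bounded:
  obtains B where "0 \<le> B" "\<And>t k. 0 < t \<Longrightarrow> \<bar>EI k t\<bar> \<le> B"
proof -
  obtain G where G: "0 < G" "\<And>c. 1 < c \<Longrightarrow> \<bar>g c\<bar> \<le> G * dom c" using g_dom1 by blast
  define h where "h c = \<bar>G * dom c\<bar>" for c
  have hi: "integrable lborel h"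
    unfolding h_def by (intro integrable_abs integrable_mult_right integrable_dom)
  show thesis
  proof (rule that[of "integral\<^sup>L lborel h"])
    show "0 \<le> integral\<^sup>L lborel h" by (intro Bochner_Integration.integral_nonneg) (auto simp: h_def)
    fix t :: real and k assume t: "0 < t"
    have "norm (EI k t) \<le> integral\<^sup>L lborel h"
      unfolding EI_def
    proof (rule Bochner_Integration.integral_norm_bound_integral[OF integrable_EI[OF t] hi])
      fix c
      show "norm (indicator (Cset t) c * (ek 0 c t ^ k * g c)) \<le> h c"
      proof (cases "c \<in> Cset t")
        case True
        then have c: "1 < c" "c * sinh t \<le> cosh t" by (auto simp: Cset_def)
        have "exp (- t) \<le> 1" using t by simp
        then have "\<bar>ek 0 c t\<bar> \<le> 1" using ek_neg[OF c, of t] t by linarith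
        then have "\<bar>ek 0 c t ^ k\<bar> \<le> 1" by (simp add: power_abs power_le_one)
        then have "\<bar>ek 0 c t ^ k * g c\<bar> \<le> 1 * \<bar>G * dom c\<bar>"
          unfolding abs_mult[of _ "g c"] using G(2)[OF c(1)] by (intro mult_mono) auto
        then show ?thesis using True c by (simp add: h_def)
      qed (simp add: h_def)
    qed
    then show "\<bar>EI k t\<bar> \<le> integral\<^sup>L lborel h" by simp
  qed
qed

text \<open>The third equation uses cosh t e_c(t) - sinh t e_c'(t) = -1, which lowers the power of
  e_c from three to two.\<close>

lemma VA_by_EI:
  assumes t: "0 < t"
  shows "VA 0 0 0 0 (0, 0, t, 0) = 2 * kap * cosh t * at_exp t + EI 1 t"
    "VA 0 0 0 0 (t, t, t, 0) = kap * EZ t + EI 3 t"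
    "3 * cosh t * VA 0 0 0 0 (t, t, t, 0) - sinh t * D1 VA 0 0 0 0 (t, t, t, 0) dg
      = kap * (3 * cosh t * EZ t - sinh t * EZ1 t) - 3 * EI 2 t"
proof -
  have "II expX 0 0 0 0 (0, 0, t, 0) = EI 1 t"
    unfolding II_def EI_def prod.case by (rule Bochner_Integration.integral_cong) (simp_all add: ek_def expX_def)
  then show "VA 0 0 0 0 (0, 0, t, 0) = 2 * kap * cosh t * at_exp t + EI 1 t"
    by (simp add: VA_def VK_def VE_def sk_def sh_def be_def)
  have "II expX 0 0 0 0 (t, t, t, 0) = EI 3 t"
    unfolding II_def EI_def prod.case
    by (rule Bochner_Integration.integral_cong) (simp_all add: expX_def power3_eq_cube)
  then show Z: "VA 0 0 0 0 (t, t, t, 0) = kap * EZ t + EI 3 t"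
    using VE_diag(1)[OF t, of 0] by (simp add: VA_def VK_def)
  define q where "q c = indicator (Cset t) c * (ek 0 c t ^ 2 * ek 1 c t * g c)" for c
  have iq: "integrable lborel q"
    unfolding q_def[abs_def] Cset_pos[OF t] by (intro integrable_continuous_g continuous_intros)
  have "II expX (Suc 0) 0 0 0 (t, t, t, 0) = integral\<^sup>L lborel q" "II expX 0 (Suc 0) 0 0 (t, t, t, 0) = integral\<^sup>L lborel q"
    "II expX 0 0 (Suc 0) 0 (t, t, t, 0) = integral\<^sup>L lborel q"
    unfolding II_def prod.case
    by (rule Bochner_Integration.integral_cong; simp add: q_def expX_def power2_eq_square mult_ac)+
  then have d: "D1 (VK expX) 0 0 0 0 (t, t, t, 0) dg = 3 * integral\<^sup>L lborel q"
    by (simp add: D1_def VK_def)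
  have "cosh t * EI 3 t - sinh t * integral\<^sup>L lborel q = (LINT c|lborel. cosh t * (indicator (Cset t) c * (ek 0 c t ^ 3 * g c)) - sinh t * q c)"
    unfolding EI_def using iq integrable_EI[OF t, of 3] by simp
  also have "\<dots> = (LINT c|lborel. - (indicator (Cset t) c * (ek 0 c t ^ 2 * g c)))"
  proof (rule Bochner_Integration.integral_cong[OF refl])
    fix c
    have "cosh t * ek 0 c t - sinh t * ek 1 c t = - 1"
      using cosh_square_eq[of t] by (simp add: ek_def algebra_simps power2_eq_square)
    then have "(cosh t * ek 0 c t - sinh t * ek 1 c t) * (indicator (Cset t) c * (ek 0 c t ^ 2 * g c)) = - (indicator (Cset t) c * (ek 0 c t ^ 2 * g c))"
      by simp
    then show "cosh t * (indicator (Cset t) c * (ek 0 c t ^ 3 * g c)) - sinh t * q c = - (indicator (Cset t) c * (ek 0 c t ^ 2 * g c))"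
      by (simp add: q_def algebra_simps power2_eq_square power3_eq_cube)
  qed
  also have "\<dots> = - EI 2 t" by (simp add: EI_def)
  finally have e: "cosh t * EI 3 t - sinh t * integral\<^sup>L lborel q = - EI 2 t" .
  show "3 * cosh t * VA 0 0 0 0 (t, t, t, 0) - sinh t * D1 VA 0 0 0 0 (t, t, t, 0) dg
      = kap * (3 * cosh t * EZ t - sinh t * EZ1 t) - 3 * EI 2 t"
    unfolding Z D_VABC VE_diag[OF t] d using e by (simp add: algebra_simps)
qed

lemma EI_4: "VK ekX 0 0 0 0 (t, t, t, t) = - EI 4 t"
proof -
  have "II ekX 0 0 0 0 (t, t, t, t) = (LINT c|lborel. - (indicator (Cset t) c * (ek 0 c t ^ 4 * g c)))"
    unfolding II_def prod.case
    by (rule Bochner_Integration.integral_cong) (simp_all add: ekX_def eval_nat_numeral mult_ac)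
  then show ?thesis by (simp add: EI_def VK_def)
qed

text \<open>-e_c(t)^4 is the kernel of C with all four arguments equal to t, so the derivative comes
  from \<open>C.tower_VK\<close> in the direction (1, 1, 1, 1); sinh t e_c'(t) = cosh t e_c(t) + 1
  then expresses it through moments.\<close>

lemma EI_4_derivative:
  assumes t: "0 < t"
  shows "(EI 4 has_real_derivative 4 * (cosh t * EI 4 t + EI 3 t) / sinh t) (at t)"
proof -
  define q where "q c = indicator (Cset t) c * (ek 0 c t ^ 3 * ek 1 c t * g c)" for c
  have iq: "integrable lborel q"
    unfolding q_def[abs_def] Cset_pos[OF t] by (intro integrable_continuous_g continuous_intros)
  have "VK ekX i j k l (t, t, t, t) = (LINT c|lborel. - q c)" if "(i, j, k, l) \<in> {(1, 0, 0, 0), (0, 1, 0, 0), (0, 0, 1, 0), (0, 0, 0, 1)}" for i j k l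
  proof -
    have "II ekX i j k l (t, t, t, t) = (LINT c|lborel. - q c)"
      unfolding II_def prod.case
      by (rule Bochner_Integration.integral_cong) (use that in \<open>auto simp: q_def ekX_def power3_eq_cube mult_ac\<close>)
    then show ?thesis using that by (auto simp: VK_def)
  qed
  then have d: "D1 (VK ekX) 0 0 0 0 (t, t, t, t) (1, 1, 1, 1) = - 4 * integral\<^sup>L lborel q"
    by (simp add: D1_def)
  have "((\<lambda>r. VK ekX 0 0 0 0 ((t, t, t, t) + r *\<^sub>R (1, 1, 1, 1))) has_real_derivative D1 (VK ekX) 0 0 0 0 (t, t, t, t) (1, 1, 1, 1)) (at 0)"
    by (rule towerD[OF C.tower_VK]) (use t in auto)
  then have "((\<lambda>r. - VK ekX 0 0 0 0 ((t, t, t, t) + r *\<^sub>R (1, 1, 1, 1))) has_real_derivative 4 * integral\<^sup>L lborel q) (at 0)"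
    using DERIV_minus[of _ "- 4 * integral\<^sup>L lborel q"] unfolding d by fastforce
  then have "((\<lambda>r. EI 4 (r + t)) has_real_derivative 4 * integral\<^sup>L lborel q) (at 0)"
    by (simp add: EI_4 add.commute)
  then have D: "(EI 4 has_real_derivative 4 * integral\<^sup>L lborel q) (at t)"
    using DERIV_at_within_shift[of "EI 4" "4 * integral\<^sup>L lborel q" t 0 UNIV] by (simp add: add.commute)
  have "sinh t * integral\<^sup>L lborel q = (LINT c|lborel. sinh t * q c)" by simp
  also have "\<dots> = (LINT c|lborel. cosh t * (indicator (Cset t) c * (ek 0 c t ^ 4 * g c)) + indicator (Cset t) c * (ek 0 c t ^ 3 * g c))"
  proof (rule Bochner_Integration.integral_cong[OF refl])
    fix c
    have e: "sinh t * ek 1 c t = cosh t * ek 0 c t + 1"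
      using cosh_square_eq[of t] by (simp add: ek_def algebra_simps power2_eq_square)
    have "sinh t * q c = (sinh t * ek 1 c t) * (indicator (Cset t) c * (ek 0 c t ^ 3 * g c))" by (simp add: q_def)
    also have "\<dots> = cosh t * (indicator (Cset t) c * (ek 0 c t ^ 4 * g c)) + indicator (Cset t) c * (ek 0 c t ^ 3 * g c)"
      unfolding e by (simp add: algebra_simps eval_nat_numeral)
    finally show "sinh t * q c = cosh t * (indicator (Cset t) c * (ek 0 c t ^ 4 * g c)) + indicator (Cset t) c * (ek 0 c t ^ 3 * g c)" .
  qed
  also have "\<dots> = cosh t * EI 4 t + EI 3 t"
    unfolding EI_def using integrable_EI[OF t] by simp
  finally have "integral\<^sup>L lborel q = (cosh t * EI 4 t + EI 3 t) / sinh t"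
    using t by (simp add: field_simps)
  then show ?thesis using D by simp
qed

lemma at_exp_tendsto: "(at_exp \<longlongrightarrow> 0) at_top"
  unfolding at_exp_def[abs_def] by real_asymp

text \<open>The substitution r = coth t turns arccoth r into t and sqrt(r^2 - 1) into 1 / sinh t.
  The right-hand side has the shape of minus the derivative of a quotient by cosh t, as required for
  \<open>U\<close>.\<close>

lemma H_eq:
  assumes t: "0 < t"
  shows "H t = - ((g (cosh t / sinh t) / sinh t ^ 2 - kap / cosh t) / 5 - kap * cosh t) / cosh t ^ 2"
proof -
  define S C where "S = sinh t" and "C = cosh t"
  have S: "0 < S" and C: "0 < C" and sq: "C * C = 1 + S * S"
    using t by (auto simp: S_def C_def cosh_square_eq simp flip: power2_eq_square)
  have d: "sinh (2 * t) = 2 * S * C" "cosh (2 * t) = C * C + S * S"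
    by (simp_all add: sinh_double cosh_double S_def C_def power2_eq_square)
  have d4: "sinh (4 * t) = 2 * (2 * S * C) * (C * C + S * S)"
    using sinh_double[of "2 * t"] d by simp
  have d6: "sinh (6 * t) = sinh (4 * t) * cosh (2 * t) + cosh (4 * t) * sinh (2 * t)"
    using sinh_add[of "4 * t" "2 * t"] by simp
  have c4: "cosh (4 * t) = (C * C + S * S) * (C * C + S * S) + (2 * S * C) * (2 * S * C)"
    using cosh_double[of "2 * t"] d by (simp add: power2_eq_square)
  have "(C / S + 1) / (C / S - 1) = exp t / exp (- t)"
  proof -
    have "C + S = exp t" "C - S = exp (- t)" by (simp_all add: C_def S_def cosh_plus_sinh cosh_minus_sinh)
    moreover have "(C / S + 1) / (C / S - 1) = (C + S) / (C - S)" using S by (simp add: divide_simps)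
    ultimately show ?thesis by simp
  qed
  then have ar: "arccoth (C / S) = t" by (simp add: arccoth_def ln_div)
  have r: "sqrt ((C / S)\<^sup>2 - 1) = 1 / S" using coth_sq[OF t] by (simp add: C_def S_def)
  have k: "kap = 1 / (2 * sqrt 2)" by (simp add: kap_def)
  have X: "(C / S)\<^sup>2 - 1 = 1 / (S * S)" using S sq by (simp add: field_simps power2_eq_square)
  have gS: "g (C / S) = (8 * S ^ 5 - 25 * C\<^sup>2 * S ^ 3 + 15 * C ^ 4 * S - 15 * C * t) / (16 * sqrt 2 * C * S ^ 3)"
    unfolding g_def ar r unfolding X using S C by (simp add: divide_simps eval_nat_numeral) (simp add: algebra_simps)
  have "g (C / S) / S ^ 2 = (8 * S ^ 5 - 25 * C\<^sup>2 * S ^ 3 + 15 * C ^ 4 * S - 15 * C * t) / (16 * sqrt 2 * C * S ^ 5)"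
    unfolding gS using S by (simp add: eval_nat_numeral)
  then have R: "- ((g (C / S) / S ^ 2 - kap / C) / 5 - kap * C) / C ^ 2
      = (- (8 * S ^ 5 - 25 * C\<^sup>2 * S ^ 3 + 15 * C ^ 4 * S - 15 * C * t) + 8 * S ^ 5 + 40 * C ^ 2 * S ^ 5) / (80 * sqrt 2 * C ^ 3 * S ^ 5)"
    unfolding k using S C by (simp add: divide_simps eval_nat_numeral) (simp add: algebra_simps)
  have L: "H t = 3 * (t / 16 - 2 * S * C / 64 - sinh (4 * t) / 64 + sinh (6 * t) / 192) / (sqrt 2 * S ^ 5 * C ^ 2)"
    unfolding H_def d S_def C_def by simp
  have "80 * C ^ 3 * S ^ 5 * (3 * (t / 16 - 2 * S * C / 64 - sinh (4 * t) / 64 + sinh (6 * t) / 192))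
     = (- (8 * S ^ 5 - 25 * C\<^sup>2 * S ^ 3 + 15 * C ^ 4 * S - 15 * C * t) + 8 * S ^ 5 + 40 * C ^ 2 * S ^ 5) * (S ^ 5 * C ^ 2)"
  proof -
    have "5 * C * (192 * t - 96 * S * C - 48 * sinh (4 * t) + 16 * sinh (6 * t)) / 64
      = - (8 * S ^ 5 - 25 * C\<^sup>2 * S ^ 3 + 15 * C ^ 4 * S - 15 * C * t) + 8 * S ^ 5 + 40 * C ^ 2 * S ^ 5"
      unfolding d6 c4 d4 d using sq by (simp add: eval_nat_numeral) algebra
    note e = this
    show ?thesis
      unfolding e[symmetric] by (simp add: eval_nat_numeral algebra_simps)
  qed
  then have "H t = (- (8 * S ^ 5 - 25 * C\<^sup>2 * S ^ 3 + 15 * C ^ 4 * S - 15 * C * t) + 8 * S ^ 5 + 40 * C ^ 2 * S ^ 5) / (80 * sqrt 2 * C ^ 3 * S ^ 5)"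
    unfolding L using S C by (simp add: frac_eq_eq) (simp add: mult_ac)
  then show ?thesis using R by (simp add: S_def C_def)
qed

text \<open>U / cosh is a tail integral of \<open>H\<close>, so -VA / cosh should be a primitive of
  \<open>H\<close> vanishing at infinity. The kernel part of the quotient rule collapses by cosh r
  e_c'(r) - sinh r e_c(r) = c to the integral of c g(c), which the differential equation of
  \<open>g\<close> evaluates.\<close>

lemma U_eq:
  assumes t: "0 < t"
  shows "U t = VA 0 0 0 0 (0, 0, t, 0)"
proof -
  define N where "N r = - (VA 0 0 0 0 (0, 0, r, 0) / cosh r)" for r
  have dN: "(N has_real_derivative H r) (at r)" if r: "0 < r" for r
  proof -
    have "((\<lambda>s. VA 0 0 0 0 ((0, 0, r, 0) + s *\<^sub>R (0, 0, 1, 0))) has_real_derivative D1 VA 0 0 0 0 (0, 0, r, 0) (0, 0, 1, 0)) (at 0)"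
      by (rule towerD[OF tower_VABC(1)]) (use r in auto)
    then have "((\<lambda>s. VA 0 0 0 0 (0, 0, s + r, 0)) has_real_derivative VA 0 0 1 0 (0, 0, r, 0)) (at 0)"
      by (simp add: D1_def add.commute)
    then have d: "((\<lambda>s. VA 0 0 0 0 (0, 0, s, 0)) has_real_derivative VA 0 0 1 0 (0, 0, r, 0)) (at r)"
      using DERIV_at_within_shift[of "\<lambda>s. VA 0 0 0 0 (0, 0, s, 0)" "VA 0 0 1 0 (0, 0, r, 0)" r 0 UNIV] by (simp add: add.commute)
    define i where "i k c = indicator (Cset r) c * (ek k c r * g c)" for k c
    have ii: "integrable lborel (i k)" for k
      unfolding i_def[abs_def] Cset_pos[OF r] by (intro integrable_continuous_g continuous_intros)
    have e: "II expX 0 0 k 0 (0, 0, r, 0) = integral\<^sup>L lborel (i k)" for k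
      unfolding II_def prod.case by (rule Bochner_Integration.integral_cong) (simp_all add: i_def expX_def ek_def)
    have "cosh r * integral\<^sup>L lborel (i 1) - sinh r * integral\<^sup>L lborel (i 0) = (LINT c|lborel. cosh r * i 1 c - sinh r * i 0 c)"
      using ii by simp
    also have "\<dots> = (LINT c|lborel. indicator (Cset r) c * (c * g c))"
    proof (rule Bochner_Integration.integral_cong[OF refl])
      fix c
      have "cosh r * ek 1 c r - sinh r * ek 0 c r = c"
        using cosh_square_eq[of r] by (simp add: ek_def algebra_simps power2_eq_square)
      then have "(cosh r * ek 1 c r - sinh r * ek 0 c r) * (indicator (Cset r) c * g c) = c * (indicator (Cset r) c * g c)" by simp
      then show "cosh r * i 1 c - sinh r * i 0 c = indicator (Cset r) c * (c * g c)"
        by (simp add: i_def algebra_simps)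
    qed
    also have "5 * \<dots> = g (cosh r / sinh r) / sinh r ^ 2 - kap / cosh r"
    proof -
      let ?\<Phi> = "\<lambda>c. (c\<^sup>2 - 1) * g c - kap * pr 0 c"
      have "5 * (LINT c|lborel. indicator (Cset r) c * (c * g c)) = (LINT c|lborel. indicator (Cset r) c * (5 * c * g c))"
        unfolding Bochner_Integration.integral_mult_right_zero[symmetric]
        by (rule Bochner_Integration.integral_cong) simp_all
      also have "\<dots> = ?\<Phi> (cosh r / sinh r) - ?\<Phi> 1"
      proof (rule Cset_FTC[OF r])
        show "continuous_on UNIV (\<lambda>c::real. 5 * c)" by (intro continuous_intros)
        show "continuous_on {1..cosh r / sinh r} ?\<Phi>"
          by (intro continuous_on_diff continuous_on_mult[OF continuous_on_const] continuous_on_subset[OF Xg_continuous]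
              continuous_on_subset[OF pr_continuous]) auto
        fix c :: real assume c: "1 < c"
        have "(?\<Phi> has_real_derivative 5 * c * g c + r0 c - kap * (c ^ 0 / (c\<^sup>2 * sqrt (c\<^sup>2 - 1)))) (at c)"
          by (intro DERIV_diff DERIV_cmult Xg_derivative pr_derivative c) simp
        then show "(?\<Phi> has_real_derivative 5 * c * g c) (at c)" by (simp add: r0_def)
      qed
      also have "\<dots> = g (cosh r / sinh r) / sinh r ^ 2 - kap / cosh r"
      proof -
        have "(cosh r / sinh r)\<^sup>2 - 1 = 1 / sinh r ^ 2" using r by (simp add: power_divide cosh_square_eq add_divide_distrib)
        then show ?thesis using pr_coth(1)[OF r] by simp
      qed
      finally show ?thesis .
    qed
    finally have k: "cosh r * integral\<^sup>L lborel (i 1) - sinh r * integral\<^sup>L lborel (i 0)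
        = (g (cosh r / sinh r) / sinh r ^ 2 - kap / cosh r) / 5" by simp
    have v: "VA 0 0 1 0 (0, 0, r, 0) = 2 * kap * (sinh r * at_exp r - 1 / 2) + integral\<^sup>L lborel (i 1)"
      "VA 0 0 0 0 (0, 0, r, 0) = 2 * kap * (cosh r * at_exp r) + integral\<^sup>L lborel (i 0)"
      by (simp_all add: VA_def VK_def VE_def sk_def sh_def be_def e)
    have "(N has_real_derivative - ((VA 0 0 1 0 (0, 0, r, 0) * cosh r - VA 0 0 0 0 (0, 0, r, 0) * sinh r) / (cosh r * cosh r))) (at r)"
      unfolding N_def[abs_def] by (intro DERIV_minus DERIV_divide d) (auto intro!: derivative_eq_intros)
    moreover have "VA 0 0 1 0 (0, 0, r, 0) * cosh r - VA 0 0 0 0 (0, 0, r, 0) * sinh r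
        = (cosh r * integral\<^sup>L lborel (i 1) - sinh r * integral\<^sup>L lborel (i 0)) - kap * cosh r"
      unfolding v by (simp add: algebra_simps)
    ultimately show ?thesis unfolding k H_eq[OF r] by (simp only: power2_eq_square minus_divide_left)
  qed
  have H_lim: "((\<lambda>t. H t * exp t) \<longlongrightarrow> 1 / sqrt 2) at_top"
  proof -
    have "((\<lambda>t. 3 / (((exp t - exp (- t)) / 2) ^ 5 * ((exp t + exp (- t)) / 2) ^ 2) *
       (t / 16 - ((exp (2 * t) - exp (- (2 * t))) / 2) / 64 - ((exp (4 * t) - exp (- (4 * t))) / 2) / 64 + ((exp (6 * t) - exp (- (6 * t))) / 2) / 192) * exp t) \<longlongrightarrow> 1) (at_top :: real filter)"
      by (real_asymp simp: eval_nat_numeral)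
    then have "((\<lambda>t. 3 / (sinh t ^ 5 * cosh t ^ 2) * (t / 16 - sinh (2 * t) / 64 - sinh (4 * t) / 64 + sinh (6 * t) / 192) * exp t) \<longlongrightarrow> 1) (at_top :: real filter)"
      unfolding sinh_field_def cosh_field_def .
    then have "((\<lambda>t. 1 / sqrt 2 * (3 / (sinh t ^ 5 * cosh t ^ 2) * (t / 16 - sinh (2 * t) / 64 - sinh (4 * t) / 64 + sinh (6 * t) / 192) * exp t)) \<longlongrightarrow> 1 / sqrt 2 * 1) (at_top :: real filter)"
      by (rule tendsto_mult[OF tendsto_const])
    then show ?thesis by (simp add: H_def mult.assoc)
  qed
  have cH: "continuous_on {t..} H"
    unfolding H_def[abs_def] using t by (auto intro!: continuous_intros)
  obtain B where B: "0 < B" "\<And>x. t \<le> x \<Longrightarrow> \<bar>H x * exp x\<bar> \<le> B"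
    by (rule bounded_atLeast[OF continuous_on_mult[OF cH continuous_on_exp[OF continuous_on_id]] H_lim]) auto
  have "integral {t..} H = 0 - N t"
  proof (rule improper_FTC[OF cH])
    show "(N has_real_derivative H x) (at x)" if "t \<le> x" for x using dN that t by simp
    obtain E where E: "0 \<le> E" "\<And>t k. 0 < t \<Longrightarrow> \<bar>EI k t\<bar> \<le> E" using EI_bounded by metis
    have "((\<lambda>x. - (2 * kap * at_exp x + EI 1 x / cosh x)) \<longlongrightarrow> - (2 * kap * 0 + 0)) at_top"
    proof (intro tendsto_minus tendsto_add tendsto_mult tendsto_const at_exp_tendsto)
      have "((\<lambda>x::real. E / ((exp x + exp (- x)) / 2)) \<longlongrightarrow> 0) at_top" by real_asymp
      then have l: "((\<lambda>x::real. E / cosh x) \<longlongrightarrow> 0) at_top" unfolding cosh_field_def .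
      show "((\<lambda>x. EI 1 x / cosh x) \<longlongrightarrow> 0) at_top"
      proof (rule Lim_null_comparison[OF _ l])
        show "\<forall>\<^sub>F x in at_top. norm (EI 1 x / cosh x) \<le> E / cosh x"
          using eventually_gt_at_top[of 0] by eventually_elim (use E in \<open>auto simp: abs_divide intro!: divide_right_mono\<close>)
      qed
    qed
    moreover have "\<forall>\<^sub>F x in at_top. - (2 * kap * at_exp x + EI 1 x / cosh x) = N x"
      using eventually_gt_at_top[of 0] by eventually_elim (simp add: N_def VA_by_EI add_divide_distrib)
    ultimately show "(N \<longlongrightarrow> 0) at_top" using Lim_transform_eventually by fastforce
    show "\<bar>H x\<bar> \<le> B * exp (- x)" if "t \<le> x" for x
    proof -
      have "\<bar>H x\<bar> * exp x * exp (- x) \<le> B * exp (- x)" using B(2)[OF that] by (intro mult_right_mono) (auto simp: abs_mult)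
      then show ?thesis by (simp add: mult.assoc flip: exp_add)
    qed
  qed
  then show ?thesis by (simp add: U_def N_def)
qed

subsection \<open>The function P\<close>

text \<open>The elementary counterpart of \<open>EI_4_derivative\<close>: V = kap EQ - EI 4
  satisfies sinh V' = 4 (cosh V - Z), where Z is the restriction of \<open>VA\<close> at w = 0 to
  the diagonal.\<close>

lemma EQ_derivative:
  assumes t: "0 < t"
  shows "(EQ has_real_derivative 4 * (cosh t * EQ t - EZ t) / sinh t) (at t)"
proof -
  have c: "cosh t * cosh t = 1 + sinh t * sinh t" by (simp add: cosh_square_eq flip: power2_eq_square)
  have s: "sinh t \<noteq> 0" using t by simp
  define A where "A = at_exp t"
  define L where "L = lt t"
  have "(EQ has_real_derivative 8 * cosh t ^ 3 * sinh t * A + 2 * cosh t ^ 4 * (- 1 / (2 * cosh t)) - 3 * cosh t - 15 * sinh t ^ 2 * cosh t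
      - (12 * sinh t ^ 2 * cosh t * cosh t + 4 * sinh t ^ 3 * sinh t) * L - 4 * sinh t ^ 3 * cosh t * (1 / sinh t)) (at t)"
    unfolding EQ_def[abs_def] A_def L_def
    by (rule derivative_eq_intros lt_has_real_derivative[OF t] at_exp_has_real_derivative refl)+ (simp add: eval_nat_numeral algebra_simps)
  moreover have "8 * cosh t ^ 3 * sinh t * A + 2 * cosh t ^ 4 * (- 1 / (2 * cosh t)) - 3 * cosh t - 15 * sinh t ^ 2 * cosh t
      - (12 * sinh t ^ 2 * cosh t * cosh t + 4 * sinh t ^ 3 * sinh t) * L - 4 * sinh t ^ 3 * cosh t * (1 / sinh t)
    = 4 * (cosh t * EQ t - EZ t) / sinh t"
    unfolding EQ_def EZ_def A_def[symmetric] L_def[symmetric] using s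
    by (simp add: divide_simps eval_nat_numeral) (use c in algebra)
  ultimately show ?thesis by simp
qed

lemma continuous_on_U_formula: "continuous_on {0<..} (\<lambda>t. VA 0 0 0 0 (0, 0, t, 0))"
proof -
  have "continuous_on A.Dom (VA 0 0 0 0)" using ctower_VABC(1) unfolding ctower_def by simp
  then show ?thesis
    by (rule continuous_on_compose2) (auto simp: A.Dom_def intro!: continuous_intros)
qed

lemma integrable_exp_decay:
  fixes f :: "real \<Rightarrow> real"
  assumes f: "continuous_on {a..} f" and b: "\<And>x. a \<le> x \<Longrightarrow> \<bar>f x\<bar> \<le> B * exp (- x)"
  shows "f integrable_on {a..}"
proof (rule measurable_bounded_by_integrable_imp_integrable)
  show "f \<in> borel_measurable (lebesgue_on {a..})"
    by (rule continuous_imp_measurable_on_sets_lebesgue[OF f]) simp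
  show "(\<lambda>x. B * exp (- x)) integrable_on {a..}"
    using integrable_on_mult_right[of "\<lambda>x. exp (- 1 * x)" "{a..}" B] integrable_on_exp_minus_to_infinity[of 1 a] by simp
qed (use b in auto)

text \<open>In the variable x = coth t the ratio sinh(t - \<alpha>) / sinh t is linear with slope
  -sinh \<alpha>. Both integrals therefore follow by repeated integration by parts once iterated
  primitives of U / sinh^3 are known.\<close>

lemma P_integrals:
  fixes \<alpha> \<rho> :: real
  assumes \<rho>: "0 < \<rho>" and \<alpha>: "0 \<le> \<alpha>" "\<alpha> \<le> \<rho>"
  defines "\<sigma> \<equiv> sinh \<alpha>" and "m \<equiv> sinh (\<rho> - \<alpha>) / sinh \<rho>"
    and "z0 \<equiv> VA 0 0 0 0 (\<rho>, \<rho>, \<rho>, 0)" and "z1 \<equiv> D1 VA 0 0 0 0 (\<rho>, \<rho>, \<rho>, 0) dg" and "v0 \<equiv> kap * EQ \<rho> - EI 4 \<rho>"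
  shows "integral {\<rho>..} (\<lambda>r. sinh (r - \<alpha>) * U r / sinh r ^ 4)
      = (m * (3 * cosh \<rho> * z0 - sinh \<rho> * z1) / sinh \<rho> ^ 2 + \<sigma> * z0 / sinh \<rho> ^ 3) / 6" (is "?I0 = _")
    and "integral {\<rho>..} (\<lambda>r. sinh (r - \<alpha>) ^ 2 * U r / sinh r ^ 5)
      = (m ^ 2 * (3 * cosh \<rho> * z0 - sinh \<rho> * z1) / sinh \<rho> ^ 2 + 2 * \<sigma> * m * z0 / sinh \<rho> ^ 3 + 2 * \<sigma> ^ 2 * v0 / sinh \<rho> ^ 4 / 4) / 6" (is "?I1 = _")
    and "(\<lambda>r. sinh (r - \<alpha>) * U r / sinh r ^ 4) integrable_on {\<rho>..}"
    and "(\<lambda>r. sinh (r - \<alpha>) ^ 2 * U r / sinh r ^ 5) integrable_on {\<rho>..}"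
proof -
  define Z Z1 Z2 where Zd: "Z = (\<lambda>t. VA 0 0 0 0 (t, t, t, 0))" "Z1 = (\<lambda>t. D1 VA 0 0 0 0 (t, t, t, 0) dg)" "Z2 = (\<lambda>t. D2 VA (t, t, t, 0) dg dg)"
  interpret z: zfun Z Z1 Z2 unfolding Zd by (rule zfun_VA) simp
  define V where "V t = kap * EQ t - EI 4 t" for t
  \<comment> \<open>With x = coth t, so that dx/dt = -1 / sinh(t)^2, one has dy0/dx = y1, dy1/dx =
    y2 and dy2/dx = 6 U / sinh t.\<close>
  define y0 y1 y2 where "y0 t = V t / sinh t ^ 4 / 4" and "y1 t = Z t / sinh t ^ 3" and "y2 t = (3 * cosh t * Z t - sinh t * Z1 t) / sinh t ^ 2" for t
  define n where "n t = sinh (t - \<alpha>) / sinh t" for t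
  have UW: "U t = z.W t t t" if t: "0 < t" for t
    unfolding zfun_W_polar[OF z.zfun_axioms] unfolding Zd polar_VA[OF t] using U_eq[OF t] by simp
  have d: "(n has_real_derivative \<sigma> / sinh t ^ 2) (at t)" "(y0 has_real_derivative - y1 t / sinh t ^ 2) (at t)"
    "(y1 has_real_derivative - y2 t / sinh t ^ 2) (at t)" "(y2 has_real_derivative - 6 * U t / sinh t ^ 3) (at t)"
    if t: "0 < t" for t
  proof -
    have s: "sinh t \<noteq> 0" using t by simp
    have c: "cosh t * cosh t = 1 + sinh t * sinh t" by (simp add: cosh_square_eq flip: power2_eq_square)
    have "sinh \<alpha> = cosh (t - \<alpha>) * sinh t - sinh (t - \<alpha>) * cosh t"
      using sinh_diff[of t "t - \<alpha>"] by (simp add: mult.commute)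
    then show "(n has_real_derivative \<sigma> / sinh t ^ 2) (at t)"
      unfolding n_def[abs_def] using s by (auto intro!: derivative_eq_intros simp: \<sigma>_def power2_eq_square)
    have "(V has_real_derivative 4 * (cosh t * V t - Z t) / sinh t) (at t)"
    proof -
      have "(V has_real_derivative kap * (4 * (cosh t * EQ t - EZ t) / sinh t) - 4 * (cosh t * EI 4 t + EI 3 t) / sinh t) (at t)"
        unfolding V_def[abs_def] by (intro DERIV_diff DERIV_cmult EQ_derivative EI_4_derivative t)
      moreover have "kap * (4 * (cosh t * EQ t - EZ t) / sinh t) - 4 * (cosh t * EI 4 t + EI 3 t) / sinh t = 4 * (cosh t * V t - Z t) / sinh t"
        unfolding V_def Zd VA_by_EI(2)[OF t] using s by (simp add: field_simps)
      ultimately show ?thesis by simp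
    qed
    then show "(y0 has_real_derivative - y1 t / sinh t ^ 2) (at t)"
      unfolding y0_def[abs_def] y1_def using s by (auto intro!: derivative_eq_intros simp: field_simps eval_nat_numeral)
    show "(y1 has_real_derivative - y2 t / sinh t ^ 2) (at t)"
      unfolding y1_def[abs_def] y2_def using s by (auto intro!: derivative_eq_intros z.dZ t simp: field_simps eval_nat_numeral)
    have "(y2 has_real_derivative ((3 * (sinh t * Z t + cosh t * Z1 t) - (cosh t * Z1 t + sinh t * Z2 t)) * sinh t ^ 2
        - (3 * cosh t * Z t - sinh t * Z1 t) * (2 * sinh t * cosh t)) / (sinh t ^ 2 * sinh t ^ 2)) (at t)"
      unfolding y2_def[abs_def] using s
      by (intro DERIV_divide) (auto intro!: derivative_eq_intros z.dZ z.dZ1 t simp: field_simps)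
    moreover have "((3 * (sinh t * Z t + cosh t * Z1 t) - (cosh t * Z1 t + sinh t * Z2 t)) * sinh t ^ 2
        - (3 * cosh t * Z t - sinh t * Z1 t) * (2 * sinh t * cosh t)) / (sinh t ^ 2 * sinh t ^ 2) = - 6 * U t / sinh t ^ 3"
      unfolding UW[OF t] z.KW_diag[symmetric] z.KW_def
      using s by (simp add: divide_simps power2_eq_square power3_eq_cube) (use c in algebra)
    ultimately show "(y2 has_real_derivative - 6 * U t / sinh t ^ 3) (at t)" by simp
  qed
  obtain B where B: "\<And>r. \<rho> \<le> r \<Longrightarrow> \<bar>Z r\<bar> \<le> B \<and> \<bar>Z1 r\<bar> \<le> B \<and> \<bar>Z2 r\<bar> \<le> B" using z.bZ[OF \<rho>] by blast
  have B0: "0 \<le> B" using B[of \<rho>] by linarith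
  have inv: "((\<lambda>t::real. c / sinh t ^ k) \<longlongrightarrow> 0) at_top" if "k \<in> {3, 4}" for c :: real and k
  proof -
    have "((\<lambda>t::real. c / ((exp t - exp (- t)) / 2) ^ 3) \<longlongrightarrow> 0) at_top" "((\<lambda>t::real. c / ((exp t - exp (- t)) / 2) ^ 4) \<longlongrightarrow> 0) at_top"
      by real_asymp+
    then show ?thesis using that unfolding sinh_field_def by auto
  qed
  have lim: "(y0 \<longlongrightarrow> 0) at_top" "(y1 \<longlongrightarrow> 0) at_top" "(y2 \<longlongrightarrow> 0) at_top"
  proof -
    obtain E where E: "0 \<le> E" "\<And>t k. 0 < t \<Longrightarrow> \<bar>EI k t\<bar> \<le> E" using EI_bounded by metis
    obtain E' where E': "0 < E'" "\<And>t f. \<rho> \<le> t \<Longrightarrow> f \<in> {EZ, EZ1, EZ2, EY, EY1, EY2, EB, EQ} \<Longrightarrow> \<bar>f t\<bar> \<le> E'"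
      using EZ_bounded[OF \<rho>] by blast
    have k: "0 < kap" by (simp add: kap_def)
    show "(y0 \<longlongrightarrow> 0) at_top"
    proof (rule Lim_null_comparison[OF _ inv[of 4 "(kap * E' + E) / 4"]])
      show "\<forall>\<^sub>F t in at_top. norm (y0 t) \<le> (kap * E' + E) / 4 / sinh t ^ 4"
        using eventually_ge_at_top[of \<rho>]
      proof eventually_elim
        fix t assume t: "\<rho> \<le> t"
        have "\<bar>kap * EQ t\<bar> \<le> kap * E'" unfolding abs_mult using E'(2)[OF t] k by (intro mult_mono) auto
        moreover have "\<bar>EI 4 t\<bar> \<le> E" using E(2)[of t 4] t \<rho> by simp
        ultimately have "\<bar>V t\<bar> \<le> kap * E' + E" unfolding V_def by linarith
        then have "\<bar>V t / 4\<bar> \<le> (kap * E' + E) / 4" by simp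
        then have "\<bar>V t / 4 / sinh t ^ 4\<bar> \<le> (kap * E' + E) / 4 / sinh t ^ 4"
          unfolding abs_divide[of _ "sinh t ^ 4"] using t \<rho> by (simp add: divide_right_mono)
        then show "norm (y0 t) \<le> (kap * E' + E) / 4 / sinh t ^ 4" by (simp add: y0_def mult.commute)
      qed
    qed simp
    show "(y1 \<longlongrightarrow> 0) at_top"
    proof (rule Lim_null_comparison[OF _ inv[of 3 B]])
      show "\<forall>\<^sub>F t in at_top. norm (y1 t) \<le> B / sinh t ^ 3"
        using eventually_ge_at_top[of \<rho>] by eventually_elim (use B \<rho> in \<open>auto simp: y1_def abs_divide intro!: divide_right_mono\<close>)
    qed simp
    have "((\<lambda>r. (3 * cosh r * Z r - sinh r * Z1 r) / sinh r ^ 2) \<longlongrightarrow> 0) at_top"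
    proof (rule z.bounded_over_sinh[OF _ \<rho>])
      fix r assume r: "\<rho> \<le> r"
      have "\<bar>cosh r * Z r\<bar> \<le> cosh r * B" "\<bar>sinh r * Z1 r\<bar> \<le> cosh r * B"
        unfolding abs_mult using B[OF r] B0 r \<rho> sinh_le_cosh_real[of r] by (auto intro!: mult_mono)
      then show "\<bar>3 * cosh r * Z r - sinh r * Z1 r\<bar> \<le> 4 * B * cosh r"
        by (simp add: mult_ac)
    qed
    then show "(y2 \<longlongrightarrow> 0) at_top" by (simp add: y2_def[abs_def])
  qed
  have n_lim: "(n \<longlongrightarrow> exp (- \<alpha>)) at_top"
  proof -
    have "((\<lambda>t::real. cosh \<alpha> - ((exp t + exp (- t)) / 2) / ((exp t - exp (- t)) / 2) * sinh \<alpha>) \<longlongrightarrow> cosh \<alpha> - 1 * sinh \<alpha>) at_top"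
      by (intro tendsto_diff tendsto_mult tendsto_const) real_asymp
    then have "((\<lambda>t::real. cosh \<alpha> - cosh t / sinh t * sinh \<alpha>) \<longlongrightarrow> cosh \<alpha> - 1 * sinh \<alpha>) at_top"
      unfolding sinh_field_def[of t for t :: real] cosh_field_def[of t for t :: real] .
    moreover have "\<forall>\<^sub>F t in at_top. cosh \<alpha> - cosh t / sinh t * sinh \<alpha> = n t"
      using eventually_gt_at_top[of 0] by eventually_elim (simp add: n_def sinh_diff field_simps)
    ultimately show ?thesis using Lim_transform_eventually by (fastforce simp: cosh_minus_sinh)
  qed
  obtain D where D: "0 < D" "\<And>x. \<rho> \<le> x \<Longrightarrow> cosh x ^ 2 / sinh x ^ 3 \<le> D * exp (- x)" using sinh_cosh_decay[OF \<rho>] by metis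
  have cU: "continuous_on {\<rho>..} U"
    by (rule continuous_on_eq[OF continuous_on_subset[OF continuous_on_U_formula]]) (use \<rho> U_eq in auto)
  have cn: "continuous_on {\<rho>..} n" unfolding n_def[abs_def] using \<rho> by (auto intro!: continuous_intros)
  have n01: "0 \<le> n r" "n r \<le> 1" if "\<rho> \<le> r" for r
    using that \<rho> \<alpha> by (auto simp: n_def)
  have b: "\<bar>n r ^ k * U r / sinh r ^ 3\<bar> \<le> 3 * B * D * exp (- r)" if r: "\<rho> \<le> r" for r k
  proof -
    have "\<bar>U r\<bar> \<le> 3 * B * cosh r ^ 2"
      using z.KW_bound[of r B r] B[OF r] r \<rho> UW[of r] by (simp add: z.KW_diag)
    then have "n r ^ k * \<bar>U r\<bar> \<le> 1 * (3 * B * cosh r ^ 2)"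
      using n01[OF r] by (intro mult_mono power_le_one) auto
    then have "\<bar>n r ^ k * U r / sinh r ^ 3\<bar> \<le> 1 * (3 * B * cosh r ^ 2) / sinh r ^ 3"
      unfolding abs_divide abs_mult using r \<rho> n01[OF r] by (auto intro!: divide_right_mono)
    also have "\<dots> = 3 * B * (cosh r ^ 2 / sinh r ^ 3)" by simp
    also have "\<dots> \<le> 3 * B * (D * exp (- r))" using D(2)[OF r] B0 by (intro mult_left_mono) auto
    finally show ?thesis by (simp add: mult.assoc)
  qed
  have cf: "continuous_on {\<rho>..} (\<lambda>r. n r ^ k * U r / sinh r ^ 3)" for k
    using \<rho> by (intro continuous_on_divide continuous_on_mult continuous_on_power cn cU continuous_on_sinh continuous_on_id) auto
  have e: "n r ^ 1 * U r / sinh r ^ 3 = sinh (r - \<alpha>) * U r / sinh r ^ 4" "n r ^ 2 * U r / sinh r ^ 3 = sinh (r - \<alpha>) ^ 2 * U r / sinh r ^ 5"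
    if "r \<in> {\<rho>..}" for r using that \<rho> by (auto simp: n_def field_simps eval_nat_numeral)
  show "(\<lambda>r. sinh (r - \<alpha>) * U r / sinh r ^ 4) integrable_on {\<rho>..}"
    using integrable_eq[OF integrable_exp_decay[OF cf b] e(1)] by blast
  show "(\<lambda>r. sinh (r - \<alpha>) ^ 2 * U r / sinh r ^ 5) integrable_on {\<rho>..}"
    using integrable_eq[OF integrable_exp_decay[OF cf b] e(2)] by blast
  have "?I0 = integral {\<rho>..} (\<lambda>r. n r ^ 1 * U r / sinh r ^ 3)"
    by (rule integral_cong) (simp only: e)
  also have "\<dots> = 0 - (- (n \<rho> * y2 \<rho> + \<sigma> * y1 \<rho>) / 6)"
  proof (rule improper_FTC[OF cf _ _ b])
    fix r assume r: "\<rho> \<le> r"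
    then have r0: "0 < r" using \<rho> by simp
    have "((\<lambda>r. - (n r * y2 r + \<sigma> * y1 r) / 6) has_real_derivative
        - ((n r * (- 6 * U r / sinh r ^ 3) + \<sigma> / sinh r ^ 2 * y2 r) + \<sigma> * (- y2 r / sinh r ^ 2)) / 6) (at r)"
      by (auto intro!: derivative_eq_intros d r0)
    then show "((\<lambda>r. - (n r * y2 r + \<sigma> * y1 r) / 6) has_real_derivative n r ^ 1 * U r / sinh r ^ 3) (at r)" by simp
  next
    have "((\<lambda>r. - (n r * y2 r + \<sigma> * y1 r) / 6) \<longlongrightarrow> - (exp (- \<alpha>) * 0 + \<sigma> * 0) / 6) at_top"
      by (intro tendsto_intros n_lim lim) simp
    then show "((\<lambda>r. - (n r * y2 r + \<sigma> * y1 r) / 6) \<longlongrightarrow> 0) at_top" by simp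
  qed
  also have "\<dots> = (n \<rho> * y2 \<rho> + \<sigma> * y1 \<rho>) / 6" by (simp only: diff_0 minus_divide_left minus_minus)
  finally show "?I0 = (m * (3 * cosh \<rho> * z0 - sinh \<rho> * z1) / sinh \<rho> ^ 2 + \<sigma> * z0 / sinh \<rho> ^ 3) / 6"
    by (simp add: n_def m_def y2_def y1_def Zd z0_def z1_def)
  have "?I1 = integral {\<rho>..} (\<lambda>r. n r ^ 2 * U r / sinh r ^ 3)"
    by (rule integral_cong) (simp only: e)
  also have "\<dots> = 0 - (- (n \<rho> ^ 2 * y2 \<rho> + 2 * \<sigma> * n \<rho> * y1 \<rho> + 2 * \<sigma> ^ 2 * y0 \<rho>) / 6)"
  proof (rule improper_FTC[OF cf _ _ b])
    fix r assume r: "\<rho> \<le> r"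
    then have r0: "0 < r" using \<rho> by simp
    have "((\<lambda>r. n r ^ 2 * y2 r + 2 * \<sigma> * n r * y1 r + 2 * \<sigma> ^ 2 * y0 r) has_real_derivative - 6 * (n r ^ 2 * U r / sinh r ^ 3)) (at r)"
      by (rule derivative_eq_intros d r0 refl)+ (simp add: algebra_simps power2_eq_square)
    from DERIV_cdivide[OF DERIV_minus[OF this], of 6]
    show "((\<lambda>r. - (n r ^ 2 * y2 r + 2 * \<sigma> * n r * y1 r + 2 * \<sigma> ^ 2 * y0 r) / 6) has_real_derivative n r ^ 2 * U r / sinh r ^ 3) (at r)" by simp
  next
    have "((\<lambda>r. - (n r ^ 2 * y2 r + 2 * \<sigma> * n r * y1 r + 2 * \<sigma> ^ 2 * y0 r) / 6) \<longlongrightarrow> - (exp (- \<alpha>) ^ 2 * 0 + 2 * \<sigma> * exp (- \<alpha>) * 0 + 2 * \<sigma> ^ 2 * 0) / 6) at_top"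
      by (intro tendsto_intros n_lim lim) simp
    then show "((\<lambda>r. - (n r ^ 2 * y2 r + 2 * \<sigma> * n r * y1 r + 2 * \<sigma> ^ 2 * y0 r) / 6) \<longlongrightarrow> 0) at_top" by simp
  qed
  also have "\<dots> = (n \<rho> ^ 2 * y2 \<rho> + 2 * \<sigma> * n \<rho> * y1 \<rho> + 2 * \<sigma> ^ 2 * y0 \<rho>) / 6"
    by (simp only: diff_0 minus_divide_left minus_minus)
  finally show "?I1 = (m ^ 2 * (3 * cosh \<rho> * z0 - sinh \<rho> * z1) / sinh \<rho> ^ 2 + 2 * \<sigma> * m * z0 / sinh \<rho> ^ 3 + 2 * \<sigma> ^ 2 * v0 / sinh \<rho> ^ 4 / 4) / 6"
    by (simp add: n_def m_def y2_def y1_def y0_def Zd z0_def z1_def v0_def V_def)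
qed

text \<open>exp(2 \<alpha>) - exp(2 r) = -2 exp(\<alpha> + r) sinh(r - \<alpha>) makes the
  exponentials disappear, and the two integrals of \<open>P\<close> become combinations of those in
  \<open>P_integrals\<close>.\<close>

lemma P_reduced:
  fixes y z :: real
  assumes y: "0 < y" and z: "0 < z"
  defines "\<alpha> \<equiv> z / 3"
  defines "\<rho> \<equiv> y + \<alpha>"
  shows "P y z = sinh y ^ 3 / sinh \<rho> ^ 3 * U \<rho>
    + 12 * sinh \<alpha> * sinh \<rho> * integral {\<rho>..} (\<lambda>r. sinh (r - \<alpha>) ^ 2 * U r / sinh r ^ 5)
    - 6 * sinh \<alpha> * sinh y * integral {\<rho>..} (\<lambda>r. sinh (r - \<alpha>) * U r / sinh r ^ 4)"
proof -
  have \<rho>: "0 < \<rho>" "0 \<le> \<alpha>" "\<alpha> \<le> \<rho>" using y z by (simp_all add: \<alpha>_def \<rho>_def)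
  note i = P_integrals(3,4)[OF \<rho>]
  define a where "a = exp \<alpha>"
  have a0: "a \<noteq> 0" by (simp add: a_def)
  have a: "sinh \<alpha> = (a - 1 / a) / 2" "exp (2 * \<alpha>) = a ^ 2" "exp (- 4 * \<alpha>) = 1 / a ^ 4" "exp (- 2 * \<alpha>) = 1 / a ^ 2"
    unfolding a_def sinh_field_def exp_minus inverse_eq_divide
    by (simp_all add: exp_minus inverse_eq_divide flip: exp_of_nat_mult)
  have e1: "exp (- 2 * r) * (exp (2 * \<alpha>) - exp (2 * r)) ^ 2 * U r / sinh r ^ 5 = 4 * a ^ 2 * (sinh (r - \<alpha>) ^ 2 * U r / sinh r ^ 5)"
    and e2: "r \<in> {\<rho>..} \<Longrightarrow> exp (- 2 * r) * (exp (2 * \<alpha>) - exp (2 * r)) * (exp (2 * \<alpha>) - (exp (2 * r) + 1) / 2) * U r / sinh r ^ 5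
      = 4 * a ^ 2 * (sinh (r - \<alpha>) ^ 2 * U r / sinh r ^ 5) - 2 * a * (sinh (r - \<alpha>) * U r / sinh r ^ 4)" for r
  proof -
    define b where "b = exp r"
    have b0: "b \<noteq> 0" by (simp add: b_def)
    have b: "exp (2 * r) = b ^ 2" "exp (- 2 * r) = 1 / b ^ 2" "sinh r = (b - 1 / b) / 2"
      unfolding b_def sinh_field_def by (simp_all add: exp_minus inverse_eq_divide flip: exp_of_nat_mult)
    have s: "sinh (r - \<alpha>) = (b / a - a / b) / 2"
      unfolding b_def a_def sinh_field_def by (simp add: exp_diff)
    have "exp (- 2 * r) * (exp (2 * \<alpha>) - exp (2 * r)) ^ 2 = 4 * a ^ 2 * sinh (r - \<alpha>) ^ 2"
      unfolding s b a using a0 b0 by (simp add: field_simps eval_nat_numeral)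
    then show "exp (- 2 * r) * (exp (2 * \<alpha>) - exp (2 * r)) ^ 2 * U r / sinh r ^ 5 = 4 * a ^ 2 * (sinh (r - \<alpha>) ^ 2 * U r / sinh r ^ 5)"
      by simp
    have "exp (- 2 * r) * (exp (2 * \<alpha>) - exp (2 * r)) * (exp (2 * \<alpha>) - (exp (2 * r) + 1) / 2)
        = 4 * a ^ 2 * sinh (r - \<alpha>) ^ 2 - 2 * a * sinh (r - \<alpha>) * sinh r"
      unfolding s b a using a0 b0 by (simp add: field_simps eval_nat_numeral)
    then have e: "exp (- 2 * r) * (exp (2 * \<alpha>) - exp (2 * r)) * (exp (2 * \<alpha>) - (exp (2 * r) + 1) / 2) * U r / sinh r ^ 5
        = (4 * a ^ 2 * sinh (r - \<alpha>) ^ 2 - 2 * a * sinh (r - \<alpha>) * sinh r) * U r / sinh r ^ 5" by simp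
    show "exp (- 2 * r) * (exp (2 * \<alpha>) - exp (2 * r)) * (exp (2 * \<alpha>) - (exp (2 * r) + 1) / 2) * U r / sinh r ^ 5
      = 4 * a ^ 2 * (sinh (r - \<alpha>) ^ 2 * U r / sinh r ^ 5) - 2 * a * (sinh (r - \<alpha>) * U r / sinh r ^ 4)" if "r \<in> {\<rho>..}"
    proof -
      have "sinh r \<noteq> 0" using that \<rho>(1) by simp
      then show ?thesis unfolding e by (simp add: field_simps eval_nat_numeral)
    qed
  qed
  define I1 I0 where "I1 = integral {\<rho>..} (\<lambda>r. sinh (r - \<alpha>) ^ 2 * U r / sinh r ^ 5)"
    and "I0 = integral {\<rho>..} (\<lambda>r. sinh (r - \<alpha>) * U r / sinh r ^ 4)"
  have "integral {\<rho>..} (\<lambda>r. exp (- 2 * r) * (exp (2 * \<alpha>) - exp (2 * r)) ^ 2 * U r / sinh r ^ 5) = 4 * a ^ 2 * I1"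
    unfolding e1 I1_def by (rule integral_mult_right)
  moreover have "integral {\<rho>..} (\<lambda>r. exp (- 2 * r) * (exp (2 * \<alpha>) - exp (2 * r)) * (exp (2 * \<alpha>) - (exp (2 * r) + 1) / 2) * U r / sinh r ^ 5)
      = integral {\<rho>..} (\<lambda>r. 4 * a ^ 2 * (sinh (r - \<alpha>) ^ 2 * U r / sinh r ^ 5) - 2 * a * (sinh (r - \<alpha>) * U r / sinh r ^ 4))"
    by (rule integral_cong) (rule e2)
  moreover have "\<dots> = 4 * a ^ 2 * I1 - 2 * a * I0"
    unfolding I1_def I0_def using i by (simp only: integral_diff integrable_on_mult_right integral_mult_right)
  ultimately have p: "P y z = sinh y ^ 3 / sinh \<rho> ^ 3 * U \<rho> + 3 / 4 * exp (- y - 4 * \<alpha>) * (exp (2 * \<alpha>) - 1) ^ 2 * (4 * a ^ 2 * I1)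
      + 3 / 2 * sinh y * exp (- 2 * \<alpha>) * (exp (2 * \<alpha>) - 1) * (4 * a ^ 2 * I1 - 2 * a * I0)"
    unfolding P_def Let_def \<alpha>_def[symmetric] \<rho>_def[symmetric] by simp
  have q: "exp (- y - 4 * \<alpha>) = (cosh y - sinh y) / a ^ 4"
    using a(3) by (simp add: cosh_minus_sinh exp_diff divide_inverse exp_minus)
  have r: "sinh \<rho> = sinh y * ((a + 1 / a) / 2) + cosh y * ((a - 1 / a) / 2)"
    unfolding \<rho>_def sinh_add a(1)[symmetric] unfolding a_def cosh_field_def by (simp add: exp_minus inverse_eq_divide)
  have c: "3 / 4 * exp (- y - 4 * \<alpha>) * (exp (2 * \<alpha>) - 1) ^ 2 * (4 * a ^ 2) + 3 / 2 * sinh y * exp (- 2 * \<alpha>) * (exp (2 * \<alpha>) - 1) * (4 * a ^ 2)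
      = 12 * sinh \<alpha> * sinh \<rho>"
    "3 / 2 * sinh y * exp (- 2 * \<alpha>) * (exp (2 * \<alpha>) - 1) * (2 * a) = 6 * sinh \<alpha> * sinh y"
    unfolding q r a using a0 by (simp_all add: field_simps eval_nat_numeral)
  show ?thesis
    unfolding I1_def[symmetric] I0_def[symmetric] p c[symmetric] by (simp only: ring_distribs mult.assoc)
qed

text \<open>With m = sinh(\<rho> - \<alpha>) / sinh \<rho> and n = sinh \<alpha> / sinh \<rho> one
  has e_c(\<alpha>) = n e_c(\<rho>) - m. The kernel -e_c(\<alpha>)^3 e_c(\<rho>) then expands by the
  binomial theorem into the moments \<open>EI 1\<close> to \<open>EI 4\<close>, and \<open>P\<close>
  is the cubic form in m, n with the matching coefficients.\<close>

lemma P_eq: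
  assumes y: "0 < y" and z: "0 < z"
  shows "P y z = VC 0 0 0 0 (z / 3, z / 3, y + z / 3, z / 3)"
proof -
  define \<alpha> where "\<alpha> = z / 3"
  define \<rho> where "\<rho> = y + \<alpha>"
  have \<rho>: "0 < \<rho>" "0 \<le> \<alpha>" "\<alpha> \<le> \<rho>" using y z by (simp_all add: \<alpha>_def \<rho>_def)
  define S C m n where "S = sinh \<rho>" and "C = cosh \<rho>" and "m = sinh (\<rho> - \<alpha>) / sinh \<rho>" and "n = sinh \<alpha> / sinh \<rho>"
  have S: "0 < S" using \<rho> by (simp add: S_def)
  have mn: "sinh y = m * S" "sinh \<alpha> = n * S" "sinh (\<rho> - \<alpha>) = m * S"
    using S by (simp_all add: m_def n_def S_def \<rho>_def)
  have ch: "cosh \<alpha> = m + C * n"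
    using S unfolding m_def n_def sinh_diff C_def by (simp add: S_def field_simps)
  have sq: "C * C = 1 + S * S" "(m + C * n) * (m + C * n) = 1 + (n * S) * (n * S)"
    unfolding mn(2)[symmetric] ch[symmetric] unfolding C_def S_def by (simp_all add: cosh_square_eq flip: power2_eq_square)
  define z0 y2 v0 where "z0 = VA 0 0 0 0 (\<rho>, \<rho>, \<rho>, 0)"
    and "y2 = 3 * C * VA 0 0 0 0 (\<rho>, \<rho>, \<rho>, 0) - S * D1 VA 0 0 0 0 (\<rho>, \<rho>, \<rho>, 0) dg" and "v0 = kap * EQ \<rho> - EI 4 \<rho>"
  have I: "integral {\<rho>..} (\<lambda>r. sinh (r - \<alpha>) * U r / sinh r ^ 4) = (m * y2 / S ^ 2 + n * S * z0 / S ^ 3) / 6"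
    "integral {\<rho>..} (\<lambda>r. sinh (r - \<alpha>) ^ 2 * U r / sinh r ^ 5)
      = (m ^ 2 * y2 / S ^ 2 + 2 * (n * S) * m * z0 / S ^ 3 + 2 * (n * S) ^ 2 * v0 / S ^ 4 / 4) / 6"
    unfolding P_integrals(1,2)[OF \<rho>] mn(2) z0_def y2_def v0_def S_def[symmetric] C_def[symmetric] m_def[symmetric]
    unfolding m_def S_def by (rule refl)+
  have "P y z = sinh y ^ 3 / S ^ 3 * U \<rho>
      + 12 * sinh \<alpha> * S * ((m ^ 2 * y2 / S ^ 2 + 2 * (n * S) * m * z0 / S ^ 3 + 2 * (n * S) ^ 2 * v0 / S ^ 4 / 4) / 6)
      - 6 * sinh \<alpha> * sinh y * ((m * y2 / S ^ 2 + n * S * z0 / S ^ 3) / 6)"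
    using P_reduced[OF y z, folded \<alpha>_def, folded \<rho>_def] unfolding I S_def[symmetric] .
  also have "\<dots> = m ^ 3 * U \<rho> + m ^ 2 * n * y2 + 3 * m * n ^ 2 * z0 + n ^ 3 * v0"
    unfolding mn using S by (simp add: field_simps eval_nat_numeral)
  finally have L: "P y z = \<dots>" .
  have "VK ekX 0 0 0 0 (\<alpha>, \<alpha>, \<rho>, \<alpha>) = II ekX 0 0 0 0 (\<alpha>, \<alpha>, \<rho>, \<alpha>)" by (simp add: VK_def)
  also have "\<dots> = (LINT c|lborel. m ^ 3 * (indicator (Cset \<rho>) c * (ek 0 c \<rho> ^ 1 * g c)) - 3 * m ^ 2 * n * (indicator (Cset \<rho>) c * (ek 0 c \<rho> ^ 2 * g c))
      + 3 * m * n ^ 2 * (indicator (Cset \<rho>) c * (ek 0 c \<rho> ^ 3 * g c)) - n ^ 3 * (indicator (Cset \<rho>) c * (ek 0 c \<rho> ^ 4 * g c)))"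
    unfolding II_def prod.case
  proof (rule Bochner_Integration.integral_cong[OF refl])
    fix c
    have e: "ek 0 c \<alpha> = n * ek 0 c \<rho> - m"
      unfolding ek_def by (simp add: mn ch S_def[symmetric] C_def[symmetric]) (simp add: algebra_simps)
    show "indicator (Cset \<rho>) c * (ek 0 c \<alpha> * ek 0 c \<alpha> * ek 0 c \<rho> * ekX 0 c \<alpha> * g c)
      = m ^ 3 * (indicator (Cset \<rho>) c * (ek 0 c \<rho> ^ 1 * g c)) - 3 * m ^ 2 * n * (indicator (Cset \<rho>) c * (ek 0 c \<rho> ^ 2 * g c))
      + 3 * m * n ^ 2 * (indicator (Cset \<rho>) c * (ek 0 c \<rho> ^ 3 * g c)) - n ^ 3 * (indicator (Cset \<rho>) c * (ek 0 c \<rho> ^ 4 * g c))"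
      unfolding ekX_def e by (simp add: algebra_simps eval_nat_numeral)
  qed
  also have "\<dots> = m ^ 3 * EI 1 \<rho> - 3 * m ^ 2 * n * EI 2 \<rho> + 3 * m * n ^ 2 * EI 3 \<rho> - n ^ 3 * EI 4 \<rho>"
  proof -
    define f where "f k c = indicator (Cset \<rho>) c * (ek 0 c \<rho> ^ k * g c)" for k c
    have "integrable lborel (f k)" for k unfolding f_def[abs_def] by (rule integrable_EI[OF \<rho>(1)])
    then show ?thesis unfolding EI_def f_def[symmetric] by simp
  qed
  finally have k: "VK ekX 0 0 0 0 (\<alpha>, \<alpha>, \<rho>, \<alpha>) = \<dots>" .
  have "\<alpha> + \<alpha> + \<alpha> = 3 * \<alpha>" by simp
  then have "sinh (\<alpha> + \<alpha> + \<alpha>) = 3 * (n * S) + 4 * (n * S) ^ 3"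
    using sinh_add[of "2 * \<alpha>" \<alpha>] sq(2) by (simp add: sinh_double cosh_double mn ch) algebra
  then have "VE4 0 0 0 0 (\<alpha>, \<alpha>, \<rho>, \<alpha>) = kap * (2 * (m + C * n) ^ 3 * (C * at_exp \<rho>) - (3 * (n * S) + 4 * (n * S) ^ 3)
      - (n * S) ^ 3 * (C * lt \<rho> + 1) - 3 * (n * S) ^ 2 * (m + C * n) * (S * lt \<rho>))"
    unfolding VE4_def prod.case
    by (simp add: sk_def sh_simps be_simps la_simps mn ch S_def[symmetric] C_def[symmetric] eval_nat_numeral mult_ac)
      (simp add: algebra_simps)
  also have "\<dots> = m ^ 3 * (2 * kap * C * at_exp \<rho>) + m ^ 2 * n * (kap * (3 * C * EZ \<rho> - S * EZ1 \<rho>)) + 3 * m * n ^ 2 * (kap * EZ \<rho>) + n ^ 3 * (kap * EQ \<rho>)"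
  proof -
    have "2 * (m + C * n) ^ 3 * (C * at_exp \<rho>) - (3 * (n * S) + 4 * (n * S) ^ 3) - (n * S) ^ 3 * (C * lt \<rho> + 1) - 3 * (n * S) ^ 2 * (m + C * n) * (S * lt \<rho>)
      = m ^ 3 * (2 * C * at_exp \<rho>) + m ^ 2 * n * (3 * C * EZ \<rho> - S * EZ1 \<rho>) + 3 * m * n ^ 2 * EZ \<rho> + n ^ 3 * EQ \<rho>"
      unfolding EZ_def EZ1_def EQ_def S_def[symmetric] C_def[symmetric] power2_eq_square power3_eq_cube
      using sq by (simp add: eval_nat_numeral) algebra
    then show ?thesis by (metis (no_types, opaque_lifting) distrib_left mult.assoc mult.left_commute)
  qed
  finally have R: "VE4 0 0 0 0 (\<alpha>, \<alpha>, \<rho>, \<alpha>) = \<dots>" .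
  have y2: "y2 = kap * (3 * C * EZ \<rho> - S * EZ1 \<rho>) - 3 * EI 2 \<rho>"
    using VA_by_EI(3)[OF \<rho>(1)] by (simp only: y2_def S_def C_def)
  have "P y z = VC 0 0 0 0 (\<alpha>, \<alpha>, \<rho>, \<alpha>)"
    unfolding L VC_def R k v0_def y2 z0_def VA_by_EI(1,2)[OF \<rho>(1)] U_eq[OF \<rho>(1)] C_def[symmetric]
    by (simp add: algebra_simps)
  then show ?thesis by (simp add: \<rho>_def \<alpha>_def)
qed

subsection \<open>The chamber and its reflections\<close>

lemma v_regular_w0:
  assumes q: "q \<in> regular_points"
  shows "q $ 2 \<le> q $ 4 \<Longrightarrow> v_AC q = w0 q" "q $ 4 \<le> q $ 2 \<Longrightarrow> v_B q = w0 q"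
proof -
  have o: "0 \<le> q $ 1" "0 \<le> q $ 2" "0 \<le> q $ 3" "0 \<le> q $ 4" and r: "0 < q $ 3 + min (q $ 2) (q $ 4)"
    using q by (auto simp: regular_points_def orthant_def)
  show "v_AC q = w0 q" if c: "q $ 2 \<le> q $ 4"
  proof (cases "q $ 4 - q $ 2 \<le> 2 * q $ 1")
    case True
    then have "q \<in> SA" using o c by (simp add: SA_def)
    then show ?thesis using v_AC_on_SA[of q] w_A(1)[of q] r c by (simp add: add.commute min_def)
  next
    case False
    then have "q \<in> SC" using o c by (simp add: SC_def)
    then show ?thesis using v_AC_on_SC[of q, OF _ _ _ P_eq] w_C(1)[of q] r c False by (simp add: add.commute min_def)
  qed
  show "v_B q = w0 q" if c: "q $ 4 \<le> q $ 2"
  proof -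
    have "q \<in> SB" using o c by (simp add: SB_def)
    moreover have "0 < q $ 3 + q $ 4" using r c by (simp add: min_absorb2)
    ultimately show ?thesis using v_B_on_SB[of q] w_B(1)[of q] by simp
  qed
qed

lemma regular_points_dense:
  assumes q: "q \<in> orthant" shows "q islimpt regular_points"
  unfolding islimpt_approachable
proof (intro allI impI)
  fix e :: real assume e: "0 < e"
  have c: "0 \<le> q $ 1" "0 \<le> q $ 2" "0 \<le> q $ 3" "0 \<le> q $ 4" using q by (auto simp: orthant_def)
  let ?x = "q + vec4 0 0 (e / 2) 0"
  have "vec4 0 0 (e / 2) 0 = (e / 2) *\<^sub>R axis 3 1" by (simp add: vec_eq_iff forall_4 axis_def)
  then have n: "norm (vec4 0 0 (e / 2) 0) = e / 2" using e by simp
  show "\<exists>x'\<in>regular_points. x' \<noteq> q \<and> dist x' q < e"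
  proof (intro bexI[of _ ?x] conjI)
    show "?x \<in> regular_points"
      using c e by (auto simp: regular_points_def orthant_def forall_4 min_def)
    show "?x \<noteq> q" using n e by auto
    show "dist ?x q < e" using n e by (simp add: dist_norm)
  qed
qed

text \<open>\<open>w0\<close> is continuous on the orthant and agrees with the regional formulas on
  the dense set of regular points, so the limit in the definition of \<open>v\<close> exists and
  equals \<open>w0\<close>.\<close>

lemma v_eq_w0:
  assumes q: "q \<in> orthant" shows "v q = w0 q"
proof -
  have r: "v_regular x = w0 x" if "x \<in> regular_points" for x
    using v_regular_w0[OF that] by (simp add: v_regular_def)
  show ?thesis
  proof (cases "q \<in> regular_points")
    case True
    then show ?thesis using r by (simp add: v_def)
  next
    case False
    have "(w0 \<longlongrightarrow> w0 q) (at q within orthant)"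
      using jet_w q by (auto simp: jet_def continuous_within dest!: bspec has_derivative_continuous)
    then have "(w0 \<longlongrightarrow> w0 q) (at q within regular_points)"
      by (rule tendsto_within_subset) (auto simp: regular_points_def)
    then have "(v_regular \<longlongrightarrow> w0 q) (at q within regular_points)"
      by (rule Lim_transform_eventually) (auto simp: eventually_at_filter r)
    then show ?thesis
      using False regular_points_dense[OF q] by (simp add: v_def tendsto_Lim trivial_limit_within)
  qed
qed

lemma exhaust_5:
  fixes x :: 5 shows "x = 1 \<or> x = 2 \<or> x = 3 \<or> x = 4 \<or> x = 5"
proof (induct x)
  case (of_int z)
  then have "0 \<le> z" "z < 5" by simp_all
  \<comment> \<open>The representative 0 is the index 5.\<close>
  then have "z = 0 \<or> z = 1 \<or> z = 2 \<or> z = 3 \<or> z = 4" by arith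
  then show ?case by auto
qed

lemma forall_5: "(\<forall>i::5. Q i) \<longleftrightarrow> Q 1 \<and> Q 2 \<and> Q 3 \<and> Q 4 \<and> Q 5"
  by (metis exhaust_5)

lemma UNIV_5: "UNIV = {1, 2, 3, 4, 5 :: 5}"
  using exhaust_5 by auto

lemma distinct_5: "distinct [1, 2, 3, 4, 5 :: 5]"
  by simp

lemma vector_5: "(vector [a, b, c, d, e] :: real ^ 5) $ 1 = a" "(vector [a, b, c, d, e] :: real ^ 5) $ 2 = b"
  "(vector [a, b, c, d, e] :: real ^ 5) $ 3 = c" "(vector [a, b, c, d, e] :: real ^ 5) $ 4 = d"
  "(vector [a, b, c, d, e] :: real ^ 5) $ 5 = e"
  unfolding vector_def by simp_all

definition gaps :: "real ^ 5 \<Rightarrow> real ^ 4" where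
  "gaps x = vec4 (x $ 2 - x $ 1) (x $ 3 - x $ 2) (x $ 4 - x $ 3) (x $ 5 - x $ 4)"

lemma linear_gaps: "linear gaps"
  by (rule linearI) (simp_all add: gaps_def vec_eq_iff forall_4 algebra_simps)

lemma gaps_orthant: "x \<in> chamber \<Longrightarrow> gaps x \<in> orthant"
  by (auto simp: gaps_def chamber_def orthant_def forall_4)

definition ch0 :: "real ^ 5 \<Rightarrow> real" where "ch0 x = x $ 5 + w0 (gaps x)"

definition ch1 :: "real ^ 5 \<Rightarrow> real ^ 5 \<Rightarrow> real" where "ch1 x h = h $ 5 + w1 (gaps x) (gaps h)"

definition ch2 :: "real ^ 5 \<Rightarrow> real ^ 5 \<Rightarrow> real ^ 5 \<Rightarrow> real" where "ch2 x h k = w2 (gaps x) (gaps h) (gaps k)"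

lemma jet_chamber: "jet chamber ch0 ch1 ch2"
proof -
  have "jet chamber (\<lambda>x. w0 (gaps x)) (\<lambda>x h. w1 (gaps x) (gaps h)) (\<lambda>x h k. w2 (gaps x) (gaps h) (gaps k))"
    by (rule jet_linear_pullback[OF jet_w linear_gaps]) (use gaps_orthant in auto)
  from jet_add_linear[OF this bounded_linear_vec_nth[of 5]] show ?thesis
    by (simp add: ch0_def[abs_def] ch1_def[abs_def] ch2_def[abs_def])
qed

lemma chamber_fun_eq: "x \<in> chamber \<Longrightarrow> chamber_fun x = ch0 x"
  using v_eq_w0[OF gaps_orthant, of x] by (simp add: chamber_fun_def ch0_def gaps_def vec4_def)

lemma jet_linear:
  assumes J: "jet S f f1 f2" and x: "x \<in> S"
  shows "linear (f1 x)" "linear (f2 x h)" "f2 x h k = f2 x k h"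
  using J x has_derivative_linear unfolding jet_def by blast+

text \<open>A vector tangential to the wall is the difference of its positive and negative parts.
  Both can be added to \<open>q\<close> without leaving the wall inside the orthant, so
  \<open>jet_wall_tangential\<close> applies to each.\<close>

lemma w2_wall:
  assumes q: "q \<in> orthant" "q $ m = 0" and c: "\<And>q. q \<in> orthant \<Longrightarrow> q $ m = 0 \<Longrightarrow> w1 q n = c" and h: "h $ m = 0"
  shows "w2 q n h = 0"
proof -
  define W where "W = {q \<in> orthant. q $ m = 0}"
  have "convex W" unfolding W_def orthant_def convex_def by auto
  then have t: "w2 q n (y - q) = 0" if "y \<in> W" for y
    using that q by (intro jet_wall_tangential[OF jet_w, of W]) (auto simp: W_def c)
  define h' where "h' s = (\<chi> i. max (s * h $ i) 0)" for s :: real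
  have "q + h' s \<in> W" for s
    using q h by (auto simp: W_def orthant_def h'_def)
  from t[OF this] have "w2 q n (h' s) = 0" for s by simp
  moreover have "h = h' 1 - h' (- 1)" by (simp add: h'_def vec_eq_iff max_def)
  ultimately show ?thesis using linear_diff[OF jet_linear(2)[OF jet_w q(1), of n], of "h' 1" "h' (- 1)"] by simp
qed

section \<open>Invariance of the jet under permutations fixing a point\<close>

definition pv :: "(5 \<Rightarrow> 5) \<Rightarrow> real ^ 5 \<Rightarrow> real ^ 5" where
  "pv p x = (\<chi> i. x $ p i)"

lemma pv_nth [simp]: "pv p x $ i = x $ p i"
  by (simp add: pv_def)

lemma linear_pv: "linear (pv p)"
  by (rule linearI) (simp_all add: vec_eq_iff)

lemma pv_comp: "pv (p \<circ> r) x = pv r (pv p x)"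
  by (simp add: vec_eq_iff)

definition preserves :: "real ^ 5 \<Rightarrow> (5 \<Rightarrow> 5) \<Rightarrow> bool" where
  "preserves y p \<longleftrightarrow> (\<forall>h. ch1 y (pv p h) = ch1 y h) \<and> (\<forall>h k. ch2 y (pv p h) (pv p k) = ch2 y h k)"

lemma preserves_comp: "preserves y p \<Longrightarrow> preserves y r \<Longrightarrow> preserves y (p \<circ> r)"
  by (simp add: preserves_def pv_comp)

text \<open>Every vector splits into a part fixed by the transposition and a multiple of n = e_j -
  e_i, whose sign the transposition reverses. The first derivative kills n, and the second has no
  mixed entries between n and fixed vectors, so it sees only the product of two reversed
  signs.\<close>

lemma preserves_adjacent:
  assumes y: "y \<in> chamber" and ij: "i \<noteq> j" and m: "\<And>x. gaps x $ m = x $ j - x $ i" and e: "y $ i = y $ j"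
    and c: "\<And>q. q \<in> orthant \<Longrightarrow> q $ m = 0 \<Longrightarrow> w1 q (gaps (axis j 1 - axis i 1)) = - (axis j 1 - axis i 1 :: real ^ 5) $ 5"
  shows "preserves y (Transposition.transpose i j)"
proof -
  define n :: "real ^ 5" where "n = axis j 1 - axis i 1"
  note l1 = jet_linear(1)[OF jet_chamber y] and l2 = jet_linear(2)[OF jet_chamber y] and s = jet_linear(3)[OF jet_chamber y]
  have g: "gaps y \<in> orthant" "gaps y $ m = 0" using gaps_orthant[OF y] m[of y] e by auto
  have n1: "ch1 y n = 0" using c[OF g] by (simp add: ch1_def n_def)
  have n2: "ch2 y n k = 0" if "k $ i = k $ j" for k
    unfolding ch2_def using w2_wall[OF g, of "gaps n" _ "gaps k"] c m[of k] that by (auto simp: n_def)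
  have t: "pv (Transposition.transpose i j) h = h + (h $ i - h $ j) *\<^sub>R n" for h
    using ij by (auto simp: vec_eq_iff n_def axis_def Transposition.transpose_def)
  have d: "\<exists>h' a. h' $ i = h' $ j \<and> h = h' + a *\<^sub>R n \<and> pv (Transposition.transpose i j) h = h' + (- a) *\<^sub>R n" for h
    by (intro exI[of _ "h + ((h $ i - h $ j) / 2) *\<^sub>R n"] exI[of _ "- ((h $ i - h $ j) / 2)"])
      (use ij in \<open>auto simp: t vec_eq_iff n_def axis_def field_simps\<close>)
  have add2: "ch2 y (h + h') k = ch2 y h k + ch2 y h' k" "ch2 y (r *\<^sub>R h) k = r * ch2 y h k" for h h' k r
    using linear_add[OF l2, of k h h'] linear_scale[OF l2, of k r h] s by simp_all
  have exp: "ch2 y (h' + a *\<^sub>R n) (k' + b *\<^sub>R n) = ch2 y h' k' + a * b * ch2 y n n"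
    if "h' $ i = h' $ j" "k' $ i = k' $ j" for h' k' a b
    using n2[OF that(1)] n2[OF that(2)] s[of h' n]
    by (simp add: add2 linear_add[OF l2] linear_scale[OF l2])
  have "ch2 y (pv (Transposition.transpose i j) h) (pv (Transposition.transpose i j) k) = ch2 y h k" for h k
  proof -
    obtain h' a where h: "h' $ i = h' $ j" "h = h' + a *\<^sub>R n" "pv (Transposition.transpose i j) h = h' + (- a) *\<^sub>R n" using d by blast
    obtain k' b where k: "k' $ i = k' $ j" "k = k' + b *\<^sub>R n" "pv (Transposition.transpose i j) k = k' + (- b) *\<^sub>R n" using d by blast
    show ?thesis unfolding h(3) k(3) unfolding h(2) k(2) exp[OF h(1) k(1)] by simp
  qed
  moreover have "ch1 y (pv (Transposition.transpose i j) h) = ch1 y h" for h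
    unfolding t using n1 by (simp add: linear_add[OF l1] linear_scale[OF l1])
  ultimately show ?thesis by (simp add: preserves_def)
qed

text \<open>A transposition of i and k is a conjugate of that of j and k by that of i and j.\<close>

lemma preserves_trans:
  assumes "preserves y (Transposition.transpose i j)" "preserves y (Transposition.transpose j k)" "i \<noteq> k" "j \<noteq> k"
  shows "preserves y (Transposition.transpose i k)"
proof -
  have "Transposition.transpose i k = Transposition.transpose i j \<circ> Transposition.transpose j k \<circ> Transposition.transpose i j"
    using assms(3,4) by (auto simp: fun_eq_iff Transposition.transpose_def)
  then show ?thesis using assms(1,2) by (simp add: preserves_comp)
qed

text \<open>In the chamber equality of two coordinates forces equality of all between them, so
  non-adjacent transpositions are built from adjacent ones.\<close>

lemma preserves_transpose:
  assumes y: "y \<in> chamber" and e: "y $ i = y $ j"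
  shows "preserves y (Transposition.transpose i j)"
proof -
  have c: "y $ 1 \<le> y $ 2" "y $ 2 \<le> y $ 3" "y $ 3 \<le> y $ 4" "y $ 4 \<le> y $ 5" using y by (auto simp: chamber_def)
  have 12: "y $ 1 = y $ 2 \<Longrightarrow> preserves y (Transposition.transpose 1 2)"
    by (rule preserves_adjacent[OF y, where m=1]) (use wall1 in \<open>simp_all add: gaps_def axis_def\<close>)
  have 23: "y $ 2 = y $ 3 \<Longrightarrow> preserves y (Transposition.transpose 2 3)"
    by (rule preserves_adjacent[OF y, where m=2]) (use wall2 in \<open>simp_all add: gaps_def axis_def\<close>)
  have 34: "y $ 3 = y $ 4 \<Longrightarrow> preserves y (Transposition.transpose 3 4)"
    by (rule preserves_adjacent[OF y, where m=3]) (use wall3 in \<open>simp_all add: gaps_def axis_def\<close>)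
  have 45: "y $ 4 = y $ 5 \<Longrightarrow> preserves y (Transposition.transpose 4 5)"
    by (rule preserves_adjacent[OF y, where m=4]) (use wall4 in \<open>simp_all add: gaps_def axis_def\<close>)
  have 13: "y $ 1 = y $ 3 \<Longrightarrow> preserves y (Transposition.transpose 1 3)" using c by (intro preserves_trans[OF 12 23]) auto
  have 24: "y $ 2 = y $ 4 \<Longrightarrow> preserves y (Transposition.transpose 2 4)" using c by (intro preserves_trans[OF 23 34]) auto
  have 35: "y $ 3 = y $ 5 \<Longrightarrow> preserves y (Transposition.transpose 3 5)" using c by (intro preserves_trans[OF 34 45]) auto
  have 14: "y $ 1 = y $ 4 \<Longrightarrow> preserves y (Transposition.transpose 1 4)" using c by (intro preserves_trans[OF 12 24]) auto
  have 25: "y $ 2 = y $ 5 \<Longrightarrow> preserves y (Transposition.transpose 2 5)" using c by (intro preserves_trans[OF 23 35]) auto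
  have 15: "y $ 1 = y $ 5 \<Longrightarrow> preserves y (Transposition.transpose 1 5)" using c by (intro preserves_trans[OF 12 25]) auto
  define ok where "ok i j \<longleftrightarrow> (y $ i = y $ j \<longrightarrow> preserves y (Transposition.transpose i j))" for i j
  have "ok i i" for i by (simp add: ok_def preserves_def pv_def)
  moreover have "ok j i" if "ok i j" for i j using that by (simp add: ok_def Transposition.transpose_commute[of i j])
  moreover have "ok 1 2" "ok 2 3" "ok 3 4" "ok 4 5" "ok 1 3" "ok 2 4" "ok 3 5" "ok 1 4" "ok 2 5" "ok 1 5"
    unfolding ok_def using 12 23 34 45 13 24 35 14 25 15 by blast+
  ultimately have "\<forall>i j. ok i j" unfolding forall_5 by blast
  then show ?thesis using e by (simp add: ok_def)
qed

text \<open>Induction on the number of moved indices: composing with the transposition of i and p i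
  fixes i, unfixes nothing, and stays in the stabilizer of y.\<close>

lemma preserves_stabilizer:
  assumes y: "y \<in> chamber" and p: "inj p" and e: "\<And>i. y $ p i = y $ i"
  shows "preserves y p"
  using p e
proof (induction "card {i. p i \<noteq> i}" arbitrary: p rule: less_induct)
  case less
  show ?case
  proof (cases "\<exists>i. p i \<noteq> i")
    case False
    then have "p = id" by auto
    then show ?thesis by (simp add: preserves_def pv_def)
  next
    case True
    then obtain i where i: "p i \<noteq> i" by blast
    define r where "r = Transposition.transpose i (p i) \<circ> p"
    have "r i = i" by (simp add: r_def)
    moreover have "r k = k" if "p k = k" for k
    proof -
      have "k \<noteq> i" using that i by auto
      moreover have "k \<noteq> p i" using that injD[OF less.prems(1), of k i] \<open>k \<noteq> i\<close> by auto
      ultimately show ?thesis using that by (simp add: r_def)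
    qed
    ultimately have "{k. r k \<noteq> k} \<subset> {k. p k \<noteq> k}" using i by auto
    then have "card {k. r k \<noteq> k} < card {k. p k \<noteq> k}" by (intro psubset_card_mono) simp_all
    moreover have "inj r" unfolding r_def using less.prems(1) by (intro inj_compose) simp_all
    moreover have "y $ r k = y $ k" for k
      using less.prems(2)[of k] less.prems(2)[of i] unfolding r_def Transposition.transpose_def by auto
    ultimately have "preserves y r" by (rule less.hyps)
    moreover have "preserves y (Transposition.transpose i (p i))" by (rule preserves_transpose[OF y]) (simp add: less.prems(2))
    moreover have "p = Transposition.transpose i (p i) \<circ> r" by (simp add: r_def fun_eq_iff)
    ultimately show ?thesis using preserves_comp by metis
  qed
qed

section \<open>Sorting, and the space as a finite union of reflected chambers\<close>

lemma rearrangement_eq: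
  assumes p: "inj p" and x: "pv p x \<in> chamber"
  shows "rearrangement x = pv p x"
proof -
  have "image_mset p (mset_set UNIV) = mset_set UNIV"
    using image_mset_mset_set[OF p] finite_UNIV_inj_surj[OF _ p] by simp
  moreover have "(UNIV :: 5 set) = set [1, 2, 3, 4, 5]" unfolding UNIV_5 list.set ..
  then have "mset_set (UNIV :: 5 set) = mset [1, 2, 3, 4, 5]"
    using mset_set_set[OF distinct_5] by (simp only:)
  ultimately have "mset (map p [1, 2, 3, 4, 5]) = mset [1, 2, 3, 4, 5]" by (simp only: mset_map)
  then have "image_mset (($) x) (mset (map p [1, 2, 3, 4, 5])) = image_mset (($) x) (mset [1, 2, 3, 4, 5])" by (rule arg_cong)
  then have "mset [x $ p 1, x $ p 2, x $ p 3, x $ p 4, x $ p 5] = mset [x $ 1, x $ 2, x $ 3, x $ 4, x $ 5]" by simp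
  moreover have "sorted [x $ p 1, x $ p 2, x $ p 3, x $ p 4, x $ p 5]" using x by (auto simp: chamber_def)
  ultimately have s: "sort [x $ 1, x $ 2, x $ 3, x $ 4, x $ 5] = [x $ p 1, x $ p 2, x $ p 3, x $ p 4, x $ p 5]"
    by (rule properties_for_sort)
  show ?thesis unfolding rearrangement_def s by (simp add: vec_eq_iff forall_5 vector_5)
qed

lemma sorting_permutation: "\<exists>p. inj p \<and> pv p x \<in> chamber"
proof -
  define l where "l = sort_key (($) x) [1, 2, 3, 4, 5 :: 5]"
  have "length l = 5" by (simp add: l_def)
  then obtain a b c d e where l: "l = [a, b, c, d, e]" by (auto simp: length_Suc_conv numeral_eq_Suc)
  define p where "p i = (if i = 1 then a else if i = 2 then b else if i = 3 then c else if i = 4 then d else e)" for i :: 5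
  have "set l = UNIV" unfolding l_def set_sort UNIV_5 list.set ..
  moreover have "range p = set l" unfolding UNIV_5 l by (simp add: p_def insert_commute)
  ultimately have "inj p" using finite_UNIV_surj_inj[of p] by simp
  moreover have "sorted (map (($) x) l)" unfolding l_def by (rule sorted_sort_key)
  then have "pv p x \<in> chamber" unfolding l chamber_def p_def by simp
  ultimately show ?thesis by blast
qed

lemma closed_chamber: "closed chamber"
  unfolding chamber_def by (intro closed_Collect_conj closed_Collect_le continuous_intros)

text \<open>The jet at \<open>x\<close> is transported from the chamber by an arbitrarily chosen
  sorting permutation. Any other sorting permutation differs from it by a stabilizer of the sorted
  point, so on each closed reflected chamber the chosen jet is the pulled-back one.\<close>

lemma jet_ranked_extension: "\<exists>f1 f2. jet UNIV ranked_extension f1 f2"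
proof -
  obtain p where p: "\<And>x. inj (p x)" "\<And>x. pv (p x) x \<in> chamber" using sorting_permutation by metis
  define f1 where "f1 x h = ch1 (pv (p x) x) (pv (p x) h)" for x h
  define f2 where "f2 x h k = ch2 (pv (p x) x) (pv (p x) h) (pv (p x) k)" for x h k
  define Q where "Q r = {x. pv r x \<in> chamber}" for r
  have cQ: "closed (Q r)" for r
    using continuous_closed_vimage[OF closed_chamber, of "pv r"] linear_continuous_at[of "pv r"] linear_pv[of r]
    by (simp add: Q_def vimage_def linear_conv_bounded_linear)
  have jQ: "jet (Q r) ranked_extension f1 f2" if r: "inj r" for r
  proof (rule jet_cong[OF jet_linear_pullback[OF jet_chamber linear_pv[of r], of "Q r"]])
    show "pv r ` Q r \<subseteq> chamber" by (auto simp: Q_def)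
    fix x assume x: "x \<in> Q r"
    then have xr: "pv r x \<in> chamber" by (simp add: Q_def)
    show "ranked_extension x = ch0 (pv r x)"
      unfolding ranked_extension_def rearrangement_eq[OF r xr] by (rule chamber_fun_eq[OF xr])
    have e: "pv (p x) x = pv r x" using rearrangement_eq[OF r xr] rearrangement_eq[OF p] by simp
    have br: "r (inv r i) = i" for i
      using finite_UNIV_inj_surj[OF _ r] by (simp add: surj_f_inv_f)
    \<comment> \<open>Both \<open>r\<close> and \<open>p x\<close> sort \<open>x\<close> to the same
      point, so \<open>s\<close>, which compares them, fixes \<open>pv r x\<close>.\<close>
    define s where "s = inv r \<circ> p x"
    have ps: "pv (p x) h = pv s (pv r h)" for h by (simp add: vec_eq_iff s_def br)
    have "preserves (pv r x) s"
    proof (rule preserves_stabilizer[OF xr])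
      show "inj s" unfolding s_def using finite_UNIV_inj_surj[OF _ r] p(1) by (intro inj_compose surj_imp_inj_inv) simp_all
      show "pv r x $ s i = pv r x $ i" for i using ps[of x] e by (metis pv_nth)
    qed
    then show "f1 x h = ch1 (pv r x) (pv r h)" "f2 x h k = ch2 (pv r x) (pv r h) (pv r k)" for h k
      unfolding f1_def f2_def preserves_def unfolding e unfolding ps by blast+
  qed
  have "jet (\<Union>r\<in>{r. inj r}. Q r) ranked_extension f1 f2"
    by (rule jet_closed_Union) (use cQ jQ in auto)
  moreover have "(\<Union>r\<in>{r. inj r}. Q r) = UNIV" using p by (auto simp: Q_def)
  ultimately show ?thesis by auto
qed

theorem theorem3p1:
  shows "(\<forall>q\<in>regular_points. q $ 2 = q $ 4 \<longrightarrow> v_AC q = v_B q)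
    \<and> C2_on orthant v
    \<and> C2_on chamber chamber_fun
    \<and> C2_on UNIV ranked_extension"
proof (intro conjI ballI impI)
  show "v_AC q = v_B q" if "q \<in> regular_points" "q $ 2 = q $ 4" for q
    using v_regular_w0[OF that(1)] that(2) by simp
  show "C2_on orthant v"
    by (rule jet_imp_C2_on, rule jet_cong[OF jet_w]) (use v_eq_w0 in auto)
  show "C2_on chamber chamber_fun"
    by (rule jet_imp_C2_on, rule jet_cong[OF jet_chamber]) (use chamber_fun_eq in auto)
  show "C2_on UNIV ranked_extension"
    using jet_ranked_extension jet_imp_C2_on by blast
qed

end
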